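(* Let $k$ be a field, let $B=kQ/I$ be a bound quiver algebra and let $a$ be a single new arrow from a vertex $e$ to a vertex $f$ of $Q$ which is not a relative loop. Let $\Delta=\dim_k HH^1(B_{\{a\}})-\dim_k HH^1(B)$. Then $$\Delta=\dim_k ZB_{\{a\}}-\dim_k ZB+\dim_k fBe+\dim_k fBf\;\dim_k eBe+\dim_k\mathrm{Ext}^1_B(I_e,P_f)-\dim_k\mathrm{Hom}_B(I_e,P_f).$$
   Context: A quiver $Q$ has a finite set of vertices $Q_0$, a finite set of arrows $Q_1$, and source and target maps $s,t:Q_1\to Q_0$. A path of length $n>0$ is a sequence of arrows $(a_n,\dots,a_1)$ with $s(a_{i+1})=t(a_i)$; its source is $s(a_1)$ and its target is $t(a_n)$; vertices are the paths of length $0$. $Q_n$ is the set of paths of length $n$. In the path algebra $kQ$ the product $\beta\alpha$ of two paths is their concatenation if $t(\alpha)=s(\beta)$, and $0$ otherwise; vertices are orthogonal idempotents. A bound quiver algebra is $B=kQ/I$ with $I$ a two-sided ideal which is admissible, i.e. $\langle Q_n\rangle\subset I\subset\langle Q_2\rangle$ for some $n\ge 2$. Given a new arrow $a$ with source $s(a)=e\in Q_0$ and target $t(a)=f\in Q_0$, let $Q_{\{a\}}$ be the quiver with vertices $Q_0$ and arrows $Q_1\sqcup\{a\}$, and let $B_{\{a\}}=kQ_{\{a\}}/\langle I\rangle_{kQ_{\{a\}}}$, where $\langle I\rangle_{kQ_{\{a\}}}$ is the two-sided ideal of $kQ_{\{a\}}$ generated by $I$. The arrow $a$ is a relative loop if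 $s(a)\,B\,t(a)=eBf\neq0$. $HH^1(A)=H^1(A,A)$ is the first Hochschild cohomology, $ZA$ is the center of $A$. For $x\in Q_0$, $P_x=Bx$ and $I_x=\mathrm{Hom}_k(xB,k)$ are respectively the projective cover and the injective envelope of the simple left $B$-module at $x$. *)

theory Defs
  imports
    "HOL-Algebra.QuotRing"
    "Graph_Theory.Arc_Walk"
    "Jordan_Normal_Form.Missing_VectorSpace"
begin

section \<open>Vector spaces and modules as records\<close>

text \<open>
  The record type \<^typ>\<open>('a, 'b) module\<close> serves three purposes: a \<open>K\<close>-algebra (all fields are used),
  a \<open>K\<close>-vector space, and a left module over a possibly noncommutative ring \<open>A\<close> (the scalars are then
  the elements of \<open>A\<close>).  In the last two cases the multiplicative fields inherited from
  \<^typ>\<open>'b ring\<close> carry no information.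
\<close>

definition bare_module ::
  "'b set \<Rightarrow> 'b \<Rightarrow> ('b \<Rightarrow> 'b \<Rightarrow> 'b) \<Rightarrow> ('a \<Rightarrow> 'b \<Rightarrow> 'b) \<Rightarrow> ('a, 'b) module"
  where "bare_module C z p s =
    \<lparr>carrier = C, mult = undefined, one = undefined, zero = z, add = p, smult = s\<rparr>"

text \<open>
  Quotient of a \<open>K\<close>-algebra by a two-sided ideal, or of a vector space by a subspace: the library's
  quotient ring together with the induced scalar multiplication \<open>c (I + x) = I + c x\<close>.
\<close>

definition quot_module :: "('a, 'b) module \<Rightarrow> 'b set \<Rightarrow> ('a, 'b set) module"
  where "quot_module A I =
    ring.extend (A Quot I) (module.fields (\<lambda>c X. \<Union>x\<in>X. I +>\<^bsub>A\<^esub> (c \<odot>\<^bsub>A\<^esub> x)))"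

text \<open>
  The \<open>K\<close>-space \<open>Hom\<^sub>R(M, N)\<close>, where \<open>s\<close> is the action of \<open>K\<close> on \<open>N\<close>.  Maps are extensional so that
  they are determined by their values on the carrier of \<open>M\<close>.
\<close>

definition hom_space ::
  "('r, 'z) ring_scheme \<Rightarrow> ('r, 'm) module \<Rightarrow> ('r, 'n) module \<Rightarrow> ('k \<Rightarrow> 'n \<Rightarrow> 'n)
    \<Rightarrow> ('k, 'm \<Rightarrow> 'n) module"
  where "hom_space R M N s = bare_module
    (module_hom R M N \<inter> extensional (carrier M))
    (\<lambda>m\<in>carrier M. \<zero>\<^bsub>N\<^esub>)
    (\<lambda>\<phi> \<psi>. \<lambda>m\<in>carrier M. \<phi> m \<oplus>\<^bsub>N\<^esub> \<psi> m)
    (\<lambda>c \<phi>. \<lambda>m\<in>carrier M. s c (\<phi> m))"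

definition linear_space ::
  "('k, 'z) ring_scheme \<Rightarrow> ('k, 'v) module \<Rightarrow> ('k, 'w) module \<Rightarrow> ('k, 'v \<Rightarrow> 'w) module"
  where "linear_space K V W = hom_space K V W (smult W)"

text \<open>A left \<open>A\<close>-module is a \<open>K\<close>-space through \<open>K \<rightarrow> A, c \<mapsto> c 1\<^sub>A\<close>.\<close>

definition mod_hom_space ::
  "('k, 'a) module \<Rightarrow> ('a, 'm) module \<Rightarrow> ('a, 'n) module \<Rightarrow> ('k, 'm \<Rightarrow> 'n) module"
  where "mod_hom_space A M N = hom_space A M N (\<lambda>c n. (c \<odot>\<^bsub>A\<^esub> \<one>\<^bsub>A\<^esub>) \<odot>\<^bsub>N\<^esub> n)"


section \<open>Ext via free resolutions\<close>

text \<open>Free left \<open>A\<close>-module on a set \<open>X\<close>: finitely supported functions \<open>X \<rightarrow> A\<close>.\<close>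

definition free_module :: "('k, 'a) module \<Rightarrow> 'x set \<Rightarrow> ('a, 'x \<Rightarrow> 'a) module"
  where "free_module A X = bare_module
    {u \<in> X \<rightarrow>\<^sub>E carrier A. finite {x \<in> X. u x \<noteq> \<zero>\<^bsub>A\<^esub>}}
    (\<lambda>x\<in>X. \<zero>\<^bsub>A\<^esub>)
    (\<lambda>u v. \<lambda>x\<in>X. u x \<oplus>\<^bsub>A\<^esub> v x)
    (\<lambda>b u. \<lambda>x\<in>X. b \<otimes>\<^bsub>A\<^esub> u x)"

definition free_cover :: "('k, 'a) module \<Rightarrow> ('a, 'm) module \<Rightarrow> ('a, 'm \<Rightarrow> 'a) module"
  where "free_cover A M = free_module A (carrier M)"

definition cover_map :: "('k, 'a) module \<Rightarrow> ('a, 'm) module \<Rightarrow> ('m \<Rightarrow> 'a) \<Rightarrow> 'm"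
  where "cover_map A M u = finsum M (\<lambda>m. u m \<odot>\<^bsub>M\<^esub> m) {m \<in> carrier M. u m \<noteq> \<zero>\<^bsub>A\<^esub>}"

definition syzygy :: "('k, 'a) module \<Rightarrow> ('a, 'm) module \<Rightarrow> ('a, 'm \<Rightarrow> 'a) module"
  where "syzygy A M = (free_cover A M)
    \<lparr>carrier := {u \<in> carrier (free_cover A M). cover_map A M u = \<zero>\<^bsub>M\<^esub>}\<rparr>"

text \<open>
  \<open>Ext\<^sup>1\<^sub>A(M, N)\<close> is the first cohomology of \<open>Hom\<^sub>A(F\<^sub>0, N) \<rightarrow> Hom\<^sub>A(F\<^sub>1, N) \<rightarrow> Hom\<^sub>A(F\<^sub>2, N)\<close>
  for the canonical free resolution \<open>F\<^sub>2 \<rightarrow> F\<^sub>1 \<rightarrow> F\<^sub>0 \<rightarrow> M\<close>, in which \<open>F\<^sub>0\<close>, \<open>F\<^sub>1\<close>, \<open>F\<^sub>2\<close> are the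
  free covers of \<open>M\<close>, of its syzygy \<open>\<Omega>M \<subseteq> F\<^sub>0\<close> and of \<open>\<Omega>\<Omega>M \<subseteq> F\<^sub>1\<close>.
\<close>

definition ext1 ::
  "('k, 'a) module \<Rightarrow> ('a, 'm) module \<Rightarrow> ('a, 'n) module
    \<Rightarrow> ('k, ((('m \<Rightarrow> 'a) \<Rightarrow> 'a) \<Rightarrow> 'n) set) module"
  where "ext1 A M N =
   (let F0 = free_cover A M;
        F1 = free_cover A (syzygy A M);
        F2 = free_cover A (syzygy A (syzygy A M));
        d1 = cover_map A (syzygy A M);
        d2 = cover_map A (syzygy A (syzygy A M))
    in quot_module
      ((mod_hom_space A F1 N)
        \<lparr>carrier := {\<phi> \<in> carrier (mod_hom_space A F1 N). \<forall>u\<in>carrier F2. \<phi> (d2 u) = \<zero>\<^bsub>N\<^esub>}\<rparr>)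
      {\<lambda>u\<in>carrier F1. \<psi> (d1 u) | \<psi>. \<psi> \<in> carrier (mod_hom_space A F0 N)})"


section \<open>First Hochschild cohomology and center\<close>

text \<open>
  The beginning \<open>A \<rightarrow> Hom\<^sub>K(A, A) \<rightarrow> Hom\<^sub>K(A \<otimes> A, A)\<close> of the Hochschild complex with coefficients
  in \<open>A\<close>; elements of the last term are written as functions of two variables.
\<close>

definition hochschild_d0 :: "('k, 'a) module \<Rightarrow> 'a \<Rightarrow> 'a \<Rightarrow> 'a"
  where "hochschild_d0 A a = (\<lambda>x\<in>carrier A. x \<otimes>\<^bsub>A\<^esub> a \<ominus>\<^bsub>A\<^esub> a \<otimes>\<^bsub>A\<^esub> x)"

definition hochschild_d1 :: "('k, 'a) module \<Rightarrow> ('a \<Rightarrow> 'a) \<Rightarrow> 'a \<Rightarrow> 'a \<Rightarrow> 'a"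
  where "hochschild_d1 A \<phi> x y =
    x \<otimes>\<^bsub>A\<^esub> \<phi> y \<ominus>\<^bsub>A\<^esub> \<phi> (x \<otimes>\<^bsub>A\<^esub> y) \<oplus>\<^bsub>A\<^esub> \<phi> x \<otimes>\<^bsub>A\<^esub> y"

definition HH1 :: "('k, 'z) ring_scheme \<Rightarrow> ('k, 'a) module \<Rightarrow> ('k, ('a \<Rightarrow> 'a) set) module"
  where "HH1 K A = quot_module
    ((linear_space K A A)
      \<lparr>carrier := {\<phi> \<in> carrier (linear_space K A A).
        \<forall>x\<in>carrier A. \<forall>y\<in>carrier A. hochschild_d1 A \<phi> x y = \<zero>\<^bsub>A\<^esub>}\<rparr>)
    (hochschild_d0 A ` carrier A)"

definition center :: "('k, 'a) module \<Rightarrow> ('k, 'a) module"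
  where "center A = A
    \<lparr>carrier := {z \<in> carrier A. \<forall>x\<in>carrier A. z \<otimes>\<^bsub>A\<^esub> x = x \<otimes>\<^bsub>A\<^esub> z}\<rparr>"


section \<open>Path algebras\<close>

text \<open>
  A quiver is a \<^typ>\<open>('v, 'e) pre_digraph\<close> \<open>Q\<close> with \<^prop>\<open>fin_digraph Q\<close>.  A path is a pair of its
  source and its list of arrows \<open>[a\<^sub>1, \<dots>, a\<^sub>n]\<close> in order of traversal, i.e. the reverse of
  \<open>(a\<^sub>n, \<dots>, a\<^sub>1)\<close>; the pair \<open>(u, [])\<close> is the vertex \<open>u\<close>.
\<close>

definition paths :: "('v, 'e) pre_digraph \<Rightarrow> ('v \<times> 'e list) set"
  where "paths Q = {(u, p). \<exists>v. pre_digraph.awalk Q u p v}"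

definition path_target :: "('v, 'e) pre_digraph \<Rightarrow> 'v \<times> 'e list \<Rightarrow> 'v"
  where "path_target Q \<gamma> = last (pre_digraph.awalk_verts Q (fst \<gamma>) (snd \<gamma>))"

text \<open>
  Elements of \<open>KQ\<close> are the finitely supported functions \<open>paths Q \<rightarrow> K\<close>, extended by zero.  In the
  product \<open>\<beta>\<alpha>\<close> the path \<open>\<alpha>\<close> is traversed first.
\<close>

definition path_algebra ::
  "('k, 'z) ring_scheme \<Rightarrow> ('v, 'e) pre_digraph \<Rightarrow> ('k, 'v \<times> 'e list \<Rightarrow> 'k) module"
  where "path_algebra K Q =
    \<lparr>carrier = {x. (\<forall>\<gamma>. x \<gamma> \<in> carrier K) \<and> (\<forall>\<gamma>. \<gamma> \<notin> paths Q \<longrightarrow> x \<gamma> = \<zero>\<^bsub>K\<^esub>)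
        \<and> finite {\<gamma>. x \<gamma> \<noteq> \<zero>\<^bsub>K\<^esub>}},
     mult = (\<lambda>x y \<gamma>. finsum K (\<lambda>(\<beta>, \<alpha>). x \<beta> \<otimes>\<^bsub>K\<^esub> y \<alpha>)
        {(\<beta>, \<alpha>). \<beta> \<in> paths Q \<and> \<alpha> \<in> paths Q \<and> path_target Q \<alpha> = fst \<beta>
          \<and> (fst \<alpha>, snd \<alpha> @ snd \<beta>) = \<gamma>}),
     one = (\<lambda>\<gamma>. if \<gamma> \<in> paths Q \<and> snd \<gamma> = [] then \<one>\<^bsub>K\<^esub> else \<zero>\<^bsub>K\<^esub>),
     zero = (\<lambda>\<gamma>. \<zero>\<^bsub>K\<^esub>),
     add = (\<lambda>x y \<gamma>. x \<gamma> \<oplus>\<^bsub>K\<^esub> y \<gamma>),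
     smult = (\<lambda>c x \<gamma>. c \<otimes>\<^bsub>K\<^esub> x \<gamma>)\<rparr>"

definition path_elt :: "('k, 'z) ring_scheme \<Rightarrow> 'v \<times> 'e list \<Rightarrow> 'v \<times> 'e list \<Rightarrow> 'k"
  where "path_elt K \<gamma> = (\<lambda>\<delta>. if \<delta> = \<gamma> then \<one>\<^bsub>K\<^esub> else \<zero>\<^bsub>K\<^esub>)"

definition length_ideal ::
  "('k, 'z) ring_scheme \<Rightarrow> ('v, 'e) pre_digraph \<Rightarrow> nat \<Rightarrow> ('v \<times> 'e list \<Rightarrow> 'k) set"
  where "length_ideal K Q n =
    Idl\<^bsub>path_algebra K Q\<^esub> (path_elt K ` {\<gamma> \<in> paths Q. length (snd \<gamma>) = n})"

definition admissible_ideal ::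
  "('k, 'z) ring_scheme \<Rightarrow> ('v, 'e) pre_digraph \<Rightarrow> ('v \<times> 'e list \<Rightarrow> 'k) set \<Rightarrow> bool"
  where "admissible_ideal K Q I \<longleftrightarrow> ideal I (path_algebra K Q) \<and>
    (\<exists>n\<ge>2. length_ideal K Q n \<subseteq> I \<and> I \<subseteq> length_ideal K Q 2)"

text \<open>The class in \<open>KQ/I\<close> of the idempotent given by the vertex \<open>x\<close>.\<close>

definition vertex_elt ::
  "('k, 'z) ring_scheme \<Rightarrow> ('v, 'e) pre_digraph \<Rightarrow> ('v \<times> 'e list \<Rightarrow> 'k) set
    \<Rightarrow> 'v \<Rightarrow> ('v \<times> 'e list \<Rightarrow> 'k) set"
  where "vertex_elt K Q I x = I +>\<^bsub>path_algebra K Q\<^esub> path_elt K (x, [])"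

text \<open>
  Adding a new arrow \<open>a\<close> from \<open>e\<close> to \<open>f\<close>.  If \<open>a\<close> is not already an arrow of \<open>Q\<close>, then
  \<open>paths Q \<subseteq> paths (add_arrow Q a e f)\<close>, so \<open>KQ\<close> is literally a subset of the path algebra of the
  enlarged quiver.
\<close>

definition add_arrow :: "('v, 'e) pre_digraph \<Rightarrow> 'e \<Rightarrow> 'v \<Rightarrow> 'v \<Rightarrow> ('v, 'e) pre_digraph"
  where "add_arrow Q a e f =
    Q\<lparr>arcs := insert a (arcs Q), tail := (tail Q)(a := e), head := (head Q)(a := f)\<rparr>"


section \<open>Corners, projectives and injectives\<close>

text \<open>In this section \<open>x\<close> and \<open>y\<close> are idempotents of a \<open>K\<close>-algebra \<open>B\<close>.\<close>

definition corner :: "('k, 'b) module \<Rightarrow> 'b \<Rightarrow> 'b \<Rightarrow> ('k, 'b) module"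
  where "corner B x y = B\<lparr>carrier := {x \<otimes>\<^bsub>B\<^esub> b \<otimes>\<^bsub>B\<^esub> y | b. b \<in> carrier B}\<rparr>"

text \<open>For a new arrow with source \<open>x\<close> and target \<open>y\<close>.\<close>

definition relative_loop :: "('k, 'b) module \<Rightarrow> 'b \<Rightarrow> 'b \<Rightarrow> bool"
  where "relative_loop B x y \<longleftrightarrow> carrier (corner B x y) \<noteq> {\<zero>\<^bsub>B\<^esub>}"

definition proj_module :: "('k, 'b) module \<Rightarrow> 'b \<Rightarrow> ('b, 'b) module"
  where "proj_module B x =
    bare_module {b \<otimes>\<^bsub>B\<^esub> x | b. b \<in> carrier B} \<zero>\<^bsub>B\<^esub> (add B) (mult B)"

definition right_ideal_space :: "('k, 'b) module \<Rightarrow> 'b \<Rightarrow> ('k, 'b) module"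
  where "right_ideal_space B x = B\<lparr>carrier := {x \<otimes>\<^bsub>B\<^esub> b | b. b \<in> carrier B}\<rparr>"

definition field_space :: "('k, 'z) ring_scheme \<Rightarrow> ('k, 'k) module"
  where "field_space K = bare_module (carrier K) \<zero>\<^bsub>K\<^esub> (add K) (mult K)"

text \<open>\<open>Hom\<^sub>K(xB, K)\<close> with the left action \<open>(b \<phi>)(z) = \<phi>(z b)\<close>.\<close>

definition inj_module ::
  "('k, 'z) ring_scheme \<Rightarrow> ('k, 'b) module \<Rightarrow> 'b \<Rightarrow> ('b, 'b \<Rightarrow> 'k) module"
  where "inj_module K B x =
   (let D = linear_space K (right_ideal_space B x) (field_space K)
    in bare_module (carrier D) \<zero>\<^bsub>D\<^esub> (add D)
      (\<lambda>b \<phi>. \<lambda>z\<in>carrier (right_ideal_space B x). \<phi> (z \<otimes>\<^bsub>B\<^esub> b)))"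

end

theory Submission
  imports Defs
begin

text \<open>
  Write \<open>A\<close> for the algebra \<open>B\<^bsub>{a}\<^esub>\<close> and \<open>e\<close>, \<open>f\<close> for the idempotents of the source and the target of the
  new arrow.  The formula comes from identifying \<open>A\<close> with a trivial extension of \<open>B\<close> whose bimodule is
  a space of linear maps, and from counting the derivations of that extension.

  Why \<open>A\<close> is a trivial extension.  Between two occurrences of \<open>a\<close> a path runs from \<open>f\<close> to \<open>e\<close>, and such
  a path, if it consists of arrows of \<open>Q\<close>, lies in \<open>e B f = 0\<close>.  So paths through \<open>a\<close> more than once
  vanish in \<open>A\<close>, and \<open>A = B \<oplus> B a B\<close> where \<open>B a B\<close> has square zero and is \<open>B f \<otimes>\<^sub>K e B\<close>.  In finite dimension
  the bimodule \<open>B f \<otimes>\<^sub>K e B\<close> is \<open>H = Hom\<^sub>K(I\<^sub>e, P\<^sub>f)\<close>, because \<open>P\<^sub>f = B f\<close> and \<open>I\<^sub>e\<close> is the dual of \<open>e B\<close>;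
  the tensor \<open>x \<otimes> y\<close> is the rank one map \<open>\<phi> \<mapsto> \<phi>(y) x\<close>.  This is \<open>one_arrow_algebra_iso\<close>, and it is
  the reason why \<open>Hom\<^sub>B(I\<^sub>e, P\<^sub>f)\<close> and \<open>Ext\<^sup>1\<^sub>B(I\<^sub>e, P\<^sub>f)\<close> appear.

  Why the dimensions add up.  Four counts are combined in \<open>dim_HH1_triv_ext\<close>.

  \<^item> For a finite dimensional algebra the sequence \<open>0 \<rightarrow> ZA \<rightarrow> A \<rightarrow> Der A \<rightarrow> HH\<^sup>1(A) \<rightarrow> 0\<close> is exact
    (\<open>dim_HH1\<close>), so \<open>dim HH\<^sup>1(A) - dim HH\<^sup>1(B)\<close> is \<open>dim Der A - dim Der B\<close>, corrected by the centers and
    by \<open>dim A - dim B = dim H\<close>.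

  \<^item> Let \<open>T = B \<oplus> H\<close> and \<open>\<alpha> = f \<otimes> e\<close>, the element that plays the new arrow.  A derivation of \<open>T\<close> is
    the same as a derivation \<open>B \<rightarrow> T\<close> together with an arbitrary element of \<open>f T e\<close>, the component
    \<open>f D(\<alpha>) e\<close> (\<open>derivation_extends\<close>, \<open>dim_Der_T\<close>).  That every such pair occurs rests once more on
    \<open>e B f = 0\<close>.  Moreover \<open>Der(B, T) = Der(B, B) \<times> Der(B, H)\<close> (\<open>dim_Der_B_T\<close>).

  \<^item> \<open>f T e = f B e \<oplus> f H e\<close>, and \<open>f H e\<close> is \<open>f B f \<otimes>\<^sub>K e B e\<close> (\<open>dim_corner_T\<close>).

  \<^item> For finite dimensional modules \<open>X\<close>, \<open>Y\<close> the sequence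
    \<open>0 \<rightarrow> Hom\<^sub>B(X, Y) \<rightarrow> Hom\<^sub>K(X, Y) \<rightarrow> Der(B, Hom\<^sub>K(X, Y)) \<rightarrow> Ext\<^sup>1\<^sub>B(X, Y) \<rightarrow> 0\<close> is exact
    (\<open>dim_derivations_ext1\<close>).  For \<open>X = I\<^sub>e\<close> and \<open>Y = P\<^sub>f\<close> its term \<open>Hom\<^sub>K(X, Y) = H\<close> cancels against
    \<open>dim A - dim B\<close>.
\<close>

section \<open>Vector spaces as records\<close>

lemma linear_mapI:
  assumes "vectorspace K V" "vectorspace K W" "T \<in> module_hom K V W"
  shows "linear_map K V W T"
  using assms by (simp add: linear_map_def mod_hom_def mod_hom_axioms_def vectorspace_def)

lemma module_homI:
  assumes "\<And>x. x \<in> carrier M \<Longrightarrow> f x \<in> carrier N"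
    and "\<And>x y. x \<in> carrier M \<Longrightarrow> y \<in> carrier M \<Longrightarrow> f (x \<oplus>\<^bsub>M\<^esub> y) = f x \<oplus>\<^bsub>N\<^esub> f y"
    and "\<And>c x. c \<in> carrier R \<Longrightarrow> x \<in> carrier M \<Longrightarrow> f (c \<odot>\<^bsub>M\<^esub> x) = c \<odot>\<^bsub>N\<^esub> f x"
  shows "f \<in> module_hom R M N"
  using assms by (auto simp: module_hom_def)

lemma module_homD:
  assumes "f \<in> module_hom R M N"
  shows "x \<in> carrier M \<Longrightarrow> f x \<in> carrier N"
    and "x \<in> carrier M \<Longrightarrow> y \<in> carrier M \<Longrightarrow> f (x \<oplus>\<^bsub>M\<^esub> y) = f x \<oplus>\<^bsub>N\<^esub> f y"
    and "c \<in> carrier R \<Longrightarrow> x \<in> carrier M \<Longrightarrow> f (c \<odot>\<^bsub>M\<^esub> x) = c \<odot>\<^bsub>N\<^esub> f x"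
  using assms by (auto simp: module_hom_def)

text \<open>
  Only additivity is assumed here and in the next two lemmas: they are applied to products and module
  actions as functions of a single argument.
\<close>

lemma additive_zero:
  assumes V: "abelian_group V" and W: "abelian_group W"
    and f: "f \<in> carrier V \<rightarrow> carrier W"
    and add: "\<And>x y. x \<in> carrier V \<Longrightarrow> y \<in> carrier V \<Longrightarrow> f (x \<oplus>\<^bsub>V\<^esub> y) = f x \<oplus>\<^bsub>W\<^esub> f y"
  shows "f \<zero>\<^bsub>V\<^esub> = \<zero>\<^bsub>W\<^esub>"
proof -
  interpret V: abelian_group V by fact
  interpret W: abelian_group W by fact
  have c: "f \<zero>\<^bsub>V\<^esub> \<in> carrier W" using f by auto
  have "f \<zero>\<^bsub>V\<^esub> \<oplus>\<^bsub>W\<^esub> f \<zero>\<^bsub>V\<^esub> = f \<zero>\<^bsub>V\<^esub>" using add[of "\<zero>\<^bsub>V\<^esub>" "\<zero>\<^bsub>V\<^esub>"] by simp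
  then show ?thesis using c by simp
qed

lemma additive_minus:
  assumes V: "abelian_group V" and W: "abelian_group W"
    and f: "f \<in> carrier V \<rightarrow> carrier W"
    and add: "\<And>x y. x \<in> carrier V \<Longrightarrow> y \<in> carrier V \<Longrightarrow> f (x \<oplus>\<^bsub>V\<^esub> y) = f x \<oplus>\<^bsub>W\<^esub> f y"
    and x: "x \<in> carrier V" and y: "y \<in> carrier V"
  shows "f (\<ominus>\<^bsub>V\<^esub> x) = \<ominus>\<^bsub>W\<^esub> f x" "f (x \<ominus>\<^bsub>V\<^esub> y) = f x \<ominus>\<^bsub>W\<^esub> f y"
proof -
  interpret V: abelian_group V by fact
  interpret W: abelian_group W by fact
  have neg: "f (\<ominus>\<^bsub>V\<^esub> z) = \<ominus>\<^bsub>W\<^esub> f z" if z: "z \<in> carrier V" for z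
  proof -
    have "f (\<ominus>\<^bsub>V\<^esub> z) \<oplus>\<^bsub>W\<^esub> f z = \<zero>\<^bsub>W\<^esub>"
      using add[of "\<ominus>\<^bsub>V\<^esub> z" z] z additive_zero[OF V W f add] by (simp add: V.l_neg)
    then show ?thesis using f z by (intro W.minus_equality[symmetric]) auto
  qed
  show "f (\<ominus>\<^bsub>V\<^esub> x) = \<ominus>\<^bsub>W\<^esub> f x" by (rule neg[OF x])
  show "f (x \<ominus>\<^bsub>V\<^esub> y) = f x \<ominus>\<^bsub>W\<^esub> f y"
    using add[of x "\<ominus>\<^bsub>V\<^esub> y"] neg[OF y] x y by (simp add: a_minus_def)
qed

lemma additive_finsum:
  assumes V: "abelian_group V" and W: "abelian_group W"
    and f: "f \<in> carrier V \<rightarrow> carrier W"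
    and add: "\<And>x y. x \<in> carrier V \<Longrightarrow> y \<in> carrier V \<Longrightarrow> f (x \<oplus>\<^bsub>V\<^esub> y) = f x \<oplus>\<^bsub>W\<^esub> f y"
    and S: "finite S" and g: "g \<in> S \<rightarrow> carrier V"
  shows "f (finsum V g S) = finsum W (\<lambda>i. f (g i)) S"
proof -
  interpret V: abelian_group V by fact
  interpret W: abelian_group W by fact
  note [simp] = additive_zero[OF V W f add]
  show ?thesis using S g
  proof (induction S rule: finite_induct)
    case (insert i S)
    then show ?case using f by (subst V.finsum_insert; (subst W.finsum_insert)?) (auto simp: add Pi_iff)
  qed auto
qed

lemma vs_abelian_group: "vectorspace K V \<Longrightarrow> abelian_group V"
  by (simp add: vectorspace_def module_def)

lemma module_hom_finsum:
  assumes "vectorspace K V" "vectorspace K W" "f \<in> module_hom K V W" "finite S" "g \<in> S \<rightarrow> carrier V"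
  shows "f (finsum V g S) = finsum W (\<lambda>i. f (g i)) S"
  using assms by (intro additive_finsum) (auto simp: module_homD vs_abelian_group)

lemma module_hom_zero:
  assumes "vectorspace K V" "vectorspace K W" "f \<in> module_hom K V W"
  shows "f \<zero>\<^bsub>V\<^esub> = \<zero>\<^bsub>W\<^esub>"
  using assms by (intro additive_zero) (auto simp: module_homD vs_abelian_group)

lemma subspaceI:
  assumes "vectorspace K V" "S \<subseteq> carrier V" "\<zero>\<^bsub>V\<^esub> \<in> S"
    "\<And>x y. x \<in> S \<Longrightarrow> y \<in> S \<Longrightarrow> x \<oplus>\<^bsub>V\<^esub> y \<in> S"
    "\<And>c x. c \<in> carrier K \<Longrightarrow> x \<in> S \<Longrightarrow> c \<odot>\<^bsub>V\<^esub> x \<in> S"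
  shows "subspace K S V"
  using assms by (auto simp: subspace_def vectorspace_def intro!: submodule.intro)

lemma subspaceD:
  assumes "subspace K S V"
  shows "vectorspace K V" "S \<subseteq> carrier V" "\<zero>\<^bsub>V\<^esub> \<in> S"
    "\<And>x y. x \<in> S \<Longrightarrow> y \<in> S \<Longrightarrow> x \<oplus>\<^bsub>V\<^esub> y \<in> S"
    "\<And>c x. c \<in> carrier K \<Longrightarrow> x \<in> S \<Longrightarrow> c \<odot>\<^bsub>V\<^esub> x \<in> S"
    "vectorspace K (V\<lparr>carrier := S\<rparr>)"
proof -
  interpret S: submodule K S V using assms by (simp add: subspace_def)
  show V: "vectorspace K V" using assms by (simp add: subspace_def)
  show "S \<subseteq> carrier V" "\<zero>\<^bsub>V\<^esub> \<in> S" using S.subset by auto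
  show "\<And>x y. x \<in> S \<Longrightarrow> y \<in> S \<Longrightarrow> x \<oplus>\<^bsub>V\<^esub> y \<in> S" by simp
  show "\<And>c x. c \<in> carrier K \<Longrightarrow> x \<in> S \<Longrightarrow> c \<odot>\<^bsub>V\<^esub> x \<in> S" by simp
  show "vectorspace K (V\<lparr>carrier := S\<rparr>)" by (rule vectorspace.subspace_is_vs[OF V assms])
qed

lemma kernel_subspace:
  assumes "vectorspace K V" "vectorspace K W" "T \<in> module_hom K V W"
  shows "subspace K {v \<in> carrier V. T v = \<zero>\<^bsub>W\<^esub>} V"
  using linear_map.kerT_is_subspace[OF linear_mapI[OF assms]]
  by (simp add: mod_hom.ker_def[OF linear_map.axioms(3)[OF linear_mapI[OF assms]]])

lemma image_subspace:
  assumes "vectorspace K V" "vectorspace K W" "T \<in> module_hom K V W"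
  shows "subspace K (T ` carrier V) W"
  using linear_map.imT_is_subspace[OF linear_mapI[OF assms]]
  by (simp add: mod_hom.im_def[OF linear_map.axioms(3)[OF linear_mapI[OF assms]]])

lemma module_hom_restrict_codomain:
  assumes "T \<in> module_hom K V W" "\<And>v. v \<in> carrier V \<Longrightarrow> T v \<in> S"
  shows "T \<in> module_hom K V (W\<lparr>carrier := S\<rparr>)"
  using assms by (auto simp: module_hom_def)

text \<open>
  Rank and nullity for a surjection; in this form the exact sequences below turn into equations between
  dimensions.
\<close>

lemma dim_exact:
  assumes V: "vectorspace K V" and W: "vectorspace K W" and fd: "vectorspace.fin_dim K V"
    and T: "T \<in> module_hom K V W" and surj: "T ` carrier V = carrier W"
  shows "vectorspace.dim K W + vectorspace.dim K (V\<lparr>carrier := {v \<in> carrier V. T v = \<zero>\<^bsub>W\<^esub>}\<rparr>)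
      = vectorspace.dim K V"
    and "vectorspace.fin_dim K W"
proof -
  interpret linear_map K V W T by (rule linear_mapI) fact+
  show "vectorspace.dim K W + vectorspace.dim K (V\<lparr>carrier := {v \<in> carrier V. T v = \<zero>\<^bsub>W\<^esub>}\<rparr>)
      = vectorspace.dim K V"
    using rank_nullity[OF fd] surj by (simp add: im_def ker_def)
  show "vectorspace.fin_dim K W" by (rule surj_fin_dim[OF fd surj])
qed

lemma dim_iso:
  assumes V: "vectorspace K V" and W: "vectorspace K W" and fd: "vectorspace.fin_dim K V"
    and T: "T \<in> module_hom K V W" and bij: "bij_betw T (carrier V) (carrier W)"
  shows "vectorspace.dim K V = vectorspace.dim K W"
proof -
  interpret linear_map K V W T by (rule linear_mapI) fact+
  show ?thesis using dim_eq[OF fd] bij by (simp add: bij_betw_def)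
qed

text \<open>
  The identity map between two records that differ in the fields which say nothing about the vector
  space, such as the multiplicative ones.
\<close>

lemma dim_cong_operations:
  assumes "vectorspace K V" "vectorspace K W" "vectorspace.fin_dim K V" "carrier W = carrier V"
    "\<And>x y. x \<in> carrier V \<Longrightarrow> y \<in> carrier V \<Longrightarrow> x \<oplus>\<^bsub>V\<^esub> y = x \<oplus>\<^bsub>W\<^esub> y"
    "\<And>c x. c \<in> carrier K \<Longrightarrow> x \<in> carrier V \<Longrightarrow> c \<odot>\<^bsub>V\<^esub> x = c \<odot>\<^bsub>W\<^esub> x"
  shows "vectorspace.fin_dim K W" "vectorspace.dim K V = vectorspace.dim K W"
proof -
  have T: "(\<lambda>x. x) \<in> module_hom K V W" using assms by (intro module_homI) auto
  show "vectorspace.fin_dim K W" by (rule dim_exact(2)[OF assms(1,2,3) T]) (simp add: assms)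
  show "vectorspace.dim K V = vectorspace.dim K W"
    by (rule dim_iso[OF assms(1,2,3) T]) (simp add: assms bij_betw_def)
qed

text \<open>
  Independent subsets of \<open>S\<close> have at most \<open>dim V\<close> elements, so there is a maximal one, and it spans \<open>S\<close>.
\<close>

lemma subspace_fin_dim:
  assumes S: "subspace K S V" and fd: "vectorspace.fin_dim K V"
  shows "vectorspace.fin_dim K (V\<lparr>carrier := S\<rparr>)"
proof -
  interpret V: vectorspace K V by (rule subspaceD(1)[OF S])
  interpret S: vectorspace K "V\<lparr>carrier := S\<rparr>" by (rule subspaceD(6)[OF S])
  have small: "finite A \<and> card A \<le> V.dim" if "A \<subseteq> S" "S.lin_indpt A" for A
    using that V.span_li_not_depend(2)[of A S] subspaceD(2)[OF S] S fd
    by (auto simp: subspace_def intro!: V.li_le_dim)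
  have "\<exists>A. finite A \<and> maximal A (\<lambda>X. X \<subseteq> carrier (V\<lparr>carrier := S\<rparr>) \<and> S.lin_indpt X)"
    using small by (intro maximal_exists[where ?N="V.dim" and ?B="{}"]) (auto simp: S.lin_dep_def)
  then obtain A where "finite A" "maximal A (\<lambda>X. X \<subseteq> carrier (V\<lparr>carrier := S\<rparr>) \<and> S.lin_indpt X)"
    by blast
  moreover from this have "S.basis A" by (intro S.max_li_is_basis) (auto simp: maximal_def)
  ultimately show ?thesis unfolding S.fin_dim_def S.basis_def by blast
qed

text \<open>
  The axioms are equations between sums and multiples, so they pass along any surjection that respects
  the operations.  Besides projections to quotients this covers identity maps between different records.
\<close>

lemma vectorspace_image:
  assumes V: "vectorspace K V" and car: "carrier Q = \<pi> ` carrier V"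
    and add: "\<And>x y. x \<in> carrier V \<Longrightarrow> y \<in> carrier V \<Longrightarrow> \<pi> (x \<oplus>\<^bsub>V\<^esub> y) = \<pi> x \<oplus>\<^bsub>Q\<^esub> \<pi> y"
    and smult: "\<And>c x. c \<in> carrier K \<Longrightarrow> x \<in> carrier V \<Longrightarrow> \<pi> (c \<odot>\<^bsub>V\<^esub> x) = c \<odot>\<^bsub>Q\<^esub> \<pi> x"
    and zero: "\<pi> \<zero>\<^bsub>V\<^esub> = \<zero>\<^bsub>Q\<^esub>"
  shows "vectorspace K Q"
proof -
  interpret vectorspace K V by fact
  have neg: "\<exists>v\<in>carrier V. \<pi> (x \<oplus>\<^bsub>V\<^esub> v) = \<pi> \<zero>\<^bsub>V\<^esub>" if "x \<in> carrier V" for x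
    using that by (intro bexI[of _ "\<ominus>\<^bsub>V\<^esub> x"]) (auto simp: M.r_neg)
  have smult': "c \<odot>\<^bsub>Q\<^esub> \<pi> x = \<pi> (c \<odot>\<^bsub>V\<^esub> x)" if "c \<in> carrier K" "x \<in> carrier V" for c x
    using smult that by simp
  have add': "\<pi> x \<oplus>\<^bsub>Q\<^esub> \<pi> y = \<pi> (x \<oplus>\<^bsub>V\<^esub> y)" if "x \<in> carrier V" "y \<in> carrier V" for x y
    using add that by simp
  show ?thesis
    by (rule vs_criteria)
      (auto simp: car add' smult' zero[symmetric] neg M.a_ac smult_l_distr
        smult_r_distr smult_assoc1 field_axioms)
qed

lemma vectorspace_field: "vectorspace K V \<Longrightarrow> field K"
  by (simp add: vectorspace_def)

section \<open>Quotient spaces\<close>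

lemma quot_module_simps [simp]:
  "carrier (quot_module V W) = a_rcosets\<^bsub>V\<^esub> W"
  "zero (quot_module V W) = W"
  "add (quot_module V W) = set_add V"
  "mult (quot_module V W) = rcoset_mult V W"
  "one (quot_module V W) = W +>\<^bsub>V\<^esub> \<one>\<^bsub>V\<^esub>"
  "smult (quot_module V W) = (\<lambda>c X. \<Union>x\<in>X. W +>\<^bsub>V\<^esub> (c \<odot>\<^bsub>V\<^esub> x))"
  by (simp_all add: quot_module_def FactRing_def ring.defs module.defs)

text \<open>
  Multiplying a class by \<open>c\<close> is defined as a union over all representatives.  Since \<open>W\<close> is closed under
  multiples, representatives of one class have multiples in one class, and the sets in the union
  coincide.
\<close>

lemma quot_module_vectorspace:
  assumes sub: "subspace K W V"
  shows "vectorspace K (quot_module V W)"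
    and "(\<lambda>v. W +>\<^bsub>V\<^esub> v) \<in> module_hom K V (quot_module V W)"
    and "(\<lambda>v. W +>\<^bsub>V\<^esub> v) ` carrier V = carrier (quot_module V W)"
    and "v \<in> carrier V \<Longrightarrow> W +>\<^bsub>V\<^esub> v = \<zero>\<^bsub>quot_module V W\<^esub> \<longleftrightarrow> v \<in> W"
proof -
  interpret V: vectorspace K V by (rule subspaceD(1)[OF sub])
  note W = subspaceD[OF sub]
  have neg: "\<ominus>\<^bsub>V\<^esub> w \<in> W" if "w \<in> W" for w
    using W(5)[of "\<ominus>\<^bsub>K\<^esub> \<one>\<^bsub>K\<^esub>" w] that W(2) by (simp add: V.smult_minus_1 subset_iff)
  have "abelian_subgroup W V"
    using W(2-4) neg V.abelian_group_axioms
    by (intro abelian_subgroupI3 additive_subgroup.intro subgroup.intro)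
      (auto simp: a_inv_def[symmetric])
  then interpret W: abelian_subgroup W V .
  have car: "(\<lambda>v. W +>\<^bsub>V\<^esub> v) ` carrier V = carrier (quot_module V W)"
    by (auto simp: A_RCOSETS_def' )
  have sm: "(W +>\<^bsub>V\<^esub> (c \<odot>\<^bsub>V\<^esub> v)) = c \<odot>\<^bsub>quot_module V W\<^esub> (W +>\<^bsub>V\<^esub> v)"
    if c: "c \<in> carrier K" and v: "v \<in> carrier V" for c v
  proof -
    have eq: "W +>\<^bsub>V\<^esub> (c \<odot>\<^bsub>V\<^esub> x) = W +>\<^bsub>V\<^esub> (c \<odot>\<^bsub>V\<^esub> v)" if x: "x \<in> W +>\<^bsub>V\<^esub> v" for x
    proof -
      obtain w where w: "w \<in> W" "x = w \<oplus>\<^bsub>V\<^esub> v"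
        using x by (auto simp: a_r_coset_def')
      then have "c \<odot>\<^bsub>V\<^esub> x = c \<odot>\<^bsub>V\<^esub> w \<oplus>\<^bsub>V\<^esub> c \<odot>\<^bsub>V\<^esub> v"
        using c v W(2) by (auto simp: V.smult_r_distr)
      then have "c \<odot>\<^bsub>V\<^esub> x \<in> W +>\<^bsub>V\<^esub> (c \<odot>\<^bsub>V\<^esub> v)"
        using W(5)[OF c w(1)] by (auto simp: a_r_coset_def')
      then show ?thesis using c v by (intro W.a_repr_independence'[symmetric]) auto
    qed
    moreover have "v \<in> W +>\<^bsub>V\<^esub> v" using W.a_rcos_self[OF v] .
    ultimately show ?thesis
      unfolding quot_module_simps by (intro UN_constant_eq[symmetric]) blast+
  qed
  have add: "W +>\<^bsub>V\<^esub> (x \<oplus>\<^bsub>V\<^esub> y) = (W +>\<^bsub>V\<^esub> x) \<oplus>\<^bsub>quot_module V W\<^esub> (W +>\<^bsub>V\<^esub> y)"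
    if "x \<in> carrier V" "y \<in> carrier V" for x y
    using that by (simp add: W.a_rcos_sum)
  have z: "W +>\<^bsub>V\<^esub> \<zero>\<^bsub>V\<^esub> = \<zero>\<^bsub>quot_module V W\<^esub>"
    using V.a_coset_add_zero W(2) by simp
  show "(\<lambda>v. W +>\<^bsub>V\<^esub> v) ` carrier V = carrier (quot_module V W)" by fact
  show "vectorspace K (quot_module V W)"
    by (rule vectorspace_image[OF W(1) car[symmetric]]) (auto simp: add sm z simp del: quot_module_simps)
  show "(\<lambda>v. W +>\<^bsub>V\<^esub> v) \<in> module_hom K V (quot_module V W)"
    using car by (intro module_homI) (auto simp: add sm simp del: quot_module_simps)
  show "v \<in> carrier V \<Longrightarrow> W +>\<^bsub>V\<^esub> v = \<zero>\<^bsub>quot_module V W\<^esub> \<longleftrightarrow> v \<in> W"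
    using W.a_rcos_const W.a_rcos_self by auto
qed

lemma dim_quot_module:
  assumes sub: "subspace K W V" and fd: "vectorspace.fin_dim K V"
  shows "vectorspace.dim K (quot_module V W) + vectorspace.dim K (V\<lparr>carrier := W\<rparr>) = vectorspace.dim K V"
proof -
  note Q = quot_module_vectorspace[OF sub]
  have "{v \<in> carrier V. W +>\<^bsub>V\<^esub> v = \<zero>\<^bsub>quot_module V W\<^esub>} = W"
    using Q(4) subspaceD(2)[OF sub] by blast
  then show ?thesis
    using dim_exact(1)[OF subspaceD(1)[OF sub] Q(1) fd Q(2,3)] by simp
qed

lemma quot_module_lift:
  assumes W: "subspace K W V" and U: "vectorspace K U" and T: "T \<in> module_hom K V U"
    and 0: "\<And>w. w \<in> W \<Longrightarrow> T w = \<zero>\<^bsub>U\<^esub>"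
  obtains S where "S \<in> module_hom K (quot_module V W) U" "\<And>v. v \<in> carrier V \<Longrightarrow> S (W +>\<^bsub>V\<^esub> v) = T v"
proof -
  interpret V: vectorspace K V by (rule subspaceD(1)[OF W])
  interpret U: vectorspace K U by fact
  note Q = quot_module_vectorspace[OF W]
  interpret Q: vectorspace K "quot_module V W" by (rule Q(1))
  let ?p = "\<lambda>v. W +>\<^bsub>V\<^esub> v"
  have eq: "T x = T y" if xy: "x \<in> carrier V" "y \<in> carrier V" "?p x = ?p y" for x y
  proof -
    have "?p (x \<ominus>\<^bsub>V\<^esub> y) = ?p x \<ominus>\<^bsub>quot_module V W\<^esub> ?p y"
      by (rule additive_minus(2)[OF V.abelian_group_axioms Q.abelian_group_axioms])
        (use module_homD[OF Q(2)] xy in \<open>auto simp del: quot_module_simps\<close>)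
    also have "\<dots> = \<zero>\<^bsub>quot_module V W\<^esub>"
      using xy(3) module_homD(1)[OF Q(2) xy(2)] by (simp add: a_minus_def Q.M.r_neg del: quot_module_simps)
    finally have "x \<ominus>\<^bsub>V\<^esub> y \<in> W" using Q(4)[of "x \<ominus>\<^bsub>V\<^esub> y"] xy by simp
    from 0[OF this] have z: "T (x \<ominus>\<^bsub>V\<^esub> y) = \<zero>\<^bsub>U\<^esub>" .
    have "T (x \<ominus>\<^bsub>V\<^esub> y) = T x \<ominus>\<^bsub>U\<^esub> T y"
      by (rule additive_minus(2)[OF V.abelian_group_axioms U.abelian_group_axioms])
        (use module_homD[OF T] xy in auto)
    then have "T x \<ominus>\<^bsub>U\<^esub> T y = \<zero>\<^bsub>U\<^esub>" unfolding z by simp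
    then show ?thesis using module_homD(1)[OF T] xy by simp
  qed
  \<comment> \<open>\<open>T\<close> is constant on classes, so the choice of the representative does not matter\<close>
  define S where "S X = T (SOME v. v \<in> carrier V \<and> ?p v = X)" for X
  have S: "S (?p v) = T v" if v: "v \<in> carrier V" for v
    unfolding S_def
  proof (rule someI2[of _ v])
    show "v \<in> carrier V \<and> ?p v = ?p v" using v by blast
    fix y assume "y \<in> carrier V \<and> ?p y = ?p v"
    then show "T y = T v" using v by (intro eq) auto
  qed
  have "S \<in> module_hom K (quot_module V W) U"
  proof (rule module_homI)
    fix X assume "X \<in> carrier (quot_module V W)"
    from this[folded Q(3)] obtain x where x: "x \<in> carrier V" "X = ?p x" by blast
    show "S X \<in> carrier U" unfolding x(2) S[OF x(1)] by (rule module_homD(1)[OF T x(1)])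
    { fix c assume c: "c \<in> carrier K"
      show "S (c \<odot>\<^bsub>quot_module V W\<^esub> X) = c \<odot>\<^bsub>U\<^esub> S X"
        unfolding x(2) module_homD(3)[OF Q(2) c x(1), symmetric] S[OF x(1)] S[OF V.smult_closed[OF c x(1)]]
        by (rule module_homD(3)[OF T c x(1)]) }
    fix Y assume "Y \<in> carrier (quot_module V W)"
    from this[folded Q(3)] obtain y where y: "y \<in> carrier V" "Y = ?p y" by blast
    show "S (X \<oplus>\<^bsub>quot_module V W\<^esub> Y) = S X \<oplus>\<^bsub>U\<^esub> S Y"
      unfolding x(2) y(2) module_homD(2)[OF Q(2) x(1) y(1), symmetric] S[OF x(1)] S[OF y(1)]
        S[OF V.M.a_closed[OF x(1) y(1)]]
      by (rule module_homD(2)[OF T x(1) y(1)])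
  qed
  then show ?thesis using that S by blast
qed

text \<open>
  By hypothesis \<open>T\<close> followed by the projection is onto \<open>V / W\<close>; its kernel is the preimage of \<open>W\<close>.
\<close>

lemma dim_quot_module_onto:
  assumes W: "subspace K W V" and D: "vectorspace K D" and fd: "vectorspace.fin_dim K D"
    and T: "T \<in> module_hom K D V"
    and onto: "\<And>v. v \<in> carrier V \<Longrightarrow> \<exists>d\<in>carrier D. \<exists>w\<in>W. v = T d \<oplus>\<^bsub>V\<^esub> w"
  shows "vectorspace.dim K (quot_module V W) + vectorspace.dim K (D\<lparr>carrier := {d \<in> carrier D. T d \<in> W}\<rparr>)
    = vectorspace.dim K D"
proof -
  note Q = quot_module_vectorspace[OF W]
  interpret V: vectorspace K V by (rule subspaceD(1)[OF W])
  interpret Q: vectorspace K "quot_module V W" by (rule Q(1))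
  let ?p = "\<lambda>v. W +>\<^bsub>V\<^esub> v"
  have TV: "T d \<in> carrier V" if "d \<in> carrier D" for d using T that by (auto simp: module_homD)
  have hom: "(\<lambda>d. ?p (T d)) \<in> module_hom K D (quot_module V W)"
    using T by (intro module_homI) (auto simp: module_homD[OF T] module_homD[OF Q(2)] simp del: quot_module_simps)
  have surj: "(\<lambda>d. ?p (T d)) ` carrier D = carrier (quot_module V W)"
  proof
    show "(\<lambda>d. ?p (T d)) ` carrier D \<subseteq> carrier (quot_module V W)"
      using module_homD(1)[OF hom] by blast
    show "carrier (quot_module V W) \<subseteq> (\<lambda>d. ?p (T d)) ` carrier D"
    proof
      fix X assume "X \<in> carrier (quot_module V W)"
      then obtain v where v: "v \<in> carrier V" "X = ?p v" using Q(3) by auto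
      obtain d w where d: "d \<in> carrier D" "w \<in> W" "v = T d \<oplus>\<^bsub>V\<^esub> w" using onto[OF v(1)] by blast
      have wV: "w \<in> carrier V" using subspaceD(2)[OF W] d(2) by auto
      have "X = ?p (T d) \<oplus>\<^bsub>quot_module V W\<^esub> ?p w"
        unfolding v(2) d(3) by (rule module_homD(2)[OF Q(2) TV[OF d(1)] wV])
      also have "?p w = \<zero>\<^bsub>quot_module V W\<^esub>" using Q(4)[OF wV] d(2) by blast
      also have "?p (T d) \<oplus>\<^bsub>quot_module V W\<^esub> \<zero>\<^bsub>quot_module V W\<^esub> = ?p (T d)"
        by (rule Q.M.r_zero) (rule module_homD(1)[OF hom d(1)])
      finally show "X \<in> (\<lambda>d. ?p (T d)) ` carrier D" using d(1) by blast
    qed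
  qed
  have "{d \<in> carrier D. ?p (T d) = \<zero>\<^bsub>quot_module V W\<^esub>} = {d \<in> carrier D. T d \<in> W}"
    using Q(4)[OF TV] by blast
  then show ?thesis using dim_exact(1)[OF D Q(1) fd hom surj] by simp
qed

section \<open>Dual bases and spaces of linear maps\<close>

lemma field_space_simps [simp]:
  "carrier (field_space K) = carrier K"
  "zero (field_space K) = zero K"
  "add (field_space K) = add K"
  "smult (field_space K) = mult K"
  by (simp_all add: field_space_def bare_module_def)

lemma field_space_vectorspace: "field K \<Longrightarrow> vectorspace K (field_space K)"
proof -
  assume "field K"
  then interpret field K .
  show ?thesis
    by (rule vs_criteria) (auto simp: a_ac m_assoc l_distr r_distr field_axioms
        intro!: bexI[of _ "\<ominus>\<^bsub>K\<^esub> _"] simp: r_neg)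
qed

text \<open>
  A finite basis \<open>v\<close> together with its coordinate functionals \<open>p\<close>.  With the functionals at hand,
  independence and spanning become the two equations in the last lines.
\<close>

definition dual_basis ::
  "('k, 'z) ring_scheme \<Rightarrow> ('k, 'v) module \<Rightarrow> 'i set \<Rightarrow> ('i \<Rightarrow> 'v) \<Rightarrow> ('i \<Rightarrow> 'v \<Rightarrow> 'k) \<Rightarrow> bool"
  where "dual_basis K V S v p \<longleftrightarrow> finite S \<and> v \<in> S \<rightarrow> carrier V
    \<and> (\<forall>i\<in>S. p i \<in> module_hom K V (field_space K))
    \<and> (\<forall>i\<in>S. \<forall>j\<in>S. p i (v j) = (if i = j then \<one>\<^bsub>K\<^esub> else \<zero>\<^bsub>K\<^esub>))
    \<and> (\<forall>x\<in>carrier V. x = finsum V (\<lambda>i. p i x \<odot>\<^bsub>V\<^esub> v i) S)"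

lemma dual_basisD:
  assumes "dual_basis K V S v p"
  shows "finite S" "i \<in> S \<Longrightarrow> v i \<in> carrier V" "i \<in> S \<Longrightarrow> p i \<in> module_hom K V (field_space K)"
    "i \<in> S \<Longrightarrow> x \<in> carrier V \<Longrightarrow> p i x \<in> carrier K"
    "i \<in> S \<Longrightarrow> j \<in> S \<Longrightarrow> p i (v j) = (if i = j then \<one>\<^bsub>K\<^esub> else \<zero>\<^bsub>K\<^esub>)"
    "x \<in> carrier V \<Longrightarrow> finsum V (\<lambda>i. p i x \<odot>\<^bsub>V\<^esub> v i) S = x"
    "i \<in> S \<Longrightarrow> x \<in> carrier V \<Longrightarrow> y \<in> carrier V \<Longrightarrow> p i (x \<oplus>\<^bsub>V\<^esub> y) = p i x \<oplus>\<^bsub>K\<^esub> p i y"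
    "i \<in> S \<Longrightarrow> c \<in> carrier K \<Longrightarrow> x \<in> carrier V \<Longrightarrow> p i (c \<odot>\<^bsub>V\<^esub> x) = c \<otimes>\<^bsub>K\<^esub> p i x"
proof -
  show a: "i \<in> S \<Longrightarrow> p i \<in> module_hom K V (field_space K)" for i
    using assms by (simp add: dual_basis_def)
  show "i \<in> S \<Longrightarrow> x \<in> carrier V \<Longrightarrow> p i x \<in> carrier K" using module_homD(1)[OF a] by simp
  show "i \<in> S \<Longrightarrow> x \<in> carrier V \<Longrightarrow> y \<in> carrier V \<Longrightarrow> p i (x \<oplus>\<^bsub>V\<^esub> y) = p i x \<oplus>\<^bsub>K\<^esub> p i y"
    using module_homD(2)[OF a] by simp
  show "i \<in> S \<Longrightarrow> c \<in> carrier K \<Longrightarrow> x \<in> carrier V \<Longrightarrow> p i (c \<odot>\<^bsub>V\<^esub> x) = c \<otimes>\<^bsub>K\<^esub> p i x"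
    using module_homD(3)[OF a] by simp
qed (use assms in \<open>auto simp: dual_basis_def\<close>)

lemma (in vectorspace) finsum_delta:
  assumes S: "finite S" "j \<in> S" and g: "g \<in> S \<rightarrow> carrier V"
    and c: "\<And>i. i \<in> S \<Longrightarrow> c i = (if i = j then \<one>\<^bsub>K\<^esub> else \<zero>\<^bsub>K\<^esub>)"
  shows "finsum V (\<lambda>i. c i \<odot>\<^bsub>V\<^esub> g i) S = g j"
proof -
  have "finsum V (\<lambda>i. c i \<odot>\<^bsub>V\<^esub> g i) S = finsum V (\<lambda>i. if j = i then g i else \<zero>\<^bsub>V\<^esub>) S"
    using g by (intro M.finsum_cong') (auto simp: c Pi_iff)
  also have "\<dots> = g j" using S g by (intro M.finsum_singleton) auto
  finally show ?thesis .
qed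

text \<open>
  The basis is indexed by natural numbers, and not by itself, so that the index type does not depend on
  the space.
\<close>

lemma dual_basis_exists:
  assumes V: "vectorspace K V" and fd: "vectorspace.fin_dim K V"
  obtains n :: nat and v p where "dual_basis K (V :: ('k, 'v) module) {..<n} v p"
proof -
  interpret V: vectorspace K V by fact
  obtain A where A: "finite A" "V.basis A" using V.finite_basis_exists[OF fd] by blast
  have AV: "A \<subseteq> carrier V" using A(2) by (simp add: V.basis_def)
  have ex1: "\<exists>!a. a \<in> A \<rightarrow>\<^sub>E carrier K \<and> V.lincomb a A = x" if "x \<in> carrier V" for x
    using V.basis_criterion[OF A(1) AV] A(2) that by blast
  define co where "co x = (THE a. a \<in> A \<rightarrow>\<^sub>E carrier K \<and> V.lincomb a A = x)" for x
  have co: "co x \<in> A \<rightarrow>\<^sub>E carrier K" "V.lincomb (co x) A = x" if "x \<in> carrier V" for x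
    using theI'[OF ex1[OF that]] by (auto simp: co_def)
  have uniq: "co x i = a i" if "x \<in> carrier V" "a \<in> A \<rightarrow> carrier K" "V.lincomb a A = x" "i \<in> A" for a x i
  proof -
    have "V.lincomb (restrict a A) A = V.lincomb a A"
      using that AV by (intro V.lincomb_cong) auto
    then have "co x = restrict a A" using ex1[OF that(1)] co[OF that(1)] that(2,3)
      by (metis restrict_PiE_iff Pi_iff)
    then show ?thesis using that(4) by simp
  qed
  have cK: "co x i \<in> carrier K" if "x \<in> carrier V" "i \<in> A" for x i using co(1)[OF that(1)] that(2) by auto
  have dA: "dual_basis K V A (\<lambda>i. i) (\<lambda>i x. co x i)"
    unfolding dual_basis_def
  proof (intro conjI ballI)
    show "finite A" by fact
    show "(\<lambda>i. i) \<in> A \<rightarrow> carrier V" using AV by auto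
    fix i assume i: "i \<in> A"
    show "(\<lambda>x. co x i) \<in> module_hom K V (field_space K)"
    proof (rule module_homI)
      fix x y assume xy: "x \<in> carrier V" "y \<in> carrier V"
      have "V.lincomb (\<lambda>i. co x i \<oplus>\<^bsub>K\<^esub> co y i) A = V.lincomb (co x) A \<oplus>\<^bsub>V\<^esub> V.lincomb (co y) A"
        using A AV cK xy by (intro V.lincomb_sum) auto
      then show "co (x \<oplus>\<^bsub>V\<^esub> y) i = co x i \<oplus>\<^bsub>field_space K\<^esub> co y i"
        using uniq[of "x \<oplus>\<^bsub>V\<^esub> y" "\<lambda>i. co x i \<oplus>\<^bsub>K\<^esub> co y i"] xy co cK i by auto
    next
      fix c x assume cx: "c \<in> carrier K" "x \<in> carrier V"
      have "V.lincomb (\<lambda>i. c \<otimes>\<^bsub>K\<^esub> co x i) A = c \<odot>\<^bsub>V\<^esub> V.lincomb (co x) A"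
        using A AV cK cx by (intro V.lincomb_smult) auto
      then show "co (c \<odot>\<^bsub>V\<^esub> x) i = c \<odot>\<^bsub>field_space K\<^esub> co x i"
        using uniq[of "c \<odot>\<^bsub>V\<^esub> x" "\<lambda>i. c \<otimes>\<^bsub>K\<^esub> co x i"] cx co cK i by auto
    qed (use cK i in auto)
    fix j assume j: "j \<in> A"
    have "V.lincomb (\<lambda>i. if i = j then \<one>\<^bsub>K\<^esub> else \<zero>\<^bsub>K\<^esub>) A = j"
      unfolding V.lincomb_def using A AV j by (intro V.finsum_delta) auto
    then show "co j i = (if i = j then \<one>\<^bsub>K\<^esub> else \<zero>\<^bsub>K\<^esub>)"
      using uniq[of j "\<lambda>i. if i = j then \<one>\<^bsub>K\<^esub> else \<zero>\<^bsub>K\<^esub>" i] i j AV by auto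
  next
    fix x assume "x \<in> carrier V"
    then show "x = finsum V (\<lambda>i. co x i \<odot>\<^bsub>V\<^esub> i) A" using co(2)[of x] by (simp add: V.lincomb_def)
  qed
  obtain h where h: "bij_betw h {..<card A} A"
    using ex_bij_betw_nat_finite[OF A(1)] by (auto simp: atLeast0LessThan)
  have hA: "h i \<in> A" if "i < card A" for i using bij_betwE[OF h] that by auto
  have hV: "h i \<in> carrier V" if "i < card A" for i using hA[OF that] AV by auto
  have "finsum V (\<lambda>i. co x i \<odot>\<^bsub>V\<^esub> i) A = finsum V (\<lambda>i. co x (h i) \<odot>\<^bsub>V\<^esub> h i) {..<card A}"
    if x: "x \<in> carrier V" for x
  proof -
    have "finsum V (\<lambda>i. co x i \<odot>\<^bsub>V\<^esub> i) (h ` {..<card A})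
        = finsum V (\<lambda>i. co x (h i) \<odot>\<^bsub>V\<^esub> h i) {..<card A}"
      using h AV cK[OF x] by (intro V.finsum_reindex) (auto simp: bij_betw_def)
    then show ?thesis using h by (simp add: bij_betw_def)
  qed
  moreover have "h i = h j \<longleftrightarrow> i = j" if "i < card A" "j < card A" for i j
    using h that by (auto simp: bij_betw_def inj_on_def)
  ultimately have "dual_basis K V {..<card A} h (\<lambda>i x. co x (h i))"
    using dA hA hV unfolding dual_basis_def by auto
  then show ?thesis using that by blast
qed

lemma dual_basis_dim:
  assumes V: "vectorspace K V" and D: "dual_basis K V S v p"
  shows "vectorspace.fin_dim K V" "vectorspace.dim K V = card S"
proof -
  interpret V: vectorspace K V by fact
  note D = dual_basisD[OF D]
  have inj: "inj_on v S"
  proof (rule inj_onI)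
    fix i j assume "i \<in> S" "j \<in> S" "v i = v j"
    then show "i = j" using D(5)[of i i] D(5)[of i j] by (auto split: if_splits)
  qed
  have fs: "V.lincomb a (v ` S) = finsum V (\<lambda>i. a (v i) \<odot>\<^bsub>V\<^esub> v i) S" if "a \<in> v ` S \<rightarrow> carrier K" for a
    unfolding V.lincomb_def using that D(2) inj by (intro V.finsum_reindex) auto
  have sub: "v ` S \<subseteq> carrier V" using D(2) by auto
  have "V.lin_indpt (v ` S)"
  proof (rule V.finite_lin_indpt2)
    show "finite (v ` S)" using D(1) by auto
    show "v ` S \<subseteq> carrier V" by (rule sub)
    fix a assume a: "a \<in> v ` S \<rightarrow> carrier K" and 0: "V.lincomb a (v ` S) = \<zero>\<^bsub>V\<^esub>"
    have aK: "a (v i) \<in> carrier K" if "i \<in> S" for i using a that by auto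
    have "a (v j) = \<zero>\<^bsub>K\<^esub>" if j: "j \<in> S" for j
    proof -
      interpret F: vectorspace K "field_space K" by (rule field_space_vectorspace[OF vectorspace_field[OF V]])
      have "\<zero>\<^bsub>K\<^esub> = p j (V.lincomb a (v ` S))" unfolding 0
        using module_hom_zero[OF V F.vectorspace_axioms D(3)[OF j]] by simp
      also have "\<dots> = finsum (field_space K) (\<lambda>i. p j (a (v i) \<odot>\<^bsub>V\<^esub> v i)) S"
        unfolding fs[OF a]
        by (rule module_hom_finsum[OF V F.vectorspace_axioms D(3)[OF j] D(1)]) (simp add: aK D(2))
      also have "\<dots> = finsum (field_space K) (\<lambda>i. p j (v i) \<odot>\<^bsub>field_space K\<^esub> a (v i)) S"
        using j by (intro F.finsum_cong') (simp_all add: aK D(2,4,5,8))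
      also have "\<dots> = a (v j)"
        by (rule F.finsum_delta) (use D(1) j in \<open>simp_all add: aK D(5) eq_commute\<close>)
      finally show ?thesis by simp
    qed
    then show "\<forall>v\<in>v ` S. a v = \<zero>\<^bsub>K\<^esub>" by auto
  qed
  moreover have gen: "V.span (v ` S) = carrier V"
  proof
    show "V.span (v ` S) \<subseteq> carrier V" using sub V.span_closed by blast
    show "carrier V \<subseteq> V.span (v ` S)"
    proof
      fix x assume x: "x \<in> carrier V"
      define a where "a w = p (the_inv_into S v w) x" for w
      have av: "a (v i) = p i x" if "i \<in> S" for i using that inj by (simp add: a_def the_inv_into_f_f)
      have "V.lincomb a (v ` S) = finsum V (\<lambda>i. p i x \<odot>\<^bsub>V\<^esub> v i) S"
        by (subst fs) (auto simp: av D(2) D(4)[OF _ x] intro!: V.finsum_cong')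
      also have "\<dots> = x" by (rule D(6)[OF x])
      finally have "V.lincomb a (v ` S) = x" .
      moreover have "a \<in> v ` S \<rightarrow> carrier K" using av D(4)[OF _ x] by auto
      ultimately show "x \<in> V.span (v ` S)" unfolding V.span_def using D(1)
        by (intro CollectI exI[of _ a] exI[of _ "v ` S"]) simp
    qed
  qed
  ultimately have "V.basis (v ` S)" using sub by (simp add: V.basis_def)
  then have "V.dim = card (v ` S)" using D(1) by (intro V.dim_basis) auto
  then show "V.dim = card S" using inj by (simp add: card_image)
  show "V.fin_dim" unfolding V.fin_dim_def using gen sub D(1) by blast
qed

text \<open>
  If the functionals separate points, the vectors span: all functionals vanish on the difference of \<open>x\<close>
  and the sum of the \<open>p i x v i\<close>.
\<close>

lemma dual_basisI:
  assumes V: "vectorspace K V" and S: "finite S" and v: "\<And>i. i \<in> S \<Longrightarrow> v i \<in> carrier V"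
    and p: "\<And>i. i \<in> S \<Longrightarrow> p i \<in> module_hom K V (field_space K)"
    and d: "\<And>i j. i \<in> S \<Longrightarrow> j \<in> S \<Longrightarrow> p i (v j) = (if i = j then \<one>\<^bsub>K\<^esub> else \<zero>\<^bsub>K\<^esub>)"
    and sep: "\<And>x. x \<in> carrier V \<Longrightarrow> (\<And>i. i \<in> S \<Longrightarrow> p i x = \<zero>\<^bsub>K\<^esub>) \<Longrightarrow> x = \<zero>\<^bsub>V\<^esub>"
  shows "dual_basis K V S v p"
  unfolding dual_basis_def
proof (intro conjI ballI)
  interpret V: vectorspace K V by fact
  interpret F: vectorspace K "field_space K" by (rule field_space_vectorspace[OF vectorspace_field[OF V]])
  fix x assume x: "x \<in> carrier V"
  have pK: "p i y \<in> carrier K" if "i \<in> S" "y \<in> carrier V" for i y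
    using module_homD(1)[OF p] that by simp
  let ?y = "finsum V (\<lambda>i. p i x \<odot>\<^bsub>V\<^esub> v i) S"
  have y: "?y \<in> carrier V" using x v pK by (intro V.finsum_closed) auto
  have py: "p j ?y = p j x" if j: "j \<in> S" for j
  proof -
    have "p j ?y = finsum (field_space K) (\<lambda>i. p j (p i x \<odot>\<^bsub>V\<^esub> v i)) S"
      by (rule module_hom_finsum[OF V F.vectorspace_axioms p[OF j] S]) (simp add: pK v x)
    also have "\<dots> = finsum (field_space K) (\<lambda>i. p j (v i) \<odot>\<^bsub>field_space K\<^esub> p i x) S"
      using j by (intro F.finsum_cong') (simp_all add: pK v x module_homD(3)[OF p] d)
    also have "\<dots> = p j x"
      by (rule F.finsum_delta) (use S j in \<open>simp_all add: pK x d eq_commute\<close>)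
    finally show ?thesis .
  qed
  have "x \<ominus>\<^bsub>V\<^esub> ?y = \<zero>\<^bsub>V\<^esub>"
  proof (rule sep)
    fix i assume i: "i \<in> S"
    show "p i (x \<ominus>\<^bsub>V\<^esub> ?y) = \<zero>\<^bsub>K\<^esub>"
      using additive_minus(2)[OF V.abelian_group_axioms F.abelian_group_axioms _ module_homD(2)[OF p[OF i]] x y]
        module_homD(1)[OF p[OF i]] py[OF i] pK[OF i x] by (simp add: F.r_neg a_minus_def F.M.r_neg[simplified])
  qed (use x y in auto)
  then show "x = ?y" using x y by simp
qed (use S v p d in auto)

lemma bare_module_simps [simp]:
  "carrier (bare_module C z a s) = C" "zero (bare_module C z a s) = z"
  "add (bare_module C z a s) = a" "smult (bare_module C z a s) = s"
  by (simp_all add: bare_module_def)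

lemma hom_space_simps [simp]:
  "carrier (hom_space R M N s) = module_hom R M N \<inter> extensional (carrier M)"
  "zero (hom_space R M N s) = (\<lambda>m\<in>carrier M. \<zero>\<^bsub>N\<^esub>)"
  "add (hom_space R M N s) = (\<lambda>\<phi> \<psi>. \<lambda>m\<in>carrier M. \<phi> m \<oplus>\<^bsub>N\<^esub> \<psi> m)"
  "smult (hom_space R M N s) = (\<lambda>c \<phi>. \<lambda>m\<in>carrier M. s c (\<phi> m))"
  by (simp_all add: hom_space_def)

text \<open>
  The point is that \<open>K\<close> and \<open>R\<close> act on \<open>N\<close> by commuting maps, so that multiples of \<open>R\<close>-linear maps by
  elements of \<open>K\<close> are \<open>R\<close>-linear.
\<close>

lemma hom_space_vectorspace:
  assumes N: "vectorspace K (bare_module (carrier N) \<zero>\<^bsub>N\<^esub> (add N) s)"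
    and rN: "\<And>r n. r \<in> carrier R \<Longrightarrow> n \<in> carrier N \<Longrightarrow> r \<odot>\<^bsub>N\<^esub> n \<in> carrier N"
    and r_add: "\<And>r n n'. r \<in> carrier R \<Longrightarrow> n \<in> carrier N \<Longrightarrow> n' \<in> carrier N \<Longrightarrow>
      r \<odot>\<^bsub>N\<^esub> (n \<oplus>\<^bsub>N\<^esub> n') = r \<odot>\<^bsub>N\<^esub> n \<oplus>\<^bsub>N\<^esub> r \<odot>\<^bsub>N\<^esub> n'"
    and r_s: "\<And>r c n. r \<in> carrier R \<Longrightarrow> c \<in> carrier K \<Longrightarrow> n \<in> carrier N \<Longrightarrow>
      r \<odot>\<^bsub>N\<^esub> s c n = s c (r \<odot>\<^bsub>N\<^esub> n)"
    and aM: "\<And>m m'. m \<in> carrier M \<Longrightarrow> m' \<in> carrier M \<Longrightarrow> m \<oplus>\<^bsub>M\<^esub> m' \<in> carrier M"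
    and sM: "\<And>r m. r \<in> carrier R \<Longrightarrow> m \<in> carrier M \<Longrightarrow> r \<odot>\<^bsub>M\<^esub> m \<in> carrier M"
  shows "vectorspace K (hom_space R M N s)"
proof -
  interpret N: vectorspace K "bare_module (carrier N) \<zero>\<^bsub>N\<^esub> (add N) s" by fact
  note a_closed = N.M.a_closed[simplified] and z_closed = N.M.zero_closed[simplified]
    and s_closed = N.smult_closed[simplified] and s_r = N.smult_r_distr[simplified]
    and s_l = N.smult_l_distr[simplified] and s_a = N.smult_assoc1[simplified]
    and s_1 = N.smult_one[simplified] and r_z = N.M.r_zero[simplified] N.M.l_zero[simplified]
  note ac = N.M.a_assoc[simplified] N.M.a_comm[simplified] N.M.a_lcomm[simplified]
  have r0: "r \<odot>\<^bsub>N\<^esub> \<zero>\<^bsub>N\<^esub> = \<zero>\<^bsub>N\<^esub>" if "r \<in> carrier R" for r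
    using additive_zero[OF N.abelian_group_axioms N.abelian_group_axioms, of "\<lambda>n. r \<odot>\<^bsub>N\<^esub> n"] that rN r_add
    by simp
  have neg: "\<exists>n'\<in>carrier (hom_space R M N s). n \<oplus>\<^bsub>hom_space R M N s\<^esub> n' = \<zero>\<^bsub>hom_space R M N s\<^esub>"
    if n: "n \<in> carrier (hom_space R M N s)" for n
  proof
    let ?m = "\<ominus>\<^bsub>K\<^esub> \<one>\<^bsub>K\<^esub>"
    have m: "?m \<in> carrier K" by simp
    have nm: "x \<oplus>\<^bsub>N\<^esub> s ?m x = \<zero>\<^bsub>N\<^esub>" if "x \<in> carrier N" for x
      using N.smult_minus_1[of x] N.M.r_neg[of x] that by simp
    show "(\<lambda>x\<in>carrier M. s ?m (n x)) \<in> carrier (hom_space R M N s)"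
      using n by (auto intro!: module_homI simp: module_homD aM sM m s_closed s_r r_s)
    show "n \<oplus>\<^bsub>hom_space R M N s\<^esub> (\<lambda>x\<in>carrier M. s ?m (n x)) = \<zero>\<^bsub>hom_space R M N s\<^esub>"
      using n by (auto intro!: restrict_ext simp: module_homD nm)
  qed
  show ?thesis
  proof (rule vs_criteria)
    show "field K" by (rule N.field_axioms)
  qed (use neg in \<open>auto intro!: module_homI extensionalityI[of _ "carrier M"]
      simp: module_homD aM sM s_closed s_r r_s r0 z_closed a_closed r_add ac s_a s_1 s_l r_z\<close>)
qed

lemma linear_space_simps [simp]:
  "carrier (linear_space K V W) = module_hom K V W \<inter> extensional (carrier V)"
  "zero (linear_space K V W) = (\<lambda>m\<in>carrier V. \<zero>\<^bsub>W\<^esub>)"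
  "add (linear_space K V W) = (\<lambda>\<phi> \<psi>. \<lambda>m\<in>carrier V. \<phi> m \<oplus>\<^bsub>W\<^esub> \<psi> m)"
  "smult (linear_space K V W) = (\<lambda>c \<phi>. \<lambda>m\<in>carrier V. c \<odot>\<^bsub>W\<^esub> \<phi> m)"
  by (simp_all add: linear_space_def)

lemma bare_module_vectorspace:
  assumes "vectorspace K V"
  shows "vectorspace K (bare_module (carrier V) \<zero>\<^bsub>V\<^esub> (add V) (smult V))"
  by (rule vectorspace_image[OF assms, of _ "\<lambda>x. x"]) simp_all

lemma linear_space_vectorspace:
  assumes V: "vectorspace K V" and W: "vectorspace K W"
  shows "vectorspace K (linear_space K V W)"
proof -
  interpret V: vectorspace K V by fact
  interpret W: vectorspace K W by fact
  show ?thesis unfolding linear_space_def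
  proof (rule hom_space_vectorspace[OF bare_module_vectorspace[OF W]])
    fix r c n assume "r \<in> carrier K" "c \<in> carrier K" "n \<in> carrier W"
    then show "r \<odot>\<^bsub>W\<^esub> (c \<odot>\<^bsub>W\<^esub> n) = c \<odot>\<^bsub>W\<^esub> (r \<odot>\<^bsub>W\<^esub> n)"
      by (simp add: W.smult_assoc1[symmetric] V.m_comm)
  qed (auto simp: W.smult_r_distr)
qed

text \<open>
  The basis consists of the matrix units \<open>x \<mapsto> p i x w j\<close>; the coordinate of \<open>h\<close> at such a unit is the
  \<open>j\<close>-th coordinate of \<open>h (v i)\<close>.
\<close>

lemma dim_linear_space:
  assumes V: "vectorspace K V" and W: "vectorspace K W"
    and fV: "vectorspace.fin_dim K V" and fW: "vectorspace.fin_dim K W"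
  shows "vectorspace.fin_dim K (linear_space K V W)"
    and "vectorspace.dim K (linear_space K V W) = vectorspace.dim K V * vectorspace.dim K W"
proof -
  interpret V: vectorspace K V by fact
  interpret W: vectorspace K W by fact
  let ?L = "linear_space K V W"
  obtain n v p where D: "dual_basis K V {..<n :: nat} v p" using dual_basis_exists[OF V fV] .
  obtain n' w q where D': "dual_basis K W {..<n' :: nat} w q" using dual_basis_exists[OF W fW] .
  note d = dual_basisD[OF D] and d' = dual_basisD[OF D']
  let ?E = "\<lambda>(i, j). \<lambda>x\<in>carrier V. p i x \<odot>\<^bsub>W\<^esub> w j"
  let ?P = "\<lambda>(i, j) h. q j (h (v i))"
  have "dual_basis K ?L ({..<n} \<times> {..<n'}) ?E ?P"
  proof (rule dual_basisI[OF linear_space_vectorspace[OF V W]])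
    show "finite ({..<n} \<times> {..<n'})" using d(1) d'(1) by simp
    fix ij assume "ij \<in> {..<n} \<times> {..<n'}"
    then obtain i j where ij: "ij = (i, j)" "i \<in> {..<n}" "j \<in> {..<n'}" by auto
    show "?E ij \<in> carrier ?L"
      using ij by (auto intro!: module_homI simp: d d' W.smult_l_distr W.smult_assoc1)
    show "?P ij \<in> module_hom K ?L (field_space K)"
      using ij by (auto intro!: module_homI simp: d d' module_homD)
    fix kl assume "kl \<in> {..<n} \<times> {..<n'}"
    then obtain k l where kl: "kl = (k, l)" "k \<in> {..<n}" "l \<in> {..<n'}" by auto
    show "?P ij (?E kl) = (if ij = kl then \<one>\<^bsub>K\<^esub> else \<zero>\<^bsub>K\<^esub>)"
      using ij kl by (auto simp: d d' eq_commute)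
  next
    fix h assume h: "h \<in> carrier ?L" and 0: "\<And>ij. ij \<in> {..<n} \<times> {..<n'} \<Longrightarrow> ?P ij h = \<zero>\<^bsub>K\<^esub>"
    have hv: "h (v i) = \<zero>\<^bsub>W\<^esub>" if i: "i \<in> {..<n}" for i
    proof -
      have W: "h (v i) \<in> carrier W" using h i d(2) by (auto simp: module_homD)
      have "finsum W (\<lambda>j. q j (h (v i)) \<odot>\<^bsub>W\<^esub> w j) {..<n'} = \<zero>\<^bsub>W\<^esub>"
        using 0 i d'(2) by (intro W.M.add.finprod_one_eqI) auto
      then show ?thesis using d'(6)[OF W] by simp
    qed
    have "h x = \<zero>\<^bsub>W\<^esub>" if x: "x \<in> carrier V" for x
    proof -
      have "h x = h (finsum V (\<lambda>i. p i x \<odot>\<^bsub>V\<^esub> v i) {..<n})" using d(6)[OF x] by simp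
      also have "\<dots> = finsum W (\<lambda>i. h (p i x \<odot>\<^bsub>V\<^esub> v i)) {..<n}"
        using h by (intro module_hom_finsum[OF V W _ d(1)]) (auto simp: d(2) d(4)[OF _ x])
      also have "\<dots> = \<zero>\<^bsub>W\<^esub>"
        using h by (intro W.M.add.finprod_one_eqI) (auto simp: d(2) d(4)[OF _ x] module_homD hv)
      finally show ?thesis .
    qed
    then show "h = \<zero>\<^bsub>?L\<^esub>" using h by (auto intro!: extensionalityI[of _ "carrier V"])
  qed
  from dual_basis_dim[OF linear_space_vectorspace[OF V W] this]
  show "vectorspace.fin_dim K ?L" "vectorspace.dim K ?L = vectorspace.dim K V * vectorspace.dim K W"
    using dual_basis_dim(2)[OF V D] dual_basis_dim(2)[OF W D'] by (auto simp: card_cartesian_product)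
qed

lemma dim_field_space:
  assumes K: "field K"
  shows "vectorspace.fin_dim K (field_space K)" "vectorspace.dim K (field_space K) = 1"
proof -
  interpret F: vectorspace K "field_space K" by (rule field_space_vectorspace[OF K])
  have "dual_basis K (field_space K) {()} (\<lambda>_. \<one>\<^bsub>K\<^esub>) (\<lambda>_ x. x)"
    by (rule dual_basisI[OF F.vectorspace_axioms]) (auto intro!: module_homI)
  from dual_basis_dim[OF F.vectorspace_axioms this]
  show "vectorspace.fin_dim K (field_space K)" "vectorspace.dim K (field_space K) = 1" by auto
qed

lemma direct_sum_simps [simp]:
  "carrier (direct_sum V W) = carrier V \<times> carrier W"
  "zero (direct_sum V W) = (\<zero>\<^bsub>V\<^esub>, \<zero>\<^bsub>W\<^esub>)"
  "add (direct_sum V W) = (\<lambda>x y. (fst x \<oplus>\<^bsub>V\<^esub> fst y, snd x \<oplus>\<^bsub>W\<^esub> snd y))"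
  "smult (direct_sum V W) = (\<lambda>c x. (c \<odot>\<^bsub>V\<^esub> fst x, c \<odot>\<^bsub>W\<^esub> snd x))"
  by (auto simp: direct_sum_def)

lemma fin_dim_direct_sum:
  fixes V :: "('k, 'v) module" and W :: "('k, 'w) module"
  assumes V: "vectorspace K V" and W: "vectorspace K W"
    and fV: "vectorspace.fin_dim K V" and fW: "vectorspace.fin_dim K W"
  shows "vectorspace.fin_dim K (direct_sum V W)"
    and "vectorspace.dim K (direct_sum V W) = vectorspace.dim K V + vectorspace.dim K W"
proof -
  interpret V: vectorspace K V by fact
  interpret W: vectorspace K W by fact
  let ?L = "direct_sum V W"
  note L = direct_sum_is_vs[OF V W]
  obtain n v p where D: "dual_basis K V {..<n :: nat} v p" using dual_basis_exists[OF V fV] .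
  obtain n' w q where D': "dual_basis K W {..<n' :: nat} w q" using dual_basis_exists[OF W fW] .
  note d = dual_basisD[OF D] and d' = dual_basisD[OF D']
  have z0: "p i \<zero>\<^bsub>V\<^esub> = \<zero>\<^bsub>K\<^esub>" if "i \<in> {..<n}" for i
    using module_hom_zero[OF V field_space_vectorspace[OF V.field_axioms] d(3)[OF that]] by simp
  have z0': "q i \<zero>\<^bsub>W\<^esub> = \<zero>\<^bsub>K\<^esub>" if "i \<in> {..<n'}" for i
    using module_hom_zero[OF W field_space_vectorspace[OF V.field_axioms] d'(3)[OF that]] by simp
  have "dual_basis K ?L ({..<n} <+> {..<n'})
    (case_sum (\<lambda>i. (v i, \<zero>\<^bsub>W\<^esub>)) (\<lambda>j. (\<zero>\<^bsub>V\<^esub>, w j))) (case_sum (\<lambda>i x. p i (fst x)) (\<lambda>j x. q j (snd x)))"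
  proof (rule dual_basisI[OF L])
    fix x assume x: "x \<in> carrier ?L"
      and z: "\<And>i. i \<in> {..<n} <+> {..<n'} \<Longrightarrow> case_sum (\<lambda>i x. p i (fst x)) (\<lambda>j x. q j (snd x)) i x = \<zero>\<^bsub>K\<^esub>"
    have zl: "p i (fst x) = \<zero>\<^bsub>K\<^esub>" if "i < n" for i using z[of "Inl i"] that by (simp add: Plus_def)
    have zr: "q i (snd x) = \<zero>\<^bsub>K\<^esub>" if "i < n'" for i using z[of "Inr i"] that by (simp add: Plus_def)
    have "fst x \<in> carrier V" "snd x \<in> carrier W" using x by auto
    moreover have "finsum V (\<lambda>i. p i (fst x) \<odot>\<^bsub>V\<^esub> v i) {..<n} = \<zero>\<^bsub>V\<^esub>"
      using zl d(2) by (intro V.M.add.finprod_one_eqI) auto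
    moreover have "finsum W (\<lambda>i. q i (snd x) \<odot>\<^bsub>W\<^esub> w i) {..<n'} = \<zero>\<^bsub>W\<^esub>"
      using zr d'(2) by (intro W.M.add.finprod_one_eqI) auto
    ultimately show "x = \<zero>\<^bsub>?L\<^esub>" using d(6) d'(6) by (auto simp: prod_eq_iff)
  qed (auto intro!: module_homI simp: d d' z0 z0' split: if_splits)
  from dual_basis_dim[OF L this]
  show "vectorspace.fin_dim K ?L" "vectorspace.dim K ?L = vectorspace.dim K V + vectorspace.dim K W"
    using dual_basis_dim(2)[OF V D] dual_basis_dim(2)[OF W D'] d(1) d'(1) by (auto simp: card_Plus)
qed

section \<open>Algebras, bimodules and derivations\<close>

locale kalg = ring A + V: vectorspace K A
  for K :: "('k, 'z) ring_scheme" and A :: "('k, 'a) module" (structure) +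
  assumes smult_mult_left: "c \<in> carrier K \<Longrightarrow> x \<in> carrier A \<Longrightarrow> y \<in> carrier A \<Longrightarrow>
      (c \<odot> x) \<otimes> y = c \<odot> (x \<otimes> y)"
    and smult_mult_right: "c \<in> carrier K \<Longrightarrow> x \<in> carrier A \<Longrightarrow> y \<in> carrier A \<Longrightarrow>
      x \<otimes> (c \<odot> y) = c \<odot> (x \<otimes> y)"

text \<open>
  The two actions are parameters and not fields of a record, because one space carries several of them:
  the trivial extension \<open>T\<close> is used as a bimodule over itself and over \<open>B\<close>.
\<close>

locale bimod = kalg K A + M: vectorspace K M
  for K :: "('k, 'z) ring_scheme" and A :: "('k, 'a) module" (structure)
    and M :: "('k, 'm) module" +
  fixes l :: "'a \<Rightarrow> 'm \<Rightarrow> 'm" and r :: "'m \<Rightarrow> 'a \<Rightarrow> 'm"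
  assumes l_closed [simp]: "x \<in> carrier A \<Longrightarrow> m \<in> carrier M \<Longrightarrow> l x m \<in> carrier M"
    and r_closed [simp]: "x \<in> carrier A \<Longrightarrow> m \<in> carrier M \<Longrightarrow> r m x \<in> carrier M"
    and l_add: "x \<in> carrier A \<Longrightarrow> m \<in> carrier M \<Longrightarrow> n \<in> carrier M \<Longrightarrow> l x (m \<oplus>\<^bsub>M\<^esub> n) = l x m \<oplus>\<^bsub>M\<^esub> l x n"
    and add_l: "x \<in> carrier A \<Longrightarrow> y \<in> carrier A \<Longrightarrow> m \<in> carrier M \<Longrightarrow> l (x \<oplus> y) m = l x m \<oplus>\<^bsub>M\<^esub> l y m"
    and r_add: "x \<in> carrier A \<Longrightarrow> y \<in> carrier A \<Longrightarrow> m \<in> carrier M \<Longrightarrow> r m (x \<oplus> y) = r m x \<oplus>\<^bsub>M\<^esub> r m y"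
    and add_r: "x \<in> carrier A \<Longrightarrow> m \<in> carrier M \<Longrightarrow> n \<in> carrier M \<Longrightarrow> r (m \<oplus>\<^bsub>M\<^esub> n) x = r m x \<oplus>\<^bsub>M\<^esub> r n x"
    and l_smult: "c \<in> carrier K \<Longrightarrow> x \<in> carrier A \<Longrightarrow> m \<in> carrier M \<Longrightarrow> l x (c \<odot>\<^bsub>M\<^esub> m) = c \<odot>\<^bsub>M\<^esub> l x m"
    and smult_l: "c \<in> carrier K \<Longrightarrow> x \<in> carrier A \<Longrightarrow> m \<in> carrier M \<Longrightarrow> l (c \<odot> x) m = c \<odot>\<^bsub>M\<^esub> l x m"
    and r_smult: "c \<in> carrier K \<Longrightarrow> x \<in> carrier A \<Longrightarrow> m \<in> carrier M \<Longrightarrow> r m (c \<odot> x) = c \<odot>\<^bsub>M\<^esub> r m x"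
    and smult_r: "c \<in> carrier K \<Longrightarrow> x \<in> carrier A \<Longrightarrow> m \<in> carrier M \<Longrightarrow> r (c \<odot>\<^bsub>M\<^esub> m) x = c \<odot>\<^bsub>M\<^esub> r m x"
    and l_assoc: "x \<in> carrier A \<Longrightarrow> y \<in> carrier A \<Longrightarrow> m \<in> carrier M \<Longrightarrow> l (x \<otimes> y) m = l x (l y m)"
    and r_assoc: "x \<in> carrier A \<Longrightarrow> y \<in> carrier A \<Longrightarrow> m \<in> carrier M \<Longrightarrow> r m (x \<otimes> y) = r (r m x) y"
    and lr_assoc: "x \<in> carrier A \<Longrightarrow> y \<in> carrier A \<Longrightarrow> m \<in> carrier M \<Longrightarrow> r (l x m) y = l x (r m y)"
    and l_one [simp]: "m \<in> carrier M \<Longrightarrow> l \<one> m = m"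
    and r_one [simp]: "m \<in> carrier M \<Longrightarrow> r m \<one> = m"

context bimod begin

lemma l_zero [simp]: "x \<in> carrier A \<Longrightarrow> l x \<zero>\<^bsub>M\<^esub> = \<zero>\<^bsub>M\<^esub>"
  by (rule additive_zero[OF M.abelian_group_axioms M.abelian_group_axioms]) (auto simp: l_add)

lemma r_zero' [simp]: "x \<in> carrier A \<Longrightarrow> r \<zero>\<^bsub>M\<^esub> x = \<zero>\<^bsub>M\<^esub>"
  by (rule additive_zero[OF M.abelian_group_axioms M.abelian_group_axioms]) (auto simp: add_r)

lemma zero_l [simp]: "m \<in> carrier M \<Longrightarrow> l \<zero> m = \<zero>\<^bsub>M\<^esub>"
  by (rule additive_zero[OF abelian_group_axioms M.abelian_group_axioms, of "\<lambda>x. l x m"]) (auto simp: add_l)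

lemma zero_r [simp]: "m \<in> carrier M \<Longrightarrow> r m \<zero> = \<zero>\<^bsub>M\<^esub>"
  by (rule additive_zero[OF abelian_group_axioms M.abelian_group_axioms, of "\<lambda>x. r m x"]) (auto simp: r_add)

end

definition derivations ::
  "('k, 'z) ring_scheme \<Rightarrow> ('k, 'a) module \<Rightarrow> ('k, 'm) module \<Rightarrow> ('a \<Rightarrow> 'm \<Rightarrow> 'm) \<Rightarrow> ('m \<Rightarrow> 'a \<Rightarrow> 'm)
    \<Rightarrow> ('a \<Rightarrow> 'm) set"
  where "derivations K A M l r = {d \<in> carrier (linear_space K A M).
    \<forall>x\<in>carrier A. \<forall>y\<in>carrier A. d (x \<otimes>\<^bsub>A\<^esub> y) = l x (d y) \<oplus>\<^bsub>M\<^esub> r (d x) y}"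

definition der_space ::
  "('k, 'z) ring_scheme \<Rightarrow> ('k, 'a) module \<Rightarrow> ('k, 'm) module \<Rightarrow> ('a \<Rightarrow> 'm \<Rightarrow> 'm) \<Rightarrow> ('m \<Rightarrow> 'a \<Rightarrow> 'm)
    \<Rightarrow> ('k, 'a \<Rightarrow> 'm) module"
  where "der_space K A M l r = (linear_space K A M)\<lparr>carrier := derivations K A M l r\<rparr>"

lemma der_space_simps [simp]:
  "carrier (der_space K A M l r) = derivations K A M l r"
  "zero (der_space K A M l r) = (\<lambda>m\<in>carrier A. \<zero>\<^bsub>M\<^esub>)"
  "add (der_space K A M l r) = (\<lambda>\<phi> \<psi>. \<lambda>m\<in>carrier A. \<phi> m \<oplus>\<^bsub>M\<^esub> \<psi> m)"
  "smult (der_space K A M l r) = (\<lambda>c \<phi>. \<lambda>m\<in>carrier A. c \<odot>\<^bsub>M\<^esub> \<phi> m)"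
  by (simp_all add: der_space_def)

lemma derivationsD:
  assumes "d \<in> derivations K A M l r"
  shows "d \<in> carrier (linear_space K A M)" "d \<in> module_hom K A M" "d \<in> extensional (carrier A)"
    "x \<in> carrier A \<Longrightarrow> d x \<in> carrier M"
    "x \<in> carrier A \<Longrightarrow> y \<in> carrier A \<Longrightarrow> d (x \<oplus>\<^bsub>A\<^esub> y) = d x \<oplus>\<^bsub>M\<^esub> d y"
    "c \<in> carrier K \<Longrightarrow> x \<in> carrier A \<Longrightarrow> d (c \<odot>\<^bsub>A\<^esub> x) = c \<odot>\<^bsub>M\<^esub> d x"
    "x \<in> carrier A \<Longrightarrow> y \<in> carrier A \<Longrightarrow> d (x \<otimes>\<^bsub>A\<^esub> y) = l x (d y) \<oplus>\<^bsub>M\<^esub> r (d x) y"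
  using assms by (auto simp: derivations_def module_homD)

lemma derivationsI:
  assumes "d \<in> extensional (carrier A)"
    "\<And>x. x \<in> carrier A \<Longrightarrow> d x \<in> carrier M"
    "\<And>x y. x \<in> carrier A \<Longrightarrow> y \<in> carrier A \<Longrightarrow> d (x \<oplus>\<^bsub>A\<^esub> y) = d x \<oplus>\<^bsub>M\<^esub> d y"
    "\<And>c x. c \<in> carrier K \<Longrightarrow> x \<in> carrier A \<Longrightarrow> d (c \<odot>\<^bsub>A\<^esub> x) = c \<odot>\<^bsub>M\<^esub> d x"
    "\<And>x y. x \<in> carrier A \<Longrightarrow> y \<in> carrier A \<Longrightarrow> d (x \<otimes>\<^bsub>A\<^esub> y) = l x (d y) \<oplus>\<^bsub>M\<^esub> r (d x) y"
  shows "d \<in> derivations K A M l r"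
  using assms by (auto simp: derivations_def intro!: module_homI)

context bimod begin

lemma derivations_subspace: "subspace K (derivations K A M l r) (linear_space K A M)"
proof (rule subspaceI)
  show "vectorspace K (linear_space K A M)"
    by (rule linear_space_vectorspace[OF V.vectorspace_axioms M.vectorspace_axioms])
  then interpret L: vectorspace K "linear_space K A M" .
  show "derivations K A M l r \<subseteq> carrier (linear_space K A M)" by (auto simp: derivations_def)
  show "\<zero>\<^bsub>linear_space K A M\<^esub> \<in> derivations K A M l r"
    by (rule derivationsI) auto
  fix d d' assume d: "d \<in> derivations K A M l r" and d': "d' \<in> derivations K A M l r"
  note d = derivationsD[OF d] and d' = derivationsD[OF d']
  show "d \<oplus>\<^bsub>linear_space K A M\<^esub> d' \<in> derivations K A M l r"
    by (rule derivationsI) (auto simp: d(4-) d'(4-) M.a_ac M.smult_r_distr l_add add_r)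
next
  fix c d assume c: "c \<in> carrier K" and d: "d \<in> derivations K A M l r"
  note d = derivationsD[OF d]
  show "c \<odot>\<^bsub>linear_space K A M\<^esub> d \<in> derivations K A M l r"
    by (rule derivationsI)
      (auto simp: d(4-) c M.smult_r_distr M.smult_assoc1[symmetric] V.m_comm l_smult smult_r)
qed

lemma der_space_vectorspace: "vectorspace K (der_space K A M l r)"
  unfolding der_space_def by (rule subspaceD(6)[OF derivations_subspace])

lemma der_space_fin_dim:
  assumes "V.fin_dim" "M.fin_dim"
  shows "vectorspace.fin_dim K (der_space K A M l r)"
  unfolding der_space_def
  by (rule subspace_fin_dim[OF derivations_subspace
        dim_linear_space(1)[OF V.vectorspace_axioms M.vectorspace_axioms assms]])

end

lemma (in kalg) regular_bimod: "bimod K A A (mult A) (mult A)"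
  by unfold_locales (auto simp: l_distr r_distr m_assoc smult_mult_left smult_mult_right)

context kalg begin

lemma hochschild_cocycles:
  "{\<phi> \<in> carrier (linear_space K A A). \<forall>x\<in>carrier A. \<forall>y\<in>carrier A. hochschild_d1 A \<phi> x y = \<zero>}
    = derivations K A A (mult A) (mult A)"
proof -
  have "hochschild_d1 A \<phi> x y = \<zero> \<longleftrightarrow> \<phi> (x \<otimes> y) = x \<otimes> \<phi> y \<oplus> \<phi> x \<otimes> y"
    if "\<phi> \<in> carrier (linear_space K A A)" "x \<in> carrier A" "y \<in> carrier A" for \<phi> x y
  proof -
    have c: "\<phi> x \<in> carrier A" "\<phi> y \<in> carrier A" "\<phi> (x \<otimes> y) \<in> carrier A"
      using that by (auto simp: module_homD)
    have "hochschild_d1 A \<phi> x y = (x \<otimes> \<phi> y \<oplus> \<phi> x \<otimes> y) \<ominus> \<phi> (x \<otimes> y)"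
      unfolding hochschild_d1_def using that(2,3) c by algebra
    also have "\<dots> = \<zero> \<longleftrightarrow> x \<otimes> \<phi> y \<oplus> \<phi> x \<otimes> y = \<phi> (x \<otimes> y)"
      using that(2,3) c by simp
    finally show ?thesis by auto
  qed
  then show ?thesis by (auto simp: derivations_def)
qed

lemma hochschild_d0_derivation: "z \<in> carrier A \<Longrightarrow> hochschild_d0 A z \<in> derivations K A A (mult A) (mult A)"
proof (rule derivationsI)
  fix c x assume "c \<in> carrier K" "x \<in> carrier A" "z \<in> carrier A"
  then show "hochschild_d0 A z (c \<odot> x) = c \<odot> hochschild_d0 A z x"
    by (simp add: hochschild_d0_def smult_mult_left smult_mult_right a_minus_def V.smult_r_distr V.smult_r_minus)
next
  fix x y assume "x \<in> carrier A" "y \<in> carrier A" "z \<in> carrier A"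
  then show "hochschild_d0 A z (x \<oplus> y) = hochschild_d0 A z x \<oplus> hochschild_d0 A z y"
    unfolding hochschild_d0_def by (simp, algebra)
next
  fix x y assume "x \<in> carrier A" "y \<in> carrier A" "z \<in> carrier A"
  then show "hochschild_d0 A z (x \<otimes> y) = x \<otimes> hochschild_d0 A z y \<oplus> hochschild_d0 A z x \<otimes> y"
    unfolding hochschild_d0_def by (simp, algebra)
qed (auto simp: hochschild_d0_def)

text \<open>
  The map \<open>hochschild_d0\<close> sends an element to its inner derivation.  Its kernel is the center, and
  \<open>HH1\<close> is the cokernel of its corestriction to the derivations.
\<close>

lemma dim_HH1:
  assumes fd: "V.fin_dim"
  shows "vectorspace.dim K (HH1 K A) + vectorspace.dim K A
    = vectorspace.dim K (der_space K A A (mult A) (mult A)) + vectorspace.dim K (center A)"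
proof -
  interpret bimod K A A "mult A" "mult A" by (rule regular_bimod)
  let ?D = "der_space K A A (mult A) (mult A)"
  let ?I = "hochschild_d0 A ` carrier A"
  interpret D: vectorspace K ?D by (rule der_space_vectorspace)
  have hom: "hochschild_d0 A \<in> module_hom K A ?D"
  proof (rule module_homI)
    fix x assume "x \<in> carrier A"
    then show "hochschild_d0 A x \<in> carrier ?D" by (simp add: hochschild_d0_derivation)
  next
    fix x y assume xy: "x \<in> carrier A" "y \<in> carrier A"
    have "z \<otimes> (x \<oplus> y) \<ominus> (x \<oplus> y) \<otimes> z = z \<otimes> x \<ominus> x \<otimes> z \<oplus> (z \<otimes> y \<ominus> y \<otimes> z)" if "z \<in> carrier A" for z
      using that xy by algebra
    then show "hochschild_d0 A (x \<oplus> y) = hochschild_d0 A x \<oplus>\<^bsub>?D\<^esub> hochschild_d0 A y"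
      by (auto simp: hochschild_d0_def intro!: restrict_ext)
  next
    fix c x assume "c \<in> carrier K" "x \<in> carrier A"
    then show "hochschild_d0 A (c \<odot> x) = c \<odot>\<^bsub>?D\<^esub> hochschild_d0 A x"
      by (auto simp: hochschild_d0_def smult_mult_left smult_mult_right a_minus_def
          V.smult_r_distr V.smult_r_minus intro!: restrict_ext)
  qed
  have sub: "subspace K ?I ?D"
    using linear_map.imT_is_subspace[OF linear_mapI[OF V.vectorspace_axioms D.vectorspace_axioms hom]]
    by (simp add: mod_hom.im_def[OF linear_map.axioms(3)[OF linear_mapI[OF V.vectorspace_axioms D.vectorspace_axioms hom]]])
  have HH: "HH1 K A = quot_module ?D ?I"
    unfolding HH1_def hochschild_cocycles der_space_def ..
  have 1: "vectorspace.dim K (HH1 K A) + vectorspace.dim K (?D\<lparr>carrier := ?I\<rparr>) = vectorspace.dim K ?D"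
    unfolding HH by (rule dim_quot_module[OF sub der_space_fin_dim[OF fd fd]])
  have ker: "{v \<in> carrier A. hochschild_d0 A v = \<zero>\<^bsub>?D\<lparr>carrier := ?I\<rparr>\<^esub>} = carrier (center A)"
  proof -
    have "hochschild_d0 A z = (\<lambda>m\<in>carrier A. \<zero>) \<longleftrightarrow> (\<forall>x\<in>carrier A. z \<otimes> x = x \<otimes> z)"
      if z: "z \<in> carrier A" for z
    proof -
      have "hochschild_d0 A z = (\<lambda>m\<in>carrier A. \<zero>) \<longleftrightarrow> (\<forall>x\<in>carrier A. x \<otimes> z \<ominus> z \<otimes> x = \<zero>)"
        by (auto simp: hochschild_d0_def restrict_def fun_eq_iff)
      also have "\<dots> \<longleftrightarrow> (\<forall>x\<in>carrier A. z \<otimes> x = x \<otimes> z)"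
        using z by (intro ball_cong refl) auto
      finally show ?thesis .
    qed
    then show ?thesis by (auto simp: center_def)
  qed
  have "vectorspace.dim K (?D\<lparr>carrier := ?I\<rparr>)
      + vectorspace.dim K (A\<lparr>carrier := {v \<in> carrier A. hochschild_d0 A v = \<zero>\<^bsub>?D\<lparr>carrier := ?I\<rparr>\<^esub>}\<rparr>)
      = vectorspace.dim K A"
  proof (rule dim_exact(1)[OF V.vectorspace_axioms _ fd])
    show "vectorspace K (?D\<lparr>carrier := ?I\<rparr>)" by (rule subspaceD(6)[OF sub])
    show "hochschild_d0 A \<in> module_hom K A (?D\<lparr>carrier := ?I\<rparr>)"
      using hom by (auto simp: module_hom_def)
  qed simp
  then show ?thesis using 1 unfolding ker by (simp add: center_def)
qed

end

text \<open>
  By \<open>dim_HH1\<close> the difference is \<open>dim Der A - dim A\<close>, and derivations are transported along \<open>\<theta>\<close>.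
\<close>

lemma kalg_iso_dim_HH1:
  assumes A: "kalg K A" and B: "kalg K B" and fd: "vectorspace.fin_dim K A"
    and \<theta>: "\<theta> \<in> module_hom K A B" and bij: "bij_betw \<theta> (carrier A) (carrier B)"
    and mult: "\<And>x y. x \<in> carrier A \<Longrightarrow> y \<in> carrier A \<Longrightarrow> \<theta> (x \<otimes>\<^bsub>A\<^esub> y) = \<theta> x \<otimes>\<^bsub>B\<^esub> \<theta> y"
  shows "int (vectorspace.dim K (HH1 K A)) - int (vectorspace.dim K (center A))
    = int (vectorspace.dim K (HH1 K B)) - int (vectorspace.dim K (center B))"
proof -
  interpret A: kalg K A by fact
  interpret B: kalg K B by fact
  interpret AA: bimod K A A "mult A" "mult A" by (rule A.regular_bimod)
  interpret BB: bimod K B B "mult B" "mult B" by (rule B.regular_bimod)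
  let ?DA = "der_space K A A (mult A) (mult A)" and ?DB = "der_space K B B (mult B) (mult B)"
  have fdB: "vectorspace.fin_dim K B"
    using dim_exact(2)[OF A.V.vectorspace_axioms B.V.vectorspace_axioms fd \<theta>] bij by (simp add: bij_betw_def)
  define \<iota> where "\<iota> = inv_into (carrier A) \<theta>"
  have \<iota>: "\<iota> y \<in> carrier A" "\<theta> (\<iota> y) = y" if "y \<in> carrier B" for y
    using bij that unfolding \<iota>_def by (metis bij_betw_def inv_into_into, metis bij_betw_def f_inv_into_f)
  have \<iota>\<theta>: "\<iota> (\<theta> x) = x" if "x \<in> carrier A" for x
    using bij that by (simp add: \<iota>_def bij_betw_def)
  note \<theta>D = module_homD[OF \<theta>]
  have \<iota>_add: "\<iota> (x \<oplus>\<^bsub>B\<^esub> y) = \<iota> x \<oplus>\<^bsub>A\<^esub> \<iota> y" if "x \<in> carrier B" "y \<in> carrier B" for x y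
    using \<iota>\<theta>[of "\<iota> x \<oplus>\<^bsub>A\<^esub> \<iota> y"] that by (simp add: \<iota> \<theta>D)
  have \<iota>_mult: "\<iota> (x \<otimes>\<^bsub>B\<^esub> y) = \<iota> x \<otimes>\<^bsub>A\<^esub> \<iota> y" if "x \<in> carrier B" "y \<in> carrier B" for x y
    using \<iota>\<theta>[of "\<iota> x \<otimes>\<^bsub>A\<^esub> \<iota> y"] that by (simp add: \<iota> mult)
  have \<iota>_smult: "\<iota> (c \<odot>\<^bsub>B\<^esub> x) = c \<odot>\<^bsub>A\<^esub> \<iota> x" if "c \<in> carrier K" "x \<in> carrier B" for c x
    using \<iota>\<theta>[of "c \<odot>\<^bsub>A\<^esub> \<iota> x"] that by (simp add: \<iota> \<theta>D)
  let ?\<Psi> = "\<lambda>D. \<lambda>x\<in>carrier B. \<theta> (D (\<iota> x))"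
  have \<Psi>: "?\<Psi> \<in> module_hom K ?DA ?DB"
  proof (rule module_homI)
    fix D assume "D \<in> carrier ?DA"
    then have D: "D \<in> derivations K A A (mult A) (mult A)" by simp
    show "?\<Psi> D \<in> carrier ?DB"
      unfolding der_space_simps
      by (rule derivationsI) (auto simp: derivationsD[OF D] \<iota> \<iota>_add \<iota>_mult \<iota>_smult \<theta>D mult)
  next
    fix D D' assume "D \<in> carrier ?DA" "D' \<in> carrier ?DA"
    then have D: "D \<in> derivations K A A (mult A) (mult A)" and D': "D' \<in> derivations K A A (mult A) (mult A)" by simp_all
    show "?\<Psi> (D \<oplus>\<^bsub>?DA\<^esub> D') = ?\<Psi> D \<oplus>\<^bsub>?DB\<^esub> ?\<Psi> D'"
      by (auto simp: \<iota> \<theta>D derivationsD(4)[OF D] derivationsD(4)[OF D'] intro!: restrict_ext)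
  next
    fix c D assume c: "c \<in> carrier K" and "D \<in> carrier ?DA"
    then have D: "D \<in> derivations K A A (mult A) (mult A)" by simp
    show "?\<Psi> (c \<odot>\<^bsub>?DA\<^esub> D) = c \<odot>\<^bsub>?DB\<^esub> ?\<Psi> D"
      using c by (auto simp: \<iota> \<theta>D derivationsD(4)[OF D] intro!: restrict_ext)
  qed
  have "inj_on ?\<Psi> (carrier ?DA)"
  proof (rule inj_onI)
    fix D D' assume "D \<in> carrier ?DA" "D' \<in> carrier ?DA" and eq: "?\<Psi> D = ?\<Psi> D'"
    then have D: "D \<in> derivations K A A (mult A) (mult A)" and D': "D' \<in> derivations K A A (mult A) (mult A)" by simp_all
    have "D x = D' x" if x: "x \<in> carrier A" for x
    proof -
      have "\<theta> (D x) = \<theta> (D' x)" using fun_cong[OF eq, of "\<theta> x"] x by (simp add: \<iota>\<theta> \<theta>D)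
      from arg_cong[OF this, of \<iota>] show ?thesis
        by (simp only: \<iota>\<theta>[OF derivationsD(4)[OF D x]] \<iota>\<theta>[OF derivationsD(4)[OF D' x]])
    qed
    then show "D = D'" using derivationsD(3)[OF D] derivationsD(3)[OF D']
      by (intro extensionalityI[of _ "carrier A"]) auto
  qed
  moreover have "?\<Psi> ` carrier ?DA = carrier ?DB"
  proof
    show "?\<Psi> ` carrier ?DA \<subseteq> carrier ?DB" using module_homD(1)[OF \<Psi>] by blast
    show "carrier ?DB \<subseteq> ?\<Psi> ` carrier ?DA"
    proof
      fix D assume "D \<in> carrier ?DB"
      then have D: "D \<in> derivations K B B (mult B) (mult B)" by simp
      let ?D = "\<lambda>x\<in>carrier A. \<iota> (D (\<theta> x))"
      have a: "?D \<in> carrier ?DA"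
        unfolding der_space_simps
        by (rule derivationsI) (auto simp: derivationsD[OF D] \<iota> \<iota>_add \<iota>_mult \<iota>_smult \<iota>\<theta> \<theta>D mult)
      have b: "D = ?\<Psi> ?D"
        using derivationsD(3,4)[OF D] by (intro extensionalityI[of _ "carrier B"]) (auto simp: \<iota>)
      show "D \<in> ?\<Psi> ` carrier ?DA" by (rule image_eqI[of D ?\<Psi> ?D, OF b a])
    qed
  qed
  ultimately have "vectorspace.dim K ?DA = vectorspace.dim K ?DB"
    by (intro dim_iso[OF AA.der_space_vectorspace BB.der_space_vectorspace AA.der_space_fin_dim[OF fd fd] \<Psi>])
      (simp add: bij_betw_def)
  moreover have "vectorspace.dim K A = vectorspace.dim K B"
    by (rule dim_iso[OF A.V.vectorspace_axioms B.V.vectorspace_axioms fd \<theta> bij])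
  ultimately show ?thesis using A.dim_HH1[OF fd] B.dim_HH1[OF fdB] by simp
qed

section \<open>Modules over an algebra\<close>

locale lmod = kalg K A + M: abelian_group M
  for K :: "('k, 'z) ring_scheme" and A :: "('k, 'a) module" (structure)
    and M :: "('a, 'm) module" +
  assumes act_closed [simp]: "x \<in> carrier A \<Longrightarrow> m \<in> carrier M \<Longrightarrow> x \<odot>\<^bsub>M\<^esub> m \<in> carrier M"
    and act_add: "x \<in> carrier A \<Longrightarrow> m \<in> carrier M \<Longrightarrow> n \<in> carrier M \<Longrightarrow>
      x \<odot>\<^bsub>M\<^esub> (m \<oplus>\<^bsub>M\<^esub> n) = x \<odot>\<^bsub>M\<^esub> m \<oplus>\<^bsub>M\<^esub> x \<odot>\<^bsub>M\<^esub> n"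
    and add_act: "x \<in> carrier A \<Longrightarrow> y \<in> carrier A \<Longrightarrow> m \<in> carrier M \<Longrightarrow>
      (x \<oplus> y) \<odot>\<^bsub>M\<^esub> m = x \<odot>\<^bsub>M\<^esub> m \<oplus>\<^bsub>M\<^esub> y \<odot>\<^bsub>M\<^esub> m"
    and act_assoc: "x \<in> carrier A \<Longrightarrow> y \<in> carrier A \<Longrightarrow> m \<in> carrier M \<Longrightarrow>
      (x \<otimes> y) \<odot>\<^bsub>M\<^esub> m = x \<odot>\<^bsub>M\<^esub> (y \<odot>\<^bsub>M\<^esub> m)"
    and act_one [simp]: "m \<in> carrier M \<Longrightarrow> \<one> \<odot>\<^bsub>M\<^esub> m = m"

text \<open>
  Restriction of scalars along \<open>K \<rightarrow> A\<close>.
\<close>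

definition res_space :: "('k, 'a) module \<Rightarrow> ('a, 'm) module \<Rightarrow> ('k, 'm) module"
  where "res_space A M = bare_module (carrier M) \<zero>\<^bsub>M\<^esub> (add M) (\<lambda>c m. (c \<odot>\<^bsub>A\<^esub> \<one>\<^bsub>A\<^esub>) \<odot>\<^bsub>M\<^esub> m)"

lemma res_space_simps [simp]:
  "carrier (res_space A M) = carrier M" "zero (res_space A M) = \<zero>\<^bsub>M\<^esub>"
  "add (res_space A M) = add M" "smult (res_space A M) = (\<lambda>c m. (c \<odot>\<^bsub>A\<^esub> \<one>\<^bsub>A\<^esub>) \<odot>\<^bsub>M\<^esub> m)"
  by (simp_all add: res_space_def)

lemma finsum_res_space: "finsum (res_space A M) f S = finsum M f S"
  by (simp add: finsum_def finprod_def res_space_def bare_module_def)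

context kalg begin

lemma scalar_mult: "c \<in> carrier K \<Longrightarrow> x \<in> carrier A \<Longrightarrow> (c \<odot> \<one>) \<otimes> x = c \<odot> x"
  by (simp add: smult_mult_left)

lemma mult_scalar: "c \<in> carrier K \<Longrightarrow> x \<in> carrier A \<Longrightarrow> x \<otimes> (c \<odot> \<one>) = c \<odot> x"
  by (simp add: smult_mult_right)

end

context lmod begin

lemma act_zero [simp]: "x \<in> carrier A \<Longrightarrow> x \<odot>\<^bsub>M\<^esub> \<zero>\<^bsub>M\<^esub> = \<zero>\<^bsub>M\<^esub>"
  by (rule additive_zero[OF M.abelian_group_axioms M.abelian_group_axioms]) (auto simp: act_add)

lemma zero_act [simp]: "m \<in> carrier M \<Longrightarrow> \<zero> \<odot>\<^bsub>M\<^esub> m = \<zero>\<^bsub>M\<^esub>"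
  by (rule additive_zero[OF abelian_group_axioms M.abelian_group_axioms, of "\<lambda>x. x \<odot>\<^bsub>M\<^esub> m"])
    (auto simp: add_act)

lemma act_minus: "x \<in> carrier A \<Longrightarrow> m \<in> carrier M \<Longrightarrow> n \<in> carrier M \<Longrightarrow>
    x \<odot>\<^bsub>M\<^esub> (m \<ominus>\<^bsub>M\<^esub> n) = x \<odot>\<^bsub>M\<^esub> m \<ominus>\<^bsub>M\<^esub> x \<odot>\<^bsub>M\<^esub> n"
  by (rule additive_minus[OF M.abelian_group_axioms M.abelian_group_axioms]) (auto simp: act_add)

lemma act_scalar: "x \<in> carrier A \<Longrightarrow> c \<in> carrier K \<Longrightarrow> m \<in> carrier M \<Longrightarrow>
    x \<odot>\<^bsub>M\<^esub> ((c \<odot> \<one>) \<odot>\<^bsub>M\<^esub> m) = (c \<odot> \<one>) \<odot>\<^bsub>M\<^esub> (x \<odot>\<^bsub>M\<^esub> m)"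
  by (simp add: act_assoc[symmetric] scalar_mult mult_scalar)

lemma smult_act: "x \<in> carrier A \<Longrightarrow> c \<in> carrier K \<Longrightarrow> m \<in> carrier M \<Longrightarrow>
    (c \<odot> x) \<odot>\<^bsub>M\<^esub> m = (c \<odot> \<one>) \<odot>\<^bsub>M\<^esub> (x \<odot>\<^bsub>M\<^esub> m)"
  by (simp add: act_assoc[symmetric] scalar_mult)

lemma res_vectorspace: "vectorspace K (res_space A M)"
proof (rule vs_criteria)
  show "field K" by (rule V.field_axioms)
  show "\<forall>v\<in>carrier (res_space A M). \<exists>neg_v\<in>carrier (res_space A M).
      v \<oplus>\<^bsub>res_space A M\<^esub> neg_v = \<zero>\<^bsub>res_space A M\<^esub>"
    using M.r_neg by auto
qed (auto simp: M.a_ac add_act act_add act_assoc[symmetric] scalar_mult V.smult_assoc1 V.smult_l_distr)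

lemma submodule_lmod:
  assumes S: "S \<subseteq> carrier M" "\<zero>\<^bsub>M\<^esub> \<in> S"
    and add: "\<And>m n. m \<in> S \<Longrightarrow> n \<in> S \<Longrightarrow> m \<oplus>\<^bsub>M\<^esub> n \<in> S"
    and act: "\<And>x m. x \<in> carrier A \<Longrightarrow> m \<in> S \<Longrightarrow> x \<odot>\<^bsub>M\<^esub> m \<in> S"
  shows "lmod K A (M\<lparr>carrier := S\<rparr>)"
proof -
  have SM: "m \<in> S \<Longrightarrow> m \<in> carrier M" for m using S by auto
  have neg: "(\<ominus> \<one>) \<odot>\<^bsub>M\<^esub> m \<oplus>\<^bsub>M\<^esub> m = \<zero>\<^bsub>M\<^esub>" if "m \<in> carrier M" for m
    using that add_act[of "\<ominus> \<one>" \<one> m] by (simp add: l_neg)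
  have "abelian_group (M\<lparr>carrier := S\<rparr>)"
  proof (rule abelian_groupI)
    fix m assume "m \<in> carrier (M\<lparr>carrier := S\<rparr>)"
    then show "\<exists>n\<in>carrier (M\<lparr>carrier := S\<rparr>). n \<oplus>\<^bsub>M\<lparr>carrier := S\<rparr>\<^esub> m = \<zero>\<^bsub>M\<lparr>carrier := S\<rparr>\<^esub>"
      using neg[OF SM] act[of "\<ominus> \<one>" m] by auto
  qed (auto simp: S add M.a_ac SM)
  then interpret S: abelian_group "M\<lparr>carrier := S\<rparr>" .
  show ?thesis
    by unfold_locales (auto simp: act SM act_add add_act act_assoc)
qed

end

section \<open>Free modules, covers and syzygies\<close>

lemma free_module_simps [simp]:
  "carrier (free_module A X) = {u \<in> X \<rightarrow>\<^sub>E carrier A. finite {x \<in> X. u x \<noteq> \<zero>\<^bsub>A\<^esub>}}"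
  "zero (free_module A X) = (\<lambda>x\<in>X. \<zero>\<^bsub>A\<^esub>)"
  "add (free_module A X) = (\<lambda>u v. \<lambda>x\<in>X. u x \<oplus>\<^bsub>A\<^esub> v x)"
  "smult (free_module A X) = (\<lambda>b u. \<lambda>x\<in>X. b \<otimes>\<^bsub>A\<^esub> u x)"
  by (simp_all add: free_module_def)

definition free_gen :: "('k, 'a) module \<Rightarrow> 'x set \<Rightarrow> 'a \<Rightarrow> 'x \<Rightarrow> 'x \<Rightarrow> 'a"
  where "free_gen A X b x = (\<lambda>y\<in>X. if y = x then b else \<zero>\<^bsub>A\<^esub>)"

text \<open>
  The additive map on the free module that takes the value \<open>\<theta> b x\<close> on the multiple by \<open>b\<close> of the
  generator \<open>x\<close>.  Linearity of \<open>\<theta>\<close> over \<open>A\<close> is not built in, since derivations are extended to free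
  modules in the same way as module maps.
\<close>

definition free_lift ::
  "('k, 'a) module \<Rightarrow> ('r, 'n) module \<Rightarrow> 'x set \<Rightarrow> ('a \<Rightarrow> 'x \<Rightarrow> 'n) \<Rightarrow> ('x \<Rightarrow> 'a) \<Rightarrow> 'n"
  where "free_lift A N X \<theta> u = finsum N (\<lambda>x. \<theta> (u x) x) {x \<in> X. u x \<noteq> \<zero>\<^bsub>A\<^esub>}"

context kalg begin

lemma free_add_closed:
  assumes "u \<in> carrier (free_module A X)" "v \<in> carrier (free_module A X)"
  shows "u \<oplus>\<^bsub>free_module A X\<^esub> v \<in> carrier (free_module A X)"
proof -
  have "{x \<in> X. u x \<oplus> v x \<noteq> \<zero>} \<subseteq> {x \<in> X. u x \<noteq> \<zero>} \<union> {x \<in> X. v x \<noteq> \<zero>}" by auto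
  then have "finite {x \<in> X. u x \<oplus> v x \<noteq> \<zero>}" using assms by (auto intro: finite_subset)
  then show ?thesis using assms by (auto cong: conj_cong)
qed

lemma free_act_closed:
  assumes "b \<in> carrier A" "u \<in> carrier (free_module A X)"
  shows "b \<odot>\<^bsub>free_module A X\<^esub> u \<in> carrier (free_module A X)"
proof -
  have "{x \<in> X. b \<otimes> u x \<noteq> \<zero>} \<subseteq> {x \<in> X. u x \<noteq> \<zero>}" using assms by auto
  then have "finite {x \<in> X. b \<otimes> u x \<noteq> \<zero>}" using assms by (auto intro: finite_subset)
  then show ?thesis using assms by (auto cong: conj_cong)
qed

lemma free_lmod: "lmod K A (free_module A X)"
proof -
  let ?F = "free_module A X"
  have val: "u x \<in> carrier A" if "u \<in> carrier ?F" "x \<in> X" for u x using that by auto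
  have ext: "(\<lambda>x\<in>X. u x) = u" if "u \<in> carrier ?F" for u using that by (auto simp: PiE_def)
  have "abelian_group ?F"
  proof (rule abelian_groupI)
    fix u assume u: "u \<in> carrier ?F"
    have "(\<ominus> \<one>) \<odot>\<^bsub>?F\<^esub> u \<in> carrier ?F" using u by (intro free_act_closed) auto
    moreover have "(\<ominus> \<one>) \<odot>\<^bsub>?F\<^esub> u \<oplus>\<^bsub>?F\<^esub> u = \<zero>\<^bsub>?F\<^esub>"
      using val[OF u] by (auto intro!: restrict_ext simp: l_minus l_neg)
    ultimately show "\<exists>v\<in>carrier ?F. v \<oplus>\<^bsub>?F\<^esub> u = \<zero>\<^bsub>?F\<^esub>" by blast
  next
    fix u v w assume "u \<in> carrier ?F" "v \<in> carrier ?F" "w \<in> carrier ?F"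
    then show "u \<oplus>\<^bsub>?F\<^esub> v \<oplus>\<^bsub>?F\<^esub> w = u \<oplus>\<^bsub>?F\<^esub> (v \<oplus>\<^bsub>?F\<^esub> w)"
      using val by (auto intro!: restrict_ext simp: a_assoc simp del: free_module_simps(1))
  next
    fix u v assume "u \<in> carrier ?F" "v \<in> carrier ?F"
    then show "u \<oplus>\<^bsub>?F\<^esub> v = v \<oplus>\<^bsub>?F\<^esub> u"
      using val by (auto intro!: restrict_ext simp: a_comm simp del: free_module_simps(1))
  next
    fix u assume u: "u \<in> carrier ?F"
    then show "\<zero>\<^bsub>?F\<^esub> \<oplus>\<^bsub>?F\<^esub> u = u" by (intro extensionalityI[of _ X]) (auto simp: PiE_def Pi_iff)
  qed (auto intro!: free_add_closed simp del: free_module_simps, auto)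
  then interpret F: abelian_group ?F .
  show ?thesis
  proof unfold_locales
    fix u assume u: "u \<in> carrier ?F"
    then have "(\<lambda>x\<in>X. \<one> \<otimes> u x) = (\<lambda>x\<in>X. u x)" using val by (intro restrict_ext) auto
    then show "\<one> \<odot>\<^bsub>?F\<^esub> u = u" using ext[OF u] by simp
  next
    fix b u assume "b \<in> carrier A" "u \<in> carrier ?F"
    then show "b \<odot>\<^bsub>?F\<^esub> u \<in> carrier ?F" by (rule free_act_closed)
  next
    fix b u v assume "b \<in> carrier A" "u \<in> carrier ?F" "v \<in> carrier ?F"
    then show "b \<odot>\<^bsub>?F\<^esub> (u \<oplus>\<^bsub>?F\<^esub> v) = b \<odot>\<^bsub>?F\<^esub> u \<oplus>\<^bsub>?F\<^esub> b \<odot>\<^bsub>?F\<^esub> v"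
      using val by (auto intro!: restrict_ext simp: r_distr simp del: free_module_simps(1))
  next
    fix b c u assume "b \<in> carrier A" "c \<in> carrier A" "u \<in> carrier ?F"
    then show "(b \<oplus> c) \<odot>\<^bsub>?F\<^esub> u = b \<odot>\<^bsub>?F\<^esub> u \<oplus>\<^bsub>?F\<^esub> c \<odot>\<^bsub>?F\<^esub> u"
      "(b \<otimes> c) \<odot>\<^bsub>?F\<^esub> u = b \<odot>\<^bsub>?F\<^esub> (c \<odot>\<^bsub>?F\<^esub> u)"
      using val by (auto intro!: restrict_ext simp: l_distr m_assoc simp del: free_module_simps(1))
  qed
qed

lemma free_gen_closed [simp]: "b \<in> carrier A \<Longrightarrow> free_gen A X b x \<in> carrier (free_module A X)"
proof -
  assume b: "b \<in> carrier A"
  have "{y \<in> X. (if y = x then b else \<zero>) \<noteq> \<zero>} \<subseteq> {x}" by auto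
  then show ?thesis using b by (auto simp: free_gen_def intro: finite_subset cong: conj_cong)
qed

lemma free_gen_add: "b \<in> carrier A \<Longrightarrow> c \<in> carrier A \<Longrightarrow>
    free_gen A X (b \<oplus> c) x = free_gen A X b x \<oplus>\<^bsub>free_module A X\<^esub> free_gen A X c x"
  by (auto simp: free_gen_def intro!: restrict_ext)

lemma free_gen_act: "b \<in> carrier A \<Longrightarrow> c \<in> carrier A \<Longrightarrow>
    b \<odot>\<^bsub>free_module A X\<^esub> free_gen A X c x = free_gen A X (b \<otimes> c) x"
  by (auto simp: free_gen_def intro!: restrict_ext)

lemma free_induct [consumes 1, case_names zero add]:
  assumes u: "u \<in> carrier (free_module A X)"
    and z: "P \<zero>\<^bsub>free_module A X\<^esub>"
    and step: "\<And>u b x. u \<in> carrier (free_module A X) \<Longrightarrow> b \<in> carrier A \<Longrightarrow> x \<in> X \<Longrightarrow> P u \<Longrightarrow>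
      P (free_gen A X b x \<oplus>\<^bsub>free_module A X\<^esub> u)"
  shows "P u"
proof -
  have "P u" if "finite S" "u \<in> carrier (free_module A X)" "{x \<in> X. u x \<noteq> \<zero>} \<subseteq> S" for S u
    using that
  proof (induction S arbitrary: u rule: finite_induct)
    case empty
    then have "u = \<zero>\<^bsub>free_module A X\<^esub>" by (auto simp: PiE_def intro!: extensionalityI[of _ X])
    then show ?case using z by (simp del: free_module_simps)
  next
    case (insert x S)
    show ?case
    proof (cases "x \<in> X")
      case False
      then show ?thesis using insert.prems by (intro insert.IH) auto
    next
      case True
      let ?v = "u(x := \<zero>)"
      have "finite {y \<in> X. ?v y \<noteq> \<zero>}"
        by (rule finite_subset[of _ "{y \<in> X. u y \<noteq> \<zero>}"]) (use insert.prems(1) in auto)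
      then have v: "?v \<in> carrier (free_module A X)" using insert.prems(1) True by (auto simp: PiE_def extensional_def)
      have sub: "{y \<in> X. ?v y \<noteq> \<zero>} \<subseteq> S" using insert.prems(2) by auto
      have "u = free_gen A X (u x) x \<oplus>\<^bsub>free_module A X\<^esub> ?v"
        using insert.prems(1) True by (auto simp: free_gen_def PiE_def Pi_iff intro!: extensionalityI[of _ X])
      moreover have "P (free_gen A X (u x) x \<oplus>\<^bsub>free_module A X\<^esub> ?v)"
        using insert.prems(1) True by (intro step v insert.IH sub) auto
      ultimately show ?thesis by simp
    qed
  qed
  from this[of "{x \<in> X. u x \<noteq> \<zero>}" u] u show ?thesis by auto
qed

lemma free_eqI:
  assumes W: "abelian_group W" and u: "u \<in> carrier (free_module A X)"
    and f: "f \<in> carrier (free_module A X) \<rightarrow> carrier W" and g: "g \<in> carrier (free_module A X) \<rightarrow> carrier W"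
    and fa: "\<And>u v. u \<in> carrier (free_module A X) \<Longrightarrow> v \<in> carrier (free_module A X) \<Longrightarrow>
      f (u \<oplus>\<^bsub>free_module A X\<^esub> v) = f u \<oplus>\<^bsub>W\<^esub> f v"
    and ga: "\<And>u v. u \<in> carrier (free_module A X) \<Longrightarrow> v \<in> carrier (free_module A X) \<Longrightarrow>
      g (u \<oplus>\<^bsub>free_module A X\<^esub> v) = g u \<oplus>\<^bsub>W\<^esub> g v"
    and eq: "\<And>b x. b \<in> carrier A \<Longrightarrow> x \<in> X \<Longrightarrow> f (free_gen A X b x) = g (free_gen A X b x)"
  shows "f u = g u"
  using u
proof (induction rule: free_induct)
  interpret F: lmod K A "free_module A X" by (rule free_lmod)
  case zero
  have "f \<zero>\<^bsub>free_module A X\<^esub> = \<zero>\<^bsub>W\<^esub>"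
    by (rule additive_zero[OF F.M.abelian_group_axioms W f]) (rule fa)
  moreover have "g \<zero>\<^bsub>free_module A X\<^esub> = \<zero>\<^bsub>W\<^esub>"
    by (rule additive_zero[OF F.M.abelian_group_axioms W g]) (rule ga)
  ultimately show ?case by (simp del: free_module_simps)
next
  case (add u b x)
  then show ?case by (simp add: fa ga eq del: free_module_simps)
qed

context
  fixes N :: "('r, 'n) module" and X :: "'x set" and \<theta> :: "'a \<Rightarrow> 'x \<Rightarrow> 'n"
  assumes N: "abelian_group N"
    and \<theta>_closed: "\<And>b x. b \<in> carrier A \<Longrightarrow> x \<in> X \<Longrightarrow> \<theta> b x \<in> carrier N"
    and \<theta>_add: "\<And>b c x. b \<in> carrier A \<Longrightarrow> c \<in> carrier A \<Longrightarrow> x \<in> X \<Longrightarrow> \<theta> (b \<oplus> c) x = \<theta> b x \<oplus>\<^bsub>N\<^esub> \<theta> c x"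
begin

interpretation N: abelian_group N by (rule N)

text \<open>
  Additivity of \<open>free_lift\<close> is read off on a set that contains the supports of both summands.
\<close>

lemma free_lift_superset:
  assumes u: "u \<in> carrier (free_module A X)" and S: "finite S" "S \<subseteq> X" "{x \<in> X. u x \<noteq> \<zero>} \<subseteq> S"
  shows "free_lift A N X \<theta> u = finsum N (\<lambda>x. \<theta> (u x) x) S"
proof -
  have 0: "\<theta> \<zero> x = \<zero>\<^bsub>N\<^esub>" if "x \<in> X" for x
    using that additive_zero[OF abelian_group_axioms N, of "\<lambda>b. \<theta> b x"] by (simp add: \<theta>_closed \<theta>_add)
  show ?thesis unfolding free_lift_def
    using S u 0 by (intro N.add.finprod_mono_neutral_cong_left) (auto intro!: \<theta>_closed)
qed

lemma free_lift_closed: "u \<in> carrier (free_module A X) \<Longrightarrow> free_lift A N X \<theta> u \<in> carrier N"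
  unfolding free_lift_def by (intro N.finsum_closed) (auto intro!: \<theta>_closed)

lemma free_lift_add:
  assumes u: "u \<in> carrier (free_module A X)" and v: "v \<in> carrier (free_module A X)"
  shows "free_lift A N X \<theta> (u \<oplus>\<^bsub>free_module A X\<^esub> v) = free_lift A N X \<theta> u \<oplus>\<^bsub>N\<^esub> free_lift A N X \<theta> v"
proof -
  let ?S = "{x \<in> X. u x \<noteq> \<zero>} \<union> {x \<in> X. v x \<noteq> \<zero>}"
  have S: "finite ?S" "?S \<subseteq> X" using u v by auto
  have "free_lift A N X \<theta> (u \<oplus>\<^bsub>free_module A X\<^esub> v) = finsum N (\<lambda>x. \<theta> ((u \<oplus>\<^bsub>free_module A X\<^esub> v) x) x) ?S"
    using u v S by (intro free_lift_superset free_add_closed) auto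
  also have "\<dots> = finsum N (\<lambda>x. \<theta> (u x) x \<oplus>\<^bsub>N\<^esub> \<theta> (v x) x) ?S"
    using u v by (intro N.finsum_cong') (auto intro!: \<theta>_add \<theta>_closed N.a_closed)
  also have "\<dots> = finsum N (\<lambda>x. \<theta> (u x) x) ?S \<oplus>\<^bsub>N\<^esub> finsum N (\<lambda>x. \<theta> (v x) x) ?S"
    using u v by (intro N.finsum_addf) (auto intro!: \<theta>_closed)
  also have "finsum N (\<lambda>x. \<theta> (u x) x) ?S = free_lift A N X \<theta> u"
    using u S by (intro free_lift_superset[symmetric]) auto
  also have "finsum N (\<lambda>x. \<theta> (v x) x) ?S = free_lift A N X \<theta> v"
    using v S by (intro free_lift_superset[symmetric]) auto
  finally show ?thesis .
qed

lemma free_lift_gen: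
  assumes b: "b \<in> carrier A" and x: "x \<in> X"
  shows "free_lift A N X \<theta> (free_gen A X b x) = \<theta> b x"
proof -
  have "free_lift A N X \<theta> (free_gen A X b x) = finsum N (\<lambda>y. \<theta> (free_gen A X b x y) y) {x}"
    using x by (intro free_lift_superset free_gen_closed[OF b]) (auto simp: free_gen_def)
  also have "\<dots> = \<theta> b x" using b x by (simp add: free_gen_def \<theta>_closed)
  finally show ?thesis .
qed

end

lemma free_lift_act:
  assumes N: "lmod K A N"
    and closed: "\<And>b x. b \<in> carrier A \<Longrightarrow> x \<in> X \<Longrightarrow> \<theta> b x \<in> carrier N"
    and add: "\<And>b c x. b \<in> carrier A \<Longrightarrow> c \<in> carrier A \<Longrightarrow> x \<in> X \<Longrightarrow> \<theta> (b \<oplus> c) x = \<theta> b x \<oplus>\<^bsub>N\<^esub> \<theta> c x"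
    and act: "\<And>b c x. b \<in> carrier A \<Longrightarrow> c \<in> carrier A \<Longrightarrow> x \<in> X \<Longrightarrow> \<theta> (b \<otimes> c) x = b \<odot>\<^bsub>N\<^esub> \<theta> c x"
    and b: "b \<in> carrier A" and u: "u \<in> carrier (free_module A X)"
  shows "free_lift A N X \<theta> (b \<odot>\<^bsub>free_module A X\<^esub> u) = b \<odot>\<^bsub>N\<^esub> free_lift A N X \<theta> u"
proof -
  interpret N: lmod K A N by fact
  interpret F: lmod K A "free_module A X" by (rule free_lmod)
  note L = free_lift_closed[OF N.M.abelian_group_axioms closed add]
    free_lift_add[OF N.M.abelian_group_axioms closed add]
    free_lift_gen[OF N.M.abelian_group_axioms closed add]
  show ?thesis
    by (rule free_eqI[OF N.M.abelian_group_axioms u])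
      (auto simp: L b F.act_add N.act_add free_gen_act act simp del: free_module_simps)
qed

end

lemma cover_map_free_lift: "cover_map A M = free_lift A M (carrier M) (\<lambda>b m. b \<odot>\<^bsub>M\<^esub> m)"
  by (simp add: fun_eq_iff cover_map_def free_lift_def)

context lmod begin

abbreviation "F0 \<equiv> free_cover A M"
abbreviation "\<Omega> \<equiv> syzygy A M"
abbreviation "F1 \<equiv> free_cover A \<Omega>"
abbreviation "\<pi> \<equiv> cover_map A M"

lemma free_cover_lmod: "lmod K A F0"
  unfolding free_cover_def by (rule free_lmod)

lemma cover_map_closed: "u \<in> carrier F0 \<Longrightarrow> \<pi> u \<in> carrier M"
  unfolding cover_map_free_lift free_cover_def
  by (rule free_lift_closed[OF M.abelian_group_axioms]) (auto simp: add_act)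

lemma cover_map_add: "u \<in> carrier F0 \<Longrightarrow> v \<in> carrier F0 \<Longrightarrow>
    \<pi> (u \<oplus>\<^bsub>F0\<^esub> v) = \<pi> u \<oplus>\<^bsub>M\<^esub> \<pi> v"
  unfolding cover_map_free_lift free_cover_def
  by (rule free_lift_add[OF M.abelian_group_axioms]) (auto simp: add_act)

lemma cover_map_gen: "b \<in> carrier A \<Longrightarrow> m \<in> carrier M \<Longrightarrow>
    \<pi> (free_gen A (carrier M) b m) = b \<odot>\<^bsub>M\<^esub> m"
  unfolding cover_map_free_lift
  by (rule free_lift_gen[OF M.abelian_group_axioms]) (auto simp: add_act)

lemma cover_map_act: "b \<in> carrier A \<Longrightarrow> u \<in> carrier F0 \<Longrightarrow>
    \<pi> (b \<odot>\<^bsub>F0\<^esub> u) = b \<odot>\<^bsub>M\<^esub> \<pi> u"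
  unfolding cover_map_free_lift free_cover_def
  by (rule free_lift_act[OF lmod_axioms]) (auto simp: add_act act_assoc)

lemma syzygy_simps:
  "u \<in> carrier \<Omega> \<longleftrightarrow> u \<in> carrier F0 \<and> \<pi> u = \<zero>\<^bsub>M\<^esub>"
  "zero \<Omega> = zero F0" "add \<Omega> = add F0"
  "smult \<Omega> = smult F0"
  by (auto simp: syzygy_def)

lemma syzygy_lmod: "lmod K A \<Omega>"
proof -
  interpret F: lmod K A "F0" by (rule free_cover_lmod)
  have "\<pi> \<zero>\<^bsub>F0\<^esub> = \<zero>\<^bsub>M\<^esub>"
    by (rule additive_zero[OF F.M.abelian_group_axioms M.abelian_group_axioms])
      (auto simp: cover_map_closed cover_map_add)
  then show ?thesis unfolding syzygy_def
    by (intro F.submodule_lmod) (auto simp: cover_map_add cover_map_act)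
qed

lemma cover_map_surj: "m \<in> carrier M \<Longrightarrow> \<exists>u\<in>carrier F0. \<pi> u = m"
  using cover_map_gen[of \<one> m] free_gen_closed[of \<one> "carrier M" m]
  by (auto simp: free_cover_def simp del: free_module_simps)

end

section \<open>The bimodule of linear maps between two modules\<close>

definition hom_lact :: "('a, 'm) module \<Rightarrow> ('a, 'n) module \<Rightarrow> 'a \<Rightarrow> ('m \<Rightarrow> 'n) \<Rightarrow> 'm \<Rightarrow> 'n"
  where "hom_lact M N b h = (\<lambda>m\<in>carrier M. b \<odot>\<^bsub>N\<^esub> h m)"

definition hom_ract :: "('a, 'm) module \<Rightarrow> ('m \<Rightarrow> 'n) \<Rightarrow> 'a \<Rightarrow> 'm \<Rightarrow> 'n"
  where "hom_ract M h b = (\<lambda>m\<in>carrier M. h (b \<odot>\<^bsub>M\<^esub> m))"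

locale lmod2 = lmod K A M + N: lmod K A N
  for K :: "('k, 'z) ring_scheme" and A :: "('k, 'a) module" (structure)
    and M :: "('a, 'm) module" and N :: "('a, 'n) module"
begin

lemma mod_hom_simps:
  "carrier (mod_hom_space A M N) = module_hom A M N \<inter> extensional (carrier M)"
  "zero (mod_hom_space A M N) = (\<lambda>m\<in>carrier M. \<zero>\<^bsub>N\<^esub>)"
  "add (mod_hom_space A M N) = (\<lambda>\<phi> \<psi>. \<lambda>m\<in>carrier M. \<phi> m \<oplus>\<^bsub>N\<^esub> \<psi> m)"
  "smult (mod_hom_space A M N) = (\<lambda>c \<phi>. \<lambda>m\<in>carrier M. (c \<odot> \<one>) \<odot>\<^bsub>N\<^esub> \<phi> m)"
  by (simp_all add: mod_hom_space_def)

lemma mod_hom_space_vectorspace: "vectorspace K (mod_hom_space A M N)"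
  unfolding mod_hom_space_def
  by (rule hom_space_vectorspace)
    (auto simp: N.act_add N.act_scalar N.res_vectorspace[unfolded res_space_def])

lemma mod_homD:
  assumes "g \<in> carrier (mod_hom_space A M N)"
  shows "m \<in> carrier M \<Longrightarrow> g m \<in> carrier N"
    "m \<in> carrier M \<Longrightarrow> m' \<in> carrier M \<Longrightarrow> g (m \<oplus>\<^bsub>M\<^esub> m') = g m \<oplus>\<^bsub>N\<^esub> g m'"
    "b \<in> carrier A \<Longrightarrow> m \<in> carrier M \<Longrightarrow> g (b \<odot>\<^bsub>M\<^esub> m) = b \<odot>\<^bsub>N\<^esub> g m"
    "m \<in> carrier M \<Longrightarrow> m' \<in> carrier M \<Longrightarrow> g (m \<ominus>\<^bsub>M\<^esub> m') = g m \<ominus>\<^bsub>N\<^esub> g m'"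
    "g \<zero>\<^bsub>M\<^esub> = \<zero>\<^bsub>N\<^esub>"
    "g \<in> extensional (carrier M)"
proof -
  have g: "g \<in> module_hom A M N" using assms by (simp add: mod_hom_simps)
  show "m \<in> carrier M \<Longrightarrow> g m \<in> carrier N"
    "m \<in> carrier M \<Longrightarrow> m' \<in> carrier M \<Longrightarrow> g (m \<oplus>\<^bsub>M\<^esub> m') = g m \<oplus>\<^bsub>N\<^esub> g m'"
    "b \<in> carrier A \<Longrightarrow> m \<in> carrier M \<Longrightarrow> g (b \<odot>\<^bsub>M\<^esub> m) = b \<odot>\<^bsub>N\<^esub> g m"
    using module_homD[OF g] by auto
  show "m \<in> carrier M \<Longrightarrow> m' \<in> carrier M \<Longrightarrow> g (m \<ominus>\<^bsub>M\<^esub> m') = g m \<ominus>\<^bsub>N\<^esub> g m'"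
    by (rule additive_minus(2)[OF M.abelian_group_axioms N.M.abelian_group_axioms])
      (auto simp: module_homD[OF g])
  show "g \<zero>\<^bsub>M\<^esub> = \<zero>\<^bsub>N\<^esub>"
    by (rule additive_zero[OF M.abelian_group_axioms N.M.abelian_group_axioms])
      (auto simp: module_homD[OF g])
  show "g \<in> extensional (carrier M)" using assms by (simp add: mod_hom_simps)
qed

lemma mod_homI:
  assumes "\<And>m. m \<in> carrier M \<Longrightarrow> g m \<in> carrier N"
    "\<And>m m'. m \<in> carrier M \<Longrightarrow> m' \<in> carrier M \<Longrightarrow> g (m \<oplus>\<^bsub>M\<^esub> m') = g m \<oplus>\<^bsub>N\<^esub> g m'"
    "\<And>b m. b \<in> carrier A \<Longrightarrow> m \<in> carrier M \<Longrightarrow> g (b \<odot>\<^bsub>M\<^esub> m) = b \<odot>\<^bsub>N\<^esub> g m"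
    "g \<in> extensional (carrier M)"
  shows "g \<in> carrier (mod_hom_space A M N)"
  using assms by (auto simp: mod_hom_simps intro!: module_homI)

abbreviation "H \<equiv> linear_space K (res_space A M) (res_space A N)"

lemma H_vectorspace: "vectorspace K H"
  by (rule linear_space_vectorspace[OF res_vectorspace N.res_vectorspace])

lemma H_D:
  assumes "h \<in> carrier H"
  shows "m \<in> carrier M \<Longrightarrow> h m \<in> carrier N"
    "m \<in> carrier M \<Longrightarrow> m' \<in> carrier M \<Longrightarrow> h (m \<oplus>\<^bsub>M\<^esub> m') = h m \<oplus>\<^bsub>N\<^esub> h m'"
    "c \<in> carrier K \<Longrightarrow> m \<in> carrier M \<Longrightarrow> h ((c \<odot> \<one>) \<odot>\<^bsub>M\<^esub> m) = (c \<odot> \<one>) \<odot>\<^bsub>N\<^esub> h m"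
    "h \<in> extensional (carrier M)" "h \<zero>\<^bsub>M\<^esub> = \<zero>\<^bsub>N\<^esub>"
proof -
  have g: "h \<in> module_hom K (res_space A M) (res_space A N)" using assms by simp
  show "m \<in> carrier M \<Longrightarrow> h m \<in> carrier N"
    "m \<in> carrier M \<Longrightarrow> m' \<in> carrier M \<Longrightarrow> h (m \<oplus>\<^bsub>M\<^esub> m') = h m \<oplus>\<^bsub>N\<^esub> h m'"
    "c \<in> carrier K \<Longrightarrow> m \<in> carrier M \<Longrightarrow> h ((c \<odot> \<one>) \<odot>\<^bsub>M\<^esub> m) = (c \<odot> \<one>) \<odot>\<^bsub>N\<^esub> h m"
    using module_homD[OF g] by auto
  show "h \<zero>\<^bsub>M\<^esub> = \<zero>\<^bsub>N\<^esub>" using module_hom_zero[OF res_vectorspace N.res_vectorspace g] by simp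
  show "h \<in> extensional (carrier M)" using assms by simp
qed

lemma H_I:
  assumes "\<And>m. m \<in> carrier M \<Longrightarrow> h m \<in> carrier N"
    "\<And>m m'. m \<in> carrier M \<Longrightarrow> m' \<in> carrier M \<Longrightarrow> h (m \<oplus>\<^bsub>M\<^esub> m') = h m \<oplus>\<^bsub>N\<^esub> h m'"
    "\<And>c m. c \<in> carrier K \<Longrightarrow> m \<in> carrier M \<Longrightarrow> h ((c \<odot> \<one>) \<odot>\<^bsub>M\<^esub> m) = (c \<odot> \<one>) \<odot>\<^bsub>N\<^esub> h m"
    "h \<in> extensional (carrier M)"
  shows "h \<in> carrier H"
  using assms by (auto intro!: module_homI)

lemma hom_bimod: "bimod K A H (hom_lact M N) (hom_ract M)"
proof -
  have [simp]: "vectorspace K H" by (rule H_vectorspace)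
  interpret H: vectorspace K H by (rule H_vectorspace)
  show ?thesis
  proof unfold_locales
    fix x h assume "x \<in> carrier A" "h \<in> carrier H"
    then show "hom_lact M N x h \<in> carrier H"
      unfolding hom_lact_def by (intro H_I) (auto simp: H_D N.act_add N.act_scalar simp del: linear_space_simps(1))
  next
    fix x h assume "x \<in> carrier A" "h \<in> carrier H"
    then show "hom_ract M h x \<in> carrier H"
      unfolding hom_ract_def by (intro H_I) (auto simp: H_D act_add act_scalar simp del: linear_space_simps(1))
  next
    fix c x h assume x: "c \<in> carrier K" "x \<in> carrier A" "h \<in> carrier H"
    note hD = H_D[OF x(3)]
    show "hom_lact M N x (c \<odot>\<^bsub>H\<^esub> h) = c \<odot>\<^bsub>H\<^esub> hom_lact M N x h"
      "hom_lact M N (c \<odot> x) h = c \<odot>\<^bsub>H\<^esub> hom_lact M N x h"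
      "hom_ract M h (c \<odot> x) = c \<odot>\<^bsub>H\<^esub> hom_ract M h x"
      "hom_ract M (c \<odot>\<^bsub>H\<^esub> h) x = c \<odot>\<^bsub>H\<^esub> hom_ract M h x"
      using x(1,2) by (auto simp: hom_lact_def hom_ract_def hD(1,3) N.act_scalar[OF x(2,1)]
        N.smult_act[OF x(2,1)] smult_act[OF x(2,1)] intro!: restrict_ext)
  next
    fix x y h assume x: "x \<in> carrier A" "y \<in> carrier A" "h \<in> carrier H"
    note hD = H_D[OF x(3)]
    show "hom_lact M N (x \<oplus> y) h = hom_lact M N x h \<oplus>\<^bsub>H\<^esub> hom_lact M N y h"
      "hom_ract M h (x \<oplus> y) = hom_ract M h x \<oplus>\<^bsub>H\<^esub> hom_ract M h y"
      "hom_lact M N (x \<otimes> y) h = hom_lact M N x (hom_lact M N y h)"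
      "hom_ract M h (x \<otimes> y) = hom_ract M (hom_ract M h x) y"
      "hom_ract M (hom_lact M N x h) y = hom_lact M N x (hom_ract M h y)"
      using x(1,2) by (auto simp: hom_lact_def hom_ract_def hD(1,2) N.add_act add_act N.act_assoc act_assoc
          intro!: restrict_ext)
  next
    fix x g h assume x: "x \<in> carrier A" "g \<in> carrier H" "h \<in> carrier H"
    show "hom_lact M N x (g \<oplus>\<^bsub>H\<^esub> h) = hom_lact M N x g \<oplus>\<^bsub>H\<^esub> hom_lact M N x h"
      "hom_ract M (g \<oplus>\<^bsub>H\<^esub> h) x = hom_ract M g x \<oplus>\<^bsub>H\<^esub> hom_ract M h x"
      using x(1) by (auto simp: hom_lact_def hom_ract_def H_D(1)[OF x(2)] H_D(1)[OF x(3)] N.act_add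
          intro!: restrict_ext)
  next
    fix h assume h: "h \<in> carrier H"
    note hD = H_D[OF h]
    have "restrict h (carrier M) = h" using hD(4) by (rule extensional_restrict)
    moreover have "(\<lambda>m\<in>carrier M. \<one> \<odot>\<^bsub>N\<^esub> h m) = restrict h (carrier M)"
      "(\<lambda>m\<in>carrier M. h (\<one> \<odot>\<^bsub>M\<^esub> m)) = restrict h (carrier M)"
      using hD(1) by (auto intro!: restrict_ext)
    ultimately show "hom_lact M N \<one> h = h" "hom_ract M h \<one> = h"
      by (simp_all add: hom_lact_def hom_ract_def)
  qed
qed

abbreviation "Der \<equiv> der_space K A H (hom_lact M N) (hom_ract M)"

lemma Der_D:
  assumes "\<eta> \<in> carrier Der"
  shows "b \<in> carrier A \<Longrightarrow> \<eta> b \<in> carrier H"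
    "b \<in> carrier A \<Longrightarrow> m \<in> carrier M \<Longrightarrow> \<eta> b m \<in> carrier N"
    "b \<in> carrier A \<Longrightarrow> c \<in> carrier A \<Longrightarrow> m \<in> carrier M \<Longrightarrow> \<eta> (b \<oplus> c) m = \<eta> b m \<oplus>\<^bsub>N\<^esub> \<eta> c m"
    "k \<in> carrier K \<Longrightarrow> b \<in> carrier A \<Longrightarrow> m \<in> carrier M \<Longrightarrow> \<eta> (k \<odot> b) m = (k \<odot> \<one>) \<odot>\<^bsub>N\<^esub> \<eta> b m"
    "b \<in> carrier A \<Longrightarrow> c \<in> carrier A \<Longrightarrow> m \<in> carrier M \<Longrightarrow>
      \<eta> (b \<otimes> c) m = b \<odot>\<^bsub>N\<^esub> \<eta> c m \<oplus>\<^bsub>N\<^esub> \<eta> b (c \<odot>\<^bsub>M\<^esub> m)"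
    "m \<in> carrier M \<Longrightarrow> \<eta> \<one> m = \<zero>\<^bsub>N\<^esub>"
proof -
  have \<eta>: "\<eta> \<in> derivations K A H (hom_lact M N) (hom_ract M)" using assms by simp
  note d = derivationsD[OF \<eta>]
  show "b \<in> carrier A \<Longrightarrow> \<eta> b \<in> carrier H" for b by (rule d(4))
  from H_D(1)[OF this] show c: "b \<in> carrier A \<Longrightarrow> m \<in> carrier M \<Longrightarrow> \<eta> b m \<in> carrier N" for b m .
  show "b \<in> carrier A \<Longrightarrow> c \<in> carrier A \<Longrightarrow> m \<in> carrier M \<Longrightarrow> \<eta> (b \<oplus> c) m = \<eta> b m \<oplus>\<^bsub>N\<^esub> \<eta> c m"
    by (simp add: d(5))
  show "k \<in> carrier K \<Longrightarrow> b \<in> carrier A \<Longrightarrow> m \<in> carrier M \<Longrightarrow> \<eta> (k \<odot> b) m = (k \<odot> \<one>) \<odot>\<^bsub>N\<^esub> \<eta> b m"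
    by (simp add: d(6))
  show m: "b \<in> carrier A \<Longrightarrow> c \<in> carrier A \<Longrightarrow> m \<in> carrier M \<Longrightarrow>
      \<eta> (b \<otimes> c) m = b \<odot>\<^bsub>N\<^esub> \<eta> c m \<oplus>\<^bsub>N\<^esub> \<eta> b (c \<odot>\<^bsub>M\<^esub> m)" for b c
    by (simp add: d(7) hom_lact_def hom_ract_def)
  show "m \<in> carrier M \<Longrightarrow> \<eta> \<one> m = \<zero>\<^bsub>N\<^esub>"
    using m[of \<one> \<one>] c[of \<one> m] by simp
qed

definition inner :: "('m \<Rightarrow> 'n) \<Rightarrow> 'a \<Rightarrow> 'm \<Rightarrow> 'n"
  where "inner h = (\<lambda>b\<in>carrier A. \<lambda>m\<in>carrier M. b \<odot>\<^bsub>N\<^esub> h m \<ominus>\<^bsub>N\<^esub> h (b \<odot>\<^bsub>M\<^esub> m))"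

lemma Der_I:
  assumes "\<And>b m. b \<in> carrier A \<Longrightarrow> m \<in> carrier M \<Longrightarrow> w b m \<in> carrier N"
    "\<And>b m m'. b \<in> carrier A \<Longrightarrow> m \<in> carrier M \<Longrightarrow> m' \<in> carrier M \<Longrightarrow> w b (m \<oplus>\<^bsub>M\<^esub> m') = w b m \<oplus>\<^bsub>N\<^esub> w b m'"
    "\<And>b k m. b \<in> carrier A \<Longrightarrow> k \<in> carrier K \<Longrightarrow> m \<in> carrier M \<Longrightarrow>
      w b ((k \<odot> \<one>) \<odot>\<^bsub>M\<^esub> m) = (k \<odot> \<one>) \<odot>\<^bsub>N\<^esub> w b m"
    "\<And>b c m. b \<in> carrier A \<Longrightarrow> c \<in> carrier A \<Longrightarrow> m \<in> carrier M \<Longrightarrow> w (b \<oplus> c) m = w b m \<oplus>\<^bsub>N\<^esub> w c m"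
    "\<And>k b m. k \<in> carrier K \<Longrightarrow> b \<in> carrier A \<Longrightarrow> m \<in> carrier M \<Longrightarrow> w (k \<odot> b) m = (k \<odot> \<one>) \<odot>\<^bsub>N\<^esub> w b m"
    "\<And>b c m. b \<in> carrier A \<Longrightarrow> c \<in> carrier A \<Longrightarrow> m \<in> carrier M \<Longrightarrow>
      w (b \<otimes> c) m = b \<odot>\<^bsub>N\<^esub> w c m \<oplus>\<^bsub>N\<^esub> w b (c \<odot>\<^bsub>M\<^esub> m)"
  shows "(\<lambda>b\<in>carrier A. \<lambda>m\<in>carrier M. w b m) \<in> carrier Der"
  unfolding der_space_simps
proof (rule derivationsI)
  fix b assume "b \<in> carrier A"
  then show "(\<lambda>b\<in>carrier A. \<lambda>m\<in>carrier M. w b m) b \<in> carrier H"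
    using assms(1-3) by (simp del: linear_space_simps(1)) (rule H_I, auto)
qed (use assms(1,4-) in \<open>auto simp: hom_lact_def hom_ract_def intro!: restrict_ext\<close>)

lemma inner_Der: "h \<in> carrier H \<Longrightarrow> inner h \<in> carrier Der"
  unfolding inner_def
proof (rule Der_I)
  assume h: "h \<in> carrier H"
  note hD = H_D[OF h]
  fix b c m assume b: "b \<in> carrier A" "c \<in> carrier A" "m \<in> carrier M"
  have "b \<odot>\<^bsub>N\<^esub> (c \<odot>\<^bsub>N\<^esub> h m) \<ominus>\<^bsub>N\<^esub> h (b \<odot>\<^bsub>M\<^esub> (c \<odot>\<^bsub>M\<^esub> m))
    = b \<odot>\<^bsub>N\<^esub> (c \<odot>\<^bsub>N\<^esub> h m) \<ominus>\<^bsub>N\<^esub> b \<odot>\<^bsub>N\<^esub> h (c \<odot>\<^bsub>M\<^esub> m)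
      \<oplus>\<^bsub>N\<^esub> (b \<odot>\<^bsub>N\<^esub> h (c \<odot>\<^bsub>M\<^esub> m) \<ominus>\<^bsub>N\<^esub> h (b \<odot>\<^bsub>M\<^esub> (c \<odot>\<^bsub>M\<^esub> m)))"
    using b hD(1) by (simp add: a_minus_def N.M.a_assoc N.M.r_neg1)
  then show "(b \<otimes> c) \<odot>\<^bsub>N\<^esub> h m \<ominus>\<^bsub>N\<^esub> h ((b \<otimes> c) \<odot>\<^bsub>M\<^esub> m)
    = b \<odot>\<^bsub>N\<^esub> (c \<odot>\<^bsub>N\<^esub> h m \<ominus>\<^bsub>N\<^esub> h (c \<odot>\<^bsub>M\<^esub> m))
      \<oplus>\<^bsub>N\<^esub> (b \<odot>\<^bsub>N\<^esub> h (c \<odot>\<^bsub>M\<^esub> m) \<ominus>\<^bsub>N\<^esub> h (b \<odot>\<^bsub>M\<^esub> (c \<odot>\<^bsub>M\<^esub> m)))"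
    using b hD(1) by (simp add: N.act_assoc act_assoc N.act_minus)
next
  assume h: "h \<in> carrier H"
  fix b k m assume b: "b \<in> carrier A" "k \<in> carrier K" "m \<in> carrier M"
  show "b \<odot>\<^bsub>N\<^esub> h ((k \<odot> \<one>) \<odot>\<^bsub>M\<^esub> m) \<ominus>\<^bsub>N\<^esub> h (b \<odot>\<^bsub>M\<^esub> ((k \<odot> \<one>) \<odot>\<^bsub>M\<^esub> m))
    = (k \<odot> \<one>) \<odot>\<^bsub>N\<^esub> (b \<odot>\<^bsub>N\<^esub> h m \<ominus>\<^bsub>N\<^esub> h (b \<odot>\<^bsub>M\<^esub> m))"
    "(k \<odot> b) \<odot>\<^bsub>N\<^esub> h m \<ominus>\<^bsub>N\<^esub> h ((k \<odot> b) \<odot>\<^bsub>M\<^esub> m)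
    = (k \<odot> \<one>) \<odot>\<^bsub>N\<^esub> (b \<odot>\<^bsub>N\<^esub> h m \<ominus>\<^bsub>N\<^esub> h (b \<odot>\<^bsub>M\<^esub> m))"
    using b by (simp_all add: H_D(1,3)[OF h] N.act_minus N.act_scalar[OF b(1,2)] act_scalar[OF b(1,2)]
        N.smult_act[OF b(1,2)] smult_act[OF b(1,2)])
qed (auto simp: a_minus_def act_add N.act_add N.add_act add_act N.M.a_ac N.M.minus_add H_D(1,2)
      simp del: linear_space_simps)

end

section \<open>Derivations into linear maps and Ext\<close>

text \<open>
  If \<open>v\<close> is a \<open>K\<close>-basis of \<open>M\<close> with coordinates \<open>p\<close>, the section sends \<open>m\<close> to the combination of the
  generators at \<open>v i\<close> with coefficients \<open>p i m\<close>.  In contrast to the map that sends \<open>m\<close> to the generator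
  at \<open>m\<close>, it is \<open>K\<close>-linear.
\<close>

lemma (in lmod) linear_section:
  assumes fd: "vectorspace.fin_dim K (res_space A M)"
  obtains s where "\<And>m. m \<in> carrier M \<Longrightarrow> s m \<in> carrier F0"
    "\<And>m m'. m \<in> carrier M \<Longrightarrow> m' \<in> carrier M \<Longrightarrow> s (m \<oplus>\<^bsub>M\<^esub> m') = s m \<oplus>\<^bsub>F0\<^esub> s m'"
    "\<And>c m. c \<in> carrier K \<Longrightarrow> m \<in> carrier M \<Longrightarrow>
      s ((c \<odot> \<one>) \<odot>\<^bsub>M\<^esub> m) = (c \<odot> \<one>) \<odot>\<^bsub>F0\<^esub> s m"
    "\<And>m. m \<in> carrier M \<Longrightarrow> \<pi> (s m) = m"
proof -
  obtain n v p where D: "dual_basis K (res_space A M) {..<n :: nat} v p"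
    using dual_basis_exists[OF res_vectorspace fd] .
  note d = dual_basisD[OF D, simplified]
  interpret F: lmod K A "F0" by (rule free_cover_lmod)
  let ?g = "\<lambda>b i. free_gen A (carrier M) b (v i)"
  let ?s = "\<lambda>m. finsum F0 (\<lambda>i. ?g (p i m \<odot> \<one>) i) {..<n}"
  have g: "?g b i \<in> carrier F0" if "b \<in> carrier A" for b i
    unfolding free_cover_def using that by (rule free_gen_closed)
  have gc: "(\<lambda>i. ?g (p i m \<odot> \<one>) i) \<in> {..<n} \<rightarrow> carrier F0" if "m \<in> carrier M" for m
    using that d by (auto intro!: g)
  show ?thesis
  proof
    fix m assume m: "m \<in> carrier M"
    show "?s m \<in> carrier F0" by (rule F.M.finsum_closed[OF gc[OF m]])
    have "\<pi> (?s m) = finsum M (\<lambda>i. \<pi> (?g (p i m \<odot> \<one>) i)) {..<n}"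
      using gc[OF m] by (intro additive_finsum[OF F.M.abelian_group_axioms M.abelian_group_axioms])
        (auto simp: cover_map_closed cover_map_add)
    also have "\<dots> = finsum M (\<lambda>i. (p i m \<odot> \<one>) \<odot>\<^bsub>M\<^esub> v i) {..<n}"
      using d(2) d(4)[OF _ m] by (intro M.finsum_cong') (auto simp: cover_map_gen)
    also have "\<dots> = m" using d(6)[OF m] by (simp add: finsum_res_space)
    finally show "\<pi> (?s m) = m" .
    fix m' assume m': "m' \<in> carrier M"
    have "?s (m \<oplus>\<^bsub>M\<^esub> m') = finsum F0
        (\<lambda>i. ?g (p i m \<odot> \<one>) i \<oplus>\<^bsub>F0\<^esub> ?g (p i m' \<odot> \<one>) i) {..<n}"
    proof (rule F.M.finsum_cong')
      fix i assume "i \<in> {..<n}"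
      then have i: "i < n" by simp
      show "?g (p i (m \<oplus>\<^bsub>M\<^esub> m') \<odot> \<one>) i = ?g (p i m \<odot> \<one>) i \<oplus>\<^bsub>F0\<^esub> ?g (p i m' \<odot> \<one>) i"
        using m m' d(4)[OF i] unfolding free_cover_def d(7)[OF i m m']
        by (subst free_gen_add[symmetric]) (auto simp: V.smult_l_distr)
    qed (use gc[OF m] gc[OF m'] in auto)
    also have "\<dots> = ?s m \<oplus>\<^bsub>F0\<^esub> ?s m'" by (rule F.M.finsum_addf[OF gc[OF m] gc[OF m']])
    finally show "?s (m \<oplus>\<^bsub>M\<^esub> m') = ?s m \<oplus>\<^bsub>F0\<^esub> ?s m'" .
  next
    fix c m assume c: "c \<in> carrier K" and m: "m \<in> carrier M"
    have "(c \<odot> \<one>) \<odot>\<^bsub>F0\<^esub> ?s m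
        = finsum F0 (\<lambda>i. (c \<odot> \<one>) \<odot>\<^bsub>F0\<^esub> ?g (p i m \<odot> \<one>) i) {..<n}"
      using gc[OF m] c by (intro additive_finsum[OF F.M.abelian_group_axioms F.M.abelian_group_axioms])
        (auto simp: F.act_add)
    also have "\<dots> = ?s ((c \<odot> \<one>) \<odot>\<^bsub>M\<^esub> m)"
    proof (rule F.M.finsum_cong')
      fix i assume "i \<in> {..<n}"
      then have i: "i < n" by simp
      show "(c \<odot> \<one>) \<odot>\<^bsub>F0\<^esub> ?g (p i m \<odot> \<one>) i = ?g (p i ((c \<odot> \<one>) \<odot>\<^bsub>M\<^esub> m) \<odot> \<one>) i"
        using c m d(4)[OF i] unfolding free_cover_def d(8)[OF i c m]
        by (subst free_gen_act) (auto simp: scalar_mult V.smult_assoc1)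
    qed (use gc[of "(c \<odot> \<one>) \<odot>\<^bsub>M\<^esub> m"] c m in auto)
    finally show "?s ((c \<odot> \<one>) \<odot>\<^bsub>M\<^esub> m) = (c \<odot> \<one>) \<odot>\<^bsub>F0\<^esub> ?s m" by simp
  qed
qed

context lmod2 begin

text \<open>
  The cover induces \<open>F0 / \<Omega> \<cong> M\<close>, so \<open>\<psi> m\<close> may be computed on any preimage of \<open>m\<close>; the generator at \<open>m\<close>
  is one.
\<close>

lemma factor_through_cover:
  assumes \<phi>: "\<phi> \<in> carrier (mod_hom_space A F0 N)"
    and 0: "\<And>u. u \<in> carrier \<Omega> \<Longrightarrow> \<phi> u = \<zero>\<^bsub>N\<^esub>"
  obtains \<psi> where "\<psi> \<in> carrier (mod_hom_space A M N)"
    "\<And>u. u \<in> carrier F0 \<Longrightarrow> \<phi> u = \<psi> (\<pi> u)"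
proof -
  interpret F: lmod K A "F0" by (rule free_cover_lmod)
  interpret FN: lmod2 K A "F0" N ..
  note \<phi>D = FN.mod_homD[OF \<phi>]
  have eq: "\<phi> u = \<phi> v" if uv: "u \<in> carrier F0" "v \<in> carrier F0"
    "\<pi> u = \<pi> v" for u v
  proof -
    have "\<pi> (u \<ominus>\<^bsub>F0\<^esub> v) = \<pi> u \<ominus>\<^bsub>M\<^esub> \<pi> v"
      by (rule additive_minus(2)[OF F.M.abelian_group_axioms M.abelian_group_axioms])
        (auto simp: cover_map_closed cover_map_add uv(1,2))
    then have "u \<ominus>\<^bsub>F0\<^esub> v \<in> carrier \<Omega>"
      using uv cover_map_closed[OF uv(2)] by (simp add: syzygy_simps)
    from 0[OF this] show ?thesis using uv \<phi>D(1,4) by simp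
  qed
  define \<psi> where "\<psi> = (\<lambda>m\<in>carrier M. \<phi> (free_gen A (carrier M) \<one> m))"
  have g: "free_gen A (carrier M) \<one> m \<in> carrier F0" for m
    unfolding free_cover_def by (rule free_gen_closed) simp
  have \<psi>: "\<psi> (\<pi> u) = \<phi> u" if u: "u \<in> carrier F0" for u
    using eq[OF g u] cover_map_closed[OF u] by (simp add: \<psi>_def cover_map_gen)
  have "\<psi> \<in> carrier (mod_hom_space A M N)"
  proof (rule mod_homI)
    fix m assume m: "m \<in> carrier M"
    then obtain u where u: "u \<in> carrier F0" "\<pi> u = m" using cover_map_surj by blast
    show "\<psi> m \<in> carrier N" using \<psi>[OF u(1)] \<phi>D(1)[OF u(1)] u(2) by simp
    fix b assume b: "b \<in> carrier A"
    show "\<psi> (b \<odot>\<^bsub>M\<^esub> m) = b \<odot>\<^bsub>N\<^esub> \<psi> m"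
      using \<psi>[OF F.act_closed[OF b u(1)]] \<psi>[OF u(1)] u by (simp add: cover_map_act b \<phi>D(3))
  next
    fix m m' assume m: "m \<in> carrier M" "m' \<in> carrier M"
    obtain u where u: "u \<in> carrier F0" "\<pi> u = m" using cover_map_surj m by blast
    obtain u' where u': "u' \<in> carrier F0" "\<pi> u' = m'" using cover_map_surj m by blast
    show "\<psi> (m \<oplus>\<^bsub>M\<^esub> m') = \<psi> m \<oplus>\<^bsub>N\<^esub> \<psi> m'"
      using \<psi>[OF F.M.a_closed[OF u(1) u'(1)]] \<psi>[OF u(1)] \<psi>[OF u'(1)] u u' by (simp add: cover_map_add \<phi>D(2))
  qed (simp add: \<psi>_def)
  then show ?thesis using \<psi> that by simp
qed

definition pullback :: "('m \<Rightarrow> 'n) \<Rightarrow> ('m \<Rightarrow> 'a) \<Rightarrow> 'n"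
  where "pullback \<psi> = (\<lambda>u\<in>carrier F0. \<psi> (\<pi> u))"

lemma pullback_hom: "pullback \<in> module_hom K (mod_hom_space A M N) (mod_hom_space A F0 N)"
proof -
  interpret F: lmod K A "F0" by (rule free_cover_lmod)
  interpret FN: lmod2 K A "F0" N ..
  show ?thesis
  proof (rule module_homI)
    fix \<psi> assume \<psi>: "\<psi> \<in> carrier (mod_hom_space A M N)"
    show "pullback \<psi> \<in> carrier (mod_hom_space A F0 N)"
      unfolding pullback_def by (rule FN.mod_homI)
        (auto simp: cover_map_closed cover_map_add cover_map_act mod_homD[OF \<psi>])
  qed (auto simp: pullback_def mod_hom_simps FN.mod_hom_simps cover_map_closed intro!: restrict_ext)
qed

text \<open>
  Left exactness of \<open>Hom(-, N)\<close> on the presentation \<open>F1 \<rightarrow> F0 \<rightarrow> M \<rightarrow> 0\<close>.  With \<open>\<Omega>\<close> in the place of \<open>M\<close> it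
  identifies the cocycles in the definition of \<open>ext1\<close> with the module maps \<open>\<Omega> \<rightarrow> N\<close>.
\<close>

lemma vanish_on_syzygy_iff_pullback:
  "{\<phi> \<in> carrier (mod_hom_space A F0 N).
      \<forall>u\<in>carrier F1. \<phi> (cover_map A \<Omega> u) = \<zero>\<^bsub>N\<^esub>}
    = pullback ` carrier (mod_hom_space A M N)" (is "?Z = ?P")
proof
  interpret F: lmod K A "F0" by (rule free_cover_lmod)
  interpret FN: lmod2 K A "F0" N ..
  interpret S: lmod K A "\<Omega>" by (rule syzygy_lmod)
  show "?Z \<subseteq> ?P"
  proof
    fix \<phi> assume \<phi>: "\<phi> \<in> ?Z"
    have "\<phi> u = \<zero>\<^bsub>N\<^esub>" if "u \<in> carrier \<Omega>" for u
      using S.cover_map_surj[OF that] \<phi> by auto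
    then obtain \<psi> where \<psi>: "\<psi> \<in> carrier (mod_hom_space A M N)"
      "\<And>u. u \<in> carrier F0 \<Longrightarrow> \<phi> u = \<psi> (\<pi> u)"
      using factor_through_cover[of \<phi>] \<phi> by blast
    have "\<phi> = pullback \<psi>"
      using \<phi> \<psi>(2) FN.mod_homD(6)[of \<phi>] unfolding pullback_def
      by (intro extensionalityI[of _ "carrier F0"]) auto
    then show "\<phi> \<in> ?P" using \<psi>(1) by blast
  qed
  show "?P \<subseteq> ?Z"
    using module_homD(1)[OF pullback_hom] S.cover_map_closed
    by (auto simp: pullback_def mod_homD(5) syzygy_simps)
qed

interpretation F: lmod K A "F0" by (rule free_cover_lmod)
interpretation S: lmod K A "\<Omega>" by (rule syzygy_lmod)
interpretation FN: lmod2 K A "F0" N ..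
interpretation SN: lmod2 K A "\<Omega>" N ..

abbreviation "gen \<equiv> free_gen A (carrier M)"

lemma gen_closed: "b \<in> carrier A \<Longrightarrow> gen b m \<in> carrier F0"
  unfolding free_cover_def by (rule free_gen_closed)

lemma gen_act: "b \<in> carrier A \<Longrightarrow> c \<in> carrier A \<Longrightarrow>
    b \<odot>\<^bsub>F0\<^esub> gen c m = gen (b \<otimes> c) m"
  unfolding free_cover_def by (rule free_gen_act)

lemma cover_eqI:
  assumes "abelian_group W" "u \<in> carrier F0"
    "\<And>u. u \<in> carrier F0 \<Longrightarrow> f u \<in> carrier W"
    "\<And>u. u \<in> carrier F0 \<Longrightarrow> g u \<in> carrier W"
    "\<And>u v. u \<in> carrier F0 \<Longrightarrow> v \<in> carrier F0 \<Longrightarrow>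
      f (u \<oplus>\<^bsub>F0\<^esub> v) = f u \<oplus>\<^bsub>W\<^esub> f v"
    "\<And>u v. u \<in> carrier F0 \<Longrightarrow> v \<in> carrier F0 \<Longrightarrow>
      g (u \<oplus>\<^bsub>F0\<^esub> v) = g u \<oplus>\<^bsub>W\<^esub> g v"
    "\<And>b m. b \<in> carrier A \<Longrightarrow> m \<in> carrier M \<Longrightarrow> f (gen b m) = g (gen b m)"
  shows "f u = g u"
  by (rule free_eqI[where X = "carrier M" and W = W, folded free_cover_def]) (use assms in auto)

abbreviation der_lift :: "('a \<Rightarrow> 'm \<Rightarrow> 'n) \<Rightarrow> ('m \<Rightarrow> 'a) \<Rightarrow> 'n"
  where "der_lift \<eta> \<equiv> free_lift A N (carrier M) \<eta>"

lemma der_lift: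
  assumes \<eta>: "\<eta> \<in> carrier Der"
  shows "u \<in> carrier F0 \<Longrightarrow> der_lift \<eta> u \<in> carrier N"
    "u \<in> carrier F0 \<Longrightarrow> v \<in> carrier F0 \<Longrightarrow>
      der_lift \<eta> (u \<oplus>\<^bsub>F0\<^esub> v) = der_lift \<eta> u \<oplus>\<^bsub>N\<^esub> der_lift \<eta> v"
    "b \<in> carrier A \<Longrightarrow> m \<in> carrier M \<Longrightarrow> der_lift \<eta> (gen b m) = \<eta> b m"
proof -
  note d = Der_D(2,3)[OF \<eta>]
  show "u \<in> carrier F0 \<Longrightarrow> der_lift \<eta> u \<in> carrier N"
    unfolding free_cover_def by (rule free_lift_closed[OF N.M.abelian_group_axioms]) (auto intro: d)
  show "u \<in> carrier F0 \<Longrightarrow> v \<in> carrier F0 \<Longrightarrow>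
      der_lift \<eta> (u \<oplus>\<^bsub>F0\<^esub> v) = der_lift \<eta> u \<oplus>\<^bsub>N\<^esub> der_lift \<eta> v"
    unfolding free_cover_def by (rule free_lift_add[OF N.M.abelian_group_axioms]) (auto intro: d)
  show "b \<in> carrier A \<Longrightarrow> m \<in> carrier M \<Longrightarrow> der_lift \<eta> (gen b m) = \<eta> b m"
    by (rule free_lift_gen[OF N.M.abelian_group_axioms]) (auto intro: d)
qed

text \<open>
  The extension of a derivation to the free cover fails to be \<open>A\<close>-linear by a term that depends on
  \<open>\<pi> u\<close> only.  So its restriction to \<open>\<Omega>\<close>, the kernel of \<open>\<pi>\<close>, is a module map; this defines the
  connecting map \<open>der_restrict\<close> from derivations to \<open>Hom\<^sub>A(\<Omega>, N)\<close>.
\<close>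

lemma der_lift_act:
  assumes \<eta>: "\<eta> \<in> carrier Der" and b: "b \<in> carrier A" and u: "u \<in> carrier F0"
  shows "der_lift \<eta> (b \<odot>\<^bsub>F0\<^esub> u) = b \<odot>\<^bsub>N\<^esub> der_lift \<eta> u \<oplus>\<^bsub>N\<^esub> \<eta> b (\<pi> u)"
proof (rule cover_eqI[OF N.M.abelian_group_axioms u])
  note h = H_D[OF Der_D(1)[OF \<eta> b]]
  fix u v assume uv: "u \<in> carrier F0" "v \<in> carrier F0"
  show "der_lift \<eta> (b \<odot>\<^bsub>F0\<^esub> (u \<oplus>\<^bsub>F0\<^esub> v))
    = der_lift \<eta> (b \<odot>\<^bsub>F0\<^esub> u) \<oplus>\<^bsub>N\<^esub> der_lift \<eta> (b \<odot>\<^bsub>F0\<^esub> v)"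
    using uv b by (simp add: F.act_add der_lift[OF \<eta>])
  show "b \<odot>\<^bsub>N\<^esub> der_lift \<eta> (u \<oplus>\<^bsub>F0\<^esub> v) \<oplus>\<^bsub>N\<^esub> \<eta> b (\<pi> (u \<oplus>\<^bsub>F0\<^esub> v))
    = b \<odot>\<^bsub>N\<^esub> der_lift \<eta> u \<oplus>\<^bsub>N\<^esub> \<eta> b (\<pi> u)
      \<oplus>\<^bsub>N\<^esub> (b \<odot>\<^bsub>N\<^esub> der_lift \<eta> v \<oplus>\<^bsub>N\<^esub> \<eta> b (\<pi> v))"
    using uv b by (simp add: der_lift[OF \<eta>] cover_map_add cover_map_closed h N.act_add N.M.a_ac)
next
  fix c m assume cm: "c \<in> carrier A" "m \<in> carrier M"
  show "der_lift \<eta> (b \<odot>\<^bsub>F0\<^esub> gen c m)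
    = b \<odot>\<^bsub>N\<^esub> der_lift \<eta> (gen c m) \<oplus>\<^bsub>N\<^esub> \<eta> b (\<pi> (gen c m))"
    using cm b by (simp add: gen_act der_lift(3)[OF \<eta>] cover_map_gen Der_D(5)[OF \<eta>])
qed (use b in \<open>simp_all add: der_lift[OF \<eta>] cover_map_closed Der_D(2)[OF \<eta>]\<close>)

definition der_restrict :: "('a \<Rightarrow> 'm \<Rightarrow> 'n) \<Rightarrow> ('m \<Rightarrow> 'a) \<Rightarrow> 'n"
  where "der_restrict \<eta> = (\<lambda>u\<in>carrier \<Omega>. der_lift \<eta> u)"

lemma Der_zero: "\<eta> \<in> carrier Der \<Longrightarrow> b \<in> carrier A \<Longrightarrow> \<eta> b \<zero>\<^bsub>M\<^esub> = \<zero>\<^bsub>N\<^esub>"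
  using H_D(5)[OF Der_D(1)] by simp

lemma der_restrict_closed: "\<eta> \<in> carrier Der \<Longrightarrow> der_restrict \<eta> \<in> carrier (mod_hom_space A \<Omega> N)"
proof (rule SN.mod_homI)
  assume \<eta>: "\<eta> \<in> carrier Der"
  fix b u assume b: "b \<in> carrier A" and u: "u \<in> carrier \<Omega>"
  then show "der_restrict \<eta> (b \<odot>\<^bsub>\<Omega>\<^esub> u) = b \<odot>\<^bsub>N\<^esub> der_restrict \<eta> u"
    using S.act_closed[OF b u]
    by (simp add: der_restrict_def syzygy_simps der_lift_act[OF \<eta>] Der_zero[OF \<eta>] der_lift[OF \<eta>])
next
  assume \<eta>: "\<eta> \<in> carrier Der"
  fix u v assume u: "u \<in> carrier \<Omega>" "v \<in> carrier \<Omega>"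
  then show "der_restrict \<eta> (u \<oplus>\<^bsub>\<Omega>\<^esub> v) = der_restrict \<eta> u \<oplus>\<^bsub>N\<^esub> der_restrict \<eta> v"
    using S.M.a_closed[OF u] by (simp add: der_restrict_def syzygy_simps der_lift[OF \<eta>])
qed (auto simp: der_restrict_def syzygy_simps der_lift simp del: der_space_simps)

lemma der_restrict_hom: "der_restrict \<in> module_hom K Der (mod_hom_space A \<Omega> N)"
proof (rule module_homI)
  interpret b: bimod K A H "hom_lact M N" "hom_ract M" by (rule hom_bimod)
  interpret D: vectorspace K Der by (rule b.der_space_vectorspace)
  fix \<eta> assume \<eta>: "\<eta> \<in> carrier Der"
  show "der_restrict \<eta> \<in> carrier (mod_hom_space A \<Omega> N)" by (rule der_restrict_closed[OF \<eta>])
  {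
    fix \<eta>' assume \<eta>': "\<eta>' \<in> carrier Der"
    have s: "\<eta> \<oplus>\<^bsub>Der\<^esub> \<eta>' \<in> carrier Der" by (rule D.M.a_closed[OF \<eta> \<eta>'])
    have "der_lift (\<eta> \<oplus>\<^bsub>Der\<^esub> \<eta>') u = der_lift \<eta> u \<oplus>\<^bsub>N\<^esub> der_lift \<eta>' u"
      if u: "u \<in> carrier F0" for u
    proof (rule cover_eqI[OF N.M.abelian_group_axioms u])
      fix b m assume bm: "b \<in> carrier A" "m \<in> carrier M"
      have "(\<eta> \<oplus>\<^bsub>Der\<^esub> \<eta>') b m = \<eta> b m \<oplus>\<^bsub>N\<^esub> \<eta>' b m" using bm by simp
      then show "der_lift (\<eta> \<oplus>\<^bsub>Der\<^esub> \<eta>') (gen b m) = der_lift \<eta> (gen b m) \<oplus>\<^bsub>N\<^esub> der_lift \<eta>' (gen b m)"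
        by (simp only: der_lift(3)[OF s bm] der_lift(3)[OF \<eta> bm] der_lift(3)[OF \<eta>' bm])
    qed (simp_all add: der_lift[OF \<eta>] der_lift[OF \<eta>'] der_lift[OF s] N.M.a_ac del: der_space_simps)
    then show "der_restrict (\<eta> \<oplus>\<^bsub>Der\<^esub> \<eta>') = der_restrict \<eta> \<oplus>\<^bsub>mod_hom_space A \<Omega> N\<^esub> der_restrict \<eta>'"
      by (auto simp: der_restrict_def SN.mod_hom_simps syzygy_simps intro!: restrict_ext simp del: der_space_simps)
  }
  fix c assume c: "c \<in> carrier K"
  have s: "c \<odot>\<^bsub>Der\<^esub> \<eta> \<in> carrier Der" by (rule D.smult_closed[OF c \<eta>])
  have "der_lift (c \<odot>\<^bsub>Der\<^esub> \<eta>) u = (c \<odot> \<one>) \<odot>\<^bsub>N\<^esub> der_lift \<eta> u"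
    if u: "u \<in> carrier F0" for u
  proof (rule cover_eqI[OF N.M.abelian_group_axioms u])
    fix b m assume bm: "b \<in> carrier A" "m \<in> carrier M"
    have "(c \<odot>\<^bsub>Der\<^esub> \<eta>) b m = (c \<odot> \<one>) \<odot>\<^bsub>N\<^esub> \<eta> b m" using bm by simp
    then show "der_lift (c \<odot>\<^bsub>Der\<^esub> \<eta>) (gen b m) = (c \<odot> \<one>) \<odot>\<^bsub>N\<^esub> der_lift \<eta> (gen b m)"
      by (simp only: der_lift(3)[OF s bm] der_lift(3)[OF \<eta> bm])
  qed (use c in \<open>simp_all add: der_lift[OF \<eta>] der_lift[OF s] N.act_add del: der_space_simps\<close>)
  then show "der_restrict (c \<odot>\<^bsub>Der\<^esub> \<eta>) = c \<odot>\<^bsub>mod_hom_space A \<Omega> N\<^esub> der_restrict \<eta>"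
    by (auto simp: der_restrict_def SN.mod_hom_simps syzygy_simps intro!: restrict_ext simp del: der_space_simps)
qed

text \<open>
  Modulo restrictions of module maps on \<open>F0\<close>, every \<open>\<psi> : \<Omega> \<rightarrow> N\<close> comes from a derivation.  Choose a
  \<open>K\<close>-linear section \<open>s\<close> of the cover.  It fails to be \<open>A\<close>-linear by \<open>w b m = b s(m) - s(b m)\<close>, which lies
  in \<open>\<Omega>\<close>, and \<open>\<eta> = \<psi> \<circ> w\<close> is the derivation.  To compare it with \<open>\<psi>\<close>, let \<open>p\<close> be the endomorphism of
  \<open>F0\<close> that sends the generator at \<open>m\<close> to \<open>s(m)\<close>.  Then \<open>\<pi> \<circ> p = \<pi>\<close>, and the extension of \<open>\<eta>\<close> to \<open>F0\<close> is
  \<open>u \<mapsto> \<psi>(p(u) - s(\<pi>(u)))\<close>; on \<open>\<Omega>\<close> this is \<open>\<psi> \<circ> p\<close>.  The difference with \<open>\<psi>\<close> is the restriction of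
  \<open>g(u) = \<psi>(u - p(u))\<close>, which makes sense on all of \<open>F0\<close>.
\<close>

lemma der_restrict_onto:
  assumes fd: "vectorspace.fin_dim K (res_space A M)"
    and \<psi>: "\<psi> \<in> carrier (mod_hom_space A \<Omega> N)"
  obtains \<eta> g where "\<eta> \<in> carrier Der" "g \<in> carrier (mod_hom_space A F0 N)"
    "\<And>u. u \<in> carrier \<Omega> \<Longrightarrow> \<psi> u = der_restrict \<eta> u \<oplus>\<^bsub>N\<^esub> g u"
proof -
  obtain s where s: "\<And>m. m \<in> carrier M \<Longrightarrow> s m \<in> carrier F0"
    "\<And>m m'. m \<in> carrier M \<Longrightarrow> m' \<in> carrier M \<Longrightarrow> s (m \<oplus>\<^bsub>M\<^esub> m') = s m \<oplus>\<^bsub>F0\<^esub> s m'"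
    "\<And>c m. c \<in> carrier K \<Longrightarrow> m \<in> carrier M \<Longrightarrow>
      s ((c \<odot> \<one>) \<odot>\<^bsub>M\<^esub> m) = (c \<odot> \<one>) \<odot>\<^bsub>F0\<^esub> s m"
    "\<And>m. m \<in> carrier M \<Longrightarrow> \<pi> (s m) = m"
    using linear_section[OF fd] by metis
  note \<psi>D = SN.mod_homD[OF \<psi>, unfolded syzygy_simps]
  have cm_minus: "\<pi> (u \<ominus>\<^bsub>F0\<^esub> v) = \<pi> u \<ominus>\<^bsub>M\<^esub> \<pi> v"
    if "u \<in> carrier F0" "v \<in> carrier F0" for u v
    by (rule additive_minus(2)[OF F.M.abelian_group_axioms M.abelian_group_axioms])
      (auto simp: cover_map_closed cover_map_add that)
  have minus_S: "u \<ominus>\<^bsub>F0\<^esub> v \<in> carrier \<Omega>"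
    if "u \<in> carrier F0" "v \<in> carrier F0" "\<pi> u = \<pi> v" for u v
    using that cover_map_closed[OF that(2)] by (simp add: syzygy_simps cm_minus)
  have s0: "s \<zero>\<^bsub>M\<^esub> = \<zero>\<^bsub>F0\<^esub>"
    by (rule additive_zero[OF M.abelian_group_axioms F.M.abelian_group_axioms]) (auto simp: s)
  \<comment> \<open>the failure of \<open>s\<close> to be \<open>A\<close>-linear\<close>
  define w where "w b m = b \<odot>\<^bsub>F0\<^esub> s m \<ominus>\<^bsub>F0\<^esub> s (b \<odot>\<^bsub>M\<^esub> m)" for b m
  have wS: "w b m \<in> carrier \<Omega>" if "b \<in> carrier A" "m \<in> carrier M" for b m
    unfolding w_def by (rule minus_S) (use that in \<open>simp_all add: s cover_map_act\<close>)
  have wF: "w b m \<in> carrier F0" if "b \<in> carrier A" "m \<in> carrier M" for b m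
    using wS[OF that] by (simp add: syzygy_simps)
  have \<psi>_closed: "u \<in> carrier \<Omega> \<Longrightarrow> \<psi> u \<in> carrier N"
    and \<psi>_add: "u \<in> carrier \<Omega> \<Longrightarrow> v \<in> carrier \<Omega> \<Longrightarrow>
      \<psi> (u \<oplus>\<^bsub>F0\<^esub> v) = \<psi> u \<oplus>\<^bsub>N\<^esub> \<psi> v"
    and \<psi>_act: "b \<in> carrier A \<Longrightarrow> u \<in> carrier \<Omega> \<Longrightarrow>
      \<psi> (b \<odot>\<^bsub>F0\<^esub> u) = b \<odot>\<^bsub>N\<^esub> \<psi> u" for u v b
    using \<psi>D(1-3) by (simp_all add: syzygy_simps)
  have k1: "k \<odot> \<one> \<in> carrier A" if "k \<in> carrier K" for k using that by simp
  define \<eta> where "\<eta> = (\<lambda>b\<in>carrier A. \<lambda>m\<in>carrier M. \<psi> (w b m))"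
  have \<eta>: "\<eta> \<in> carrier Der"
    unfolding \<eta>_def
  proof (rule Der_I)
    fix b m assume bm: "b \<in> carrier A" "m \<in> carrier M"
    show "\<psi> (w b m) \<in> carrier N" by (rule \<psi>_closed[OF wS[OF bm]])
    { fix m' assume m': "m' \<in> carrier M"
      have "w b (m \<oplus>\<^bsub>M\<^esub> m') = w b m \<oplus>\<^bsub>F0\<^esub> w b m'"
        using bm m' by (simp add: w_def s act_add F.act_add a_minus_def F.M.minus_add F.M.a_ac)
      then show "\<psi> (w b (m \<oplus>\<^bsub>M\<^esub> m')) = \<psi> (w b m) \<oplus>\<^bsub>N\<^esub> \<psi> (w b m')"
        using \<psi>_add[OF wS[OF bm] wS[OF bm(1) m']] by simp }
    { fix k assume k: "k \<in> carrier K"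
      have "w b ((k \<odot> \<one>) \<odot>\<^bsub>M\<^esub> m) = (k \<odot> \<one>) \<odot>\<^bsub>F0\<^esub> w b m"
        "w (k \<odot> b) m = (k \<odot> \<one>) \<odot>\<^bsub>F0\<^esub> w b m"
        using bm k by (simp_all add: w_def s act_scalar[OF bm(1) k] F.act_scalar[OF bm(1) k]
          smult_act[OF bm(1) k] F.smult_act[OF bm(1) k] F.act_minus)
      then show "\<psi> (w b ((k \<odot> \<one>) \<odot>\<^bsub>M\<^esub> m)) = (k \<odot> \<one>) \<odot>\<^bsub>N\<^esub> \<psi> (w b m)"
        "\<psi> (w (k \<odot> b) m) = (k \<odot> \<one>) \<odot>\<^bsub>N\<^esub> \<psi> (w b m)"
        using \<psi>_act[OF k1[OF k] wS[OF bm]] by simp_all }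
    { fix c assume c: "c \<in> carrier A"
      have "w (b \<oplus> c) m = w b m \<oplus>\<^bsub>F0\<^esub> w c m"
        using bm c by (simp add: w_def s add_act F.add_act a_minus_def F.M.minus_add F.M.a_ac)
      then show "\<psi> (w (b \<oplus> c) m) = \<psi> (w b m) \<oplus>\<^bsub>N\<^esub> \<psi> (w c m)"
        using \<psi>_add[OF wS[OF bm] wS[OF c bm(2)]] by simp
      have "w (b \<otimes> c) m = b \<odot>\<^bsub>F0\<^esub> w c m \<oplus>\<^bsub>F0\<^esub> w b (c \<odot>\<^bsub>M\<^esub> m)"
        using bm c by (simp add: w_def s act_assoc F.act_assoc F.act_minus[unfolded a_minus_def] a_minus_def F.M.a_assoc F.M.r_neg1)
      moreover have "b \<odot>\<^bsub>F0\<^esub> w c m \<in> carrier \<Omega>"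
        using S.act_closed[OF bm(1) wS[OF c bm(2)]] by (simp add: syzygy_simps)
      moreover have "w b (c \<odot>\<^bsub>M\<^esub> m) \<in> carrier \<Omega>" using bm c by (intro wS) auto
      ultimately show "\<psi> (w (b \<otimes> c) m) = b \<odot>\<^bsub>N\<^esub> \<psi> (w c m) \<oplus>\<^bsub>N\<^esub> \<psi> (w b (c \<odot>\<^bsub>M\<^esub> m))"
        using \<psi>_add \<psi>_act[OF bm(1) wS[OF c bm(2)]] by simp }
  qed
  \<comment> \<open>the \<open>A\<close>-linear map with \<open>p (gen b m) = b s(m)\<close>\<close>
  define p where "p = free_lift A F0 (carrier M) (\<lambda>b m. b \<odot>\<^bsub>F0\<^esub> s m)"
  have p_closed: "p u \<in> carrier F0" if "u \<in> carrier F0" for u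
    unfolding p_def using that free_lift_closed[OF F.M.abelian_group_axioms, of "carrier M"]
    by (auto simp: free_cover_def[symmetric] s F.add_act)
  have p_add: "p (u \<oplus>\<^bsub>F0\<^esub> v) = p u \<oplus>\<^bsub>F0\<^esub> p v"
    if "u \<in> carrier F0" "v \<in> carrier F0" for u v
    unfolding p_def using that free_lift_add[OF F.M.abelian_group_axioms, of "carrier M"]
    by (auto simp: free_cover_def[symmetric] s F.add_act)
  have p_gen: "p (gen b m) = b \<odot>\<^bsub>F0\<^esub> s m" if "b \<in> carrier A" "m \<in> carrier M" for b m
    unfolding p_def using that free_lift_gen[OF F.M.abelian_group_axioms, of "carrier M"]
    by (auto simp: free_cover_def[symmetric] s F.add_act)
  have p_act: "p (b \<odot>\<^bsub>F0\<^esub> u) = b \<odot>\<^bsub>F0\<^esub> p u"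
    if "b \<in> carrier A" "u \<in> carrier F0" for b u
    unfolding p_def using that free_lift_act[OF F.lmod_axioms, of "carrier M"]
    by (auto simp: free_cover_def[symmetric] s F.add_act F.act_assoc)
  have cp: "\<pi> (p u) = \<pi> u" if u: "u \<in> carrier F0" for u
    by (rule cover_eqI[OF M.abelian_group_axioms u])
      (auto simp: cover_map_closed cover_map_add p_closed p_add p_gen cover_map_act cover_map_gen s)
  have psS: "p u \<ominus>\<^bsub>F0\<^esub> s (\<pi> u) \<in> carrier \<Omega>"
    if "u \<in> carrier F0" for u
    using that by (intro minus_S) (auto simp: p_closed s cover_map_closed cp)
  have lift: "der_lift \<eta> u = \<psi> (p u \<ominus>\<^bsub>F0\<^esub> s (\<pi> u))"
    if u: "u \<in> carrier F0" for u
  proof (rule cover_eqI[OF N.M.abelian_group_axioms u])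
    fix u v assume uv: "u \<in> carrier F0" "v \<in> carrier F0"
    have "p (u \<oplus>\<^bsub>F0\<^esub> v) \<ominus>\<^bsub>F0\<^esub> s (\<pi> (u \<oplus>\<^bsub>F0\<^esub> v))
      = (p u \<ominus>\<^bsub>F0\<^esub> s (\<pi> u)) \<oplus>\<^bsub>F0\<^esub>
        (p v \<ominus>\<^bsub>F0\<^esub> s (\<pi> v))"
      using uv by (simp add: p_add p_closed cover_map_add cover_map_closed s a_minus_def F.M.minus_add F.M.a_ac)
    then show "\<psi> (p (u \<oplus>\<^bsub>F0\<^esub> v) \<ominus>\<^bsub>F0\<^esub> s (\<pi> (u \<oplus>\<^bsub>F0\<^esub> v)))
      = \<psi> (p u \<ominus>\<^bsub>F0\<^esub> s (\<pi> u)) \<oplus>\<^bsub>N\<^esub> \<psi> (p v \<ominus>\<^bsub>F0\<^esub> s (\<pi> v))"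
      using \<psi>_add[OF psS[OF uv(1)] psS[OF uv(2)]] by simp
  next
    fix b m assume bm: "b \<in> carrier A" "m \<in> carrier M"
    show "der_lift \<eta> (gen b m) = \<psi> (p (gen b m) \<ominus>\<^bsub>F0\<^esub> s (\<pi> (gen b m)))"
      unfolding der_lift(3)[OF \<eta> bm] using bm by (simp add: \<eta>_def w_def p_gen cover_map_gen)
  qed (auto simp: der_lift[OF \<eta>] \<psi>_closed psS)
  define g where "g = (\<lambda>u\<in>carrier F0. \<psi> (u \<ominus>\<^bsub>F0\<^esub> p u))"
  have upS: "u \<ominus>\<^bsub>F0\<^esub> p u \<in> carrier \<Omega>" if "u \<in> carrier F0" for u
    using that by (intro minus_S) (auto simp: p_closed cp)
  have "g \<in> carrier (mod_hom_space A F0 N)"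
  proof (rule FN.mod_homI)
    fix u assume u: "u \<in> carrier F0"
    show "g u \<in> carrier N" using u by (simp add: g_def \<psi>_closed upS)
    { fix v assume v: "v \<in> carrier F0"
      have "(u \<oplus>\<^bsub>F0\<^esub> v) \<ominus>\<^bsub>F0\<^esub> p (u \<oplus>\<^bsub>F0\<^esub> v)
        = (u \<ominus>\<^bsub>F0\<^esub> p u) \<oplus>\<^bsub>F0\<^esub> (v \<ominus>\<^bsub>F0\<^esub> p v)"
        using u v by (simp add: p_add p_closed a_minus_def F.M.minus_add F.M.a_ac)
      then show "g (u \<oplus>\<^bsub>F0\<^esub> v) = g u \<oplus>\<^bsub>N\<^esub> g v"
        using u v \<psi>_add[OF upS[OF u] upS[OF v]] by (simp add: g_def) }
    fix b assume b: "b \<in> carrier A"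
    have "(b \<odot>\<^bsub>F0\<^esub> u) \<ominus>\<^bsub>F0\<^esub> p (b \<odot>\<^bsub>F0\<^esub> u)
        = b \<odot>\<^bsub>F0\<^esub> (u \<ominus>\<^bsub>F0\<^esub> p u)"
      using u b by (simp add: p_act F.act_minus p_closed)
    then show "g (b \<odot>\<^bsub>F0\<^esub> u) = b \<odot>\<^bsub>N\<^esub> g u"
      using u b \<psi>_act[OF b upS[OF u]] by (simp add: g_def)
  qed (simp add: g_def)
  moreover have "\<psi> u = der_restrict \<eta> u \<oplus>\<^bsub>N\<^esub> g u" if uS: "u \<in> carrier \<Omega>" for u
  proof -
    have u: "u \<in> carrier F0" "\<pi> u = \<zero>\<^bsub>M\<^esub>" using uS by (auto simp: syzygy_simps)
    have pu: "p u \<in> carrier \<Omega>" using u by (simp add: syzygy_simps p_closed cp)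
    have "u = p u \<oplus>\<^bsub>F0\<^esub> (u \<ominus>\<^bsub>F0\<^esub> p u)"
      using u(1) p_closed[OF u(1)] by (simp add: a_minus_def F.M.a_lcomm F.M.r_neg)
    then have "\<psi> u = \<psi> (p u) \<oplus>\<^bsub>N\<^esub> \<psi> (u \<ominus>\<^bsub>F0\<^esub> p u)"
      using \<psi>_add[OF pu upS[OF u(1)]] by simp
    moreover have "p u \<ominus>\<^bsub>F0\<^esub> s (\<pi> u) = p u"
      using p_closed[OF u(1)] by (simp add: u(2) s0 a_minus_def)
    ultimately show ?thesis using lift[OF u(1)] uS u(1) by (simp add: der_restrict_def g_def)
  qed
  ultimately show ?thesis using that \<eta> by blast
qed

text \<open>
  The extension of \<open>inner h\<close> to \<open>F0\<close> is \<open>g - h \<circ> \<pi>\<close>, where \<open>g\<close> is the module map that equals \<open>h\<close> on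
  generators.
\<close>

lemma der_restrict_inner:
  assumes h: "h \<in> carrier H"
  obtains g where "g \<in> carrier (mod_hom_space A F0 N)"
    "\<And>u. u \<in> carrier \<Omega> \<Longrightarrow> der_restrict (inner h) u = g u"
proof -
  note hD = H_D[OF h]
  note \<eta> = inner_Der[OF h]
  define g where "g = restrict (free_lift A N (carrier M) (\<lambda>b m. b \<odot>\<^bsub>N\<^esub> h m)) (carrier F0)"
  let ?g = "free_lift A N (carrier M) (\<lambda>b m. b \<odot>\<^bsub>N\<^esub> h m)"
  have g_closed: "?g u \<in> carrier N" if "u \<in> carrier F0" for u
    using that free_lift_closed[OF N.M.abelian_group_axioms, of "carrier M"]
    by (auto simp: free_cover_def[symmetric] hD N.add_act)
  have g_add: "?g (u \<oplus>\<^bsub>F0\<^esub> v) = ?g u \<oplus>\<^bsub>N\<^esub> ?g v"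
    if "u \<in> carrier F0" "v \<in> carrier F0" for u v
    using that free_lift_add[OF N.M.abelian_group_axioms, of "carrier M"]
    by (auto simp: free_cover_def[symmetric] hD N.add_act)
  have g_gen: "?g (gen b m) = b \<odot>\<^bsub>N\<^esub> h m" if "b \<in> carrier A" "m \<in> carrier M" for b m
    using that free_lift_gen[OF N.M.abelian_group_axioms, of "carrier M"]
    by (auto simp: hD N.add_act)
  have g_act: "?g (b \<odot>\<^bsub>F0\<^esub> u) = b \<odot>\<^bsub>N\<^esub> ?g u"
    if "b \<in> carrier A" "u \<in> carrier F0" for b u
    using that free_lift_act[OF N.lmod_axioms, of "carrier M"]
    by (auto simp: free_cover_def[symmetric] hD N.add_act N.act_assoc)
  have lift: "der_lift (inner h) u = ?g u \<ominus>\<^bsub>N\<^esub> h (\<pi> u)"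
    if u: "u \<in> carrier F0" for u
  proof (rule cover_eqI[OF N.M.abelian_group_axioms u])
    fix b m assume bm: "b \<in> carrier A" "m \<in> carrier M"
    show "der_lift (inner h) (gen b m) = ?g (gen b m) \<ominus>\<^bsub>N\<^esub> h (\<pi> (gen b m))"
      unfolding der_lift(3)[OF \<eta> bm] using bm by (simp add: inner_def g_gen cover_map_gen)
  qed (auto simp: der_lift[OF \<eta>] g_closed g_add cover_map_closed cover_map_add hD a_minus_def
      N.M.minus_add N.M.a_ac simp del: der_space_simps)
  have "g \<in> carrier (mod_hom_space A F0 N)"
    unfolding g_def by (rule FN.mod_homI) (auto simp: g_closed g_add g_act)
  moreover have "der_restrict (inner h) u = g u" if "u \<in> carrier \<Omega>" for u
    using that lift[of u] g_closed[of u] by (auto simp: der_restrict_def g_def syzygy_simps hD a_minus_def)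
  ultimately show ?thesis using that by blast
qed

text \<open>
  Since \<open>g\<close> and the extension of \<open>\<eta>\<close> agree on the kernel of \<open>\<pi>\<close>, their difference factors as \<open>h \<circ> \<pi>\<close>
  with \<open>h m\<close> the value of \<open>g\<close> at the generator of \<open>m\<close>.  Comparing the elements of \<open>F0\<close> that represent
  \<open>b m\<close> as a multiple and as a generator yields \<open>\<eta> = inner h\<close>.
\<close>

lemma inner_if_der_restrict_extends:
  assumes \<eta>: "\<eta> \<in> carrier Der" and g: "g \<in> carrier (mod_hom_space A F0 N)"
    and eq: "\<And>u. u \<in> carrier \<Omega> \<Longrightarrow> der_restrict \<eta> u = g u"
  obtains h where "h \<in> carrier H" "\<eta> = inner h"
proof -
  note gD = FN.mod_homD[OF g]
  define h where "h = (\<lambda>m\<in>carrier M. g (gen \<one> m))"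
  have hN: "h m \<in> carrier N" if "m \<in> carrier M" for m using that by (simp add: h_def gD gen_closed)
  have lift_minus: "der_lift \<eta> (u \<ominus>\<^bsub>F0\<^esub> v) = der_lift \<eta> u \<ominus>\<^bsub>N\<^esub> der_lift \<eta> v"
    if "u \<in> carrier F0" "v \<in> carrier F0" for u v
    by (rule additive_minus(2)[OF F.M.abelian_group_axioms N.M.abelian_group_axioms])
      (auto simp: der_lift[OF \<eta>] that simp del: der_space_simps)
  have cm_minus: "\<pi> (u \<ominus>\<^bsub>F0\<^esub> v) = \<pi> u \<ominus>\<^bsub>M\<^esub> \<pi> v"
    if "u \<in> carrier F0" "v \<in> carrier F0" for u v
    by (rule additive_minus(2)[OF F.M.abelian_group_axioms M.abelian_group_axioms])
      (auto simp: cover_map_closed cover_map_add that)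
  \<comment> \<open>the two maps agree on \<open>u - v\<close>, which lies in \<open>\<Omega>\<close>\<close>
  have agree: "g u \<ominus>\<^bsub>N\<^esub> g v = der_lift \<eta> u \<ominus>\<^bsub>N\<^esub> der_lift \<eta> v"
    if "u \<in> carrier F0" "v \<in> carrier F0" "\<pi> u = \<pi> v" for u v
  proof -
    have S: "u \<ominus>\<^bsub>F0\<^esub> v \<in> carrier \<Omega>"
      using that cover_map_closed[OF that(2)] by (simp add: syzygy_simps cm_minus)
    show ?thesis using eq[OF S] S that(1,2) by (simp add: der_restrict_def lift_minus gD)
  qed
  have e: "\<eta> b m = b \<odot>\<^bsub>N\<^esub> h m \<ominus>\<^bsub>N\<^esub> h (b \<odot>\<^bsub>M\<^esub> m)" if bm: "b \<in> carrier A" "m \<in> carrier M" for b m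
  proof -
    have "g (gen b m) \<ominus>\<^bsub>N\<^esub> g (gen \<one> (b \<odot>\<^bsub>M\<^esub> m)) = \<eta> b m \<ominus>\<^bsub>N\<^esub> \<zero>\<^bsub>N\<^esub>"
      using agree[of "gen b m" "gen \<one> (b \<odot>\<^bsub>M\<^esub> m)"] bm
      by (simp add: gen_closed cover_map_gen der_lift(3)[OF \<eta>] Der_D(6)[OF \<eta>] del: der_space_simps)
    moreover have "g (gen b m) = b \<odot>\<^bsub>N\<^esub> h m"
      using gD(3)[OF bm(1) gen_closed[of \<one> m]] bm by (simp add: gen_act h_def)
    ultimately show ?thesis using bm Der_D(2)[OF \<eta> bm] by (simp add: h_def a_minus_def)
  qed
  have "h \<in> carrier H"
  proof (rule H_I)
    fix m m' assume m: "m \<in> carrier M" "m' \<in> carrier M"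
    let ?u = "gen \<one> m \<oplus>\<^bsub>F0\<^esub> gen \<one> m'" and ?v = "gen \<one> (m \<oplus>\<^bsub>M\<^esub> m')"
    have "g ?u \<ominus>\<^bsub>N\<^esub> g ?v = \<zero>\<^bsub>N\<^esub>"
      using agree[of ?u ?v] m
      by (simp add: gen_closed cover_map_gen cover_map_add der_lift[OF \<eta>] Der_D(6)[OF \<eta>] a_minus_def del: der_space_simps)
    then show "h (m \<oplus>\<^bsub>M\<^esub> m') = h m \<oplus>\<^bsub>N\<^esub> h m'"
      using m by (simp add: h_def gD gen_closed)
  next
    fix c m assume c: "c \<in> carrier K" "m \<in> carrier M"
    have "\<eta> (c \<odot> \<one>) m = \<zero>\<^bsub>N\<^esub>" using c by (simp add: Der_D(4)[OF \<eta>] Der_D(6)[OF \<eta>] del: der_space_simps)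
    then show "h ((c \<odot> \<one>) \<odot>\<^bsub>M\<^esub> m) = (c \<odot> \<one>) \<odot>\<^bsub>N\<^esub> h m"
      using e[of "c \<odot> \<one>" m] c by (simp add: hN)
  qed (simp_all add: hN, simp add: h_def)
  moreover have "\<eta> = inner h"
  proof (rule extensionalityI[of _ "carrier A"])
    show "\<eta> \<in> extensional (carrier A)" using \<eta> by (auto dest: derivationsD(3))
    show "inner h \<in> extensional (carrier A)" by (simp add: inner_def)
    fix b assume b: "b \<in> carrier A"
    have "\<eta> b \<in> extensional (carrier M)" using H_D(4)[OF Der_D(1)[OF \<eta> b]] .
    then show "\<eta> b = inner h b"
      using b e[OF b] by (auto simp: inner_def intro!: extensionalityI[of _ "carrier M"])
  qed
  ultimately show ?thesis using that by blast
qed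

text \<open>
  Exactness of \<open>0 \<rightarrow> Hom\<^sub>A(M, N) \<rightarrow> Hom\<^sub>K(M, N) \<rightarrow> Der(A, Hom\<^sub>K(M, N)) \<rightarrow> Ext\<^sup>1\<^sub>A(M, N) \<rightarrow> 0\<close>.  The second
  map is \<open>inner\<close>.  The third restricts a derivation to \<open>\<Omega>\<close> and pulls the result back to the free cover
  \<open>F1\<close> of \<open>\<Omega>\<close>; it is onto by \<open>der_restrict_onto\<close>, and by the last two lemmas its kernel consists of the
  inner derivations.
\<close>

theorem dim_derivations_ext1:
  assumes fA: "V.fin_dim" and fM: "vectorspace.fin_dim K (res_space A M)"
    and fN: "vectorspace.fin_dim K (res_space A N)"
  shows "vectorspace.dim K Der + vectorspace.dim K (mod_hom_space A M N)
    = vectorspace.dim K H + vectorspace.dim K (ext1 A M N)"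
proof -
  interpret S1: lmod K A "F1" by (rule S.free_cover_lmod)
  interpret F1N: lmod2 K A "F1" N ..
  interpret b: bimod K A H "hom_lact M N" "hom_ract M" by (rule hom_bimod)
  note HV = H_vectorspace and DV = b.der_space_vectorspace
  have fH: "vectorspace.fin_dim K H"
    by (rule dim_linear_space(1)[OF res_vectorspace N.res_vectorspace fM fN])
  have fD: "vectorspace.fin_dim K Der" by (rule b.der_space_fin_dim[OF fA fH])
  interpret Hv: vectorspace K H by (rule HV)

  have inner_hom: "inner \<in> module_hom K H Der"
  proof (rule module_homI)
    fix h assume h: "h \<in> carrier H"
    show "inner h \<in> carrier Der" by (rule inner_Der[OF h])
    { fix h' assume h': "h' \<in> carrier H"
      show "inner (h \<oplus>\<^bsub>H\<^esub> h') = inner h \<oplus>\<^bsub>Der\<^esub> inner h'"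
        using H_D(1)[OF h] H_D(1)[OF h']
        by (auto simp: inner_def N.act_add a_minus_def N.M.minus_add N.M.a_ac intro!: restrict_ext) }
    fix c assume c: "c \<in> carrier K"
    show "inner (c \<odot>\<^bsub>H\<^esub> h) = c \<odot>\<^bsub>Der\<^esub> inner h"
      using H_D(1)[OF h] c
      by (auto simp: inner_def N.act_scalar[OF _ c] N.act_minus intro!: restrict_ext)
  qed
  let ?I = "inner ` carrier H"
  have I: "subspace K ?I Der" by (rule image_subspace[OF HV DV inner_hom])
  have "{h \<in> carrier H. inner h = \<zero>\<^bsub>Der\<^esub>} = carrier (mod_hom_space A M N)"
  proof -
    have "inner h = \<zero>\<^bsub>Der\<^esub> \<longleftrightarrow> (\<forall>b\<in>carrier A. \<forall>m\<in>carrier M. h (b \<odot>\<^bsub>M\<^esub> m) = b \<odot>\<^bsub>N\<^esub> h m)"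
      if h: "h \<in> carrier H" for h
    proof -
      have "inner h = \<zero>\<^bsub>Der\<^esub> \<longleftrightarrow>
          (\<forall>b\<in>carrier A. \<forall>m\<in>carrier M. b \<odot>\<^bsub>N\<^esub> h m \<ominus>\<^bsub>N\<^esub> h (b \<odot>\<^bsub>M\<^esub> m) = \<zero>\<^bsub>N\<^esub>)"
        by (auto simp: inner_def restrict_def fun_eq_iff)
      also have "\<dots> \<longleftrightarrow> (\<forall>b\<in>carrier A. \<forall>m\<in>carrier M. h (b \<odot>\<^bsub>M\<^esub> m) = b \<odot>\<^bsub>N\<^esub> h m)"
        using H_D(1)[OF h] by (intro ball_cong refl) auto
      finally show ?thesis .
    qed
    moreover have "h \<in> carrier H" if "h \<in> carrier (mod_hom_space A M N)" for h
      using that by (intro H_I) (auto simp: mod_homD)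
    ultimately show ?thesis
      by (auto simp: mod_homD intro!: mod_homI dest: H_D simp del: linear_space_simps der_space_simps)
  qed
  moreover have "H\<lparr>carrier := carrier (mod_hom_space A M N)\<rparr> = mod_hom_space A M N"
    by (simp add: linear_space_def mod_hom_space_def hom_space_def bare_module_def)
  ultimately have dimH: "vectorspace.dim K (Der\<lparr>carrier := ?I\<rparr>) + vectorspace.dim K (mod_hom_space A M N)
      = vectorspace.dim K H"
    using dim_exact(1)[OF HV subspaceD(6)[OF I] fH module_hom_restrict_codomain[OF inner_hom]] by auto

  let ?MF1 = "mod_hom_space A F1 N"
  let ?Z = "SN.pullback ` carrier (mod_hom_space A \<Omega> N)"
  let ?ZV = "?MF1\<lparr>carrier := ?Z\<rparr>"
  let ?r = "\<lambda>g. restrict g (carrier \<Omega>)"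
  let ?B = "{\<lambda>u\<in>carrier F1. g (cover_map A \<Omega> u) | g.
      g \<in> carrier (mod_hom_space A F0 N)}"
  have pb_r: "SN.pullback (?r g) = (\<lambda>u\<in>carrier F1. g (cover_map A \<Omega> u))" for g
    by (auto simp: SN.pullback_def S.cover_map_closed intro!: restrict_ext)
  have r_closed: "?r g \<in> carrier (mod_hom_space A \<Omega> N)"
    if g: "g \<in> carrier (mod_hom_space A F0 N)" for g
    using S.M.a_closed S.act_closed
    by (intro SN.mod_homI) (auto simp: syzygy_simps FN.mod_homD[OF g])
  have B: "?B = (\<lambda>g. SN.pullback (?r g)) ` carrier (mod_hom_space A F0 N)"
    unfolding pb_r by auto
  have ext: "ext1 A M N = quot_module ?ZV ?B"
    unfolding ext1_def Let_def SN.vanish_on_syzygy_iff_pullback ..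
  have Zs: "subspace K ?Z ?MF1"
    by (rule image_subspace[OF SN.mod_hom_space_vectorspace F1N.mod_hom_space_vectorspace SN.pullback_hom])
  have ZV: "vectorspace K ?ZV" by (rule subspaceD(6)[OF Zs])
  have pbZ: "SN.pullback \<in> module_hom K (mod_hom_space A \<Omega> N) ?ZV"
    by (rule module_hom_restrict_codomain[OF SN.pullback_hom]) simp
  have r_hom: "?r \<in> module_hom K (mod_hom_space A F0 N) (mod_hom_space A \<Omega> N)"
    by (rule module_homI) (auto simp: r_closed FN.mod_hom_simps(3,4) SN.mod_hom_simps(3,4) syzygy_simps intro!: restrict_ext)
  have Bs: "subspace K ?B ?ZV"
    unfolding B
    by (rule image_subspace[OF FN.mod_hom_space_vectorspace ZV])
      (use module_homD[OF r_hom] module_homD[OF pbZ] in \<open>auto intro!: module_homI\<close>)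
  let ?T = "\<lambda>\<eta>. SN.pullback (der_restrict \<eta>)"
  have T: "?T \<in> module_hom K Der ?ZV"
    by (rule module_homI) (use module_homD[OF der_restrict_hom] module_homD[OF pbZ] in auto)
  have onto: "\<exists>\<eta>\<in>carrier Der. \<exists>w\<in>?B. z = ?T \<eta> \<oplus>\<^bsub>?ZV\<^esub> w" if z: "z \<in> carrier ?ZV" for z
  proof -
    obtain \<psi> where \<psi>: "\<psi> \<in> carrier (mod_hom_space A \<Omega> N)" "z = SN.pullback \<psi>" using z by auto
    obtain \<eta> g where eg: "\<eta> \<in> carrier Der" "g \<in> carrier (mod_hom_space A F0 N)"
      "\<And>u. u \<in> carrier \<Omega> \<Longrightarrow> \<psi> u = der_restrict \<eta> u \<oplus>\<^bsub>N\<^esub> g u"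
      using der_restrict_onto[OF fM \<psi>(1)] by blast
    have "\<psi> = der_restrict \<eta> \<oplus>\<^bsub>mod_hom_space A \<Omega> N\<^esub> ?r g"
      using SN.mod_homD(6)[OF \<psi>(1)] eg(3)
      by (intro extensionalityI[of _ "carrier \<Omega>"]) (auto simp: SN.mod_hom_simps(3))
    then have "z = ?T \<eta> \<oplus>\<^bsub>?ZV\<^esub> SN.pullback (?r g)"
      unfolding \<psi>(2) using module_homD(2)[OF pbZ der_restrict_closed[OF eg(1)] r_closed[OF eg(2)]] by simp
    then show ?thesis using eg(1,2) unfolding B by blast
  qed
  have "{\<eta> \<in> carrier Der. ?T \<eta> \<in> ?B} = ?I"
  proof
    show "{\<eta> \<in> carrier Der. ?T \<eta> \<in> ?B} \<subseteq> ?I"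
    proof
      fix \<eta> assume "\<eta> \<in> {\<eta> \<in> carrier Der. ?T \<eta> \<in> ?B}"
      then obtain g where \<eta>: "\<eta> \<in> carrier Der" and g: "g \<in> carrier (mod_hom_space A F0 N)"
        and eq: "?T \<eta> = SN.pullback (?r g)" unfolding B by blast
      have "der_restrict \<eta> u = g u" if u: "u \<in> carrier \<Omega>" for u
      proof -
        obtain v where v: "v \<in> carrier F1" "cover_map A \<Omega> v = u"
          using S.cover_map_surj[OF u] by blast
        show ?thesis using fun_cong[OF eq, of v] v u by (simp add: SN.pullback_def)
      qed
      then obtain h where "h \<in> carrier H" "\<eta> = inner h" using inner_if_der_restrict_extends[OF \<eta> g] by blast
      then show "\<eta> \<in> ?I" by blast
    qed
    show "?I \<subseteq> {\<eta> \<in> carrier Der. ?T \<eta> \<in> ?B}"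
    proof
      fix \<eta> assume "\<eta> \<in> ?I"
      then obtain h where h: "h \<in> carrier H" "\<eta> = inner h" by blast
      obtain g where g: "g \<in> carrier (mod_hom_space A F0 N)"
        "\<And>u. u \<in> carrier \<Omega> \<Longrightarrow> der_restrict (inner h) u = g u"
        using der_restrict_inner[OF h(1)] by blast
      have "der_restrict \<eta> = ?r g"
        using g(2) unfolding h(2) by (auto simp: der_restrict_def intro!: restrict_ext)
      then show "\<eta> \<in> {\<eta> \<in> carrier Der. ?T \<eta> \<in> ?B}"
        using inner_Der[OF h(1)] g(1) unfolding B h(2) by auto
    qed
  qed
  then have "vectorspace.dim K (ext1 A M N) + vectorspace.dim K (Der\<lparr>carrier := ?I\<rparr>) = vectorspace.dim K Der"
    using dim_quot_module_onto[OF Bs DV fD T onto] unfolding ext by simp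
  then show ?thesis using dimH by simp
qed

end

section \<open>Trivial extensions and corners\<close>

definition triv_ext ::
  "('k, 'a) module \<Rightarrow> ('k, 'm) module \<Rightarrow> ('a \<Rightarrow> 'm \<Rightarrow> 'm) \<Rightarrow> ('m \<Rightarrow> 'a \<Rightarrow> 'm) \<Rightarrow> ('k, 'a \<times> 'm) module"
  where "triv_ext A M l r =
    \<lparr>carrier = carrier A \<times> carrier M,
     mult = (\<lambda>x y. (fst x \<otimes>\<^bsub>A\<^esub> fst y, l (fst x) (snd y) \<oplus>\<^bsub>M\<^esub> r (snd x) (fst y))),
     one = (\<one>\<^bsub>A\<^esub>, \<zero>\<^bsub>M\<^esub>), zero = (\<zero>\<^bsub>A\<^esub>, \<zero>\<^bsub>M\<^esub>),
     add = (\<lambda>x y. (fst x \<oplus>\<^bsub>A\<^esub> fst y, snd x \<oplus>\<^bsub>M\<^esub> snd y)),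
     smult = (\<lambda>c x. (c \<odot>\<^bsub>A\<^esub> fst x, c \<odot>\<^bsub>M\<^esub> snd x))\<rparr>"

lemma triv_ext_simps [simp]:
  "carrier (triv_ext A M l r) = carrier A \<times> carrier M"
  "mult (triv_ext A M l r) = (\<lambda>x y. (fst x \<otimes>\<^bsub>A\<^esub> fst y, l (fst x) (snd y) \<oplus>\<^bsub>M\<^esub> r (snd x) (fst y)))"
  "one (triv_ext A M l r) = (\<one>\<^bsub>A\<^esub>, \<zero>\<^bsub>M\<^esub>)"
  "zero (triv_ext A M l r) = (\<zero>\<^bsub>A\<^esub>, \<zero>\<^bsub>M\<^esub>)"
  "add (triv_ext A M l r) = (\<lambda>x y. (fst x \<oplus>\<^bsub>A\<^esub> fst y, snd x \<oplus>\<^bsub>M\<^esub> snd y))"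
  "smult (triv_ext A M l r) = (\<lambda>c x. (c \<odot>\<^bsub>A\<^esub> fst x, c \<odot>\<^bsub>M\<^esub> snd x))"
  by (simp_all add: triv_ext_def)

lemma (in bimod) triv_ext_vectorspace: "vectorspace K (triv_ext A M l r)"
  by (rule vectorspace_image[OF direct_sum_is_vs[OF V.vectorspace_axioms M.vectorspace_axioms], of _ "\<lambda>x. x"]) auto

lemma (in bimod) triv_ext_kalg: "kalg K (triv_ext A M l r)"
proof -
  let ?T = "triv_ext A M l r"
  interpret T: vectorspace K ?T by (rule triv_ext_vectorspace)
  have "ring ?T"
  proof (rule ringI)
    show "abelian_group ?T" by (rule T.abelian_group_axioms)
    show "Group.monoid ?T"
      by (rule monoidI) (auto simp: m_assoc l_assoc r_assoc lr_assoc l_add add_r M.a_assoc)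
  qed (auto simp: l_distr r_distr l_add add_l r_add add_r M.a_ac)
  then interpret T: ring ?T .
  show ?thesis
    by unfold_locales
      (auto simp: smult_mult_left smult_mult_right l_smult smult_l r_smult smult_r M.smult_r_distr)
qed

lemma (in bimod) triv_ext_dim:
  assumes "V.fin_dim" "M.fin_dim"
  shows "vectorspace.fin_dim K (triv_ext A M l r)"
    "vectorspace.dim K (triv_ext A M l r) = vectorspace.dim K A + vectorspace.dim K M"
  using dim_cong_operations[OF direct_sum_is_vs[OF V.vectorspace_axioms M.vectorspace_axioms] triv_ext_vectorspace
      fin_dim_direct_sum(1)[OF V.vectorspace_axioms M.vectorspace_axioms assms]]
    fin_dim_direct_sum(2)[OF V.vectorspace_axioms M.vectorspace_axioms assms] by auto

lemma corner_simps [simp]: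
  "zero (corner A x y) = \<zero>\<^bsub>A\<^esub>" "add (corner A x y) = add A" "smult (corner A x y) = smult A"
  by (simp_all add: corner_def)

context kalg begin

lemma in_corner:
  assumes "x \<in> carrier A" "x \<otimes> x = x" "y \<in> carrier A" "y \<otimes> y = y"
  shows "z \<in> carrier (corner A x y) \<longleftrightarrow> z \<in> carrier A \<and> x \<otimes> z = z \<and> z \<otimes> y = z"
proof
  assume "z \<in> carrier (corner A x y)"
  then obtain b where b: "b \<in> carrier A" "z = x \<otimes> b \<otimes> y" by (auto simp: corner_def)
  have "x \<otimes> z = (x \<otimes> x) \<otimes> b \<otimes> y" using assms(1,3) b by (simp add: m_assoc)
  moreover have "z \<otimes> y = x \<otimes> b \<otimes> (y \<otimes> y)" using assms(1,3) b by (simp add: m_assoc)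
  ultimately show "z \<in> carrier A \<and> x \<otimes> z = z \<and> z \<otimes> y = z" using assms b by simp
next
  assume z: "z \<in> carrier A \<and> x \<otimes> z = z \<and> z \<otimes> y = z"
  then have "z = x \<otimes> z \<otimes> y" by simp
  then show "z \<in> carrier (corner A x y)" using z unfolding corner_def by (auto intro!: exI[of _ z])
qed

lemma corner_subspace:
  assumes "x \<in> carrier A" "x \<otimes> x = x" "y \<in> carrier A" "y \<otimes> y = y"
  shows "subspace K (carrier (corner A x y)) A"
  by (rule subspaceI[OF V.vectorspace_axioms])
    (auto simp: in_corner[OF assms] assms r_distr l_distr smult_mult_left smult_mult_right)

lemma corner_vectorspace:
  assumes "x \<in> carrier A" "x \<otimes> x = x" "y \<in> carrier A" "y \<otimes> y = y"
  shows "vectorspace K (corner A x y)" "V.fin_dim \<Longrightarrow> vectorspace.fin_dim K (corner A x y)"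
  using subspaceD(6)[OF corner_subspace[OF assms]] subspace_fin_dim[OF corner_subspace[OF assms]]
  by (simp_all add: corner_def)

end

section \<open>Linear maps from an injective to a projective\<close>

text \<open>
  \<open>E\<close> is \<open>e B\<close>, \<open>X\<close> is its dual \<open>I\<^sub>e\<close>, and \<open>Y\<close> is \<open>P\<^sub>f = B f\<close>.
\<close>

locale two_idempotents = kalg K B
  for K :: "('k, 'z) ring_scheme" and B :: "('k, 'b) module" (structure) +
  fixes e f :: 'b
  assumes e [simp]: "e \<in> carrier B" "e \<otimes> e = e" and f [simp]: "f \<in> carrier B" "f \<otimes> f = f"
    and fin_dim: "V.fin_dim"
begin

abbreviation "E \<equiv> right_ideal_space B e"
abbreviation "X \<equiv> inj_module K B e"
abbreviation "Y \<equiv> proj_module B f"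

lemma in_E: "y \<in> carrier E \<longleftrightarrow> y \<in> carrier B \<and> e \<otimes> y = y"
proof
  assume "y \<in> carrier E"
  then obtain b where b: "b \<in> carrier B" "y = e \<otimes> b" by (auto simp: right_ideal_space_def)
  then have "e \<otimes> y = (e \<otimes> e) \<otimes> b" by (simp only: m_assoc e(1))
  then show "y \<in> carrier B \<and> e \<otimes> y = y" using b by simp
next
  assume "y \<in> carrier B \<and> e \<otimes> y = y"
  then show "y \<in> carrier E" by (auto simp: right_ideal_space_def intro!: exI[of _ y])
qed

lemma in_Y: "x \<in> carrier Y \<longleftrightarrow> x \<in> carrier B \<and> x \<otimes> f = x"
proof
  assume "x \<in> carrier Y"
  then obtain b where b: "b \<in> carrier B" "x = b \<otimes> f" by (auto simp: proj_module_def)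
  then have "x \<otimes> f = b \<otimes> (f \<otimes> f)" by (simp only: m_assoc f(1))
  then show "x \<in> carrier B \<and> x \<otimes> f = x" using b by simp
next
  assume "x \<in> carrier B \<and> x \<otimes> f = x"
  then show "x \<in> carrier Y" by (auto simp: proj_module_def intro!: exI[of _ x])
qed

lemma E_simps [simp]:
  "zero E = \<zero>" "add E = add B" "smult E = smult B"
  by (simp_all add: right_ideal_space_def)

lemma Y_simps [simp]:
  "zero Y = \<zero>" "add Y = add B" "smult Y = mult B"
  by (simp_all add: proj_module_def)

lemma E_subspace: "subspace K (carrier E) B"
  by (rule subspaceI[OF V.vectorspace_axioms]) (auto simp: in_E r_distr smult_mult_right)

lemma E_vectorspace: "vectorspace K E" and E_fin_dim: "vectorspace.fin_dim K E"
proof -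
  have "B\<lparr>carrier := carrier E\<rparr> = E" by (simp add: right_ideal_space_def)
  then show "vectorspace K E" "vectorspace.fin_dim K E"
    using subspaceD(6)[OF E_subspace] subspace_fin_dim[OF E_subspace fin_dim] by simp_all
qed

lemma Y_subspace: "subspace K (carrier Y) B"
  by (rule subspaceI[OF V.vectorspace_axioms]) (auto simp: in_Y l_distr smult_mult_left)

lemma Y_lmod: "lmod K B Y"
proof -
  have "abelian_group Y"
  proof (rule abelian_groupI)
    fix x assume "x \<in> carrier Y"
    then show "\<exists>y\<in>carrier Y. y \<oplus>\<^bsub>Y\<^esub> x = \<zero>\<^bsub>Y\<^esub>"
      by (intro bexI[of _ "\<ominus> x"]) (auto simp: in_Y l_neg l_minus)
  qed (auto simp: in_Y l_distr a_ac)
  then interpret Y: abelian_group Y .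
  show ?thesis by unfold_locales (auto simp: in_Y l_distr r_distr m_assoc)
qed

abbreviation "D \<equiv> linear_space K E (field_space K)"

lemma D_vectorspace: "vectorspace K D"
  by (rule linear_space_vectorspace[OF E_vectorspace field_space_vectorspace[OF V.field_axioms]])

lemma X_simps [simp]:
  "carrier X = carrier D" "zero X = zero D" "add X = add D"
  "smult X = (\<lambda>b \<phi>. \<lambda>z\<in>carrier E. \<phi> (z \<otimes> b))"
  by (simp_all add: inj_module_def Let_def del: linear_space_simps)

lemma X_D:
  assumes "\<phi> \<in> carrier X"
  shows "z \<in> carrier E \<Longrightarrow> \<phi> z \<in> carrier K"
    "z \<in> carrier E \<Longrightarrow> z' \<in> carrier E \<Longrightarrow> \<phi> (z \<oplus> z') = \<phi> z \<oplus>\<^bsub>K\<^esub> \<phi> z'"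
    "c \<in> carrier K \<Longrightarrow> z \<in> carrier E \<Longrightarrow> \<phi> (c \<odot> z) = c \<otimes>\<^bsub>K\<^esub> \<phi> z"
    "\<phi> \<in> extensional (carrier E)"
proof -
  have \<phi>: "\<phi> \<in> module_hom K E (field_space K)" "\<phi> \<in> extensional (carrier E)" using assms by auto
  show "z \<in> carrier E \<Longrightarrow> \<phi> z \<in> carrier K"
    "z \<in> carrier E \<Longrightarrow> z' \<in> carrier E \<Longrightarrow> \<phi> (z \<oplus> z') = \<phi> z \<oplus>\<^bsub>K\<^esub> \<phi> z'"
    "c \<in> carrier K \<Longrightarrow> z \<in> carrier E \<Longrightarrow> \<phi> (c \<odot> z) = c \<otimes>\<^bsub>K\<^esub> \<phi> z"
    using module_homD[OF \<phi>(1)] by auto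
  show "\<phi> \<in> extensional (carrier E)" by fact
qed

lemma E_mult: "z \<in> carrier E \<Longrightarrow> b \<in> carrier B \<Longrightarrow> z \<otimes> b \<in> carrier E"
  by (auto simp: in_E m_assoc[symmetric])

lemma E_add: "z \<in> carrier E \<Longrightarrow> z' \<in> carrier E \<Longrightarrow> z \<oplus> z' \<in> carrier E"
  by (auto simp: in_E r_distr)

lemma E_smult: "c \<in> carrier K \<Longrightarrow> z \<in> carrier E \<Longrightarrow> c \<odot> z \<in> carrier E"
  by (auto simp: in_E smult_mult_right)

lemma E_B: "z \<in> carrier E \<Longrightarrow> z \<in> carrier B" by (simp add: in_E)

lemma X_lmod: "lmod K B X"
proof -
  interpret D: vectorspace K D by (rule D_vectorspace)
  have "abelian_group X"
    using D.a_closed D.a_assoc D.a_comm D.l_zero D.r_neg D.l_neg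
    by (intro abelian_groupI) (auto simp del: linear_space_simps)
  then interpret X: abelian_group X .
  show ?thesis
  proof unfold_locales
    fix b \<phi> assume b: "b \<in> carrier B" and \<phi>: "\<phi> \<in> carrier X"
    note pd = X_D[OF \<phi>]
    show "b \<odot>\<^bsub>X\<^esub> \<phi> \<in> carrier X"
      using b by (auto intro!: module_homI simp: pd E_mult l_distr smult_mult_left E_B E_add E_smult)
    { fix c assume "c \<in> carrier B"
      then show "(b \<oplus> c) \<odot>\<^bsub>X\<^esub> \<phi> = b \<odot>\<^bsub>X\<^esub> \<phi> \<oplus>\<^bsub>X\<^esub> c \<odot>\<^bsub>X\<^esub> \<phi>"
        "(b \<otimes> c) \<odot>\<^bsub>X\<^esub> \<phi> = b \<odot>\<^bsub>X\<^esub> (c \<odot>\<^bsub>X\<^esub> \<phi>)"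
        using b by (auto intro!: restrict_ext simp: r_distr pd E_mult E_B m_assoc) }
    fix \<psi> assume "\<psi> \<in> carrier X"
    then show "b \<odot>\<^bsub>X\<^esub> (\<phi> \<oplus>\<^bsub>X\<^esub> \<psi>) = b \<odot>\<^bsub>X\<^esub> \<phi> \<oplus>\<^bsub>X\<^esub> b \<odot>\<^bsub>X\<^esub> \<psi>"
      using b by (auto intro!: restrict_ext simp: E_mult)
  next
    fix \<phi> assume \<phi>: "\<phi> \<in> carrier X"
    show "\<one> \<odot>\<^bsub>X\<^esub> \<phi> = \<phi>" using X_D(4)[OF \<phi>] by (intro extensionalityI[of _ "carrier E"]) (auto simp: E_B)
  qed
qed

sublocale XY: lmod2 K B X Y
  using X_lmod Y_lmod by (simp add: lmod2_def)

lemma X_scalar: "c \<in> carrier K \<Longrightarrow> \<phi> \<in> carrier X \<Longrightarrow> (c \<odot> \<one>) \<odot>\<^bsub>X\<^esub> \<phi> = c \<odot>\<^bsub>D\<^esub> \<phi>"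
  using X_D[of \<phi>] by (auto intro!: restrict_ext simp: mult_scalar E_B)

lemma Y_scalar: "c \<in> carrier K \<Longrightarrow> x \<in> carrier Y \<Longrightarrow> (c \<odot> \<one>) \<odot>\<^bsub>Y\<^esub> x = c \<odot> x"
  by (simp add: scalar_mult in_Y)

lemma X_fin_dim: "vectorspace.fin_dim K (res_space B X)"
  by (rule dim_cong_operations(1)[OF D_vectorspace XY.res_vectorspace
        dim_linear_space(1)[OF E_vectorspace field_space_vectorspace[OF V.field_axioms] E_fin_dim
          dim_field_space(1)[OF V.field_axioms]]])
    (use X_scalar in \<open>auto simp del: X_simps linear_space_simps simp: X_simps(1,3)\<close>)

lemma Y_fin_dim: "vectorspace.fin_dim K (res_space B Y)"
  by (rule dim_cong_operations(1)[OF subspaceD(6)[OF Y_subspace] XY.N.res_vectorspace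
      subspace_fin_dim[OF Y_subspace fin_dim]])
    (auto simp: scalar_mult in_Y)

abbreviation "H \<equiv> XY.H"

lemma H_fin_dim: "vectorspace.fin_dim K H"
  by (rule dim_linear_space(1)[OF XY.res_vectorspace XY.N.res_vectorspace X_fin_dim Y_fin_dim])

text \<open>
  The image of \<open>x \<otimes> y\<close> under the isomorphism \<open>B f \<otimes>\<^sub>K e B \<rightarrow> Hom\<^sub>K(X, Y)\<close>.
\<close>

definition rank_one :: "'b \<Rightarrow> 'b \<Rightarrow> ('b \<Rightarrow> 'k) \<Rightarrow> 'b"
  where "rank_one x y = (\<lambda>\<phi>\<in>carrier X. \<phi> y \<odot> x)"

lemma Y_B: "x \<in> carrier Y \<Longrightarrow> x \<in> carrier B" by (simp add: in_Y)

lemma X_eval: "\<phi> \<in> carrier X \<Longrightarrow> y \<in> carrier E \<Longrightarrow> \<phi> y \<in> carrier K" by (rule X_D(1))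

lemma Y_smult: "c \<in> carrier K \<Longrightarrow> x \<in> carrier Y \<Longrightarrow> c \<odot> x \<in> carrier Y" by (auto simp: in_Y smult_mult_left)
lemma Y_mult: "b \<in> carrier B \<Longrightarrow> x \<in> carrier Y \<Longrightarrow> b \<otimes> x \<in> carrier Y" by (auto simp: in_Y m_assoc)

lemma X_add_apply: "y \<in> carrier E \<Longrightarrow> (\<phi> \<oplus>\<^bsub>X\<^esub> \<psi>) y = \<phi> y \<oplus>\<^bsub>K\<^esub> \<psi> y" by simp

lemma rank_one_closed:
  assumes "x \<in> carrier Y" "y \<in> carrier E"
  shows "rank_one x y \<in> carrier H"
proof (rule XY.H_I)
  fix \<phi> assume \<phi>: "\<phi> \<in> carrier X"
  show "rank_one x y \<phi> \<in> carrier Y" using assms \<phi> by (simp add: rank_one_def Y_smult X_eval del: X_simps)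
  { fix \<psi> assume \<psi>: "\<psi> \<in> carrier X"
    show "rank_one x y (\<phi> \<oplus>\<^bsub>X\<^esub> \<psi>) = rank_one x y \<phi> \<oplus>\<^bsub>Y\<^esub> rank_one x y \<psi>"
      using XY.M.a_closed[OF \<phi> \<psi>] \<phi> \<psi> assms
      by (simp add: rank_one_def X_add_apply X_eval V.smult_l_distr Y_B del: X_simps) }
  fix c assume c: "c \<in> carrier K"
  have "(c \<odot> \<one>) \<odot>\<^bsub>X\<^esub> \<phi> \<in> carrier X" using c \<phi> by (intro XY.act_closed) auto
  moreover have "((c \<odot> \<one>) \<odot>\<^bsub>X\<^esub> \<phi>) y = c \<otimes>\<^bsub>K\<^esub> \<phi> y" using assms(2) by (simp add: X_scalar[OF c \<phi>] del: X_simps)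
  ultimately show "rank_one x y ((c \<odot> \<one>) \<odot>\<^bsub>X\<^esub> \<phi>) = (c \<odot> \<one>) \<odot>\<^bsub>Y\<^esub> rank_one x y \<phi>"
    using c \<phi> assms
    by (simp add: rank_one_def Y_scalar Y_smult X_eval V.smult_assoc1 Y_B del: X_simps Y_simps)
qed (simp add: rank_one_def del: X_simps)

abbreviation "lH \<equiv> hom_lact X Y"
abbreviation "rH \<equiv> hom_ract X"

lemma rank_one_act:
  assumes x: "x \<in> carrier Y" and y: "y \<in> carrier E" and b: "b \<in> carrier B"
  shows "lH b (rank_one x y) = rank_one (b \<otimes> x) y" "rH (rank_one x y) b = rank_one x (y \<otimes> b)"
proof -
  show "lH b (rank_one x y) = rank_one (b \<otimes> x) y"
    using x y b by (auto simp: hom_lact_def rank_one_def X_eval Y_B smult_mult_right simp del: X_simps intro!: restrict_ext)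
  have "(b \<odot>\<^bsub>X\<^esub> \<phi>) y = \<phi> (y \<otimes> b)" for \<phi> using y by simp
  then show "rH (rank_one x y) b = rank_one x (y \<otimes> b)"
    using XY.act_closed[OF b] by (auto simp: hom_ract_def rank_one_def simp del: X_simps intro!: restrict_ext)
qed

text \<open>
  The coordinate functionals \<open>q\<close> of the basis \<open>v\<close> of \<open>e B\<close> form the dual basis of \<open>X\<close>: a functional \<open>\<phi>\<close> is
  the combination of the \<open>q i\<close> with coefficients \<open>\<phi> (v i)\<close>.  Applying \<open>h\<close> shows that \<open>h\<close> is a sum of rank
  one maps.
\<close>

lemma E_dual_basis:
  obtains n v q where "dual_basis K E {..<n :: nat} v q" "\<And>i. i < n \<Longrightarrow> q i \<in> carrier X"
    "\<And>h. h \<in> carrier H \<Longrightarrow> h = finsum H (\<lambda>i. rank_one (h (q i)) (v i)) {..<n}"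
proof -
  obtain n v p where D: "dual_basis K E {..<n :: nat} v p" using dual_basis_exists[OF E_vectorspace E_fin_dim] .
  note d = dual_basisD[OF D, simplified]
  \<comment> \<open>elements of \<open>X\<close> are extensional, the functionals of a dual basis need not be\<close>
  define q where "q i = restrict (p i) (carrier E)" for i
  have q: "q i \<in> carrier X" if "i < n" for i
    using d(3)[OF that] by (auto simp: q_def module_hom_def E_add E_smult)
  have "dual_basis K E {..<n} v q"
    unfolding dual_basis_def
  proof (intro conjI ballI)
    fix x assume x: "x \<in> carrier E"
    show "x = finsum E (\<lambda>i. q i x \<odot>\<^bsub>E\<^esub> v i) {..<n}" using d(6)[OF x] x by (simp add: q_def)
  qed (use q d in \<open>auto simp: q_def\<close>)
  moreover have "h = finsum H (\<lambda>i. rank_one (h (q i)) (v i)) {..<n}" if h: "h \<in> carrier H" for h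
  proof (rule extensionalityI[of _ "carrier X"])
    note hD = XY.H_D[OF h]
    let ?S = "finsum H (\<lambda>i. rank_one (h (q i)) (v i)) {..<n}"
    interpret H: vectorspace K H by (rule XY.H_vectorspace)
    have r: "(\<lambda>i. rank_one (h (q i)) (v i)) \<in> {..<n} \<rightarrow> carrier H"
      by (intro Pi_I rank_one_closed hD q d(2)) auto
    have S: "?S \<in> carrier H" by (rule H.M.finsum_closed[OF r])
    show "h \<in> extensional (carrier X)" by (rule hD)
    show "?S \<in> extensional (carrier X)" using XY.H_D(4)[OF S] .
    fix \<phi> assume \<phi>: "\<phi> \<in> carrier X"
    interpret X: vectorspace K "res_space B X" by (rule XY.res_vectorspace)
    interpret Y: vectorspace K "res_space B Y" by (rule XY.N.res_vectorspace)
    have "?S \<phi> = finsum (res_space B Y) (\<lambda>i. rank_one (h (q i)) (v i) \<phi>) {..<n}"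
    proof (rule module_hom_finsum[OF XY.H_vectorspace XY.N.res_vectorspace, where f = "\<lambda>h. h \<phi>"])
      show "(\<lambda>h. h \<phi>) \<in> module_hom K H (res_space B Y)"
        using \<phi> XY.H_D(1) by (intro module_homI) (auto simp del: X_simps Y_simps linear_space_simps(1))
    qed (use r in auto)
    also have "\<dots> = finsum (res_space B Y) (\<lambda>i. h ((\<phi> (v i) \<odot> \<one>) \<odot>\<^bsub>X\<^esub> q i)) {..<n}"
    proof (rule Y.finsum_cong')
      fix i assume "i \<in> {..<n}"
      then have i: "i < n" by simp
      have "\<phi> (v i) \<in> carrier K" by (rule X_eval[OF \<phi> d(2)[OF i]])
      then show "rank_one (h (q i)) (v i) \<phi> = h ((\<phi> (v i) \<odot> \<one>) \<odot>\<^bsub>X\<^esub> q i)"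
        using \<phi> hD(1)[OF q[OF i]] hD(3)[OF _ q[OF i]] by (simp add: rank_one_def Y_scalar del: X_simps Y_simps)
    qed (use hD(1) X_eval[OF \<phi> d(2)] q in \<open>auto simp del: X_simps Y_simps\<close>)
    also have "\<dots> = h (finsum (res_space B X) (\<lambda>i. (\<phi> (v i) \<odot> \<one>) \<odot>\<^bsub>X\<^esub> q i) {..<n})"
      using h X_eval[OF \<phi> d(2)] q
      by (intro module_hom_finsum[symmetric, OF XY.res_vectorspace XY.N.res_vectorspace])
        (auto simp del: X_simps Y_simps)
    also have "finsum (res_space B X) (\<lambda>i. (\<phi> (v i) \<odot> \<one>) \<odot>\<^bsub>X\<^esub> q i) {..<n} = \<phi>"
    proof (rule extensionalityI[of _ "carrier E"])
      let ?F = "finsum (res_space B X) (\<lambda>i. (\<phi> (v i) \<odot> \<one>) \<odot>\<^bsub>X\<^esub> q i) {..<n}"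
      have fc: "(\<lambda>i. (\<phi> (v i) \<odot> \<one>) \<odot>\<^bsub>X\<^esub> q i) \<in> {..<n} \<rightarrow> carrier (res_space B X)"
        using X_eval[OF \<phi> d(2)] q by (auto simp del: X_simps)
      have "?F \<in> carrier X" using X.M.finsum_closed[OF fc] by simp
      then show "?F \<in> extensional (carrier E)" by (rule X_D(4))
      show "\<phi> \<in> extensional (carrier E)" by (rule X_D(4)[OF \<phi>])
      fix y assume y: "y \<in> carrier E"
      interpret F: vectorspace K "field_space K" by (rule field_space_vectorspace[OF V.field_axioms])
      have "?F y = finsum (field_space K) (\<lambda>i. ((\<phi> (v i) \<odot> \<one>) \<odot>\<^bsub>X\<^esub> q i) y) {..<n}"
      proof (rule module_hom_finsum[OF XY.res_vectorspace F.vectorspace_axioms, where f = "\<lambda>\<phi>. \<phi> y"])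
        show "(\<lambda>\<phi>. \<phi> y) \<in> module_hom K (res_space B X) (field_space K)"
          using y by (intro module_homI) (auto simp: X_eval X_scalar X_add_apply simp del: X_simps)
      qed (use fc in auto)
      also have "\<dots> = finsum (field_space K) (\<lambda>i. \<phi> (q i y \<odot> v i)) {..<n}"
      proof (rule F.finsum_cong')
        fix i assume "i \<in> {..<n}"
        then have i: "i < n" by simp
        have pv: "\<phi> (v i) \<in> carrier K" by (rule X_eval[OF \<phi> d(2)[OF i]])
        show "((\<phi> (v i) \<odot> \<one>) \<odot>\<^bsub>X\<^esub> q i) y = \<phi> (q i y \<odot> v i)"
          unfolding X_scalar[OF pv q[OF i]] X_D(3)[OF \<phi> X_eval[OF q[OF i] y] d(2)[OF i]]
          using y pv X_eval[OF q[OF i] y] by (simp add: V.m_comm)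
      qed (use X_eval[OF \<phi>] X_eval[OF q y] d(2) E_smult in auto)
      also have "\<dots> = \<phi> (finsum E (\<lambda>i. q i y \<odot>\<^bsub>E\<^esub> v i) {..<n})"
        using \<phi> X_eval[OF q y] d(2) E_smult
        by (subst module_hom_finsum[OF E_vectorspace F.vectorspace_axioms, of \<phi>]) auto
      also have "finsum E (\<lambda>i. q i y \<odot>\<^bsub>E\<^esub> v i) {..<n} = y" using d(6)[OF y] y by (simp add: q_def)
      finally show "?F y = \<phi> y" .
    qed
    finally show "h \<phi> = ?S \<phi>" by simp
  qed
  ultimately show ?thesis using that q by blast
qed

lemma H_induct [consumes 1, case_names zero rank_one add]:
  assumes h: "h \<in> carrier H" and z: "P \<zero>\<^bsub>H\<^esub>"
    and r: "\<And>x y. x \<in> carrier Y \<Longrightarrow> y \<in> carrier E \<Longrightarrow> P (rank_one x y)"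
    and a: "\<And>g h. g \<in> carrier H \<Longrightarrow> h \<in> carrier H \<Longrightarrow> P g \<Longrightarrow> P h \<Longrightarrow> P (g \<oplus>\<^bsub>H\<^esub> h)"
  shows "P h"
proof -
  obtain n v q where D: "dual_basis K E {..<n :: nat} v q" "\<And>i. i < n \<Longrightarrow> q i \<in> carrier X"
    "\<And>h. h \<in> carrier H \<Longrightarrow> h = finsum H (\<lambda>i. rank_one (h (q i)) (v i)) {..<n}"
    by (rule E_dual_basis, rule that)
  interpret H: vectorspace K H by (rule XY.H_vectorspace)
  have rc: "h (q i) \<in> carrier Y" "v i \<in> carrier E" if "i < n" for i
    using that XY.H_D(1)[OF h D(2)] dual_basisD(2)[OF D(1)] by auto
  have "finsum H (\<lambda>i. rank_one (h (q i)) (v i)) S \<in> carrier H \<and> P (finsum H (\<lambda>i. rank_one (h (q i)) (v i)) S)"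
    if "finite S" "S \<subseteq> {..<n}" for S
    using that
  proof (induction S rule: finite_induct)
    case empty
    then show ?case using z H.M.zero_closed by (simp del: linear_space_simps)
  next
    case (insert i S)
    have "rank_one (h (q i)) (v i) \<in> carrier H" "P (rank_one (h (q i)) (v i))"
      using insert.prems by (auto intro!: rank_one_closed r rc simp del: linear_space_simps X_simps Y_simps)
    moreover have "(\<lambda>i. rank_one (h (q i)) (v i)) \<in> S \<rightarrow> carrier H"
      using insert.prems by (auto intro!: rank_one_closed rc simp del: linear_space_simps X_simps Y_simps)
    ultimately show ?case using insert by (simp add: H.M.finsum_insert a H.M.a_closed del: linear_space_simps)
  qed
  from this[of "{..<n}"] show ?thesis using D(3)[OF h] by simp
qed

text \<open>
  The universal property of the tensor product, for \<open>H\<close> in the role of \<open>B f \<otimes>\<^sub>K e B\<close>: in the notation of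
  \<open>E_dual_basis\<close>, \<open>L h\<close> is the sum of the \<open>F (h (q i)) (v i)\<close>.
\<close>

lemma tensor_lift:
  assumes V: "vectorspace K V"
    and F1: "\<And>y. y \<in> carrier E \<Longrightarrow> (\<lambda>x. F x y) \<in> module_hom K (B\<lparr>carrier := carrier Y\<rparr>) V"
    and F2: "\<And>x. x \<in> carrier Y \<Longrightarrow> F x \<in> module_hom K E V"
  obtains L where "L \<in> module_hom K H V" "\<And>x y. x \<in> carrier Y \<Longrightarrow> y \<in> carrier E \<Longrightarrow> L (rank_one x y) = F x y"
proof -
  obtain n v q where D: "dual_basis K E {..<n :: nat} v q" "\<And>i. i < n \<Longrightarrow> q i \<in> carrier X"
    using E_dual_basis by metis
  note d = dual_basisD[OF D(1), simplified]
  interpret W: vectorspace K V by fact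
  interpret H: vectorspace K H by (rule XY.H_vectorspace)
  have F1a: "F (x \<oplus> x') y = F x y \<oplus>\<^bsub>V\<^esub> F x' y" if "x \<in> carrier Y" "x' \<in> carrier Y" "y \<in> carrier E" for x x' y
    using module_homD(2)[OF F1[OF that(3)], of x x'] that by simp
  have F1s: "F (c \<odot> x) y = c \<odot>\<^bsub>V\<^esub> F x y" if "c \<in> carrier K" "x \<in> carrier Y" "y \<in> carrier E" for c x y
    using module_homD(3)[OF F1[OF that(3)], of c x] that by simp
  have FV: "F x y \<in> carrier V" if "x \<in> carrier Y" "y \<in> carrier E" for x y
    using module_homD(1)[OF F2[OF that(1)] that(2)] .
  let ?L = "\<lambda>h. finsum V (\<lambda>i. F (h (q i)) (v i)) {..<n}"
  have c: "(\<lambda>i. F (h (q i)) (v i)) \<in> {..<n} \<rightarrow> carrier V" if "h \<in> carrier H" for h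
    using XY.H_D(1)[OF that D(2)] d(2) FV by auto
  have L: "?L \<in> module_hom K H V"
  proof (rule module_homI)
    fix h assume h: "h \<in> carrier H"
    show "?L h \<in> carrier V" by (rule W.finsum_closed[OF c[OF h]])
    { fix g assume g: "g \<in> carrier H"
      have "?L (h \<oplus>\<^bsub>H\<^esub> g) = finsum V (\<lambda>i. F (h (q i)) (v i) \<oplus>\<^bsub>V\<^esub> F (g (q i)) (v i)) {..<n}"
        using c[OF h] c[OF g] XY.H_D(1)[OF h D(2)] XY.H_D(1)[OF g D(2)] d(2) D(2)
        by (intro W.finsum_cong') (auto simp: F1a Pi_iff simp del: X_simps Y_simps(1) simp: Y_simps(2))
      also have "\<dots> = ?L h \<oplus>\<^bsub>V\<^esub> ?L g" by (rule W.finsum_addf[OF c[OF h] c[OF g]])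
      finally show "?L (h \<oplus>\<^bsub>H\<^esub> g) = ?L h \<oplus>\<^bsub>V\<^esub> ?L g" . }
    fix k assume k: "k \<in> carrier K"
    have "?L (k \<odot>\<^bsub>H\<^esub> h) = finsum V (\<lambda>i. k \<odot>\<^bsub>V\<^esub> F (h (q i)) (v i)) {..<n}"
      using c[OF h] XY.H_D(1)[OF h D(2)] d(2) D(2) k
      by (intro W.finsum_cong') (auto simp: F1s Pi_iff Y_scalar simp del: X_simps Y_simps)
    also have "\<dots> = k \<odot>\<^bsub>V\<^esub> ?L h" using c[OF h] k by (intro W.finsum_smult_ldistr[symmetric]) auto
    finally show "?L (k \<odot>\<^bsub>H\<^esub> h) = k \<odot>\<^bsub>V\<^esub> ?L h" .
  qed
  moreover have "?L (rank_one x y) = F x y" if x: "x \<in> carrier Y" and y: "y \<in> carrier E" for x y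
  proof -
    have "F x y = F x (finsum E (\<lambda>i. q i y \<odot> v i) {..<n})" using d(6)[OF y] by simp
    also have "\<dots> = finsum V (\<lambda>i. F x (q i y \<odot> v i)) {..<n}"
      using d(2) X_eval[OF D(2) y] by (intro module_hom_finsum[OF E_vectorspace V F2[OF x]]) (auto intro: E_smult)
    also have "\<dots> = ?L (rank_one x y)"
    proof (rule W.finsum_cong')
      show "(\<lambda>i. F (rank_one x y (q i)) (v i)) \<in> {..<n} \<rightarrow> carrier V" by (rule c[OF rank_one_closed[OF x y]])
      fix i assume "i \<in> {..<n}"
      then have i: "i < n" by simp
      show "F x (q i y \<odot> v i) = F (rank_one x y (q i)) (v i)"
        using D(2)[OF i] F1s[OF X_eval[OF D(2)[OF i] y] x d(2)[OF i]]
          module_homD(3)[OF F2[OF x] X_eval[OF D(2)[OF i] y] d(2)[OF i]]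
        by (simp add: rank_one_def del: X_simps)
    qed simp
    finally show ?thesis by simp
  qed
  ultimately show ?thesis using that by blast
qed

end

section \<open>Derivations of the trivial extension\<close>

locale new_arrow = two_idempotents +
  assumes not_loop: "b \<in> carrier B \<Longrightarrow> e \<otimes> b \<otimes> f = \<zero>"
begin

sublocale HB: bimod K B H lH rH by (rule XY.hom_bimod)

text \<open>
  \<open>J\<close> embeds \<open>B\<close> into the trivial extension \<open>T\<close>, \<open>tens x y\<close> is the element \<open>x \<otimes> y\<close> of \<open>H\<close>, and \<open>\<alpha>\<close> plays
  the new arrow: \<open>tens x y\<close> is \<open>x \<alpha> y\<close>.
\<close>

definition "T = triv_ext B H lH rH"
definition "J b = (b, \<zero>\<^bsub>H\<^esub>)"
definition "tens x y = (\<zero>, rank_one x y)"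
definition "\<alpha> = tens f e"

sublocale T: kalg K T unfolding T_def by (rule HB.triv_ext_kalg)

lemma T_simps:
  "carrier T = carrier B \<times> carrier H"
  "mult T = (\<lambda>x y. (fst x \<otimes> fst y, lH (fst x) (snd y) \<oplus>\<^bsub>H\<^esub> rH (snd x) (fst y)))"
  "one T = (\<one>, \<zero>\<^bsub>H\<^esub>)" "zero T = (\<zero>, \<zero>\<^bsub>H\<^esub>)"
  "add T = (\<lambda>x y. (fst x \<oplus> fst y, snd x \<oplus>\<^bsub>H\<^esub> snd y))"
  "smult T = (\<lambda>c x. (c \<odot> fst x, c \<odot>\<^bsub>H\<^esub> snd x))"
  unfolding T_def by simp_all

lemma T_fin_dim: "vectorspace.fin_dim K T" "vectorspace.dim K T = vectorspace.dim K B + vectorspace.dim K H"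
  unfolding T_def using HB.triv_ext_dim[OF fin_dim H_fin_dim] by auto

lemma f_in_Y: "f \<in> carrier Y" and e_in_E: "e \<in> carrier E" by (auto simp: in_Y in_E)

context
  notes [simp del] = linear_space_simps X_simps Y_simps
begin

lemma J_closed [simp]: "b \<in> carrier B \<Longrightarrow> J b \<in> carrier T"
  by (simp add: J_def T_simps)

lemma tens_closed [simp]: "x \<in> carrier Y \<Longrightarrow> y \<in> carrier E \<Longrightarrow> tens x y \<in> carrier T"
  by (simp add: tens_def T_simps rank_one_closed)

lemma \<alpha>_closed [simp]: "\<alpha> \<in> carrier T" by (simp add: \<alpha>_def f_in_Y e_in_E)

lemma J_add: "b \<in> carrier B \<Longrightarrow> c \<in> carrier B \<Longrightarrow> J (b \<oplus> c) = J b \<oplus>\<^bsub>T\<^esub> J c"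
  by (simp add: J_def T_simps)

lemma J_mult: "b \<in> carrier B \<Longrightarrow> c \<in> carrier B \<Longrightarrow> J (b \<otimes> c) = J b \<otimes>\<^bsub>T\<^esub> J c"
  by (simp add: J_def T_simps)

lemma J_smult: "k \<in> carrier K \<Longrightarrow> J (k \<odot> b) = k \<odot>\<^bsub>T\<^esub> J b"
  by (simp add: J_def T_simps)

lemma J_one: "J \<one> = \<one>\<^bsub>T\<^esub>" and J_zero: "J \<zero> = \<zero>\<^bsub>T\<^esub>"
  by (simp_all add: J_def T_simps)

text \<open>
  \<open>e B \<cdot> B f\<close> is contained in \<open>e B f = 0\<close>.
\<close>

lemma E_Y_mult: "y \<in> carrier E \<Longrightarrow> x \<in> carrier Y \<Longrightarrow> y \<otimes> x = \<zero>"
proof -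
  assume y: "y \<in> carrier E" and x: "x \<in> carrier Y"
  have "y \<otimes> x = (e \<otimes> y) \<otimes> (x \<otimes> f)" using x y by (simp add: in_E in_Y)
  also have "\<dots> = e \<otimes> (y \<otimes> x) \<otimes> f" using x y by (simp add: E_B Y_B m_assoc)
  finally show ?thesis using not_loop[of "y \<otimes> x"] x y by (simp add: E_B Y_B)
qed

lemma J_tens: "b \<in> carrier B \<Longrightarrow> x \<in> carrier Y \<Longrightarrow> y \<in> carrier E \<Longrightarrow> J b \<otimes>\<^bsub>T\<^esub> tens x y = tens (b \<otimes> x) y"
  by (simp add: J_def tens_def T_simps rank_one_act rank_one_closed Y_mult)

lemma tens_J: "b \<in> carrier B \<Longrightarrow> x \<in> carrier Y \<Longrightarrow> y \<in> carrier E \<Longrightarrow> tens x y \<otimes>\<^bsub>T\<^esub> J b = tens x (y \<otimes> b)"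
  by (simp add: J_def tens_def T_simps rank_one_act rank_one_closed E_mult)

lemma tens_tens: "x \<in> carrier Y \<Longrightarrow> y \<in> carrier E \<Longrightarrow> x' \<in> carrier Y \<Longrightarrow> y' \<in> carrier E \<Longrightarrow>
    tens x y \<otimes>\<^bsub>T\<^esub> tens x' y' = \<zero>\<^bsub>T\<^esub>"
  by (simp add: tens_def T_simps rank_one_closed)

lemma tens_eq: "x \<in> carrier Y \<Longrightarrow> y \<in> carrier E \<Longrightarrow> tens x y = J x \<otimes>\<^bsub>T\<^esub> \<alpha> \<otimes>\<^bsub>T\<^esub> J y"
proof -
  assume x: "x \<in> carrier Y" and y: "y \<in> carrier E"
  have "J x \<otimes>\<^bsub>T\<^esub> \<alpha> = tens x e"
    using J_tens[OF Y_B[OF x] f_in_Y e_in_E] x by (simp add: \<alpha>_def in_Y)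
  then show ?thesis using tens_J[OF E_B[OF y] x e_in_E] y by (simp add: in_E)
qed

lemma \<alpha>_corner: "J f \<otimes>\<^bsub>T\<^esub> \<alpha> = \<alpha>" "\<alpha> \<otimes>\<^bsub>T\<^esub> J e = \<alpha>"
  by (simp_all add: \<alpha>_def J_tens tens_J e_in_E f_in_Y)

lemma T_induct [consumes 1, case_names J tens add]:
  assumes t: "t \<in> carrier T" and J: "\<And>b. b \<in> carrier B \<Longrightarrow> P (J b)"
    and r: "\<And>x y. x \<in> carrier Y \<Longrightarrow> y \<in> carrier E \<Longrightarrow> P (tens x y)"
    and a: "\<And>s t. s \<in> carrier T \<Longrightarrow> t \<in> carrier T \<Longrightarrow> P s \<Longrightarrow> P t \<Longrightarrow> P (s \<oplus>\<^bsub>T\<^esub> t)"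
  shows "P t"
proof -
  have h: "P (\<zero>, h)" if "h \<in> carrier H" for h
    using that
  proof (induction rule: H_induct)
    case zero
    show ?case using J[of \<zero>] by (simp add: J_def)
  next
    case (rank_one x y)
    then show ?case using r by (simp add: tens_def)
  next
    case (add g h)
    then show ?case using a[of "(\<zero>, g)" "(\<zero>, h)"] by (simp add: T_simps)
  qed
  have "P (J (fst t) \<oplus>\<^bsub>T\<^esub> (\<zero>, snd t))"
    using t by (intro a J h) (auto simp: T_simps J_def)
  moreover have "J (fst t) \<oplus>\<^bsub>T\<^esub> (\<zero>, snd t) = t" using t by (auto simp: T_simps J_def)
  ultimately show ?thesis by simp
qed

lemma restricted_bimod: "bimod K B T (\<lambda>b t. J b \<otimes>\<^bsub>T\<^esub> t) (\<lambda>t b. t \<otimes>\<^bsub>T\<^esub> J b)"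
  by unfold_locales (auto simp: J_add J_mult J_smult J_one T.l_distr T.r_distr T.m_assoc
      T.smult_mult_left T.smult_mult_right)

end

sublocale TB: bimod K B T "\<lambda>b t. J b \<otimes>\<^bsub>T\<^esub> t" "\<lambda>t b. t \<otimes>\<^bsub>T\<^esub> J b" by (rule restricted_bimod)
sublocale TT: bimod K T T "mult T" "mult T" by (rule T.regular_bimod)
sublocale BB: bimod K B B "mult B" "mult B" by (rule regular_bimod)

context
  notes [simp del] = linear_space_simps X_simps Y_simps
begin

abbreviation "Der_T \<equiv> der_space K T T (mult T) (mult T)"
abbreviation "Der_B_T \<equiv> der_space K B T (\<lambda>b t. J b \<otimes>\<^bsub>T\<^esub> t) (\<lambda>t b. t \<otimes>\<^bsub>T\<^esub> J b)"
abbreviation "Der_B \<equiv> der_space K B B (mult B) (mult B)"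

lemma J_idem: "J e \<otimes>\<^bsub>T\<^esub> J e = J e" "J f \<otimes>\<^bsub>T\<^esub> J f = J f" by (simp_all add: J_mult[symmetric])

lemma in_corner_T: "t \<in> carrier (corner T (J f) (J e)) \<longleftrightarrow>
    t \<in> carrier T \<and> J f \<otimes>\<^bsub>T\<^esub> t = t \<and> t \<otimes>\<^bsub>T\<^esub> J e = t"
  by (rule T.in_corner) (auto simp: J_idem)

lemmas corner_T_vectorspace = T.corner_vectorspace[OF J_closed[OF f(1)] J_idem(2) J_closed[OF e(1)] J_idem(1)]

lemma J_J_zero: "y \<in> carrier E \<Longrightarrow> x \<in> carrier Y \<Longrightarrow> J y \<otimes>\<^bsub>T\<^esub> J x = \<zero>\<^bsub>T\<^esub>"
  "y \<in> carrier E \<Longrightarrow> x \<in> carrier Y \<Longrightarrow> t \<in> carrier T \<Longrightarrow> J y \<otimes>\<^bsub>T\<^esub> (J x \<otimes>\<^bsub>T\<^esub> t) = \<zero>\<^bsub>T\<^esub>"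
proof -
  show *: "y \<in> carrier E \<Longrightarrow> x \<in> carrier Y \<Longrightarrow> J y \<otimes>\<^bsub>T\<^esub> J x = \<zero>\<^bsub>T\<^esub>"
    by (simp add: J_mult[symmetric] E_B Y_B E_Y_mult J_zero)
  show "y \<in> carrier E \<Longrightarrow> x \<in> carrier Y \<Longrightarrow> t \<in> carrier T \<Longrightarrow> J y \<otimes>\<^bsub>T\<^esub> (J x \<otimes>\<^bsub>T\<^esub> t) = \<zero>\<^bsub>T\<^esub>"
    using * by (simp add: T.m_assoc[symmetric] E_B Y_B)
qed

text \<open>
  A derivation that extends \<open>d\<close> and sends \<open>\<alpha>\<close> to \<open>w\<close>, up to terms which \<open>d\<close> forces, must send \<open>x \<alpha> y\<close> to
  \<open>d(x) \<alpha> y + x w y + x \<alpha> d(y)\<close>.  This expression is bilinear in \<open>x\<close> and \<open>y\<close>, so it defines a linear map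
  on \<open>H\<close>.  The product rule on \<open>B\<close> and \<open>H\<close> follows from that for \<open>d\<close>.  On two elements of \<open>H\<close>, whose product
  is zero, it requires \<open>x \<alpha> (y d(x') + d(y) x') \<alpha> y' = 0\<close>; the bracket is \<open>d(y x')\<close>, and \<open>y x' = 0\<close>.
\<close>

lemma derivation_extends:
  assumes d: "d \<in> carrier Der_B_T" and w: "w \<in> carrier (corner T (J f) (J e))"
  obtains D where "D \<in> carrier Der_T" "\<And>b. b \<in> carrier B \<Longrightarrow> D (J b) = d b"
    "J f \<otimes>\<^bsub>T\<^esub> D \<alpha> \<otimes>\<^bsub>T\<^esub> J e = w"
proof -
  have d': "d \<in> derivations K B T (\<lambda>b t. J b \<otimes>\<^bsub>T\<^esub> t) (\<lambda>t b. t \<otimes>\<^bsub>T\<^esub> J b)" using d by simp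
  note dD = derivationsD[OF d']
  have wT: "w \<in> carrier T" "J f \<otimes>\<^bsub>T\<^esub> w = w" "w \<otimes>\<^bsub>T\<^esub> J e = w" using w by (simp_all add: in_corner_T)
  \<comment> \<open>the value at \<open>x \<alpha> y\<close> that the product rule dictates\<close>
  let ?F = "\<lambda>x y. d x \<otimes>\<^bsub>T\<^esub> \<alpha> \<otimes>\<^bsub>T\<^esub> J y \<oplus>\<^bsub>T\<^esub> J x \<otimes>\<^bsub>T\<^esub> w \<otimes>\<^bsub>T\<^esub> J y \<oplus>\<^bsub>T\<^esub> J x \<otimes>\<^bsub>T\<^esub> \<alpha> \<otimes>\<^bsub>T\<^esub> d y"
  have "\<exists>L. L \<in> module_hom K H T \<and> (\<forall>x\<in>carrier Y. \<forall>y\<in>carrier E. L (rank_one x y) = ?F x y)"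
  proof (rule tensor_lift[OF T.V.vectorspace_axioms, of ?F])
    fix y assume y: "y \<in> carrier E"
    show "(\<lambda>x. ?F x y) \<in> module_hom K (B\<lparr>carrier := carrier Y\<rparr>) T"
      using y by (intro module_homI) (auto simp: dD wT J_add J_smult Y_B E_B T.l_distr T.r_distr T.a_ac
          T.smult_mult_left T.V.smult_r_distr)
  next
    fix x assume x: "x \<in> carrier Y"
    show "?F x \<in> module_hom K E T"
      using x by (intro module_homI) (auto simp: dD wT J_add J_smult Y_B E_B T.l_distr T.r_distr T.a_ac
          T.smult_mult_right T.V.smult_r_distr)
  qed blast
  then obtain L where L: "L \<in> module_hom K H T" "\<And>x y. x \<in> carrier Y \<Longrightarrow> y \<in> carrier E \<Longrightarrow> L (rank_one x y) = ?F x y"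
    by blast
  have L0: "L \<zero>\<^bsub>H\<^esub> = \<zero>\<^bsub>T\<^esub>" by (rule module_hom_zero[OF XY.H_vectorspace T.V.vectorspace_axioms L(1)])
  have d0: "d \<zero> = \<zero>\<^bsub>T\<^esub>" by (rule module_hom_zero[OF V.vectorspace_axioms T.V.vectorspace_axioms dD(2)])
  note LD = module_homD[OF L(1)]
  define D where "D = (\<lambda>t\<in>carrier T. d (fst t) \<oplus>\<^bsub>T\<^esub> L (snd t))"
  have T_fst: "fst t \<in> carrier B" and T_snd: "snd t \<in> carrier H" if "t \<in> carrier T" for t
    using that by (auto simp: T_simps)
  have D_closed: "D t \<in> carrier T" if "t \<in> carrier T" for t
    using that by (simp add: D_def dD LD T_fst T_snd)
  have D_add: "D (s \<oplus>\<^bsub>T\<^esub> t) = D s \<oplus>\<^bsub>T\<^esub> D t" if "s \<in> carrier T" "t \<in> carrier T" for s t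
  proof -
    have "D (s \<oplus>\<^bsub>T\<^esub> t) = d (fst s \<oplus> fst t) \<oplus>\<^bsub>T\<^esub> L (snd s \<oplus>\<^bsub>H\<^esub> snd t)"
      using that T.a_closed[OF that] by (simp add: D_def T_simps(5))
    then show ?thesis using that by (simp add: D_def dD LD T_fst T_snd T.a_ac)
  qed
  have D_smult: "D (c \<odot>\<^bsub>T\<^esub> t) = c \<odot>\<^bsub>T\<^esub> D t" if "c \<in> carrier K" "t \<in> carrier T" for c t
  proof -
    have "D (c \<odot>\<^bsub>T\<^esub> t) = d (c \<odot> fst t) \<oplus>\<^bsub>T\<^esub> L (c \<odot>\<^bsub>H\<^esub> snd t)"
      using that T.V.smult_closed[OF that] by (simp add: D_def T_simps(6))
    then show ?thesis using that by (simp add: D_def dD LD T_fst T_snd T.V.smult_r_distr)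
  qed
  have D_J: "D (J b) = d b" if "b \<in> carrier B" for b
    using that J_closed[OF that] by (simp add: D_def) (simp add: J_def L0 dD)
  have D_tens: "D (tens x y) = ?F x y" if "x \<in> carrier Y" "y \<in> carrier E" for x y
    using that tens_closed[OF that] by (simp add: D_def) (simp add: tens_def L(2) d0 dD wT Y_B E_B)
  have prod: "D (s \<otimes>\<^bsub>T\<^esub> t) = s \<otimes>\<^bsub>T\<^esub> D t \<oplus>\<^bsub>T\<^esub> D s \<otimes>\<^bsub>T\<^esub> t" if "s \<in> carrier T" "t \<in> carrier T" for s t
    using that(1)
  proof (induction rule: T_induct)
    case (J b)
    show ?case using that(2)
    proof (induction rule: T_induct)
      case (J c)
      then show ?case using \<open>b \<in> carrier B\<close> by (simp add: J_mult[symmetric] D_J dD)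
    next
      case (tens x y)
      then show ?case using \<open>b \<in> carrier B\<close> Y_mult[of b x]
        by (simp add: J_tens D_tens D_J) (simp add: tens_eq dD wT J_mult Y_B E_B T.l_distr T.r_distr T.m_assoc T.a_ac)
    next
      case (add s t)
      then show ?case using \<open>b \<in> carrier B\<close> by (simp add: T.r_distr D_add D_closed D_J dD T.a_ac)
    qed
  next
    case (tens x y)
    note xy = tens
    show ?case using that(2)
    proof (induction rule: T_induct)
      case (J c)
      then show ?case using xy E_mult[of y c]
        by (simp add: tens_J D_tens D_J) (simp add: tens_eq dD wT J_mult Y_B E_B T.l_distr T.r_distr T.m_assoc T.a_ac)
    next
      case (tens x' y')
      have c: "d x \<in> carrier T" "d y \<in> carrier T" "d x' \<in> carrier T" "d y' \<in> carrier T"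
        "J x \<in> carrier T" "J y \<in> carrier T" "J x' \<in> carrier T" "J y' \<in> carrier T"
        using xy tens by (simp_all add: dD Y_B E_B)
      \<comment> \<open>the left side is \<open>d (y x')\<close>, and \<open>y x'\<close> lies in \<open>e B f = 0\<close>\<close>
      have yx: "J y \<otimes>\<^bsub>T\<^esub> d x' \<oplus>\<^bsub>T\<^esub> d y \<otimes>\<^bsub>T\<^esub> J x' = \<zero>\<^bsub>T\<^esub>"
        using dD(7)[of y x'] xy tens by (simp add: E_Y_mult E_B Y_B d0)
      have "tens x y \<otimes>\<^bsub>T\<^esub> ?F x' y' = J x \<otimes>\<^bsub>T\<^esub> \<alpha> \<otimes>\<^bsub>T\<^esub> (J y \<otimes>\<^bsub>T\<^esub> d x') \<otimes>\<^bsub>T\<^esub> (\<alpha> \<otimes>\<^bsub>T\<^esub> J y')"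
        using xy tens c wT by (simp add: tens_eq T.r_distr T.m_assoc J_J_zero)
      moreover have "?F x y \<otimes>\<^bsub>T\<^esub> tens x' y' = J x \<otimes>\<^bsub>T\<^esub> \<alpha> \<otimes>\<^bsub>T\<^esub> (d y \<otimes>\<^bsub>T\<^esub> J x') \<otimes>\<^bsub>T\<^esub> (\<alpha> \<otimes>\<^bsub>T\<^esub> J y')"
        using xy tens c wT by (simp add: tens_eq T.l_distr T.m_assoc J_J_zero)
      ultimately have "tens x y \<otimes>\<^bsub>T\<^esub> ?F x' y' \<oplus>\<^bsub>T\<^esub> ?F x y \<otimes>\<^bsub>T\<^esub> tens x' y'
        = J x \<otimes>\<^bsub>T\<^esub> \<alpha> \<otimes>\<^bsub>T\<^esub> (J y \<otimes>\<^bsub>T\<^esub> d x' \<oplus>\<^bsub>T\<^esub> d y \<otimes>\<^bsub>T\<^esub> J x') \<otimes>\<^bsub>T\<^esub> (\<alpha> \<otimes>\<^bsub>T\<^esub> J y')"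
        using c by (simp add: T.l_distr T.r_distr)
      also have "\<dots> = \<zero>\<^bsub>T\<^esub>" unfolding yx using c by simp
      finally show ?case
        using xy tens D_J[of \<zero>] by (simp add: tens_tens D_tens J_zero d0)
    next
      case (add s t)
      then show ?case using xy by (simp add: T.r_distr D_add D_closed T.a_ac)
    qed
  next
    case (add s s')
    then show ?case using that(2) by (simp add: T.l_distr D_add D_closed T.a_ac)
  qed
  have D: "D \<in> carrier Der_T"
    unfolding der_space_simps
    by (rule derivationsI) (auto simp: D_closed D_add D_smult prod, simp add: D_def)
  \<comment> \<open>from \<open>d g = g d(g) + d(g) g\<close>; so \<open>f D(\<alpha>) e\<close> only sees the term \<open>f w e = w\<close>\<close>
  have idem0: "J g \<otimes>\<^bsub>T\<^esub> d g \<otimes>\<^bsub>T\<^esub> J g = \<zero>\<^bsub>T\<^esub>" if g: "g \<in> carrier B" "g \<otimes> g = g" for g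
  proof -
    have c: "J g \<in> carrier T" "d g \<in> carrier T" using g by (simp_all add: dD)
    have gg: "J g \<otimes>\<^bsub>T\<^esub> J g = J g" using g by (simp add: J_mult[symmetric])
    then have gg': "J g \<otimes>\<^bsub>T\<^esub> (J g \<otimes>\<^bsub>T\<^esub> t) = J g \<otimes>\<^bsub>T\<^esub> t" if "t \<in> carrier T" for t
      using c that by (simp add: T.m_assoc[symmetric])
    have dg: "d g = J g \<otimes>\<^bsub>T\<^esub> d g \<oplus>\<^bsub>T\<^esub> d g \<otimes>\<^bsub>T\<^esub> J g" using dD(7)[OF g(1) g(1)] g(2) by simp
    let ?z = "J g \<otimes>\<^bsub>T\<^esub> d g \<otimes>\<^bsub>T\<^esub> J g"
    have "?z = J g \<otimes>\<^bsub>T\<^esub> (J g \<otimes>\<^bsub>T\<^esub> d g \<oplus>\<^bsub>T\<^esub> d g \<otimes>\<^bsub>T\<^esub> J g) \<otimes>\<^bsub>T\<^esub> J g" using dg by simp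
    also have "\<dots> = ?z \<oplus>\<^bsub>T\<^esub> ?z" using c by (simp add: T.r_distr T.l_distr T.m_assoc gg gg')
    finally show ?thesis using c by simp
  qed
  have "J f \<otimes>\<^bsub>T\<^esub> D \<alpha> \<otimes>\<^bsub>T\<^esub> J e
      = J f \<otimes>\<^bsub>T\<^esub> (d f \<otimes>\<^bsub>T\<^esub> (J f \<otimes>\<^bsub>T\<^esub> \<alpha>) \<otimes>\<^bsub>T\<^esub> J e \<oplus>\<^bsub>T\<^esub> J f \<otimes>\<^bsub>T\<^esub> w \<otimes>\<^bsub>T\<^esub> J e \<oplus>\<^bsub>T\<^esub> J f \<otimes>\<^bsub>T\<^esub> (\<alpha> \<otimes>\<^bsub>T\<^esub> J e) \<otimes>\<^bsub>T\<^esub> d e) \<otimes>\<^bsub>T\<^esub> J e"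
    using D_tens[OF f_in_Y e_in_E] \<alpha>_corner by (simp add: \<alpha>_def)
  also have "\<dots> = (J f \<otimes>\<^bsub>T\<^esub> d f \<otimes>\<^bsub>T\<^esub> J f) \<otimes>\<^bsub>T\<^esub> (\<alpha> \<otimes>\<^bsub>T\<^esub> J e \<otimes>\<^bsub>T\<^esub> J e)
      \<oplus>\<^bsub>T\<^esub> J f \<otimes>\<^bsub>T\<^esub> (J f \<otimes>\<^bsub>T\<^esub> w \<otimes>\<^bsub>T\<^esub> J e) \<otimes>\<^bsub>T\<^esub> J e
      \<oplus>\<^bsub>T\<^esub> (J f \<otimes>\<^bsub>T\<^esub> J f \<otimes>\<^bsub>T\<^esub> \<alpha>) \<otimes>\<^bsub>T\<^esub> (J e \<otimes>\<^bsub>T\<^esub> d e \<otimes>\<^bsub>T\<^esub> J e)"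
    using wT(1) dD(4)[OF e(1)] dD(4)[OF f(1)] by (simp add: T.r_distr T.l_distr T.m_assoc)
  also have "\<dots> = w"
    using wT idem0[OF e] idem0[OF f] by simp
  finally have "J f \<otimes>\<^bsub>T\<^esub> D \<alpha> \<otimes>\<^bsub>T\<^esub> J e = w" .
  then show ?thesis using that D D_J by blast
qed

abbreviation "Der_B_H \<equiv> der_space K B H lH rH"

text \<open>
  A derivation \<open>D\<close> of \<open>T\<close> is determined by its restriction to \<open>B\<close> and the component \<open>f D(\<alpha>) e\<close>, since
  \<open>T\<close> is generated by \<open>B\<close> and \<open>\<alpha>\<close>; by \<open>derivation_extends\<close> both can be prescribed.
\<close>

lemma dim_Der_T:
  "vectorspace.dim K Der_T = vectorspace.dim K Der_B_T + vectorspace.dim K (corner T (J f) (J e))"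
proof -
  let ?C = "corner T (J f) (J e)"
  let ?S = "direct_sum Der_B_T ?C"
  let ?\<Phi> = "\<lambda>D. (\<lambda>b\<in>carrier B. D (J b), J f \<otimes>\<^bsub>T\<^esub> D \<alpha> \<otimes>\<^bsub>T\<^esub> J e)"
  note C = corner_T_vectorspace(1) corner_T_vectorspace(2)[OF T_fin_dim(1)]
  have fd: "vectorspace.fin_dim K Der_T" "vectorspace.fin_dim K Der_B_T"
    by (rule TT.der_space_fin_dim[OF T_fin_dim(1) T_fin_dim(1)], rule TB.der_space_fin_dim[OF fin_dim T_fin_dim(1)])
  have in_C: "J f \<otimes>\<^bsub>T\<^esub> t \<otimes>\<^bsub>T\<^esub> J e \<in> carrier ?C" if "t \<in> carrier T" for t
    using that by (auto simp: corner_def simp del: split_paired_Ex)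
  have \<Phi>: "?\<Phi> \<in> module_hom K Der_T ?S"
  proof (rule module_homI)
    fix D assume "D \<in> carrier Der_T"
    then have D: "D \<in> derivations K T T (mult T) (mult T)" by simp
    note DD = derivationsD[OF D]
    have "(\<lambda>b\<in>carrier B. D (J b)) \<in> carrier Der_B_T"
      unfolding der_space_simps by (rule derivationsI) (auto simp: DD J_add J_mult J_smult)
    then show "?\<Phi> D \<in> carrier ?S" using in_C DD(4) by simp
  next
    fix D D' assume "D \<in> carrier Der_T" "D' \<in> carrier Der_T"
    then have D: "D \<in> derivations K T T (mult T) (mult T)" and D': "D' \<in> derivations K T T (mult T) (mult T)" by simp_all
    show "?\<Phi> (D \<oplus>\<^bsub>Der_T\<^esub> D') = ?\<Phi> D \<oplus>\<^bsub>?S\<^esub> ?\<Phi> D'"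
      using derivationsD(4)[OF D] derivationsD(4)[OF D'] by (auto simp: T.l_distr T.r_distr intro!: restrict_ext)
  next
    fix c D assume c: "c \<in> carrier K" and "D \<in> carrier Der_T"
    then have D: "D \<in> derivations K T T (mult T) (mult T)" by simp
    show "?\<Phi> (c \<odot>\<^bsub>Der_T\<^esub> D) = c \<odot>\<^bsub>?S\<^esub> ?\<Phi> D"
      using derivationsD(4)[OF D] c by (auto simp: T.smult_mult_left T.smult_mult_right intro!: restrict_ext)
  qed
  have "inj_on ?\<Phi> (carrier Der_T)"
  proof (rule inj_onI)
    fix D D' assume a: "D \<in> carrier Der_T" "D' \<in> carrier Der_T" and eq: "?\<Phi> D = ?\<Phi> D'"
    then have D: "D \<in> derivations K T T (mult T) (mult T)" and D': "D' \<in> derivations K T T (mult T) (mult T)" by simp_all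
    note DD = derivationsD[OF D] and DD' = derivationsD[OF D']
    have J: "D (J b) = D' (J b)" if "b \<in> carrier B" for b
      using eq that by (auto dest: fun_cong[of _ _ b])
    have A: "J f \<otimes>\<^bsub>T\<^esub> D \<alpha> \<otimes>\<^bsub>T\<^esub> J e = J f \<otimes>\<^bsub>T\<^esub> D' \<alpha> \<otimes>\<^bsub>T\<^esub> J e" using eq by simp
    \<comment> \<open>\<open>D(\<alpha>)\<close> enters \<open>D(x \<alpha> y)\<close> through \<open>f D(\<alpha>) e\<close> only, as \<open>x = x f\<close> and \<open>y = e y\<close>\<close>
    have expand: "G (tens x y) = J x \<otimes>\<^bsub>T\<^esub> \<alpha> \<otimes>\<^bsub>T\<^esub> G (J y) \<oplus>\<^bsub>T\<^esub>
        (J x \<otimes>\<^bsub>T\<^esub> (J f \<otimes>\<^bsub>T\<^esub> G \<alpha> \<otimes>\<^bsub>T\<^esub> J e) \<otimes>\<^bsub>T\<^esub> J y \<oplus>\<^bsub>T\<^esub> G (J x) \<otimes>\<^bsub>T\<^esub> \<alpha> \<otimes>\<^bsub>T\<^esub> J y)"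
      if G: "G \<in> derivations K T T (mult T) (mult T)" and xy: "x \<in> carrier Y" "y \<in> carrier E" for G x y
    proof -
      note GD = derivationsD[OF G]
      have c: "J x \<in> carrier T" "J y \<in> carrier T" using xy by (simp_all add: Y_B E_B)
      have "J x = J x \<otimes>\<^bsub>T\<^esub> J f" "J y = J e \<otimes>\<^bsub>T\<^esub> J y"
        using xy by (simp_all add: in_Y in_E J_mult[symmetric])
      then have "J x \<otimes>\<^bsub>T\<^esub> (J f \<otimes>\<^bsub>T\<^esub> G \<alpha> \<otimes>\<^bsub>T\<^esub> J e) \<otimes>\<^bsub>T\<^esub> J y = J x \<otimes>\<^bsub>T\<^esub> G \<alpha> \<otimes>\<^bsub>T\<^esub> J y"
        using c GD(4) by (metis T.m_assoc T.m_closed J_closed \<alpha>_closed e(1) f(1))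
      then show ?thesis
        using xy c GD(4) by (simp add: tens_eq GD(7) T.l_distr T.r_distr T.a_assoc T.m_assoc)
    qed
    have tens: "D (tens x y) = D' (tens x y)" if xy: "x \<in> carrier Y" "y \<in> carrier E" for x y
      using J xy by (simp add: expand[OF D xy] expand[OF D' xy] A Y_B E_B)
    have "D t = D' t" if "t \<in> carrier T" for t
      using that by (induction rule: T_induct) (simp_all add: J tens DD DD')
    then show "D = D'" using DD(3) DD'(3) by (intro extensionalityI[of _ "carrier T"]) auto
  qed
  moreover have "?\<Phi> ` carrier Der_T = carrier ?S"
  proof
    show "?\<Phi> ` carrier Der_T \<subseteq> carrier ?S" using module_homD(1)[OF \<Phi>] by blast
    show "carrier ?S \<subseteq> ?\<Phi> ` carrier Der_T"
    proof
      fix p assume p: "p \<in> carrier ?S"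
      then obtain d w where dw: "p = (d, w)" "d \<in> carrier Der_B_T" "w \<in> carrier ?C" by auto
      obtain D where D: "D \<in> carrier Der_T" "\<And>b. b \<in> carrier B \<Longrightarrow> D (J b) = d b"
        "J f \<otimes>\<^bsub>T\<^esub> D \<alpha> \<otimes>\<^bsub>T\<^esub> J e = w"
        using derivation_extends[OF dw(2,3)] by blast
      have "d \<in> extensional (carrier B)" using dw(2) by (auto dest: derivationsD(3))
      then have "p = ?\<Phi> D" using D dw(1) by (auto intro!: extensionalityI[of _ "carrier B"])
      then show "p \<in> ?\<Phi> ` carrier Der_T" using D(1) by blast
    qed
  qed
  ultimately have bij: "bij_betw ?\<Phi> (carrier Der_T) (carrier ?S)" by (simp add: bij_betw_def)
  show ?thesis
    using dim_iso[OF TT.der_space_vectorspace direct_sum_is_vs[OF TB.der_space_vectorspace C(1)] fd(1) \<Phi> bij]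
      fin_dim_direct_sum(2)[OF TB.der_space_vectorspace C(1) fd(2) C(2)] by simp
qed

text \<open>
  As a \<open>B\<close>-bimodule, \<open>T\<close> is the direct sum of \<open>B\<close> and \<open>H\<close>.
\<close>

lemma dim_Der_B_T:
  "vectorspace.dim K Der_B_T = vectorspace.dim K Der_B + vectorspace.dim K Der_B_H"
proof -
  let ?S = "direct_sum Der_B Der_B_H"
  let ?\<Phi> = "\<lambda>d. (\<lambda>b\<in>carrier B. fst (d b), \<lambda>b\<in>carrier B. snd (d b))"
  have fd: "vectorspace.fin_dim K Der_B_T" "vectorspace.fin_dim K Der_B" "vectorspace.fin_dim K Der_B_H"
    by (rule TB.der_space_fin_dim[OF fin_dim T_fin_dim(1)], rule BB.der_space_fin_dim[OF fin_dim fin_dim],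
        rule HB.der_space_fin_dim[OF fin_dim H_fin_dim])
  have \<Phi>: "?\<Phi> \<in> module_hom K Der_B_T ?S"
  proof (rule module_homI)
    fix d assume "d \<in> carrier Der_B_T"
    then have d: "d \<in> derivations K B T (\<lambda>b t. J b \<otimes>\<^bsub>T\<^esub> t) (\<lambda>t b. t \<otimes>\<^bsub>T\<^esub> J b)" by simp
    note dD = derivationsD[OF d]
    have c: "fst (d b) \<in> carrier B" "snd (d b) \<in> carrier H" if "b \<in> carrier B" for b
      using dD(4)[OF that] by (auto simp: T_simps)
    have "(\<lambda>b\<in>carrier B. fst (d b)) \<in> carrier Der_B"
      unfolding der_space_simps by (rule derivationsI) (auto simp: dD(5-) c, auto simp: T_simps J_def)
    moreover have "(\<lambda>b\<in>carrier B. snd (d b)) \<in> carrier Der_B_H"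
      unfolding der_space_simps by (rule derivationsI) (auto simp: dD(5-) c, auto simp: T_simps J_def c)
    ultimately show "?\<Phi> d \<in> carrier ?S" by simp
  qed (auto intro!: restrict_ext simp: T_simps)
  have "inj_on ?\<Phi> (carrier Der_B_T)"
  proof (rule inj_onI)
    fix d d' assume a: "d \<in> carrier Der_B_T" "d' \<in> carrier Der_B_T" and eq: "?\<Phi> d = ?\<Phi> d'"
    have "d b = d' b" if "b \<in> carrier B" for b
      using eq that by (auto simp: prod_eq_iff dest: fun_cong[of _ _ b])
    moreover have "d \<in> extensional (carrier B)" "d' \<in> extensional (carrier B)"
      using a derivationsD(3) by auto
    ultimately show "d = d'" by (intro extensionalityI[of _ "carrier B"]) auto
  qed
  moreover have "?\<Phi> ` carrier Der_B_T = carrier ?S"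
  proof
    show "?\<Phi> ` carrier Der_B_T \<subseteq> carrier ?S" using module_homD(1)[OF \<Phi>] by blast
    show "carrier ?S \<subseteq> ?\<Phi> ` carrier Der_B_T"
    proof
      fix p assume p: "p \<in> carrier ?S"
      then obtain d \<eta> where p: "p = (d, \<eta>)" "d \<in> derivations K B B (mult B) (mult B)"
        "\<eta> \<in> derivations K B H lH rH" by auto
      note dD = derivationsD[OF p(2)] and \<eta>D = derivationsD[OF p(3)]
      let ?D = "\<lambda>b\<in>carrier B. (d b, \<eta> b)"
      have "?D \<in> carrier Der_B_T"
        unfolding der_space_simps by (rule derivationsI) (auto simp: T_simps dD \<eta>D J_def)
      moreover have "p = ?\<Phi> ?D"
        using dD(3) \<eta>D(3) p(1) by (auto intro!: extensionalityI[of _ "carrier B"])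
      ultimately show "p \<in> ?\<Phi> ` carrier Der_B_T" by blast
    qed
  qed
  ultimately have bij: "bij_betw ?\<Phi> (carrier Der_B_T) (carrier ?S)" by (simp add: bij_betw_def)
  show ?thesis
    using dim_iso[OF TB.der_space_vectorspace
        direct_sum_is_vs[OF BB.der_space_vectorspace HB.der_space_vectorspace] fd(1) \<Phi> bij]
      fin_dim_direct_sum(2)[OF BB.der_space_vectorspace HB.der_space_vectorspace fd(2,3)] by simp
qed

lemma in_corner_B:
  "z \<in> carrier (corner B f e) \<longleftrightarrow> z \<in> carrier B \<and> f \<otimes> z = z \<and> z \<otimes> e = z"
  "z \<in> carrier (corner B f f) \<longleftrightarrow> z \<in> carrier B \<and> f \<otimes> z = z \<and> z \<otimes> f = z"
  "z \<in> carrier (corner B e e) \<longleftrightarrow> z \<in> carrier B \<and> e \<otimes> z = z \<and> z \<otimes> e = z"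
  by (auto simp: in_corner)

text \<open>
  The first component maps \<open>f T e\<close> onto \<open>f B e\<close>, with kernel \<open>f H e\<close>.  If \<open>u\<close> and \<open>w\<close> are bases of \<open>f B f\<close>
  and \<open>e B e\<close>, the elements \<open>u i \<otimes> w j\<close> form a basis of \<open>f H e\<close>.
\<close>

lemma dim_corner_T:
  "vectorspace.dim K (corner T (J f) (J e)) = vectorspace.dim K (corner B f e)
    + vectorspace.dim K (corner B f f) * vectorspace.dim K (corner B e e)"
proof -
  let ?C = "corner T (J f) (J e)"
  note C = corner_T_vectorspace(1) corner_T_vectorspace(2)[OF T_fin_dim(1)]
  note fe = corner_vectorspace[OF f e] and ff = corner_vectorspace[OF f f] and ee = corner_vectorspace[OF e e]
  have Ct: "t \<in> carrier ?C \<longleftrightarrow> fst t \<in> carrier (corner B f e) \<and> snd t \<in> carrier H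
      \<and> lH f (snd t) = snd t \<and> rH (snd t) e = snd t" for t
    unfolding in_corner_T in_corner_B by (cases t) (auto simp: T_simps J_def)
  have hom: "fst \<in> module_hom K ?C (corner B f e)"
    by (rule module_homI) (simp_all add: Ct T_simps)
  have surj: "fst ` carrier ?C = carrier (corner B f e)"
  proof
    show "carrier (corner B f e) \<subseteq> fst ` carrier ?C"
    proof
      fix z assume z: "z \<in> carrier (corner B f e)"
      then have "(z, \<zero>\<^bsub>H\<^esub>) \<in> carrier ?C" using HB.M.zero_closed by (simp add: Ct)
      then show "z \<in> fst ` carrier ?C" by force
    qed
  qed (auto simp: Ct)
  let ?N = "?C\<lparr>carrier := {t \<in> carrier ?C. fst t = \<zero>\<^bsub>corner B f e\<^esub>}\<rparr>"
  have N: "vectorspace K ?N" by (rule subspaceD(6)[OF kernel_subspace[OF C(1) fe(1) hom]])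
  obtain n u P where D1: "dual_basis K (corner B f f) {..<n :: nat} u P"
    using dual_basis_exists[OF ff(1) ff(2)[OF fin_dim]] .
  obtain n' w Q where D2: "dual_basis K (corner B e e) {..<n' :: nat} w Q"
    using dual_basis_exists[OF ee(1) ee(2)[OF fin_dim]] .
  note d1 = dual_basisD[OF D1, simplified] and d2 = dual_basisD[OF D2, simplified]
  have uY: "u i \<in> carrier Y" "f \<otimes> u i = u i" if "i < n" for i
    using d1(2)[OF that] by (auto simp: in_corner_B in_Y)
  have wE: "w i \<in> carrier E" "w i \<otimes> e = w i" if "i < n'" for i
    using d2(2)[OF that] by (auto simp: in_corner_B in_E)
  have Ee: "z \<otimes> e \<in> carrier (corner B e e)" if "z \<in> carrier E" for z
    using that by (auto simp: in_corner_B in_E m_assoc[symmetric]) (simp add: m_assoc)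
  \<comment> \<open>extends the coordinate functional of \<open>e B e\<close> to \<open>e B\<close>\<close>
  define q where "q j = (\<lambda>z\<in>carrier E. Q j (z \<otimes> e))" for j
  have q: "q j \<in> carrier X" if j: "j < n'" for j
  proof -
    have "q j \<in> module_hom K E (field_space K)"
      using Ee by (intro module_homI)
        (auto simp: q_def E_add E_smult E_B l_distr smult_mult_left d2(4,7,8)[OF j])
    then show ?thesis by (simp add: X_simps linear_space_simps q_def)
  qed
  have hq: "h (q j) \<in> carrier (corner B f f)"
    if h: "h \<in> carrier H" "lH f h = h" and j: "j < n'" for h j
  proof -
    have "h (q j) \<in> carrier Y" by (rule XY.H_D(1)[OF h(1) q[OF j]])
    moreover have "f \<otimes> h (q j) = h (q j)" using fun_cong[OF h(2), of "q j"] q[OF j] by (simp add: hom_lact_def Y_simps)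
    ultimately show ?thesis by (simp add: in_corner_B in_Y)
  qed
  let ?E = "\<lambda>(i, j). tens (u i) (w j)" and ?P = "\<lambda>(i, j) t. P i (snd t (q j))"
  have "dual_basis K ?N ({..<n} \<times> {..<n'}) ?E ?P"
  proof (rule dual_basisI[OF N])
    fix ij assume "ij \<in> {..<n} \<times> {..<n'}"
    then obtain i j where ij: "ij = (i, j)" "i < n" "j < n'" by auto
    show "?E ij \<in> carrier ?N"
      using ij uY wE HB.M.zero_closed
      by (simp add: tens_def Ct rank_one_closed rank_one_act in_corner_B)
    show "?P ij \<in> module_hom K ?N (field_space K)"
    proof (rule module_homI)
      fix t assume t: "t \<in> carrier ?N"
      then have t: "snd t \<in> carrier H" "lH f (snd t) = snd t" by (auto simp: Ct)
      show "?P ij t \<in> carrier (field_space K)" using ij hq[OF t ij(3)] by (simp add: d1)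
      { fix s assume "s \<in> carrier ?N"
        then have s: "snd s \<in> carrier H" "lH f (snd s) = snd s" by (auto simp: Ct)
        show "?P ij (t \<oplus>\<^bsub>?N\<^esub> s) = ?P ij t \<oplus>\<^bsub>field_space K\<^esub> ?P ij s"
          using ij hq[OF t ij(3)] hq[OF s ij(3)] q[OF ij(3)]
          by (simp add: T_simps linear_space_simps Y_simps d1(7)) }
      fix c assume c: "c \<in> carrier K"
      have "h (q j) \<in> carrier Y" if "h \<in> carrier H" for h by (rule XY.H_D(1)[OF that q[OF ij(3)]])
      then show "?P ij (c \<odot>\<^bsub>?N\<^esub> t) = c \<odot>\<^bsub>field_space K\<^esub> ?P ij t"
        using ij hq[OF t ij(3)] q[OF ij(3)] c t
        by (simp add: T_simps linear_space_simps Y_scalar d1(8))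
    qed
    fix kl assume "kl \<in> {..<n} \<times> {..<n'}"
    then obtain k l where kl: "kl = (k, l)" "k < n" "l < n'" by auto
    have ql: "q j (w l) = (if j = l then \<one>\<^bsub>K\<^esub> else \<zero>\<^bsub>K\<^esub>)"
      using ij kl wE by (simp add: q_def d2(5))
    have P0: "P i \<zero> = \<zero>\<^bsub>K\<^esub>"
      using module_hom_zero[OF ff(1) field_space_vectorspace[OF V.field_axioms] d1(3)[OF ij(2)]] by simp
    have uk: "u k \<in> carrier B" using uY(1)[OF kl(2)] by (rule Y_B)
    show "?P ij (?E kl) = (if ij = kl then \<one>\<^bsub>K\<^esub> else \<zero>\<^bsub>K\<^esub>)"
      using ij kl q[OF ij(3)] uk by (auto simp: tens_def rank_one_def ql P0 d1(5))
  next
    fix t assume tN: "t \<in> carrier ?N" and z: "\<And>ij. ij \<in> {..<n} \<times> {..<n'} \<Longrightarrow> ?P ij t = \<zero>\<^bsub>K\<^esub>"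
    obtain h where t: "t = (\<zero>, h)" using tN by (cases t) auto
    have h: "h \<in> carrier H" "lH f h = h" "rH h e = h" using tN t by (auto simp: Ct)
    have h0: "h (q j) = \<zero>" if j: "j < n'" for j
    proof -
      interpret F: vectorspace K "corner B f f" by (rule ff(1))
      have "finsum (corner B f f) (\<lambda>i. P i (h (q j)) \<odot> u i) {..<n} = \<zero>\<^bsub>corner B f f\<^esub>"
        using z[of "(_, j)"] j t d1(2) by (intro F.M.add.finprod_one_eqI) (auto simp: in_corner_B)
      then show ?thesis using d1(6)[OF hq[OF h(1,2) j]] by simp
    qed
    have "h \<phi> = \<zero>" if \<phi>: "\<phi> \<in> carrier X" for \<phi>
    proof -
      interpret Xr: vectorspace K "res_space B X" by (rule XY.res_vectorspace)
      interpret Yr: vectorspace K "res_space B Y" by (rule XY.N.res_vectorspace)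
      interpret Fs: vectorspace K "field_space K" by (rule field_space_vectorspace[OF V.field_axioms])
      interpret Ev: vectorspace K "corner B e e" by (rule ee(1))
      let ?G = "\<lambda>j. (\<phi> (w j) \<odot> \<one>) \<odot>\<^bsub>X\<^esub> q j"
      let ?S = "finsum (res_space B X) ?G {..<n'}"
      have \<phi>w: "\<phi> (w j) \<in> carrier K" if "j < n'" for j using X_eval[OF \<phi> wE(1)[OF that]] .
      have G: "?G \<in> {..<n'} \<rightarrow> carrier (res_space B X)" using \<phi>w q by auto
      \<comment> \<open>\<open>h e = h\<close>, so \<open>h \<phi>\<close> depends on \<open>e \<phi>\<close>, and that is the sum of the \<open>\<phi> (w j) q j\<close>\<close>
      have "e \<odot>\<^bsub>X\<^esub> \<phi> = ?S"
      proof (rule extensionalityI[of _ "carrier E"])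
        show "e \<odot>\<^bsub>X\<^esub> \<phi> \<in> extensional (carrier E)" by (rule X_D(4)[OF XY.act_closed[OF e(1) \<phi>]])
        have "?S \<in> carrier X" using Xr.M.finsum_closed[OF G] by simp
        then show "?S \<in> extensional (carrier E)" by (rule X_D(4))
        fix y assume y: "y \<in> carrier E"
        have qy: "q j y = Q j (y \<otimes> e)" "Q j (y \<otimes> e) \<in> carrier K" if "j < n'" for j
          using y d2(4)[OF that Ee[OF y]] by (simp_all add: q_def)
        have "?S y = finsum (field_space K) (\<lambda>j. ?G j y) {..<n'}"
        proof (rule module_hom_finsum[OF XY.res_vectorspace Fs.vectorspace_axioms, where f = "\<lambda>\<phi>. \<phi> y"])
          show "(\<lambda>\<phi>. \<phi> y) \<in> module_hom K (res_space B X) (field_space K)"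
            using y by (intro module_homI) (auto simp: X_eval X_scalar linear_space_simps X_simps(3))
        qed (use G in auto)
        also have "\<dots> = finsum (field_space K) (\<lambda>j. \<phi> (Q j (y \<otimes> e) \<odot> w j)) {..<n'}"
        proof (rule Fs.finsum_cong')
          fix j assume "j \<in> {..<n'}"
          then have j: "j < n'" by simp
          show "?G j y = \<phi> (Q j (y \<otimes> e) \<odot> w j)"
            unfolding X_scalar[OF \<phi>w[OF j] q[OF j]] X_D(3)[OF \<phi> qy(2)[OF j] wE(1)[OF j]]
            using y \<phi>w[OF j] qy[OF j] by (simp add: linear_space_simps V.m_comm)
        qed (use X_eval[OF \<phi>] qy wE(1) E_smult in auto)
        also have "\<dots> = \<phi> (finsum (corner B e e) (\<lambda>j. Q j (y \<otimes> e) \<odot>\<^bsub>corner B e e\<^esub> w j) {..<n'})"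
        proof (subst module_hom_finsum[OF ee(1) Fs.vectorspace_axioms, of \<phi>])
          show "\<phi> \<in> module_hom K (corner B e e) (field_space K)"
            by (intro module_homI) (auto simp: in_corner_B in_E X_D[OF \<phi>])
        qed (use qy d2(2) Ev.smult_closed in auto)
        also have "finsum (corner B e e) (\<lambda>j. Q j (y \<otimes> e) \<odot>\<^bsub>corner B e e\<^esub> w j) {..<n'} = y \<otimes> e"
          using d2(6)[OF Ee[OF y]] by simp
        finally have Sy: "?S y = \<phi> (y \<otimes> e)" .
        have "(e \<odot>\<^bsub>X\<^esub> \<phi>) y = \<phi> (y \<otimes> e)" using y by (simp add: X_simps)
        then show "(e \<odot>\<^bsub>X\<^esub> \<phi>) y = ?S y" by (simp only: Sy)
      qed
      then have "h \<phi> = h ?S" using fun_cong[OF h(3), of \<phi>] \<phi> by (simp add: hom_ract_def)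
      also have "\<dots> = finsum (res_space B Y) (\<lambda>j. h (?G j)) {..<n'}"
        using h(1) by (intro module_hom_finsum[OF XY.res_vectorspace XY.N.res_vectorspace _ _ G])
          (auto simp: linear_space_simps)
      also have "\<dots> = \<zero>\<^bsub>res_space B Y\<^esub>"
        using XY.H_D(3)[OF h(1) \<phi>w q] \<phi>w by (intro Yr.M.add.finprod_one_eqI) (auto simp: h0 Y_simps)
      finally show ?thesis by (simp add: Y_simps)
    qed
    then have "h = \<zero>\<^bsub>H\<^esub>"
      using XY.H_D(4)[OF h(1)] by (intro extensionalityI[of _ "carrier X"]) (auto simp: linear_space_simps Y_simps)
    then show "t = \<zero>\<^bsub>?N\<^esub>" by (simp add: t T_simps)
  qed simp
  from dual_basis_dim(2)[OF N this]
  have "vectorspace.dim K ?N = vectorspace.dim K (corner B f f) * vectorspace.dim K (corner B e e)"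
    using dual_basis_dim(2)[OF ff(1) D1] dual_basis_dim(2)[OF ee(1) D2] by (simp add: card_cartesian_product)
  then show ?thesis using dim_exact(1)[OF C(1) fe(1) C(2) hom surj] by simp
qed

theorem dim_HH1_triv_ext:
  "int (vectorspace.dim K (HH1 K T)) - int (vectorspace.dim K (HH1 K B)) =
    int (vectorspace.dim K (center T)) - int (vectorspace.dim K (center B))
    + int (vectorspace.dim K (corner B f e))
    + int (vectorspace.dim K (corner B f f)) * int (vectorspace.dim K (corner B e e))
    + int (vectorspace.dim K (ext1 B X Y)) - int (vectorspace.dim K (mod_hom_space B X Y))"
  using T.dim_HH1[OF T_fin_dim(1)] dim_HH1[OF fin_dim] T_fin_dim(2) dim_Der_T dim_Der_B_T dim_corner_T
    XY.dim_derivations_ext1[OF fin_dim X_fin_dim Y_fin_dim]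
  by (simp flip: of_nat_mult)

end

end

section \<open>Quotient algebras\<close>

lemma kalg_image:
  assumes A: "kalg K A" and car: "carrier Q = \<pi> ` carrier A"
    and add: "\<And>x y. x \<in> carrier A \<Longrightarrow> y \<in> carrier A \<Longrightarrow> \<pi> (x \<oplus>\<^bsub>A\<^esub> y) = \<pi> x \<oplus>\<^bsub>Q\<^esub> \<pi> y"
    and mult: "\<And>x y. x \<in> carrier A \<Longrightarrow> y \<in> carrier A \<Longrightarrow> \<pi> (x \<otimes>\<^bsub>A\<^esub> y) = \<pi> x \<otimes>\<^bsub>Q\<^esub> \<pi> y"
    and smult: "\<And>c x. c \<in> carrier K \<Longrightarrow> x \<in> carrier A \<Longrightarrow> \<pi> (c \<odot>\<^bsub>A\<^esub> x) = c \<odot>\<^bsub>Q\<^esub> \<pi> x"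
    and zero: "\<pi> \<zero>\<^bsub>A\<^esub> = \<zero>\<^bsub>Q\<^esub>" and one: "\<pi> \<one>\<^bsub>A\<^esub> = \<one>\<^bsub>Q\<^esub>"
  shows "kalg K Q"
proof -
  interpret A: kalg K A by fact
  interpret Q: vectorspace K Q by (rule vectorspace_image[OF A.V.vectorspace_axioms car add smult zero])
  have add': "\<pi> x \<oplus>\<^bsub>Q\<^esub> \<pi> y = \<pi> (x \<oplus>\<^bsub>A\<^esub> y)" if "x \<in> carrier A" "y \<in> carrier A" for x y
    using add that by simp
  have mult': "\<pi> x \<otimes>\<^bsub>Q\<^esub> \<pi> y = \<pi> (x \<otimes>\<^bsub>A\<^esub> y)" if "x \<in> carrier A" "y \<in> carrier A" for x y
    using mult that by simp
  have smult': "c \<odot>\<^bsub>Q\<^esub> \<pi> x = \<pi> (c \<odot>\<^bsub>A\<^esub> x)" if "c \<in> carrier K" "x \<in> carrier A" for c x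
    using smult that by simp
  have "ring Q"
  proof (rule ringI)
    show "abelian_group Q" by (rule Q.abelian_group_axioms)
    show "Group.monoid Q"
      by (rule monoidI) (auto simp: car mult' one[symmetric] A.m_assoc)
  qed (auto simp: car mult' add' A.l_distr A.r_distr)
  then interpret Q: ring Q .
  show ?thesis
    by unfold_locales (auto simp: car mult' smult' A.smult_mult_left A.smult_mult_right)
qed

lemma (in kalg) ideal_subspace:
  assumes "ideal I A"
  shows "subspace K I A"
proof -
  interpret ideal I A by fact
  show ?thesis
  proof (rule subspaceI[OF V.vectorspace_axioms])
    fix c x assume c: "c \<in> carrier K" "x \<in> I"
    then have "(c \<odot> \<one>) \<otimes> x \<in> I" using a_subset by (intro I_l_closed) auto
    then show "c \<odot> x \<in> I" using c a_subset scalar_mult[of c x] by auto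
  qed (use a_subset in auto)
qed

lemma (in kalg) quot_module_kalg:
  assumes I: "ideal I A"
  shows "kalg K (quot_module A I)"
    and "x \<in> carrier A \<Longrightarrow> y \<in> carrier A \<Longrightarrow>
      I +> (x \<otimes> y) = (I +> x) \<otimes>\<^bsub>quot_module A I\<^esub> (I +> y)"
    and "I +> \<one> = \<one>\<^bsub>quot_module A I\<^esub>"
proof -
  interpret I: ideal I A by fact
  note Q = quot_module_vectorspace[OF ideal_subspace[OF I]]
  show mult: "x \<in> carrier A \<Longrightarrow> y \<in> carrier A \<Longrightarrow>
      I +> (x \<otimes> y) = (I +> x) \<otimes>\<^bsub>quot_module A I\<^esub> (I +> y)" for x y
    by (simp add: I.rcoset_mult_add)
  show one: "I +> \<one> = \<one>\<^bsub>quot_module A I\<^esub>" by simp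
  show "kalg K (quot_module A I)"
    by (rule kalg_image[where \<pi> = "\<lambda>x. I +> x"])
      (use Q(3) module_homD[OF Q(2)] module_hom_zero[OF V.vectorspace_axioms Q(1,2)] mult one kalg_axioms
        in \<open>auto simp del: quot_module_simps\<close>)
qed

section \<open>Path algebras\<close>

locale path_alg = field K + fin_digraph Q
  for K :: "('k, 'z) ring_scheme" and Q :: "('v, 'e) pre_digraph"
begin

abbreviation "P \<equiv> path_algebra K Q"

lemma P_simps:
  "carrier P = {x. (\<forall>\<gamma>. x \<gamma> \<in> carrier K) \<and> (\<forall>\<gamma>. \<gamma> \<notin> paths Q \<longrightarrow> x \<gamma> = \<zero>\<^bsub>K\<^esub>) \<and> finite {\<gamma>. x \<gamma> \<noteq> \<zero>\<^bsub>K\<^esub>}}"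
  "one P = (\<lambda>\<gamma>. if \<gamma> \<in> paths Q \<and> snd \<gamma> = [] then \<one>\<^bsub>K\<^esub> else \<zero>\<^bsub>K\<^esub>)"
  "zero P = (\<lambda>\<gamma>. \<zero>\<^bsub>K\<^esub>)" "add P = (\<lambda>x y \<gamma>. x \<gamma> \<oplus>\<^bsub>K\<^esub> y \<gamma>)"
  "smult P = (\<lambda>c x \<gamma>. c \<otimes>\<^bsub>K\<^esub> x \<gamma>)"
  by (simp_all add: path_algebra_def)

definition "splits \<gamma> = {(\<beta>, \<alpha>). \<beta> \<in> paths Q \<and> \<alpha> \<in> paths Q \<and> path_target Q \<alpha> = fst \<beta>
          \<and> (fst \<alpha>, snd \<alpha> @ snd \<beta>) = \<gamma>}"

lemma P_mult: "mult P x y \<gamma> = finsum K (\<lambda>(\<beta>, \<alpha>). x \<beta> \<otimes>\<^bsub>K\<^esub> y \<alpha>) (splits \<gamma>)"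
  by (simp add: path_algebra_def splits_def)

lemma in_paths: "(u, p) \<in> paths Q \<longleftrightarrow> awalk u p (path_target Q (u, p))"
  by (auto simp: paths_def path_target_def)

lemma paths_concat:
  assumes "\<beta> \<in> paths Q" "\<alpha> \<in> paths Q" "path_target Q \<alpha> = fst \<beta>"
  shows "(fst \<alpha>, snd \<alpha> @ snd \<beta>) \<in> paths Q" "path_target Q (fst \<alpha>, snd \<alpha> @ snd \<beta>) = path_target Q \<beta>"
proof -
  have "awalk (fst \<alpha>) (snd \<alpha>) (fst \<beta>)" using assms(2,3) in_paths[of "fst \<alpha>" "snd \<alpha>"] by simp
  moreover have "awalk (fst \<beta>) (snd \<beta>) (path_target Q \<beta>)" using assms(1) in_paths[of "fst \<beta>" "snd \<beta>"] by simp
  ultimately have *: "awalk (fst \<alpha>) (snd \<alpha> @ snd \<beta>) (path_target Q \<beta>)" by (rule awalk_appendI)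
  then show "(fst \<alpha>, snd \<alpha> @ snd \<beta>) \<in> paths Q" by (auto simp: paths_def)
  show "path_target Q (fst \<alpha>, snd \<alpha> @ snd \<beta>) = path_target Q \<beta>"
    using * by (auto simp: path_target_def)
qed

lemma vertex_path: "(u, []) \<in> paths Q \<longleftrightarrow> u \<in> verts Q" "path_target Q (u, []) = u"
  by (auto simp: paths_def path_target_def awalk_Nil_iff)

lemma path_verts: "\<gamma> \<in> paths Q \<Longrightarrow> fst \<gamma> \<in> verts Q" "\<gamma> \<in> paths Q \<Longrightarrow> path_target Q \<gamma> \<in> verts Q"
  by (cases \<gamma>; auto simp: in_paths)+

lemma path_Cons: "(u, x # p) \<in> paths Q \<longleftrightarrow> x \<in> arcs Q \<and> tail Q x = u \<and> (head Q x, p) \<in> paths Q"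
  by (auto simp: paths_def awalk_Cons_iff)

lemma path_target_Cons: "path_target Q (u, x # p) = path_target Q (head Q x, p)"
  by (simp add: path_target_def)

text \<open>
  A splitting of a path is determined by the length of its first part.
\<close>

lemma finite_splits: "finite (splits \<gamma>)"
proof (rule finite_subset)
  show "splits \<gamma> \<subseteq> (\<lambda>k. ((path_target Q (fst \<gamma>, take k (snd \<gamma>)), drop k (snd \<gamma>)), (fst \<gamma>, take k (snd \<gamma>)))) ` {..length (snd \<gamma>)}"
  proof (rule subsetI)
    fix z assume z: "z \<in> splits \<gamma>"
    obtain b q a p where "z = ((b, q), (a, p))" by (metis surj_pair)
    with z show "z \<in> (\<lambda>k. ((path_target Q (fst \<gamma>, take k (snd \<gamma>)), drop k (snd \<gamma>)), (fst \<gamma>, take k (snd \<gamma>)))) ` {..length (snd \<gamma>)}"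
      by (auto simp: splits_def image_iff intro!: bexI[of _ "length p"])
  qed
qed simp

lemma P_val: "x \<in> carrier P \<Longrightarrow> x \<gamma> \<in> carrier K" by (cases \<gamma>) (simp add: P_simps)

lemma P_vectorspace: "vectorspace K P"
proof (rule vs_criteria)
  show "field K" by (rule field_axioms)
  have fin: "finite {\<gamma>. x \<gamma> \<oplus>\<^bsub>K\<^esub> y \<gamma> \<noteq> \<zero>\<^bsub>K\<^esub>}" if "x \<in> carrier P" "y \<in> carrier P" for x y
    by (rule finite_subset[of _ "{\<gamma>. x \<gamma> \<noteq> \<zero>\<^bsub>K\<^esub>} \<union> {\<gamma>. y \<gamma> \<noteq> \<zero>\<^bsub>K\<^esub>}"]) (use that in \<open>auto simp: P_simps\<close>)
  have fin': "finite {\<gamma>. c \<otimes>\<^bsub>K\<^esub> x \<gamma> \<noteq> \<zero>\<^bsub>K\<^esub>}" if "c \<in> carrier K" "x \<in> carrier P" for c x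
    by (rule finite_subset[of _ "{\<gamma>. x \<gamma> \<noteq> \<zero>\<^bsub>K\<^esub>}"]) (use that in \<open>auto simp: P_simps\<close>)
  show "\<forall>v w. v \<in> carrier P \<and> w \<in> carrier P \<longrightarrow> v \<oplus>\<^bsub>P\<^esub> w \<in> carrier P" using fin by (auto simp: P_simps)
  show sm: "\<forall>c v. c \<in> carrier K \<and> v \<in> carrier P \<longrightarrow> c \<odot>\<^bsub>P\<^esub> v \<in> carrier P" using fin' by (auto simp: P_simps)
  show "\<forall>v\<in>carrier P. \<exists>neg_v\<in>carrier P. v \<oplus>\<^bsub>P\<^esub> neg_v = \<zero>\<^bsub>P\<^esub>"
  proof
    fix v assume v: "v \<in> carrier P"
    have "(\<ominus>\<^bsub>K\<^esub> \<one>\<^bsub>K\<^esub>) \<odot>\<^bsub>P\<^esub> v \<in> carrier P" using sm v by simp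
    moreover have "v \<oplus>\<^bsub>P\<^esub> (\<ominus>\<^bsub>K\<^esub> \<one>\<^bsub>K\<^esub>) \<odot>\<^bsub>P\<^esub> v = \<zero>\<^bsub>P\<^esub>"
      using P_val[OF v] by (simp add: P_simps fun_eq_iff l_minus r_neg)
    ultimately show "\<exists>neg_v\<in>carrier P. v \<oplus>\<^bsub>P\<^esub> neg_v = \<zero>\<^bsub>P\<^esub>" by blast
  qed
qed (auto simp: P_simps a_ac m_assoc l_distr r_distr)

lemma path_elt_closed [simp]: "\<gamma> \<in> paths Q \<Longrightarrow> path_elt K \<gamma> \<in> carrier P"
  by (auto simp: P_simps path_elt_def)

lemma path_induct [consumes 1, case_names zero smult add]:
  assumes x: "x \<in> carrier P" and z: "R \<zero>\<^bsub>P\<^esub>"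
    and s: "\<And>c \<gamma>. c \<in> carrier K \<Longrightarrow> \<gamma> \<in> paths Q \<Longrightarrow> R (c \<odot>\<^bsub>P\<^esub> path_elt K \<gamma>)"
    and a: "\<And>x y. x \<in> carrier P \<Longrightarrow> y \<in> carrier P \<Longrightarrow> R x \<Longrightarrow> R y \<Longrightarrow> R (x \<oplus>\<^bsub>P\<^esub> y)"
  shows "R x"
proof -
  interpret P: vectorspace K P by (rule P_vectorspace)
  have "R x" if "finite S" "x \<in> carrier P" "{\<gamma>. x \<gamma> \<noteq> \<zero>\<^bsub>K\<^esub>} \<subseteq> S" for S x
    using that
  proof (induction S arbitrary: x rule: finite_induct)
    case empty
    then have "x = \<zero>\<^bsub>P\<^esub>" by (auto simp: P_simps fun_eq_iff)
    then show ?case using z by simp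
  next
    case (insert \<gamma> S)
    show ?case
    proof (cases "\<gamma> \<in> paths Q")
      case False
      then show ?thesis using insert.prems by (intro insert.IH) (auto simp: P_simps)
    next
      case True
      let ?y = "x(\<gamma> := \<zero>\<^bsub>K\<^esub>)"
      have "finite {\<delta>. ?y \<delta> \<noteq> \<zero>\<^bsub>K\<^esub>}"
        by (rule finite_subset[of _ "{\<delta>. x \<delta> \<noteq> \<zero>\<^bsub>K\<^esub>}"]) (use insert.prems in \<open>auto simp: P_simps\<close>)
      then have y: "?y \<in> carrier P" using insert.prems(1) by (auto simp: P_simps)
      have sub: "{\<delta>. ?y \<delta> \<noteq> \<zero>\<^bsub>K\<^esub>} \<subseteq> S" using insert.prems(2) by auto
      have "x = x \<gamma> \<odot>\<^bsub>P\<^esub> path_elt K \<gamma> \<oplus>\<^bsub>P\<^esub> ?y"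
        using P_val[OF insert.prems(1)] by (auto simp: P_simps path_elt_def fun_eq_iff)
      moreover have "R (x \<gamma> \<odot>\<^bsub>P\<^esub> path_elt K \<gamma> \<oplus>\<^bsub>P\<^esub> ?y)"
        by (intro a s P.smult_closed path_elt_closed y insert.IH[OF y sub] True P_val[OF insert.prems(1)])
      ultimately show ?thesis by simp
    qed
  qed
  from this[of "{\<gamma>. x \<gamma> \<noteq> \<zero>\<^bsub>K\<^esub>}" x] show ?thesis using x by (auto simp: P_simps)
qed

lemma splits_terms: "x \<in> carrier P \<Longrightarrow> y \<in> carrier P \<Longrightarrow>
    (\<lambda>(\<beta>, \<alpha>). x \<beta> \<otimes>\<^bsub>K\<^esub> y \<alpha>) \<in> splits \<gamma> \<rightarrow> carrier K"
  by (auto simp: P_val)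

lemma P_mult_closed:
  assumes x: "x \<in> carrier P" and y: "y \<in> carrier P"
  shows "x \<otimes>\<^bsub>P\<^esub> y \<in> carrier P"
proof -
  let ?S = "(\<lambda>(\<beta>, \<alpha>). (fst \<alpha>, snd \<alpha> @ snd \<beta>)) ` ({\<beta>. x \<beta> \<noteq> \<zero>\<^bsub>K\<^esub>} \<times> {\<alpha>. y \<alpha> \<noteq> \<zero>\<^bsub>K\<^esub>})"
  have "(x \<otimes>\<^bsub>P\<^esub> y) \<gamma> = \<zero>\<^bsub>K\<^esub>" if "\<gamma> \<notin> ?S" for \<gamma>
    unfolding P_mult
  proof (rule add.finprod_one_eqI)
    fix z assume z: "z \<in> splits \<gamma>"
    obtain \<beta> \<alpha> where z': "z = (\<beta>, \<alpha>)" by (cases z)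
    then have "x \<beta> = \<zero>\<^bsub>K\<^esub> \<or> y \<alpha> = \<zero>\<^bsub>K\<^esub>" using that z by (force simp: splits_def)
    then show "(case z of (\<beta>, \<alpha>) \<Rightarrow> x \<beta> \<otimes>\<^bsub>K\<^esub> y \<alpha>) = \<zero>\<^bsub>K\<^esub>"
      using x y z' by (auto simp: P_val)
  qed
  then have "{\<gamma>. (x \<otimes>\<^bsub>P\<^esub> y) \<gamma> \<noteq> \<zero>\<^bsub>K\<^esub>} \<subseteq> ?S" by blast
  moreover have "finite ?S" using x y by (auto simp: P_simps)
  ultimately have "finite {\<gamma>. (x \<otimes>\<^bsub>P\<^esub> y) \<gamma> \<noteq> \<zero>\<^bsub>K\<^esub>}" by (rule finite_subset)
  moreover have "(x \<otimes>\<^bsub>P\<^esub> y) \<gamma> \<in> carrier K" for \<gamma>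
    unfolding P_mult using splits_terms[OF x y] by (rule finsum_closed)
  moreover have "(x \<otimes>\<^bsub>P\<^esub> y) \<gamma> = \<zero>\<^bsub>K\<^esub>" if "\<gamma> \<notin> paths Q" for \<gamma>
  proof -
    have "splits \<gamma> = {}" using that paths_concat(1) by (auto simp: splits_def)
    then show ?thesis by (simp add: P_mult)
  qed
  ultimately show ?thesis by (auto simp: P_simps(1))
qed

lemma P_l_distr:
  assumes "x \<in> carrier P" "y \<in> carrier P" "z \<in> carrier P"
  shows "(x \<oplus>\<^bsub>P\<^esub> y) \<otimes>\<^bsub>P\<^esub> z = x \<otimes>\<^bsub>P\<^esub> z \<oplus>\<^bsub>P\<^esub> y \<otimes>\<^bsub>P\<^esub> z"
proof
  fix \<gamma>
  have "((x \<oplus>\<^bsub>P\<^esub> y) \<otimes>\<^bsub>P\<^esub> z) \<gamma>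
      = finsum K (\<lambda>s. (case s of (\<beta>, \<alpha>) \<Rightarrow> x \<beta> \<otimes>\<^bsub>K\<^esub> z \<alpha>) \<oplus>\<^bsub>K\<^esub> (case s of (\<beta>, \<alpha>) \<Rightarrow> y \<beta> \<otimes>\<^bsub>K\<^esub> z \<alpha>)) (splits \<gamma>)"
    unfolding P_mult using assms by (intro finsum_cong') (auto simp: P_simps(4) P_val l_distr)
  also have "\<dots> = (x \<otimes>\<^bsub>P\<^esub> z) \<gamma> \<oplus>\<^bsub>K\<^esub> (y \<otimes>\<^bsub>P\<^esub> z) \<gamma>"
    unfolding P_mult by (intro finsum_addf splits_terms assms)
  finally show "((x \<oplus>\<^bsub>P\<^esub> y) \<otimes>\<^bsub>P\<^esub> z) \<gamma> = (x \<otimes>\<^bsub>P\<^esub> z \<oplus>\<^bsub>P\<^esub> y \<otimes>\<^bsub>P\<^esub> z) \<gamma>" by (simp add: P_simps(4))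
qed

lemma P_r_distr:
  assumes "x \<in> carrier P" "y \<in> carrier P" "z \<in> carrier P"
  shows "z \<otimes>\<^bsub>P\<^esub> (x \<oplus>\<^bsub>P\<^esub> y) = z \<otimes>\<^bsub>P\<^esub> x \<oplus>\<^bsub>P\<^esub> z \<otimes>\<^bsub>P\<^esub> y"
proof
  fix \<gamma>
  have "(z \<otimes>\<^bsub>P\<^esub> (x \<oplus>\<^bsub>P\<^esub> y)) \<gamma>
      = finsum K (\<lambda>s. (case s of (\<beta>, \<alpha>) \<Rightarrow> z \<beta> \<otimes>\<^bsub>K\<^esub> x \<alpha>) \<oplus>\<^bsub>K\<^esub> (case s of (\<beta>, \<alpha>) \<Rightarrow> z \<beta> \<otimes>\<^bsub>K\<^esub> y \<alpha>)) (splits \<gamma>)"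
    unfolding P_mult using assms by (intro finsum_cong') (auto simp: P_simps(4) P_val r_distr)
  also have "\<dots> = (z \<otimes>\<^bsub>P\<^esub> x) \<gamma> \<oplus>\<^bsub>K\<^esub> (z \<otimes>\<^bsub>P\<^esub> y) \<gamma>"
    unfolding P_mult by (intro finsum_addf splits_terms assms)
  finally show "(z \<otimes>\<^bsub>P\<^esub> (x \<oplus>\<^bsub>P\<^esub> y)) \<gamma> = (z \<otimes>\<^bsub>P\<^esub> x \<oplus>\<^bsub>P\<^esub> z \<otimes>\<^bsub>P\<^esub> y) \<gamma>" by (simp add: P_simps(4))
qed

lemma P_smult_mult:
  assumes "c \<in> carrier K" "x \<in> carrier P" "y \<in> carrier P"
  shows "(c \<odot>\<^bsub>P\<^esub> x) \<otimes>\<^bsub>P\<^esub> y = c \<odot>\<^bsub>P\<^esub> (x \<otimes>\<^bsub>P\<^esub> y)" "x \<otimes>\<^bsub>P\<^esub> (c \<odot>\<^bsub>P\<^esub> y) = c \<odot>\<^bsub>P\<^esub> (x \<otimes>\<^bsub>P\<^esub> y)"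
proof -
  have *: "(c \<odot>\<^bsub>P\<^esub> (x \<otimes>\<^bsub>P\<^esub> y)) \<gamma> = finsum K (\<lambda>s. c \<otimes>\<^bsub>K\<^esub> (case s of (\<beta>, \<alpha>) \<Rightarrow> x \<beta> \<otimes>\<^bsub>K\<^esub> y \<alpha>)) (splits \<gamma>)" for \<gamma>
    unfolding P_simps(5) P_mult by (rule finsum_rdistr[OF finite_splits assms(1) splits_terms[OF assms(2,3)]])
  show "(c \<odot>\<^bsub>P\<^esub> x) \<otimes>\<^bsub>P\<^esub> y = c \<odot>\<^bsub>P\<^esub> (x \<otimes>\<^bsub>P\<^esub> y)"
  proof
    fix \<gamma>
    show "((c \<odot>\<^bsub>P\<^esub> x) \<otimes>\<^bsub>P\<^esub> y) \<gamma> = (c \<odot>\<^bsub>P\<^esub> (x \<otimes>\<^bsub>P\<^esub> y)) \<gamma>"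
      unfolding * unfolding P_mult
      using assms by (intro finsum_cong') (auto simp: P_simps(5) P_val m_assoc)
  qed
  show "x \<otimes>\<^bsub>P\<^esub> (c \<odot>\<^bsub>P\<^esub> y) = c \<odot>\<^bsub>P\<^esub> (x \<otimes>\<^bsub>P\<^esub> y)"
  proof
    fix \<gamma>
    show "(x \<otimes>\<^bsub>P\<^esub> (c \<odot>\<^bsub>P\<^esub> y)) \<gamma> = (c \<odot>\<^bsub>P\<^esub> (x \<otimes>\<^bsub>P\<^esub> y)) \<gamma>"
      unfolding * unfolding P_mult
      using assms by (intro finsum_cong') (auto simp: P_simps(5) P_val m_lcomm)
  qed
qed

lemma path_elt_mult:
  assumes "\<beta> \<in> paths Q" "\<alpha> \<in> paths Q"
  shows "path_elt K \<beta> \<otimes>\<^bsub>P\<^esub> path_elt K \<alpha>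
    = (if path_target Q \<alpha> = fst \<beta> then path_elt K (fst \<alpha>, snd \<alpha> @ snd \<beta>) else \<zero>\<^bsub>P\<^esub>)"
proof
  fix \<gamma>
  have "(path_elt K \<beta> \<otimes>\<^bsub>P\<^esub> path_elt K \<alpha>) \<gamma>
      = finsum K (\<lambda>s. if s = (\<beta>, \<alpha>) then \<one>\<^bsub>K\<^esub> else \<zero>\<^bsub>K\<^esub>) (splits \<gamma>)"
    unfolding P_mult by (intro finsum_cong') (auto simp: path_elt_def split: if_splits)
  also have "\<dots> = (if (\<beta>, \<alpha>) \<in> splits \<gamma> then \<one>\<^bsub>K\<^esub> else \<zero>\<^bsub>K\<^esub>)"
  proof (cases "(\<beta>, \<alpha>) \<in> splits \<gamma>")
    case True
    have "finsum K (\<lambda>s. if s = (\<beta>, \<alpha>) then \<one>\<^bsub>K\<^esub> else \<zero>\<^bsub>K\<^esub>) (splits \<gamma>)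
        = finsum K (\<lambda>s. if (\<beta>, \<alpha>) = s then \<one>\<^bsub>K\<^esub> else \<zero>\<^bsub>K\<^esub>) (splits \<gamma>)"
      by (rule finsum_cong') auto
    also have "\<dots> = \<one>\<^bsub>K\<^esub>" using True finite_splits by (intro finsum_singleton) auto
    finally show ?thesis using True by simp
  next
    case False
    then show ?thesis by (auto intro!: add.finprod_one_eqI)
  qed
  finally show "(path_elt K \<beta> \<otimes>\<^bsub>P\<^esub> path_elt K \<alpha>) \<gamma>
    = (if path_target Q \<alpha> = fst \<beta> then path_elt K (fst \<alpha>, snd \<alpha> @ snd \<beta>) else \<zero>\<^bsub>P\<^esub>) \<gamma>"
    using assms by (auto simp: splits_def path_elt_def P_simps)
qed

lemma P_one_closed: "\<one>\<^bsub>P\<^esub> \<in> carrier P"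
proof -
  have "finite {\<gamma>. \<one>\<^bsub>P\<^esub> \<gamma> \<noteq> \<zero>\<^bsub>K\<^esub>}"
    by (rule finite_subset[of _ "(\<lambda>u. (u, [])) ` verts Q"]) (auto simp: P_simps(2) vertex_path finite_verts)
  then show ?thesis by (auto simp: P_simps)
qed

text \<open>
  Of the vertices that make up the unit, only the target (on the left) and the source (on the right) of
  \<open>\<gamma>\<close> contribute to the product.
\<close>

lemma one_mult_path:
  assumes \<gamma>: "\<gamma> \<in> paths Q"
  shows "\<one>\<^bsub>P\<^esub> \<otimes>\<^bsub>P\<^esub> path_elt K \<gamma> = path_elt K \<gamma>" "path_elt K \<gamma> \<otimes>\<^bsub>P\<^esub> \<one>\<^bsub>P\<^esub> = path_elt K \<gamma>"
proof -
  have L: "\<one>\<^bsub>P\<^esub> \<beta> \<otimes>\<^bsub>K\<^esub> path_elt K \<gamma> \<alpha> = path_elt K (path_target Q \<gamma>, []) \<beta> \<otimes>\<^bsub>K\<^esub> path_elt K \<gamma> \<alpha>"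
    if "(\<beta>, \<alpha>) \<in> splits \<delta>" for \<beta> \<alpha> \<delta>
    using that by (cases \<beta>) (auto simp: splits_def P_simps(2) path_elt_def)
  have R: "path_elt K \<gamma> \<beta> \<otimes>\<^bsub>K\<^esub> \<one>\<^bsub>P\<^esub> \<alpha> = path_elt K \<gamma> \<beta> \<otimes>\<^bsub>K\<^esub> path_elt K (fst \<gamma>, []) \<alpha>"
    if "(\<beta>, \<alpha>) \<in> splits \<delta>" for \<beta> \<alpha> \<delta>
    using that by (cases \<alpha>) (auto simp: splits_def P_simps(2) path_elt_def vertex_path)
  have pv: "(path_target Q \<gamma>, []) \<in> paths Q" "(fst \<gamma>, []) \<in> paths Q" using path_verts[OF \<gamma>] by (simp_all add: vertex_path)
  have "\<one>\<^bsub>P\<^esub> \<otimes>\<^bsub>P\<^esub> path_elt K \<gamma> = path_elt K (path_target Q \<gamma>, []) \<otimes>\<^bsub>P\<^esub> path_elt K \<gamma>"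
    unfolding fun_eq_iff P_mult
    using L path_elt_closed[OF \<gamma>] path_elt_closed[OF pv(1)] by (auto intro!: finsum_cong' simp: P_val)
  then show "\<one>\<^bsub>P\<^esub> \<otimes>\<^bsub>P\<^esub> path_elt K \<gamma> = path_elt K \<gamma>" using \<gamma> pv by (simp add: path_elt_mult)
  have "path_elt K \<gamma> \<otimes>\<^bsub>P\<^esub> \<one>\<^bsub>P\<^esub> = path_elt K \<gamma> \<otimes>\<^bsub>P\<^esub> path_elt K (fst \<gamma>, [])"
    unfolding fun_eq_iff P_mult
    using R path_elt_closed[OF \<gamma>] path_elt_closed[OF pv(2)] by (auto intro!: finsum_cong' simp: P_val)
  then show "path_elt K \<gamma> \<otimes>\<^bsub>P\<^esub> \<one>\<^bsub>P\<^esub> = path_elt K \<gamma>" using \<gamma> pv by (simp add: path_elt_mult vertex_path)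
qed

text \<open>
  Both sides of the associative law are trilinear, so it is enough to compare them on paths, where it is
  associativity of concatenation.
\<close>

lemma P_kalg: "kalg K P"
proof -
  interpret P: vectorspace K P by (rule P_vectorspace)
  note mc = P_mult_closed
  have z: "\<zero>\<^bsub>P\<^esub> \<otimes>\<^bsub>P\<^esub> x = \<zero>\<^bsub>P\<^esub>" "x \<otimes>\<^bsub>P\<^esub> \<zero>\<^bsub>P\<^esub> = \<zero>\<^bsub>P\<^esub>" if x: "x \<in> carrier P" for x
    using additive_zero[OF P.abelian_group_axioms P.abelian_group_axioms, of "\<lambda>z. z \<otimes>\<^bsub>P\<^esub> x"]
      additive_zero[OF P.abelian_group_axioms P.abelian_group_axioms, of "\<lambda>z. x \<otimes>\<^bsub>P\<^esub> z"] x
    by (simp_all add: mc P_l_distr P_r_distr)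
  have assoc3: "path_elt K \<gamma> \<otimes>\<^bsub>P\<^esub> path_elt K \<beta> \<otimes>\<^bsub>P\<^esub> path_elt K \<alpha> = path_elt K \<gamma> \<otimes>\<^bsub>P\<^esub> (path_elt K \<beta> \<otimes>\<^bsub>P\<^esub> path_elt K \<alpha>)"
    if "\<gamma> \<in> paths Q" "\<beta> \<in> paths Q" "\<alpha> \<in> paths Q" for \<gamma> \<beta> \<alpha>
    using that paths_concat[of \<gamma> \<beta>] paths_concat[of \<beta> \<alpha>] by (simp add: path_elt_mult z)
  have assoc: "x \<otimes>\<^bsub>P\<^esub> y \<otimes>\<^bsub>P\<^esub> w = x \<otimes>\<^bsub>P\<^esub> (y \<otimes>\<^bsub>P\<^esub> w)"
    if x: "x \<in> carrier P" and y: "y \<in> carrier P" and w: "w \<in> carrier P" for x y w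
    using x
  proof (induction rule: path_induct)
    case zero
    show ?case using y w by (simp add: z mc)
  next
    case (add x x')
    then show ?case using y w by (simp add: P_l_distr mc)
  next
    case (smult c \<gamma>)
    note c1 = smult
    have "path_elt K \<gamma> \<otimes>\<^bsub>P\<^esub> y \<otimes>\<^bsub>P\<^esub> w = path_elt K \<gamma> \<otimes>\<^bsub>P\<^esub> (y \<otimes>\<^bsub>P\<^esub> w)"
      using y
    proof (induction rule: path_induct)
      case zero
      show ?case using c1 w by (simp add: z mc)
    next
      case (add y y')
      then show ?case using c1 w by (simp add: P_l_distr P_r_distr mc)
    next
      case (smult d \<beta>)
      note c2 = smult
      have "path_elt K \<gamma> \<otimes>\<^bsub>P\<^esub> path_elt K \<beta> \<otimes>\<^bsub>P\<^esub> w = path_elt K \<gamma> \<otimes>\<^bsub>P\<^esub> (path_elt K \<beta> \<otimes>\<^bsub>P\<^esub> w)"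
        using w
      proof (induction rule: path_induct)
        case zero
        show ?case using c1 c2 by (simp add: z mc)
      next
        case (add w w')
        then show ?case using c1 c2 by (simp add: P_r_distr mc)
      next
        case (smult k \<alpha>)
        then show ?case using c1 c2 by (simp add: P_smult_mult mc assoc3)
      qed
      then show ?case using c1 c2 w by (simp add: P_smult_mult mc)
    qed
    then show ?case using c1 y w by (simp add: P_smult_mult mc)
  qed
  have one: "\<one>\<^bsub>P\<^esub> \<otimes>\<^bsub>P\<^esub> x = x \<and> x \<otimes>\<^bsub>P\<^esub> \<one>\<^bsub>P\<^esub> = x" if "x \<in> carrier P" for x
    using that
  proof (induction rule: path_induct)
    case zero
    show ?case by (simp add: z P_one_closed)
  next
    case (smult c \<gamma>)
    then show ?case by (simp add: P_smult_mult P_one_closed one_mult_path)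
  next
    case (add x y)
    then show ?case by (simp add: P_l_distr P_r_distr P_one_closed)
  qed
  have "ring P"
  proof (rule ringI)
    show "abelian_group P" by (rule P.abelian_group_axioms)
    show "Group.monoid P" by (rule monoidI) (auto simp: mc P_one_closed assoc one)
  qed (auto simp: P_l_distr P_r_distr)
  then interpret P: ring P .
  show ?thesis by unfold_locales (auto simp: P_smult_mult)
qed

end

context path_alg begin

sublocale P: kalg K P by (rule P_kalg)

lemma paths_append_split:
  assumes "(u, p @ q) \<in> paths Q"
  shows "(u, p) \<in> paths Q" "(path_target Q (u, p), q) \<in> paths Q"
proof -
  obtain v where "awalk u (p @ q) v" using assms by (auto simp: paths_def)
  then have "awalk u p (awlast u p)" "awalk (awlast u p) q v" by (auto simp: awalk_append_iff)
  then show "(u, p) \<in> paths Q" "(path_target Q (u, p), q) \<in> paths Q"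
    by (auto simp: paths_def path_target_def)
qed

lemma path_elt_append:
  assumes "(u, p @ q) \<in> paths Q"
  shows "path_elt K (u, p @ q) = path_elt K (path_target Q (u, p), q) \<otimes>\<^bsub>P\<^esub> path_elt K (u, p)"
  using paths_append_split[OF assms] by (simp add: path_elt_mult)

lemma arrow_path: "x \<in> arcs Q \<Longrightarrow> (tail Q x, [x]) \<in> paths Q \<and> path_target Q (tail Q x, [x]) = head Q x"
  by (simp add: path_Cons path_target_Cons vertex_path)

lemma path_elt_Cons:
  assumes "(u, x # p) \<in> paths Q"
  shows "path_elt K (u, x # p) = path_elt K (head Q x, p) \<otimes>\<^bsub>P\<^esub> path_elt K (tail Q x, [x])"
  using assms arrow_path[of x] by (simp add: path_Cons path_elt_mult)

lemma path_elt_vertex: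
  "\<gamma> \<in> paths Q \<Longrightarrow> path_elt K \<gamma> \<otimes>\<^bsub>P\<^esub> path_elt K (fst \<gamma>, []) = path_elt K \<gamma>"
  "\<gamma> \<in> paths Q \<Longrightarrow> path_elt K (path_target Q \<gamma>, []) \<otimes>\<^bsub>P\<^esub> path_elt K \<gamma> = path_elt K \<gamma>"
  using path_verts[of \<gamma>] by (simp_all add: path_elt_mult vertex_path)

text \<open>
  The paths form a \<open>K\<close>-basis of the path algebra.
\<close>

lemma linear_extension:
  assumes A: "vectorspace K A" and g: "\<And>\<gamma>. \<gamma> \<in> paths Q \<Longrightarrow> g \<gamma> \<in> carrier A"
  obtains \<rho> where "\<rho> \<in> module_hom K P A" "\<And>\<gamma>. \<gamma> \<in> paths Q \<Longrightarrow> \<rho> (path_elt K \<gamma>) = g \<gamma>"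
proof -
  interpret A: vectorspace K A by fact
  let ?r = "\<lambda>x. finsum A (\<lambda>\<gamma>. x \<gamma> \<odot>\<^bsub>A\<^esub> g \<gamma>) {\<gamma>. x \<gamma> \<noteq> \<zero>\<^bsub>K\<^esub>}"
  have supp: "{\<gamma>. x \<gamma> \<noteq> \<zero>\<^bsub>K\<^esub>} \<subseteq> paths Q" "finite {\<gamma>. x \<gamma> \<noteq> \<zero>\<^bsub>K\<^esub>}" if "x \<in> carrier P" for x
    using that by (auto simp: P_simps)
  have super: "?r x = finsum A (\<lambda>\<gamma>. x \<gamma> \<odot>\<^bsub>A\<^esub> g \<gamma>) S"
    if x: "x \<in> carrier P" and S: "finite S" "S \<subseteq> paths Q" "{\<gamma>. x \<gamma> \<noteq> \<zero>\<^bsub>K\<^esub>} \<subseteq> S" for x S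
  proof (rule A.M.add.finprod_mono_neutral_cong_left)
    show "\<And>i. i \<in> S - {\<gamma>. x \<gamma> \<noteq> \<zero>\<^bsub>K\<^esub>} \<Longrightarrow> x i \<odot>\<^bsub>A\<^esub> g i = \<zero>\<^bsub>A\<^esub>"
      using S g by auto
    show "(\<lambda>\<gamma>. x \<gamma> \<odot>\<^bsub>A\<^esub> g \<gamma>) \<in> S \<rightarrow> carrier A"
      using S g P_val[OF x] by auto
  qed (use S in auto)
  have c: "(\<lambda>\<gamma>. x \<gamma> \<odot>\<^bsub>A\<^esub> g \<gamma>) \<in> S \<rightarrow> carrier A" if "x \<in> carrier P" "S \<subseteq> paths Q" for x S
    using that g P_val[OF that(1)] by (auto intro!: A.smult_closed)
  have "?r \<in> module_hom K P A"
  proof (rule module_homI)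
    fix x assume x: "x \<in> carrier P"
    show "?r x \<in> carrier A" by (rule A.finsum_closed[OF c[OF x supp(1)[OF x]]])
    { fix y assume y: "y \<in> carrier P"
      let ?S = "{\<gamma>. x \<gamma> \<noteq> \<zero>\<^bsub>K\<^esub>} \<union> {\<gamma>. y \<gamma> \<noteq> \<zero>\<^bsub>K\<^esub>}"
      have S: "finite ?S" "?S \<subseteq> paths Q" using supp[OF x] supp[OF y] by auto
      have "?r (x \<oplus>\<^bsub>P\<^esub> y) = finsum A (\<lambda>\<gamma>. (x \<oplus>\<^bsub>P\<^esub> y) \<gamma> \<odot>\<^bsub>A\<^esub> g \<gamma>) ?S"
        by (rule super[OF P.a_closed[OF x y] S]) (auto simp: P_simps(4))
      also have "\<dots> = finsum A (\<lambda>\<gamma>. x \<gamma> \<odot>\<^bsub>A\<^esub> g \<gamma> \<oplus>\<^bsub>A\<^esub> y \<gamma> \<odot>\<^bsub>A\<^esub> g \<gamma>) ?S"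
      proof (rule A.finsum_cong')
        fix \<gamma> assume "\<gamma> \<in> ?S"
        then have "\<gamma> \<in> paths Q" using S by blast
        then show "(x \<oplus>\<^bsub>P\<^esub> y) \<gamma> \<odot>\<^bsub>A\<^esub> g \<gamma> = x \<gamma> \<odot>\<^bsub>A\<^esub> g \<gamma> \<oplus>\<^bsub>A\<^esub> y \<gamma> \<odot>\<^bsub>A\<^esub> g \<gamma>"
          using P_val[OF x] P_val[OF y] g by (simp add: P_simps(4) A.smult_l_distr)
      qed (use c[OF x S(2)] c[OF y S(2)] in auto)
      also have "\<dots> = ?r x \<oplus>\<^bsub>A\<^esub> ?r y"
        using super[OF x S] super[OF y S] A.finsum_addf[OF c[OF x S(2)] c[OF y S(2)]] by simp
      finally show "?r (x \<oplus>\<^bsub>P\<^esub> y) = ?r x \<oplus>\<^bsub>A\<^esub> ?r y" . }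
    fix k assume k: "k \<in> carrier K"
    note S = supp[OF x]
    have "?r (k \<odot>\<^bsub>P\<^esub> x) = finsum A (\<lambda>\<gamma>. (k \<odot>\<^bsub>P\<^esub> x) \<gamma> \<odot>\<^bsub>A\<^esub> g \<gamma>) {\<gamma>. x \<gamma> \<noteq> \<zero>\<^bsub>K\<^esub>}"
      by (rule super[OF P.V.smult_closed[OF k x] S(2,1)]) (use k in \<open>auto simp: P_simps(5)\<close>)
    also have "\<dots> = finsum A (\<lambda>\<gamma>. k \<odot>\<^bsub>A\<^esub> (x \<gamma> \<odot>\<^bsub>A\<^esub> g \<gamma>)) {\<gamma>. x \<gamma> \<noteq> \<zero>\<^bsub>K\<^esub>}"
    proof (rule A.finsum_cong')
      fix \<gamma> assume "\<gamma> \<in> {\<gamma>. x \<gamma> \<noteq> \<zero>\<^bsub>K\<^esub>}"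
      then have "\<gamma> \<in> paths Q" using S by blast
      then show "(k \<odot>\<^bsub>P\<^esub> x) \<gamma> \<odot>\<^bsub>A\<^esub> g \<gamma> = k \<odot>\<^bsub>A\<^esub> (x \<gamma> \<odot>\<^bsub>A\<^esub> g \<gamma>)"
        using P_val[OF x] k g by (simp add: P_simps(5) A.smult_assoc1)
    qed (use c[OF x S(1)] k in auto)
    also have "\<dots> = k \<odot>\<^bsub>A\<^esub> ?r x"
      using c[OF x S(1)] k S(2) by (intro A.finsum_smult_ldistr[symmetric]) auto
    finally show "?r (k \<odot>\<^bsub>P\<^esub> x) = k \<odot>\<^bsub>A\<^esub> ?r x" .
  qed
  moreover have "?r (path_elt K \<gamma>) = g \<gamma>" if \<gamma>: "\<gamma> \<in> paths Q" for \<gamma>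
  proof -
    have "?r (path_elt K \<gamma>) = finsum A (\<lambda>\<delta>. path_elt K \<gamma> \<delta> \<odot>\<^bsub>A\<^esub> g \<delta>) {\<gamma>}"
      by (rule super[OF path_elt_closed[OF \<gamma>]]) (use \<gamma> in \<open>auto simp: path_elt_def[of K \<gamma>]\<close>)
    also have "\<dots> = g \<gamma>" using g[OF \<gamma>] by (simp add: path_elt_def)
    finally show ?thesis .
  qed
  ultimately show ?thesis using that by blast
qed

text \<open>
  The universal property of the path algebra: algebra maps correspond to orthogonal idempotents for the
  vertices and elements between them for the arrows.  The map preserves products also when two paths
  do not fit together, because the idempotents are orthogonal.  The image of the unit is the sum of the
  idempotents, which may differ from the unit of \<open>A\<close>.
\<close>

lemma path_algebra_lift:
  assumes A: "kalg K A"
    and V: "\<And>u. u \<in> verts Q \<Longrightarrow> V u \<in> carrier A" "\<And>u. u \<in> verts Q \<Longrightarrow> V u \<otimes>\<^bsub>A\<^esub> V u = V u"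
      "\<And>u w. u \<in> verts Q \<Longrightarrow> w \<in> verts Q \<Longrightarrow> u \<noteq> w \<Longrightarrow> V u \<otimes>\<^bsub>A\<^esub> V w = \<zero>\<^bsub>A\<^esub>"
    and t: "\<And>x. x \<in> arcs Q \<Longrightarrow> t x \<in> carrier A" "\<And>x. x \<in> arcs Q \<Longrightarrow> V (head Q x) \<otimes>\<^bsub>A\<^esub> t x = t x"
      "\<And>x. x \<in> arcs Q \<Longrightarrow> t x \<otimes>\<^bsub>A\<^esub> V (tail Q x) = t x"
  obtains \<rho> where "\<rho> \<in> module_hom K P A"
    "\<And>x y. x \<in> carrier P \<Longrightarrow> y \<in> carrier P \<Longrightarrow> \<rho> (x \<otimes>\<^bsub>P\<^esub> y) = \<rho> x \<otimes>\<^bsub>A\<^esub> \<rho> y"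
    "\<And>u. u \<in> verts Q \<Longrightarrow> \<rho> (path_elt K (u, [])) = V u"
    "\<And>x. x \<in> arcs Q \<Longrightarrow> \<rho> (path_elt K (tail Q x, [x])) = t x"
proof -
  interpret A: kalg K A by fact
  \<comment> \<open>the product of the arrows, multiplied on the left by the idempotent of the end point, which is the value at trivial paths\<close>
  define val where "val = rec_list V (\<lambda>x p r u. r (head Q x) \<otimes>\<^bsub>A\<^esub> t x)"
  have val_simps: "val [] u = V u" "val (x # p) u = val p (head Q x) \<otimes>\<^bsub>A\<^esub> t x" for u x p
    by (simp_all add: val_def)
  have val: "val p u \<in> carrier A \<and> val p u \<otimes>\<^bsub>A\<^esub> V u = val p u \<and> V (path_target Q (u, p)) \<otimes>\<^bsub>A\<^esub> val p u = val p u"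
    if "(u, p) \<in> paths Q" for u p
    using that
  proof (induction p arbitrary: u)
    case Nil
    then show ?case using V by (simp add: val_simps vertex_path)
  next
    case (Cons x p)
    then have x: "x \<in> arcs Q" "tail Q x = u" "(head Q x, p) \<in> paths Q" by (simp_all add: path_Cons)
    have vc: "V u \<in> carrier A" "V (path_target Q (head Q x, p)) \<in> carrier A"
      using path_verts[OF x(3)] path_verts(1)[OF Cons.prems] V(1) by auto
    show ?case using Cons.IH[OF x(3)] t[OF x(1)] x(2) vc
      by (simp add: val_simps path_target_Cons A.m_assoc) (simp flip: A.m_assoc)
  qed
  have val_append: "val (p @ q) u = val q (path_target Q (u, p)) \<otimes>\<^bsub>A\<^esub> val p u" if "(u, p @ q) \<in> paths Q" for u p q
    using that
  proof (induction p arbitrary: u)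
    case Nil
    then show ?case using val[of u q] by (simp add: val_simps vertex_path)
  next
    case (Cons x p)
    then have x: "x \<in> arcs Q" "tail Q x = u" "(head Q x, p @ q) \<in> paths Q" by (simp_all add: path_Cons)
    show ?case using Cons.IH[OF x(3)] t[OF x(1)] val paths_append_split[OF x(3)]
      by (simp add: val_simps path_target_Cons A.m_assoc)
  qed
  have val_closed: "val (snd \<gamma>) (fst \<gamma>) \<in> carrier A" if "\<gamma> \<in> paths Q" for \<gamma>
    using val[of "fst \<gamma>" "snd \<gamma>"] that by simp
  have "\<exists>\<rho>. \<rho> \<in> module_hom K P A \<and> (\<forall>\<gamma>\<in>paths Q. \<rho> (path_elt K \<gamma>) = val (snd \<gamma>) (fst \<gamma>))"
  proof (rule linear_extension[OF A.V.vectorspace_axioms, of "\<lambda>\<gamma>. val (snd \<gamma>) (fst \<gamma>)"])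
    fix \<gamma> assume "\<gamma> \<in> paths Q"
    then show "val (snd \<gamma>) (fst \<gamma>) \<in> carrier A" by (rule val_closed)
  qed blast
  then obtain \<rho> where \<rho>: "\<rho> \<in> module_hom K P A" "\<And>\<gamma>. \<gamma> \<in> paths Q \<Longrightarrow> \<rho> (path_elt K \<gamma>) = val (snd \<gamma>) (fst \<gamma>)"
    by blast
  note \<rho>D = module_homD[OF \<rho>(1)]
  have \<rho>0: "\<rho> \<zero>\<^bsub>P\<^esub> = \<zero>\<^bsub>A\<^esub>" by (rule module_hom_zero[OF P_vectorspace A.V.vectorspace_axioms \<rho>(1)])
  have elt: "\<rho> (path_elt K \<beta> \<otimes>\<^bsub>P\<^esub> path_elt K \<alpha>) = \<rho> (path_elt K \<beta>) \<otimes>\<^bsub>A\<^esub> \<rho> (path_elt K \<alpha>)"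
    if \<beta>: "\<beta> \<in> paths Q" and \<alpha>: "\<alpha> \<in> paths Q" for \<alpha> \<beta>
  proof (cases "path_target Q \<alpha> = fst \<beta>")
    case True
    then show ?thesis
      using \<alpha> \<beta> paths_concat[OF \<beta> \<alpha> True] val_append[of "fst \<alpha>" "snd \<alpha>" "snd \<beta>"] by (simp add: path_elt_mult \<rho>(2))
  next
    case False
    let ?b = "val (snd \<beta>) (fst \<beta>)" and ?a = "val (snd \<alpha>) (fst \<alpha>)"
    have b: "?b \<in> carrier A" "?b \<otimes>\<^bsub>A\<^esub> V (fst \<beta>) = ?b" using val[of "fst \<beta>" "snd \<beta>"] \<beta> by auto
    have a: "?a \<in> carrier A" "V (path_target Q \<alpha>) \<otimes>\<^bsub>A\<^esub> ?a = ?a" using val[of "fst \<alpha>" "snd \<alpha>"] \<alpha> by auto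
    have vv: "V (fst \<beta>) \<in> carrier A" "V (path_target Q \<alpha>) \<in> carrier A" "V (fst \<beta>) \<otimes>\<^bsub>A\<^esub> V (path_target Q \<alpha>) = \<zero>\<^bsub>A\<^esub>"
      using path_verts(1)[OF \<beta>] path_verts(2)[OF \<alpha>] False V by auto
    have "?b \<otimes>\<^bsub>A\<^esub> ?a = (?b \<otimes>\<^bsub>A\<^esub> V (fst \<beta>)) \<otimes>\<^bsub>A\<^esub> (V (path_target Q \<alpha>) \<otimes>\<^bsub>A\<^esub> ?a)" by (simp only: a b)
    also have "\<dots> = ?b \<otimes>\<^bsub>A\<^esub> (V (fst \<beta>) \<otimes>\<^bsub>A\<^esub> V (path_target Q \<alpha>)) \<otimes>\<^bsub>A\<^esub> ?a"
      using a(1) b(1) vv(1,2) by (simp only: A.m_assoc A.m_closed)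
    also have "\<dots> = \<zero>\<^bsub>A\<^esub>" using a(1) b(1) vv(3) by simp
    finally show ?thesis using \<alpha> \<beta> False by (simp add: path_elt_mult \<rho>(2) \<rho>0)
  qed
  have mult: "\<rho> (x \<otimes>\<^bsub>P\<^esub> y) = \<rho> x \<otimes>\<^bsub>A\<^esub> \<rho> y" if x: "x \<in> carrier P" and y: "y \<in> carrier P" for x y
    using x
  proof (induction rule: path_induct)
    case zero
    then show ?case using y by (simp add: \<rho>0 \<rho>D)
  next
    case (add x x')
    then show ?case using y by (simp add: P.l_distr A.l_distr \<rho>D)
  next
    case (smult c \<beta>)
    note c1 = smult
    have "\<rho> (path_elt K \<beta> \<otimes>\<^bsub>P\<^esub> y) = \<rho> (path_elt K \<beta>) \<otimes>\<^bsub>A\<^esub> \<rho> y" using y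
    proof (induction rule: path_induct)
      case zero
      then show ?case using c1 by (simp add: \<rho>0 \<rho>D)
    next
      case (add y y')
      then show ?case using c1 by (simp add: P.r_distr A.r_distr \<rho>D)
    next
      case (smult d \<alpha>)
      then show ?case using c1 by (simp add: P.smult_mult_right A.smult_mult_right \<rho>D elt)
    qed
    then show ?case using c1 y by (simp add: P.smult_mult_left A.smult_mult_left \<rho>D)
  qed
  show ?thesis
  proof (rule that[OF \<rho>(1)])
    fix x y assume "x \<in> carrier P" "y \<in> carrier P"
    then show "\<rho> (x \<otimes>\<^bsub>P\<^esub> y) = \<rho> x \<otimes>\<^bsub>A\<^esub> \<rho> y" by (rule mult)
  next
    fix u assume "u \<in> verts Q"
    then show "\<rho> (path_elt K (u, [])) = V u" by (simp add: \<rho>(2) vertex_path val_simps)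
  next
    fix x assume x: "x \<in> arcs Q"
    then show "\<rho> (path_elt K (tail Q x, [x])) = t x"
      using arrow_path[OF x] t[OF x] by (simp add: \<rho>(2) val_simps)
  qed
qed

text \<open>
  A path of length at least \<open>n\<close> is a multiple of the path formed by its first \<open>n\<close> arrows and hence
  vanishes in the quotient, and there are finitely many shorter paths.
\<close>

lemma quot_fin_dim:
  assumes I: "ideal I P" and long: "length_ideal K Q n \<subseteq> I"
  shows "vectorspace.fin_dim K (quot_module P I)"
proof -
  note Q = quot_module_vectorspace[OF P.ideal_subspace[OF I]]
  interpret B: vectorspace K "quot_module P I" by (rule Q(1))
  let ?S = "{\<gamma> \<in> paths Q. length (snd \<gamma>) < n}"
  let ?W = "{x \<in> carrier P. \<forall>\<gamma>. x \<gamma> \<noteq> \<zero>\<^bsub>K\<^esub> \<longrightarrow> length (snd \<gamma>) < n}"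
  have W: "subspace K ?W P"
  proof (rule subspaceI[OF P_vectorspace])
    fix x y assume xy: "x \<in> ?W" "y \<in> ?W"
    have "length (snd \<gamma>) < n" if "x \<gamma> \<oplus>\<^bsub>K\<^esub> y \<gamma> \<noteq> \<zero>\<^bsub>K\<^esub>" for \<gamma>
    proof -
      have "x \<gamma> \<noteq> \<zero>\<^bsub>K\<^esub> \<or> y \<gamma> \<noteq> \<zero>\<^bsub>K\<^esub>" using that by (cases "x \<gamma> = \<zero>\<^bsub>K\<^esub>") auto
      then show ?thesis using xy by blast
    qed
    moreover have "x \<oplus>\<^bsub>P\<^esub> y \<in> carrier P" using xy by (intro P.a_closed) auto
    ultimately show "x \<oplus>\<^bsub>P\<^esub> y \<in> ?W" by (simp add: P_simps(4) del: split_paired_All)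
  next
    fix c x assume cx: "c \<in> carrier K" "x \<in> ?W"
    have "length (snd \<gamma>) < n" if "c \<otimes>\<^bsub>K\<^esub> x \<gamma> \<noteq> \<zero>\<^bsub>K\<^esub>" for \<gamma>
    proof -
      have "x \<gamma> \<noteq> \<zero>\<^bsub>K\<^esub>" using that cx(1) by auto
      then show ?thesis using cx(2) by blast
    qed
    moreover have "c \<odot>\<^bsub>P\<^esub> x \<in> carrier P" using cx by (intro P.V.smult_closed) auto
    ultimately show "c \<odot>\<^bsub>P\<^esub> x \<in> ?W" by (simp add: P_simps(5) del: split_paired_All)
  qed (use P.zero_closed in \<open>auto simp: P_simps(3)\<close>)
  have "finite {p. set p \<subseteq> arcs Q \<and> length p \<le> n}" by (rule finite_lists_length_le[OF finite_arcs])
  then have "finite (verts Q \<times> {p. set p \<subseteq> arcs Q \<and> length p \<le> n})" using finite_verts by blast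
  then have fS: "finite ?S"
    by (rule finite_subset[rotated]) (auto simp: paths_def awalk_def)
  have "dual_basis K (P\<lparr>carrier := ?W\<rparr>) ?S (path_elt K) (\<lambda>\<gamma> x. x \<gamma>)"
  proof (rule dual_basisI[OF subspaceD(6)[OF W] fS])
    fix \<gamma> assume g: "\<gamma> \<in> ?S"
    then show "path_elt K \<gamma> \<in> carrier (P\<lparr>carrier := ?W\<rparr>)"
      using path_elt_closed[of \<gamma>] by (auto simp: path_elt_def)
    show "(\<lambda>x. x \<gamma>) \<in> module_hom K (P\<lparr>carrier := ?W\<rparr>) (field_space K)"
      by (rule module_homI) (auto simp: P_val P_simps(4,5))
    fix \<delta> assume "\<delta> \<in> ?S"
    show "path_elt K \<delta> \<gamma> = (if \<gamma> = \<delta> then \<one>\<^bsub>K\<^esub> else \<zero>\<^bsub>K\<^esub>)" by (simp add: path_elt_def)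
  next
    fix x assume x: "x \<in> carrier (P\<lparr>carrier := ?W\<rparr>)" and 0: "\<And>\<gamma>. \<gamma> \<in> ?S \<Longrightarrow> x \<gamma> = \<zero>\<^bsub>K\<^esub>"
    have "x \<gamma> = \<zero>\<^bsub>K\<^esub>" for \<gamma>
    proof (rule ccontr)
      assume nz: "x \<gamma> \<noteq> \<zero>\<^bsub>K\<^esub>"
      have xP: "x \<in> carrier P" and short: "length (snd \<gamma>) < n"
        using x nz by (auto simp del: split_paired_All)
      have "\<gamma> \<in> paths Q" using xP nz unfolding P_simps(1) by blast
      then show False using 0[of \<gamma>] short nz by simp
    qed
    then show "x = \<zero>\<^bsub>P\<lparr>carrier := ?W\<rparr>\<^esub>" by (simp add: P_simps(3) fun_eq_iff)
  qed
  from dual_basis_dim(1)[OF subspaceD(6)[OF W] this]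
  have fW: "vectorspace.fin_dim K (P\<lparr>carrier := ?W\<rparr>)" .
  let ?p = "\<lambda>x. I +>\<^bsub>P\<^esub> x"
  have hom: "?p \<in> module_hom K (P\<lparr>carrier := ?W\<rparr>) (quot_module P I)"
    by (rule module_homI) (use module_homD[OF Q(2)] in \<open>auto simp del: quot_module_simps\<close>)
  have "\<exists>w\<in>?W. ?p w = ?p x" if "x \<in> carrier P" for x
    using that
  proof (induction rule: path_induct)
    case zero
    show ?case using subspaceD(3)[OF W] by blast
  next
    case (add x y)
    then obtain v w where "v \<in> ?W" "?p v = ?p x" "w \<in> ?W" "?p w = ?p y" by blast
    then show ?case using add(1,2) subspaceD(4)[OF W, of v w] module_homD(2)[OF Q(2)]
      by (intro bexI[of _ "v \<oplus>\<^bsub>P\<^esub> w"]) (auto simp del: quot_module_simps)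
  next
    case (smult c \<gamma>)
    interpret I: ideal I P by (rule I)
    show ?case
    proof (cases "length (snd \<gamma>) < n")
      case True
      then have "path_elt K \<gamma> \<in> ?W" using smult path_elt_closed[of \<gamma>] by (auto simp: path_elt_def)
      then show ?thesis using subspaceD(5)[OF W smult(1)] by blast
    next
      case False
      let ?a = "(fst \<gamma>, take n (snd \<gamma>))" and ?b = "(path_target Q (fst \<gamma>, take n (snd \<gamma>)), drop n (snd \<gamma>))"
      have \<gamma>: "(fst \<gamma>, take n (snd \<gamma>) @ drop n (snd \<gamma>)) \<in> paths Q" using smult(2) by simp
      note ab = paths_append_split[OF \<gamma>]
      have "path_elt K ` {\<gamma> \<in> paths Q. length (snd \<gamma>) = n} \<subseteq> carrier P" using path_elt_closed by blast
      from P.genideal_self[OF this] have "path_elt K ?a \<in> length_ideal K Q n"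
        unfolding length_ideal_def
      proof (rule subsetD)
        show "path_elt K ?a \<in> path_elt K ` {\<gamma> \<in> paths Q. length (snd \<gamma>) = n}"
          using ab(1) False by (intro imageI CollectI) simp
      qed
      then have "path_elt K ?b \<otimes>\<^bsub>P\<^esub> path_elt K ?a \<in> I"
        using long path_elt_closed[OF ab(2)] by (intro I.I_l_closed) auto
      then have "path_elt K \<gamma> \<in> I" using path_elt_append[OF \<gamma>] by simp
      then have "c \<odot>\<^bsub>P\<^esub> path_elt K \<gamma> \<in> I" using subspaceD(5)[OF P.ideal_subspace[OF I] smult(1)] by blast
      then have "?p (c \<odot>\<^bsub>P\<^esub> path_elt K \<gamma>) = ?p \<zero>\<^bsub>P\<^esub>"
        using Q(4)[OF I.a_Hcarr] module_hom_zero[OF P_vectorspace Q(1,2)] by (simp del: quot_module_simps)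
      then show ?thesis by (intro bexI[OF sym subspaceD(3)[OF W]])
    qed
  qed
  then have "?p ` ?W = ?p ` carrier P" by (blast intro: image_eqI[OF sym])
  then have "?p ` carrier (P\<lparr>carrier := ?W\<rparr>) = carrier (quot_module P I)"
    unfolding Q(3)[symmetric] by (simp del: split_paired_All)
  then show ?thesis by (intro dim_exact(2)[OF subspaceD(6)[OF W] Q(1) fW hom])
qed

end

section \<open>The algebra with one new arrow\<close>

locale quiver_arrow = path_alg K Q
  for K :: "('k, 'z) ring_scheme" and Q :: "('v, 'e) pre_digraph" +
  fixes I :: "('v \<times> 'e list \<Rightarrow> 'k) set" and n :: nat and a :: 'e and e f :: 'v
  assumes I: "ideal I P" and long: "length_ideal K Q n \<subseteq> I"
    and a: "a \<notin> arcs Q" and e: "e \<in> verts Q" and f: "f \<in> verts Q"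
    and not_rel_loop: "\<not> relative_loop (quot_module P I) (vertex_elt K Q I e) (vertex_elt K Q I f)"
begin

abbreviation "Qa \<equiv> add_arrow Q a e f"
abbreviation "Pa \<equiv> path_algebra K Qa"
abbreviation "B \<equiv> quot_module P I"
abbreviation "eB \<equiv> vertex_elt K Q I e"
abbreviation "fB \<equiv> vertex_elt K Q I f"
abbreviation "cl x \<equiv> I +>\<^bsub>P\<^esub> x"

lemma Qa_simps: "verts Qa = verts Q" "arcs Qa = insert a (arcs Q)"
  "tail Qa x = (if x = a then e else tail Q x)" "head Qa x = (if x = a then f else head Q x)"
  by (simp_all add: add_arrow_def)

sublocale Pa: path_alg K Qa
  by unfold_locales
    (auto simp: Qa_simps e f tail_in_verts head_in_verts finite_verts finite_arcs split: if_splits)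

lemma paths_Qa: "(u, p) \<in> paths Q \<Longrightarrow> (u, p) \<in> paths Qa \<and> path_target Qa (u, p) = path_target Q (u, p)"
proof (induction p arbitrary: u)
  case Nil
  then show ?case by (simp add: vertex_path Pa.vertex_path Qa_simps)
next
  case (Cons x p)
  then have x: "x \<in> arcs Q" "tail Q x = u" "(head Q x, p) \<in> paths Q" by (simp_all add: path_Cons)
  moreover have "x \<noteq> a" using x(1) a by auto
  ultimately show ?case using Cons.IH[OF x(3)]
    by (simp add: Pa.path_Cons Pa.path_target_Cons path_target_Cons Qa_simps)
qed

lemma paths_Q: "(u, p) \<in> paths Qa \<Longrightarrow> a \<notin> set p \<Longrightarrow> (u, p) \<in> paths Q"
proof (induction p arbitrary: u)
  case Nil
  then show ?case by (simp add: vertex_path Pa.vertex_path Qa_simps)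
next
  case (Cons x p)
  then show ?case by (auto simp: Pa.path_Cons path_Cons Qa_simps split: if_splits)
qed

lemma P_subset_Pa: "x \<in> carrier P \<Longrightarrow> x \<in> carrier Pa"
  using paths_Qa by (simp add: P_simps(1) Pa.P_simps(1)) blast

lemma P_Pa: "zero Pa = zero P" "add Pa = add P" "smult Pa = smult P"
  by (simp_all add: P_simps Pa.P_simps)

sublocale B: kalg K B by (rule P.quot_module_kalg(1)[OF I])

lemma cl_hom: "cl \<in> module_hom K P B" and cl_surj: "cl ` carrier P = carrier B"
  and cl_zero: "x \<in> carrier P \<Longrightarrow> cl x = \<zero>\<^bsub>B\<^esub> \<longleftrightarrow> x \<in> I"
  using quot_module_vectorspace[OF P.ideal_subspace[OF I]] by blast+

lemma cl_mult: "x \<in> carrier P \<Longrightarrow> y \<in> carrier P \<Longrightarrow> cl (x \<otimes>\<^bsub>P\<^esub> y) = cl x \<otimes>\<^bsub>B\<^esub> cl y"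
  by (rule P.quot_module_kalg(2)[OF I])

lemma cl_closed: "x \<in> carrier P \<Longrightarrow> cl x \<in> carrier B"
  by (rule module_homD(1)[OF cl_hom])

lemma vertex_closed: "u \<in> verts Q \<Longrightarrow> path_elt K (u, []) \<in> carrier P"
  by (simp add: vertex_path)

lemma vertex_mult: "u \<in> verts Q \<Longrightarrow> w \<in> verts Q \<Longrightarrow>
    path_elt K (u, []) \<otimes>\<^bsub>P\<^esub> path_elt K (w, []) = (if w = u then path_elt K (u, []) else \<zero>\<^bsub>P\<^esub>)"
  by (auto simp: path_elt_mult vertex_path)

lemma eB_fB: "eB = cl (path_elt K (e, []))" "fB = cl (path_elt K (f, []))"
  by (simp_all add: vertex_elt_def)

sublocale N: new_arrow K B eB fB
proof unfold_locales
  show eB: "eB \<in> carrier B" "eB \<otimes>\<^bsub>B\<^esub> eB = eB"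
    unfolding eB_fB by (simp_all only: cl_closed vertex_closed e cl_mult[symmetric] vertex_mult refl if_True)
  show fB: "fB \<in> carrier B" "fB \<otimes>\<^bsub>B\<^esub> fB = fB"
    unfolding eB_fB by (simp_all only: cl_closed vertex_closed f cl_mult[symmetric] vertex_mult refl if_True)
  show "vectorspace.fin_dim K B" by (rule quot_fin_dim[OF I long])
  fix b assume "b \<in> carrier B"
  then have "eB \<otimes>\<^bsub>B\<^esub> b \<otimes>\<^bsub>B\<^esub> fB \<in> carrier (corner B eB fB)" unfolding corner_def by auto
  then show "eB \<otimes>\<^bsub>B\<^esub> b \<otimes>\<^bsub>B\<^esub> fB = \<zero>\<^bsub>B\<^esub>" using not_rel_loop unfolding relative_loop_def by blast
qed

text \<open>
  The class of the path lies in \<open>e B f\<close>.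
\<close>

lemma P_path_in_I:
  assumes "(f, q) \<in> paths Q" "path_target Q (f, q) = e"
  shows "path_elt K (f, q) \<in> I"
proof -
  have c: "path_elt K (f, q) \<in> carrier P" by (rule path_elt_closed[OF assms(1)])
  have "path_elt K (f, q) = path_elt K (e, []) \<otimes>\<^bsub>P\<^esub> path_elt K (f, q) \<otimes>\<^bsub>P\<^esub> path_elt K (f, [])"
    using path_elt_vertex[OF assms(1)] assms(2) by simp
  then have "cl (path_elt K (f, q)) = eB \<otimes>\<^bsub>B\<^esub> cl (path_elt K (f, q)) \<otimes>\<^bsub>B\<^esub> fB"
    using c vertex_closed[OF e] vertex_closed[OF f] by (metis eB_fB cl_mult P.m_closed)
  also have "\<dots> = \<zero>\<^bsub>B\<^esub>" by (rule N.not_loop[OF cl_closed[OF c]])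
  finally show ?thesis using cl_zero[OF c] by blast
qed

abbreviation "Ia \<equiv> Idl\<^bsub>Pa\<^esub> I"
abbreviation "Ba \<equiv> quot_module Pa Ia"
abbreviation "cla x \<equiv> Ia +>\<^bsub>Pa\<^esub> x"

lemma I_subset: "I \<subseteq> carrier P"
proof -
  interpret I: ideal I P by (rule I)
  show ?thesis by (rule I.a_subset)
qed

lemma I_Pa: "I \<subseteq> carrier Pa" using I_subset P_subset_Pa by blast

lemma Ia: "ideal Ia Pa" "I \<subseteq> Ia"
  by (rule Pa.P.genideal_ideal[OF I_Pa], rule Pa.P.genideal_self[OF I_Pa])

sublocale Ba: kalg K Ba by (rule Pa.P.quot_module_kalg(1)[OF Ia(1)])

lemma cla_hom: "cla \<in> module_hom K Pa Ba" and cla_surj: "cla ` carrier Pa = carrier Ba"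
  and cla_zero: "x \<in> carrier Pa \<Longrightarrow> cla x = \<zero>\<^bsub>Ba\<^esub> \<longleftrightarrow> x \<in> Ia"
  using quot_module_vectorspace[OF Pa.P.ideal_subspace[OF Ia(1)]] by blast+

lemma cla_mult: "x \<in> carrier Pa \<Longrightarrow> y \<in> carrier Pa \<Longrightarrow> cla (x \<otimes>\<^bsub>Pa\<^esub> y) = cla x \<otimes>\<^bsub>Ba\<^esub> cla y"
  by (rule Pa.P.quot_module_kalg(2)[OF Ia(1)])

lemma cla_closed: "x \<in> carrier Pa \<Longrightarrow> cla x \<in> carrier Ba"
  by (rule module_homD(1)[OF cla_hom])

abbreviation "pa \<equiv> path_elt K (e, [a])"

lemma arrow_a: "(e, [a]) \<in> paths Qa" "path_target Qa (e, [a]) = f" "pa \<in> carrier Pa"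
  using Pa.arrow_path[of a] Pa.path_elt_closed[of "(e, [a])"] by (auto simp: Qa_simps)

text \<open>
  The cut is made at the first occurrence of the new arrow, so that the part which is traversed before
  it belongs to the original quiver.
\<close>

lemma cut_at_arrow:
  assumes "(u, p) \<in> paths Qa" "a \<in> set p"
  obtains s q where "p = s @ a # q" "(u, s) \<in> paths Q" "path_target Q (u, s) = e" "(f, q) \<in> paths Qa"
    "path_elt K (u, p) = path_elt K (f, q) \<otimes>\<^bsub>Pa\<^esub> pa \<otimes>\<^bsub>Pa\<^esub> path_elt K (u, s)"
proof -
  obtain s q where p: "p = s @ a # q" "a \<notin> set s" using split_list_first[OF assms(2)] by blast
  note sp = Pa.paths_append_split[OF assms(1)[unfolded p(1)]]
  have s: "(u, s) \<in> paths Q" by (rule paths_Q[OF sp(1) p(2)])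
  have tgt: "path_target Qa (u, s) = e" and q: "(f, q) \<in> paths Qa"
    using sp(2) by (simp_all add: Pa.path_Cons Qa_simps)
  have "path_elt K (u, p) = path_elt K (e, a # q) \<otimes>\<^bsub>Pa\<^esub> path_elt K (u, s)"
    using Pa.path_elt_append[OF assms(1)[unfolded p(1)]] tgt p(1) by simp
  also have "path_elt K (e, a # q) = path_elt K (f, q) \<otimes>\<^bsub>Pa\<^esub> pa"
    using Pa.path_elt_Cons[OF sp(2)[unfolded tgt]] by (simp add: Qa_simps)
  finally show ?thesis using that p(1) s tgt q paths_Qa[OF s] by simp
qed

text \<open>
  The map \<open>\<rho> : KQ\<^bsub>{a}\<^esub> \<rightarrow> T\<close> is the projection to \<open>B\<close> on paths of \<open>Q\<close> and sends the new arrow to \<open>\<alpha>\<close>.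
\<close>

lemma rho_exists:
  obtains \<rho> where "\<rho> \<in> module_hom K Pa N.T"
    "\<And>x y. x \<in> carrier Pa \<Longrightarrow> y \<in> carrier Pa \<Longrightarrow> \<rho> (x \<otimes>\<^bsub>Pa\<^esub> y) = \<rho> x \<otimes>\<^bsub>N.T\<^esub> \<rho> y"
    "\<And>x. x \<in> carrier P \<Longrightarrow> \<rho> x = N.J (cl x)" "\<rho> pa = N.\<alpha>"
proof -
  let ?V = "\<lambda>u. N.J (cl (path_elt K (u, [])))"
  let ?t = "\<lambda>x. if x = a then N.\<alpha> else N.J (cl (path_elt K (tail Q x, [x])))"
  have "\<exists>\<rho>. \<rho> \<in> module_hom K Pa N.T \<and>
    (\<forall>x\<in>carrier Pa. \<forall>y\<in>carrier Pa. \<rho> (x \<otimes>\<^bsub>Pa\<^esub> y) = \<rho> x \<otimes>\<^bsub>N.T\<^esub> \<rho> y) \<and>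
    (\<forall>u\<in>verts Qa. \<rho> (path_elt K (u, [])) = ?V u) \<and>
    (\<forall>x\<in>arcs Qa. \<rho> (path_elt K (tail Qa x, [x])) = ?t x)"
  proof (rule Pa.path_algebra_lift[OF N.T.kalg_axioms, of ?V ?t])
    fix u assume "u \<in> verts Qa"
    then have u: "u \<in> verts Q" by (simp add: Qa_simps)
    show "?V u \<in> carrier N.T" by (intro N.J_closed cl_closed vertex_closed u)
    show "?V u \<otimes>\<^bsub>N.T\<^esub> ?V u = ?V u"
      using N.J_mult[OF cl_closed[OF vertex_closed[OF u]] cl_closed[OF vertex_closed[OF u]]]
        cl_mult[OF vertex_closed[OF u] vertex_closed[OF u]] vertex_mult[OF u u] by simp
    fix w assume "w \<in> verts Qa" and uw: "u \<noteq> w"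
    then have w: "w \<in> verts Q" by (simp add: Qa_simps)
    have "cl (path_elt K (u, [])) \<otimes>\<^bsub>B\<^esub> cl (path_elt K (w, [])) = cl \<zero>\<^bsub>P\<^esub>"
      using cl_mult[OF vertex_closed[OF u] vertex_closed[OF w]] vertex_mult[OF u w] uw by simp
    also have "cl \<zero>\<^bsub>P\<^esub> = \<zero>\<^bsub>B\<^esub>" by (rule module_hom_zero[OF P_vectorspace B.V.vectorspace_axioms cl_hom])
    finally show "?V u \<otimes>\<^bsub>N.T\<^esub> ?V w = \<zero>\<^bsub>N.T\<^esub>"
      using N.J_mult[OF cl_closed[OF vertex_closed[OF u]] cl_closed[OF vertex_closed[OF w]]] N.J_zero by simp
  next
    fix x assume "x \<in> arcs Qa"
    then have x: "x \<noteq> a \<Longrightarrow> x \<in> arcs Q" by (auto simp: Qa_simps)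
    have ap: "(tail Q x, [x]) \<in> paths Q" "path_target Q (tail Q x, [x]) = head Q x" if "x \<noteq> a"
      using arrow_path[OF x[OF that]] by auto
    have c: "cl (path_elt K (tail Q x, [x])) \<in> carrier B" if "x \<noteq> a"
      by (rule cl_closed[OF path_elt_closed[OF ap(1)[OF that]]])
    show "?t x \<in> carrier N.T" using c N.J_closed by simp
    show "?V (head Qa x) \<otimes>\<^bsub>N.T\<^esub> ?t x = ?t x"
    proof (cases "x = a")
      case True
      then show ?thesis using N.\<alpha>_corner(1) by (simp add: Qa_simps eB_fB)
    next
      case False
      have h: "head Q x \<in> verts Q" using head_in_verts[OF x[OF False]] .
      have "cl (path_elt K (head Q x, [])) \<otimes>\<^bsub>B\<^esub> cl (path_elt K (tail Q x, [x])) = cl (path_elt K (tail Q x, [x]))"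
        using cl_mult[OF vertex_closed[OF h] path_elt_closed[OF ap(1)[OF False]]]
          path_elt_vertex(2)[OF ap(1)[OF False]] ap(2)[OF False] by simp
      then show ?thesis
        using N.J_mult[OF cl_closed[OF vertex_closed[OF h]] c[OF False]] False by (simp add: Qa_simps)
    qed
    show "?t x \<otimes>\<^bsub>N.T\<^esub> ?V (tail Qa x) = ?t x"
    proof (cases "x = a")
      case True
      then show ?thesis using N.\<alpha>_corner(2) by (simp add: Qa_simps eB_fB)
    next
      case False
      have h: "tail Q x \<in> verts Q" using tail_in_verts[OF x[OF False]] .
      have "cl (path_elt K (tail Q x, [x])) \<otimes>\<^bsub>B\<^esub> cl (path_elt K (tail Q x, [])) = cl (path_elt K (tail Q x, [x]))"
        using cl_mult[OF path_elt_closed[OF ap(1)[OF False]] vertex_closed[OF h]]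
          path_elt_vertex(1)[OF ap(1)[OF False]] by simp
      then show ?thesis
        using N.J_mult[OF c[OF False] cl_closed[OF vertex_closed[OF h]]] False by (simp add: Qa_simps)
    qed
  qed blast
  then obtain \<rho> where \<rho>: "\<rho> \<in> module_hom K Pa N.T"
    "\<And>x y. x \<in> carrier Pa \<Longrightarrow> y \<in> carrier Pa \<Longrightarrow> \<rho> (x \<otimes>\<^bsub>Pa\<^esub> y) = \<rho> x \<otimes>\<^bsub>N.T\<^esub> \<rho> y"
    "\<And>u. u \<in> verts Qa \<Longrightarrow> \<rho> (path_elt K (u, [])) = ?V u"
    "\<And>x. x \<in> arcs Qa \<Longrightarrow> \<rho> (path_elt K (tail Qa x, [x])) = ?t x" by blast
  note \<rho>D = module_homD[OF \<rho>(1)]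
  have elt: "\<rho> (path_elt K (u, p)) = N.J (cl (path_elt K (u, p)))" if "(u, p) \<in> paths Q" for u p
    using that
  proof (induction p arbitrary: u)
    case Nil
    then show ?case using \<rho>(3)[of u] by (simp add: vertex_path Qa_simps)
  next
    case (Cons x p)
    then have x: "x \<in> arcs Q" "tail Q x = u" "(head Q x, p) \<in> paths Q" by (simp_all add: path_Cons)
    have xa: "x \<noteq> a" using x(1) a by auto
    have ap: "(tail Q x, [x]) \<in> paths Q" using arrow_path[OF x(1)] by simp
    note c1 = path_elt_closed[OF x(3)] and c2 = path_elt_closed[OF ap]
    have t: "\<rho> (path_elt K (tail Q x, [x])) = N.J (cl (path_elt K (tail Q x, [x])))"
      using \<rho>(4)[of x] x(1) xa by (simp add: Qa_simps)
    have "(u, x # p) \<in> paths Qa" using paths_Qa[OF Cons.prems] by simp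
    from Pa.path_elt_Cons[OF this]
    have "\<rho> (path_elt K (u, x # p)) = \<rho> (path_elt K (head Q x, p)) \<otimes>\<^bsub>N.T\<^esub> \<rho> (path_elt K (tail Q x, [x]))"
      using \<rho>(2)[OF P_subset_Pa[OF c1] P_subset_Pa[OF c2]] xa by (simp add: Qa_simps)
    also have "\<dots> = N.J (cl (path_elt K (head Q x, p)) \<otimes>\<^bsub>B\<^esub> cl (path_elt K (tail Q x, [x])))"
      unfolding t Cons.IH[OF x(3)] by (rule N.J_mult[OF cl_closed[OF c1] cl_closed[OF c2], symmetric])
    also have "\<dots> = N.J (cl (path_elt K (u, x # p)))"
      unfolding cl_mult[OF c1 c2, symmetric] path_elt_Cons[OF Cons.prems] ..
    finally show ?case .
  qed
  have "\<rho> x = N.J (cl x)" if "x \<in> carrier P" for x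
    using that
  proof (induction rule: path_induct)
    case zero
    show ?case
      using module_hom_zero[OF Pa.P_vectorspace N.T.V.vectorspace_axioms \<rho>(1)] N.J_zero
        module_hom_zero[OF P_vectorspace B.V.vectorspace_axioms cl_hom] by (simp add: P_Pa)
  next
    case (smult c \<gamma>)
    have "\<rho> (c \<odot>\<^bsub>P\<^esub> path_elt K \<gamma>) = c \<odot>\<^bsub>N.T\<^esub> \<rho> (path_elt K \<gamma>)"
      using \<rho>D(3)[OF smult(1) P_subset_Pa[OF path_elt_closed[OF smult(2)]]] by (simp add: P_Pa)
    also have "\<dots> = N.J (c \<odot>\<^bsub>B\<^esub> cl (path_elt K \<gamma>))"
      using elt[of "fst \<gamma>" "snd \<gamma>"] smult by (simp add: N.J_smult del: quot_module_simps)
    also have "c \<odot>\<^bsub>B\<^esub> cl (path_elt K \<gamma>) = cl (c \<odot>\<^bsub>P\<^esub> path_elt K \<gamma>)"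
      by (rule module_homD(3)[OF cl_hom smult(1) path_elt_closed[OF smult(2)], symmetric])
    finally show ?case .
  next
    case (add x y)
    have "\<rho> (x \<oplus>\<^bsub>P\<^esub> y) = \<rho> x \<oplus>\<^bsub>N.T\<^esub> \<rho> y"
      using \<rho>D(2)[OF P_subset_Pa[OF add(1)] P_subset_Pa[OF add(2)]] by (simp add: P_Pa)
    also have "\<dots> = N.J (cl x \<oplus>\<^bsub>B\<^esub> cl y)"
      unfolding add by (rule N.J_add[OF cl_closed[OF add(1)] cl_closed[OF add(2)], symmetric])
    also have "cl x \<oplus>\<^bsub>B\<^esub> cl y = cl (x \<oplus>\<^bsub>P\<^esub> y)" by (rule module_homD(2)[OF cl_hom add(1,2), symmetric])
    finally show ?case .
  qed
  moreover have "\<rho> pa = N.\<alpha>" using \<rho>(4)[of a] by (simp add: Qa_simps)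
  ultimately show ?thesis using that \<rho>(1,2) by blast
qed

text \<open>
  The linear map \<open>\<theta> : T \<rightarrow> B\<^bsub>{a}\<^esub>\<close> is induced by \<open>KQ \<subseteq> KQ\<^bsub>{a}\<^esub>\<close> on \<open>B\<close>, and sends \<open>x \<otimes> y\<close> to \<open>x a y\<close>.  It is shown to
  be multiplicative only in \<open>one_arrow_algebra_iso\<close>, by means of \<open>\<rho>\<close>.
\<close>

lemma theta_exists:
  obtains \<theta> where "\<theta> \<in> module_hom K N.T Ba"
    "\<And>x. x \<in> carrier P \<Longrightarrow> \<theta> (N.J (cl x)) = cla x"
    "\<And>x y. x \<in> carrier P \<Longrightarrow> y \<in> carrier P \<Longrightarrow> cl x \<in> carrier N.Y \<Longrightarrow> cl y \<in> carrier N.E \<Longrightarrow>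
      \<theta> (N.tens (cl x) (cl y)) = cla x \<otimes>\<^bsub>Ba\<^esub> cla pa \<otimes>\<^bsub>Ba\<^esub> cla y"
proof -
  have ch: "cla \<in> module_hom K P Ba"
    using cla_hom P_subset_Pa by (auto simp: module_hom_def P_Pa simp del: quot_module_simps)
  have cz: "cla w = \<zero>\<^bsub>Ba\<^esub>" if "w \<in> I" for w
    using that Ia(2) I_Pa cla_zero by blast
  obtain j where j: "j \<in> module_hom K B Ba" "\<And>x. x \<in> carrier P \<Longrightarrow> j (cl x) = cla x"
    using quot_module_lift[OF P.ideal_subspace[OF I] Ba.V.vectorspace_axioms ch cz] by blast
  note jD = module_homD[OF j(1)]
  have A0: "cla pa \<in> carrier Ba" by (rule cla_closed[OF arrow_a(3)])
  let ?F = "\<lambda>x y. j x \<otimes>\<^bsub>Ba\<^esub> cla pa \<otimes>\<^bsub>Ba\<^esub> j y"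
  have "\<exists>L. L \<in> module_hom K N.H Ba \<and> (\<forall>x\<in>carrier N.Y. \<forall>y\<in>carrier N.E. L (N.rank_one x y) = ?F x y)"
  proof (rule N.tensor_lift[OF Ba.V.vectorspace_axioms, of ?F])
    fix y assume y: "y \<in> carrier N.E"
    show "(\<lambda>x. ?F x y) \<in> module_hom K (B\<lparr>carrier := carrier N.Y\<rparr>) Ba"
      using y A0 by (intro module_homI) (auto simp: jD N.Y_B N.E_B Ba.l_distr Ba.smult_mult_left
          simp del: quot_module_simps N.Y_simps)
  next
    fix x assume x: "x \<in> carrier N.Y"
    show "?F x \<in> module_hom K N.E Ba"
      using x A0 by (intro module_homI) (auto simp: jD N.Y_B N.E_B Ba.r_distr Ba.smult_mult_right
          simp del: quot_module_simps N.Y_simps)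
  qed blast
  then obtain L where L: "L \<in> module_hom K N.H Ba"
    "\<And>x y. x \<in> carrier N.Y \<Longrightarrow> y \<in> carrier N.E \<Longrightarrow> L (N.rank_one x y) = ?F x y" by blast
  note LD = module_homD[OF L(1)]
  define \<theta> where "\<theta> t = j (fst t) \<oplus>\<^bsub>Ba\<^esub> L (snd t)" for t
  have T_fst: "fst t \<in> carrier B" and T_snd: "snd t \<in> carrier N.H" if "t \<in> carrier N.T" for t
    using that unfolding N.T_simps(1) by auto
  have "\<theta> \<in> module_hom K N.T Ba"
  proof (rule module_homI)
    fix s t assume "s \<in> carrier N.T" "t \<in> carrier N.T"
    then show "\<theta> (s \<oplus>\<^bsub>N.T\<^esub> t) = \<theta> s \<oplus>\<^bsub>Ba\<^esub> \<theta> t"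
      using jD LD T_fst T_snd unfolding \<theta>_def N.T_simps(5) fst_conv snd_conv
      by (simp add: Ba.a_ac del: quot_module_simps linear_space_simps)
  next
    fix c t assume "c \<in> carrier K" "t \<in> carrier N.T"
    then show "\<theta> (c \<odot>\<^bsub>N.T\<^esub> t) = c \<odot>\<^bsub>Ba\<^esub> \<theta> t"
      using jD LD T_fst T_snd unfolding \<theta>_def N.T_simps(6) fst_conv snd_conv
      by (simp add: Ba.V.smult_r_distr del: quot_module_simps linear_space_simps)
  qed (use jD LD T_fst T_snd in \<open>simp add: \<theta>_def del: quot_module_simps linear_space_simps\<close>)
  moreover have "\<theta> (N.J (cl x)) = cla x" if x: "x \<in> carrier P" for x
    using module_hom_zero[OF N.XY.H_vectorspace Ba.V.vectorspace_axioms L(1)] j(2)[OF x] cla_closed[OF P_subset_Pa[OF x]]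
    by (simp add: \<theta>_def N.J_def del: quot_module_simps linear_space_simps)
  moreover have "\<theta> (N.tens (cl x) (cl y)) = cla x \<otimes>\<^bsub>Ba\<^esub> cla pa \<otimes>\<^bsub>Ba\<^esub> cla y"
    if "x \<in> carrier P" "y \<in> carrier P" "cl x \<in> carrier N.Y" "cl y \<in> carrier N.E" for x y
    using module_hom_zero[OF B.V.vectorspace_axioms Ba.V.vectorspace_axioms j(1)] j(2) L(2)[OF that(3,4)] that(1,2)
      cla_closed[OF P_subset_Pa] A0
    by (simp add: \<theta>_def N.tens_def del: quot_module_simps linear_space_simps)
  ultimately show ?thesis using that by blast
qed

text \<open>
  The composite \<open>\<theta> \<circ> \<rho>\<close> is the projection \<open>KQ\<^bsub>{a}\<^esub> \<rightarrow> B\<^bsub>{a}\<^esub>\<close>.  This is checked on paths, according to the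
  number of occurrences of \<open>a\<close>; a path through \<open>a\<close> twice lies in the ideal generated by \<open>I\<close>.  Since \<open>\<rho>\<close> is a surjective
  algebra map, \<open>\<theta>\<close> is multiplicative; it is onto because the projection is, and it is injective because
  \<open>\<rho>\<close> kills the kernel of the projection, which is generated by \<open>I\<close>.
\<close>

theorem one_arrow_algebra_iso:
  obtains \<theta> where "\<theta> \<in> module_hom K N.T Ba" "bij_betw \<theta> (carrier N.T) (carrier Ba)"
    "\<And>s t. s \<in> carrier N.T \<Longrightarrow> t \<in> carrier N.T \<Longrightarrow> \<theta> (s \<otimes>\<^bsub>N.T\<^esub> t) = \<theta> s \<otimes>\<^bsub>Ba\<^esub> \<theta> t"
proof -
  obtain \<rho> where \<rho>: "\<rho> \<in> module_hom K Pa N.T"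
    "\<And>x y. x \<in> carrier Pa \<Longrightarrow> y \<in> carrier Pa \<Longrightarrow> \<rho> (x \<otimes>\<^bsub>Pa\<^esub> y) = \<rho> x \<otimes>\<^bsub>N.T\<^esub> \<rho> y"
    "\<And>x. x \<in> carrier P \<Longrightarrow> \<rho> x = N.J (cl x)" "\<rho> pa = N.\<alpha>" by (rule rho_exists) blast
  obtain \<theta> where \<theta>: "\<theta> \<in> module_hom K N.T Ba"
    "\<And>x. x \<in> carrier P \<Longrightarrow> \<theta> (N.J (cl x)) = cla x"
    "\<And>x y. x \<in> carrier P \<Longrightarrow> y \<in> carrier P \<Longrightarrow> cl x \<in> carrier N.Y \<Longrightarrow> cl y \<in> carrier N.E \<Longrightarrow>
      \<theta> (N.tens (cl x) (cl y)) = cla x \<otimes>\<^bsub>Ba\<^esub> cla pa \<otimes>\<^bsub>Ba\<^esub> cla y" by (rule theta_exists) blast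
  note \<rho>D = module_homD[OF \<rho>(1)] and \<theta>D = module_homD[OF \<theta>(1)]
  have \<rho>0: "\<rho> \<zero>\<^bsub>Pa\<^esub> = \<zero>\<^bsub>N.T\<^esub>" by (rule module_hom_zero[OF Pa.P_vectorspace N.T.V.vectorspace_axioms \<rho>(1)])
  have \<theta>0: "\<theta> \<zero>\<^bsub>N.T\<^esub> = \<zero>\<^bsub>Ba\<^esub>" by (rule module_hom_zero[OF N.T.V.vectorspace_axioms Ba.V.vectorspace_axioms \<theta>(1)])

  have ker: "\<rho> x = \<zero>\<^bsub>N.T\<^esub>" if x: "x \<in> Ia" for x
  proof -
    let ?k = "{x \<in> carrier Pa. \<rho> x = \<zero>\<^bsub>N.T\<^esub>}"
    note ks = subspaceD[OF kernel_subspace[OF Pa.P_vectorspace N.T.V.vectorspace_axioms \<rho>(1)]]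
    have "ideal ?k Pa"
    proof (rule idealI)
      show "ring Pa" by (rule Pa.P.ring_axioms)
      show "subgroup ?k (add_monoid Pa)"
      proof (rule subgroup.intro)
        fix x assume x: "x \<in> ?k"
        have "\<rho> (\<ominus>\<^bsub>Pa\<^esub> x) = \<ominus>\<^bsub>N.T\<^esub> \<rho> x"
          using x by (intro additive_minus(1)[OF Pa.P.abelian_group_axioms N.T.abelian_group_axioms])
            (auto simp: \<rho>D)
        then have "\<ominus>\<^bsub>Pa\<^esub> x \<in> ?k" using x by simp
        then show "inv\<^bsub>add_monoid Pa\<^esub> x \<in> ?k" by (simp add: a_inv_def)
      qed (use ks(2-4) in auto)
    qed (auto simp: \<rho>(2) \<rho>D)
    moreover have "I \<subseteq> ?k"
    proof
      fix x assume x: "x \<in> I"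
      then have xP: "x \<in> carrier P" using I_subset by blast
      have "cl x = \<zero>\<^bsub>B\<^esub>" using cl_zero[OF xP] x by blast
      then have "\<rho> x = \<zero>\<^bsub>N.T\<^esub>" using \<rho>(3)[OF xP] N.J_zero by simp
      then show "x \<in> ?k" using P_subset_Pa[OF xP] by simp
    qed
    ultimately have "Ia \<subseteq> ?k" by (rule Pa.P.genideal_minimal)
    then show ?thesis using x by blast
  qed

  have comp_elt: "\<theta> (\<rho> (path_elt K (u, p))) = cla (path_elt K (u, p))" if up: "(u, p) \<in> paths Qa" for u p
  proof (cases "a \<in> set p")
    case False
    have "path_elt K (u, p) \<in> carrier P" by (rule path_elt_closed[OF paths_Q[OF up False]])
    then show ?thesis using \<rho>(3) \<theta>(2) by simp
  next
    case True
    obtain s q where sq: "p = s @ a # q" "(u, s) \<in> paths Q" "path_target Q (u, s) = e" "(f, q) \<in> paths Qa"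
      "path_elt K (u, p) = path_elt K (f, q) \<otimes>\<^bsub>Pa\<^esub> pa \<otimes>\<^bsub>Pa\<^esub> path_elt K (u, s)"
      by (rule cut_at_arrow[OF up True])
    note sP = path_elt_closed[OF sq(2)] and qPa = Pa.path_elt_closed[OF sq(4)]
    note sPa = P_subset_Pa[OF sP]
    show ?thesis
    proof (cases "a \<in> set q")
      case False
      note q = paths_Q[OF sq(4) False]
      note qP = path_elt_closed[OF q]
      have Y: "cl (path_elt K (f, q)) \<in> carrier N.Y"
        using cl_mult[OF qP vertex_closed[OF f]] path_elt_vertex(1)[OF q] cl_closed[OF qP]
        unfolding N.in_Y unfolding eB_fB by (simp del: quot_module_simps)
      have E: "cl (path_elt K (u, s)) \<in> carrier N.E"
        using cl_mult[OF vertex_closed[OF e] sP] path_elt_vertex(2)[OF sq(2)] sq(3) cl_closed[OF sP]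
        unfolding N.in_E unfolding eB_fB by (simp del: quot_module_simps)
      have "\<rho> (path_elt K (u, p)) = \<rho> (path_elt K (f, q)) \<otimes>\<^bsub>N.T\<^esub> \<rho> pa \<otimes>\<^bsub>N.T\<^esub> \<rho> (path_elt K (u, s))"
        unfolding sq(5) \<rho>(2)[OF Pa.P.m_closed[OF qPa arrow_a(3)] sPa] \<rho>(2)[OF qPa arrow_a(3)] ..
      also have "\<dots> = N.tens (cl (path_elt K (f, q))) (cl (path_elt K (u, s)))"
        unfolding \<rho>(3)[OF qP] \<rho>(3)[OF sP] \<rho>(4) by (rule N.tens_eq[OF Y E, symmetric])
      finally have "\<theta> (\<rho> (path_elt K (u, p))) = cla (path_elt K (f, q)) \<otimes>\<^bsub>Ba\<^esub> cla pa \<otimes>\<^bsub>Ba\<^esub> cla (path_elt K (u, s))"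
        using \<theta>(3)[OF qP sP Y E] by simp
      also have "\<dots> = cla (path_elt K (u, p))"
        unfolding sq(5) cla_mult[OF Pa.P.m_closed[OF qPa arrow_a(3)] sPa] cla_mult[OF qPa arrow_a(3)] ..
      finally show ?thesis .
    next
      case True
      \<comment> \<open>\<open>s'\<close> runs from the end of \<open>a\<close> to the start of its next occurrence, that is from \<open>f\<close> to \<open>e\<close>\<close>
      obtain s' q' where sq': "q = s' @ a # q'" "(f, s') \<in> paths Q" "path_target Q (f, s') = e" "(f, q') \<in> paths Qa"
        "path_elt K (f, q) = path_elt K (f, q') \<otimes>\<^bsub>Pa\<^esub> pa \<otimes>\<^bsub>Pa\<^esub> path_elt K (f, s')"
        by (rule cut_at_arrow[OF sq(4) True])
      interpret Ia: ideal Ia Pa by (rule Ia(1))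
      have "path_elt K (f, s') \<in> Ia" using P_path_in_I[OF sq'(2,3)] Ia(2) by blast
      then have "path_elt K (f, q) \<in> Ia" unfolding sq'(5)
        by (rule Ia.I_l_closed) (intro Pa.P.m_closed Pa.path_elt_closed sq'(4) arrow_a)
      then have "path_elt K (u, p) \<in> Ia" unfolding sq(5)
        by (intro Ia.I_r_closed arrow_a(3) sPa)
      then show ?thesis using ker \<theta>0 cla_zero[OF Pa.path_elt_closed[OF up]] by metis
    qed
  qed
  have comp: "\<theta> (\<rho> x) = cla x" if "x \<in> carrier Pa" for x
    using that
  proof (induction rule: Pa.path_induct)
    case zero
    show ?case unfolding \<rho>0 \<theta>0
      by (rule module_hom_zero[OF Pa.P_vectorspace Ba.V.vectorspace_axioms cla_hom, symmetric])
  next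
    case (smult c \<gamma>)
    note g = Pa.path_elt_closed[OF smult(2)]
    have "\<theta> (\<rho> (path_elt K \<gamma>)) = cla (path_elt K \<gamma>)" using comp_elt[of "fst \<gamma>" "snd \<gamma>"] smult(2) by simp
    then show ?case
      unfolding \<rho>D(3)[OF smult(1) g] \<theta>D(3)[OF smult(1) \<rho>D(1)[OF g]] module_homD(3)[OF cla_hom smult(1) g] by simp
  next
    case (add x y)
    then show ?case
      unfolding \<rho>D(2)[OF add(1,2)] \<theta>D(2)[OF \<rho>D(1)[OF add(1)] \<rho>D(1)[OF add(2)]] module_homD(2)[OF cla_hom add(1,2)]
      by simp
  qed

  have cl_rep: "\<exists>x\<in>carrier P. b = cl x" if "b \<in> carrier B" for b
    using that unfolding cl_surj[symmetric] by blast
  have \<rho>_onto: "\<exists>x\<in>carrier Pa. \<rho> x = t" if "t \<in> carrier N.T" for t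
    using that
  proof (induction rule: N.T_induct)
    case (J b)
    then obtain x where "x \<in> carrier P" "b = cl x" using cl_rep by blast
    then show ?case using \<rho>(3) P_subset_Pa by metis
  next
    case (tens x y)
    obtain x' where x: "x' \<in> carrier P" "x = cl x'" using cl_rep N.Y_B[OF tens(1)] by blast
    obtain y' where y: "y' \<in> carrier P" "y = cl y'" using cl_rep N.E_B[OF tens(2)] by blast
    note c = P_subset_Pa[OF x(1)] P_subset_Pa[OF y(1)] arrow_a(3)
    have "\<rho> (x' \<otimes>\<^bsub>Pa\<^esub> pa \<otimes>\<^bsub>Pa\<^esub> y') = N.tens x y"
      unfolding \<rho>(2)[OF Pa.P.m_closed[OF c(1,3)] c(2)] \<rho>(2)[OF c(1,3)] \<rho>(3)[OF x(1)] \<rho>(3)[OF y(1)] \<rho>(4)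
        x(2)[symmetric] y(2)[symmetric]
      by (rule N.tens_eq[OF tens, symmetric])
    then show ?case using Pa.P.m_closed[OF Pa.P.m_closed[OF c(1,3)] c(2)] by blast
  next
    case (add s t)
    then obtain x y where "x \<in> carrier Pa" "\<rho> x = s" "y \<in> carrier Pa" "\<rho> y = t" by blast
    then show ?case using \<rho>D(2) Pa.P.a_closed by metis
  qed

  have mult: "\<theta> (s \<otimes>\<^bsub>N.T\<^esub> t) = \<theta> s \<otimes>\<^bsub>Ba\<^esub> \<theta> t" if st: "s \<in> carrier N.T" "t \<in> carrier N.T" for s t
  proof -
    obtain x where x: "x \<in> carrier Pa" "\<rho> x = s" using \<rho>_onto[OF st(1)] by blast
    obtain y where y: "y \<in> carrier Pa" "\<rho> y = t" using \<rho>_onto[OF st(2)] by blast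
    have "\<theta> (\<rho> x \<otimes>\<^bsub>N.T\<^esub> \<rho> y) = \<theta> (\<rho> x) \<otimes>\<^bsub>Ba\<^esub> \<theta> (\<rho> y)"
      unfolding \<rho>(2)[OF x(1) y(1), symmetric] comp[OF Pa.P.m_closed[OF x(1) y(1)]] comp[OF x(1)] comp[OF y(1)]
      by (rule cla_mult[OF x(1) y(1)])
    then show ?thesis unfolding x(2) y(2) .
  qed
  have "inj_on \<theta> (carrier N.T)"
  proof (rule inj_onI)
    fix s t assume st: "s \<in> carrier N.T" "t \<in> carrier N.T" "\<theta> s = \<theta> t"
    have d: "s \<ominus>\<^bsub>N.T\<^esub> t \<in> carrier N.T" by (rule N.T.minus_closed[OF st(1,2)])
    obtain x where x: "x \<in> carrier Pa" "\<rho> x = s \<ominus>\<^bsub>N.T\<^esub> t" using \<rho>_onto[OF d] by blast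
    have "\<theta> (s \<ominus>\<^bsub>N.T\<^esub> t) = \<theta> s \<ominus>\<^bsub>Ba\<^esub> \<theta> t"
      by (rule additive_minus(2)[OF N.T.abelian_group_axioms Ba.abelian_group_axioms])
        (use \<theta>D(1,2) in \<open>blast intro: st(1,2)\<close>)+
    also have "\<dots> = \<zero>\<^bsub>Ba\<^esub>" unfolding st(3) a_minus_def by (rule Ba.r_neg[OF \<theta>D(1)[OF st(2)]])
    finally have "cla x = \<zero>\<^bsub>Ba\<^esub>" using comp[OF x(1)] x(2) by simp
    then have "\<rho> x = \<zero>\<^bsub>N.T\<^esub>" using ker cla_zero[OF x(1)] by blast
    then have "s \<ominus>\<^bsub>N.T\<^esub> t = \<zero>\<^bsub>N.T\<^esub>" unfolding x(2) .
    from N.T.minus_equality[OF this[unfolded a_minus_def] N.T.a_inv_closed[OF st(2)] st(1)]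
    show "s = t" unfolding N.T.minus_minus[OF st(2)] by (rule sym)
  qed
  moreover have "\<theta> ` carrier N.T = carrier Ba"
  proof
    show "\<theta> ` carrier N.T \<subseteq> carrier Ba" using \<theta>D(1) by blast
    show "carrier Ba \<subseteq> \<theta> ` carrier N.T"
      unfolding cla_surj[symmetric] using comp \<rho>D(1) by (metis image_subsetI imageI)
  qed
  ultimately show ?thesis using that[OF \<theta>(1) _ mult] by (simp add: bij_betw_def)
qed

end

theorem corollary4p3:
  fixes K :: "('k, 'z) ring_scheme"
    and Q :: "('v, 'e) pre_digraph"
    and I :: "('v \<times> 'e list \<Rightarrow> 'k) set"
    and a :: 'e
    and e f :: 'v
  assumes K: "field K"
    and Q: "fin_digraph Q"
    and I: "admissible_ideal K Q I"
    and a: "a \<notin> arcs Q"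
    and e: "e \<in> verts Q"
    and f: "f \<in> verts Q"
    and B: "B = quot_module (path_algebra K Q) I"
    and eB: "eB = vertex_elt K Q I e"
    and fB: "fB = vertex_elt K Q I f"
    and Qa: "Qa = add_arrow Q a e f"
    and Ba: "Ba = quot_module (path_algebra K Qa) (Idl\<^bsub>path_algebra K Qa\<^esub> I)"
    and not_loop: "\<not> relative_loop B eB fB"
  shows "int (vectorspace.dim K (HH1 K Ba)) - int (vectorspace.dim K (HH1 K B)) =
    int (vectorspace.dim K (center Ba)) - int (vectorspace.dim K (center B))
    + int (vectorspace.dim K (corner B fB eB))
    + int (vectorspace.dim K (corner B fB fB)) * int (vectorspace.dim K (corner B eB eB))
    + int (vectorspace.dim K (ext1 B (inj_module K B eB) (proj_module B fB)))
    - int (vectorspace.dim K (mod_hom_space B (inj_module K B eB) (proj_module B fB)))"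
proof -
  obtain n where n: "ideal I (path_algebra K Q)" "length_ideal K Q n \<subseteq> I"
    using I unfolding admissible_ideal_def by blast
  interpret S: quiver_arrow K Q I n a e f
    using K Q n a e f not_loop
    by (simp add: quiver_arrow_def quiver_arrow_axioms_def path_alg_def B eB fB)
  obtain \<theta> where \<theta>: "\<theta> \<in> module_hom K S.N.T S.Ba" "bij_betw \<theta> (carrier S.N.T) (carrier S.Ba)"
    "\<And>s t. s \<in> carrier S.N.T \<Longrightarrow> t \<in> carrier S.N.T \<Longrightarrow> \<theta> (s \<otimes>\<^bsub>S.N.T\<^esub> t) = \<theta> s \<otimes>\<^bsub>S.Ba\<^esub> \<theta> t"
    by (rule S.one_arrow_algebra_iso) blast
  show ?thesis
    using kalg_iso_dim_HH1[OF S.N.T.kalg_axioms S.Ba.kalg_axioms S.N.T_fin_dim(1) \<theta>] S.N.dim_HH1_triv_ext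
    unfolding B eB fB Ba Qa by simp
qed

end
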